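(* Consider $u_t=u_{xx}+f(t,u,u_x)$, $t>0$, $0<x<L$, with Dirichlet boundary condition $u(t,0)=u(t,L)=0$. Let $M\subset X_D\times H(f)$ be a minimal set of the associated skew-product semiflow $\Pi^D_t$ and let $$M^D_0=\{(u_0'(0),g):(u_0,g)\in M\}.$$ Assume that at least one of the following holds: (a) $f(t,-u,p)=-f(t,u,p)$ for all $(t,u,p)\in\mathbb{R}\times\mathbb{R}\times\mathbb{R}$; (b) $f(t,0,p)=0$ for all $(t,p)\in\mathbb{R}\times\mathbb{R}$, and $u_0\ge0$ for every $(u_0,g)\in M$. Then the mapping $M\ni(u_0,g)\mapsto(u_0'(0),g)\in M^D_0$ is a continuous bijection, and $\Pi^D_t|_M$ is topologically conjugate to $\pi^D_t:M^D_0\to M^D_0$, where $$\pi^D_t(u_0'(0),g)=(\phi^D_x(t,0;u_0,g),g\cdot t)\qquad\forall\,(u_0,g)\in M.$$ Hence the flow on $M$ is topologically conjugate to an almost periodically-forced minimal flow on $\mathbb{R}$.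
   Context: Standing assumption on $f$: $f=f(t,u,p)\in C^1(\mathbb{R}\times\mathbb{R}\times\mathbb{R},\mathbb{R})$, and $f$ and all its first-order partial derivatives are uniformly almost periodic in $t$. Here a function $F\in C(\mathbb{R}\times D,\mathbb{R})$, $D\subset\mathbb{R}^m$, is admissible if for every compact $K\subset D$ it is bounded and uniformly continuous on $\mathbb{R}\times K$; it is uniformly almost periodic in $t$ if it is admissible and $F(\cdot,d)$ is almost periodic for each fixed $d\in D$. The hull $H(f)$ is the closure of $\{f(\cdot+\tau,\cdot,\cdot):\tau\in\mathbb{R}\}$ in the compact-open topology; it is a compact metric space, on which $(g\cdot t)(s,u,p)=g(s+t,u,p)$ defines an (almost periodic) minimal flow. Semiflow: $L>0$, and $X_D$ is a fractional power space associated with the operator $u\mapsto -u_{xx}:H^2(0,L)\to L^2(0,L)$ with Dirichlet boundary condition $u(0)=u(L)=0$, such that $X_D$ is compactly embedded into $C^1[0,L]$. For $(u_0,g)\in X_D\times H(f)$, $\phi^D(t,x;u_0,g)$ is the (local) solution of $u_t=u_{xx}+g(t,u,u_x)$, $0<x<L$, $u(t,0)=u(t,L)=0$, with initial value $u_0$ at $t=0$, and $\Pi^D_t(u_0,g)=(\phi^D(t,\cdot;u_0,g),g\cdot t)$, $t\ge0$. A minimal set is a nonempty compact positively invariant set containing no other nonempty compact positively invariant set; on a minimal set the semiflow extends to a flow (unique backward orbits in $M$), which is used for $t<0$. Two flows are topologically conjugate if there is a homeomorphism between the spaces commuting with the flows. "Almost periodically-forced minimal flow on $\mathbb{R}$"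 means a minimal skew-product flow on a compact subset of $\mathbb{R}\times H(f)$ over the almost periodic base flow $(H(f),\cdot)$. *)

theory Defs
  imports "HOL-Analysis.Analysis"
begin

section \<open>Uniform almost periodicity, the compact-open topology and the hull\<close>

text \<open>Functions \<open>F(t, d)\<close> are given on pairs, so that \<open>f(t, u, p)\<close> is a function on
  \<open>real \<times> (real \<times> real)\<close> and the same notions apply to it and to its partial derivatives.\<close>

definition relatively_dense :: "real set \<Rightarrow> bool" where
  "relatively_dense S \<longleftrightarrow> (\<exists>l>0. \<forall>a. \<exists>\<tau>\<in>S. a \<le> \<tau> \<and> \<tau> \<le> a + l)"

text \<open>Almost periodicity in the sense of Bohr.\<close>
definition almost_periodic :: "(real \<Rightarrow> real) \<Rightarrow> bool" where
  "almost_periodic h \<longleftrightarrow> continuous_on UNIV h \<and>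
     (\<forall>\<epsilon>>0. relatively_dense {\<tau>. \<forall>t. \<bar>h (t + \<tau>) - h t\<bar> < \<epsilon>})"

definition admissible :: "'d::metric_space set \<Rightarrow> (real \<times> 'd \<Rightarrow> real) \<Rightarrow> bool" where
  "admissible D F \<longleftrightarrow> continuous_on (UNIV \<times> D) F \<and>
     (\<forall>K. K \<subseteq> D \<and> compact K \<longrightarrow>
        bounded (F ` (UNIV \<times> K)) \<and> uniformly_continuous_on (UNIV \<times> K) F)"

definition uniformly_almost_periodic :: "'d::metric_space set \<Rightarrow> (real \<times> 'd \<Rightarrow> real) \<Rightarrow> bool" where
  "uniformly_almost_periodic D F \<longleftrightarrow>
     admissible D F \<and> (\<forall>d\<in>D. almost_periodic (\<lambda>t. F (t, d)))"

type_synonym nonlinearity = "real \<times> real \<times> real \<Rightarrow> real"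

definition partial_t :: "nonlinearity \<Rightarrow> nonlinearity" where
  "partial_t f = (\<lambda>(t, u, p). deriv (\<lambda>s. f (s, u, p)) t)"

definition partial_u :: "nonlinearity \<Rightarrow> nonlinearity" where
  "partial_u f = (\<lambda>(t, u, p). deriv (\<lambda>v. f (t, v, p)) u)"

definition partial_p :: "nonlinearity \<Rightarrow> nonlinearity" where
  "partial_p f = (\<lambda>(t, u, p). deriv (\<lambda>q. f (t, u, q)) p)"

definition C1_fun :: "nonlinearity \<Rightarrow> bool" where
  "C1_fun f \<longleftrightarrow>
     (\<forall>t u p. (\<lambda>s. f (s, u, p)) field_differentiable (at t) \<and>
              (\<lambda>v. f (t, v, p)) field_differentiable (at u) \<and>
              (\<lambda>q. f (t, u, q)) field_differentiable (at p)) \<and>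
     continuous_on UNIV (partial_t f) \<and>
     continuous_on UNIV (partial_u f) \<and>
     continuous_on UNIV (partial_p f)"

definition standing_assumption :: "nonlinearity \<Rightarrow> bool" where
  "standing_assumption f \<longleftrightarrow> C1_fun f \<and>
     (\<forall>F\<in>{f, partial_t f, partial_u f, partial_p f}. uniformly_almost_periodic UNIV F)"

definition compact_open_topology ::
    "('a::topological_space \<Rightarrow> 'b::topological_space) topology" where
  "compact_open_topology =
     subtopology (topology_generated_by {{g. g ` K \<subseteq> U} | K U. compact K \<and> open U})
       {g. continuous_on UNIV g}"

definition time_shift :: "real \<Rightarrow> nonlinearity \<Rightarrow> nonlinearity" where
  "time_shift \<tau> g = (\<lambda>(s, u, p). g (s + \<tau>, u, p))"

definition Hull :: "nonlinearity \<Rightarrow> nonlinearity set" where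
  "Hull f = compact_open_topology closure_of range (\<lambda>\<tau>. time_shift \<tau> f)"

definition hull_topology :: "nonlinearity \<Rightarrow> nonlinearity topology" where
  "hull_topology f = subtopology compact_open_topology (Hull f)"


section \<open>The Dirichlet operator and its fractional power spaces\<close>

definition L2_interval :: "real \<Rightarrow> (real \<Rightarrow> real) set" where
  "L2_interval L = {u. u \<in> borel_measurable (lebesgue_on {0..L}) \<and>
                       integrable (lebesgue_on {0..L}) (\<lambda>x. (u x)\<^sup>2)}"

definition L2_inner :: "real \<Rightarrow> (real \<Rightarrow> real) \<Rightarrow> (real \<Rightarrow> real) \<Rightarrow> real" where
  "L2_inner L u v = (LINT x|lebesgue_on {0..L}. u x * v x)"

text \<open>\<open>dirichlet_op L u v\<close> says that \<open>u\<close> (through its \<open>C\<^sup>1\<close> representative) lies in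
  \<open>H\<^sup>2(0,L)\<close>, satisfies \<open>u(0) = u(L) = 0\<close>, and \<open>-u'' = v\<close>: the derivative \<open>u'\<close> is the
  indefinite integral of the square-integrable function \<open>-v\<close>.\<close>
definition dirichlet_op :: "real \<Rightarrow> (real \<Rightarrow> real) \<Rightarrow> (real \<Rightarrow> real) \<Rightarrow> bool" where
  "dirichlet_op L u v \<longleftrightarrow> v \<in> L2_interval L \<and> u 0 = 0 \<and> u L = 0 \<and>
     (\<exists>u'. \<forall>x\<in>{0..L}. (u has_real_derivative u' x) (at x within {0..L}) \<and>
                      u' x = u' 0 - (LINT y|lebesgue_on {0..x}. v y))"

definition dirichlet_eigenvalue :: "real \<Rightarrow> nat \<Rightarrow> real" where
  "dirichlet_eigenvalue L n = (real (Suc n) * pi / L)\<^sup>2"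

definition dirichlet_eigenfun :: "real \<Rightarrow> nat \<Rightarrow> real \<Rightarrow> real" where
  "dirichlet_eigenfun L n x = sqrt (2 / L) * sin (real (Suc n) * pi * x / L)"

text \<open>The domain of \<open>A\<^sup>\<alpha>\<close> and the norm \<open>\<parallel>A\<^sup>\<alpha> u\<parallel>\<close> in \<open>L\<^sup>2(0,L)\<close>, for the positive self-adjoint
  operator \<open>A\<close> given by \<open>dirichlet_op L\<close>:
  \<open>A\<^sup>\<alpha> u = (\<Sum>n. \<lambda>\<^sub>n powr \<alpha> * \<langle>u, e\<^sub>n\<rangle> e\<^sub>n)\<close>, where \<open>(\<lambda>\<^sub>n, e\<^sub>n)\<close> are the
  eigenpairs above. They form an orthonormal eigenbasis: see \<open>dirichlet_op_eigenfun\<close>,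
  \<open>dirichlet_eigenfun_orthonormal\<close> and \<open>dirichlet_eigenfun_complete\<close> below.\<close>
definition frac_coeff :: "real \<Rightarrow> real \<Rightarrow> (real \<Rightarrow> real) \<Rightarrow> nat \<Rightarrow> real" where
  "frac_coeff L \<alpha> u n = dirichlet_eigenvalue L n powr \<alpha> * L2_inner L u (dirichlet_eigenfun L n)"

definition frac_domain :: "real \<Rightarrow> real \<Rightarrow> (real \<Rightarrow> real) set" where
  "frac_domain L \<alpha> = {u \<in> L2_interval L. (\<lambda>n. (frac_coeff L \<alpha> u n)\<^sup>2) summable_on UNIV}"

definition frac_norm :: "real \<Rightarrow> real \<Rightarrow> (real \<Rightarrow> real) \<Rightarrow> real" where
  "frac_norm L \<alpha> u = sqrt (\<Sum>\<^sub>\<infinity>n. (frac_coeff L \<alpha> u n)\<^sup>2)"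

definition D_on :: "real \<Rightarrow> (real \<Rightarrow> real) \<Rightarrow> real \<Rightarrow> real" where
  "D_on L u x = vector_derivative u (at x within {0..L})"

definition C1_interval :: "real \<Rightarrow> (real \<Rightarrow> real) set" where
  "C1_interval L = {u. u differentiable_on {0..L} \<and> continuous_on {0..L} (D_on L u)}"

text \<open>Elements of \<open>L\<^sup>2\<close> are functions up to equality almost everywhere, so the embedding of
  \<open>D(A\<^sup>\<alpha>)\<close> into \<open>C\<^sup>1[0,L]\<close> picks representatives. Continuity of the embedding follows from
  the second clause.\<close>
definition compactly_embedded_C1 :: "real \<Rightarrow> real \<Rightarrow> bool" where
  "compactly_embedded_C1 L \<alpha> \<longleftrightarrow>
     (\<forall>u\<in>frac_domain L \<alpha>. \<exists>v\<in>C1_interval L. AE x in lebesgue_on {0..L}. u x = v x) \<and>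
     (\<forall>w. range w \<subseteq> frac_domain L \<alpha> \<inter> C1_interval L \<and> bounded (range (\<lambda>n. frac_norm L \<alpha> (w n))) \<longrightarrow>
        (\<exists>r v. strict_mono (r :: nat \<Rightarrow> nat) \<and> v \<in> C1_interval L \<and>
           uniform_limit {0..L} (\<lambda>n. w (r n)) v sequentially \<and>
           uniform_limit {0..L} (\<lambda>n. D_on L (w (r n))) (D_on L v) sequentially))"

text \<open>An element of \<open>X\<^sub>D\<close> is represented by its \<open>C\<^sup>1\<close> representative on \<open>[0,L]\<close>, extended by
  zero to a function on the whole line, so that equality in \<open>X\<^sub>D\<close> is equality of functions.\<close>
definition XD :: "real \<Rightarrow> real \<Rightarrow> (real \<Rightarrow> real) set" where
  "XD L \<alpha> = {u \<in> frac_domain L \<alpha> \<inter> C1_interval L. \<forall>x. x \<notin> {0..L} \<longrightarrow> u x = 0}"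

definition XD_dist :: "real \<Rightarrow> real \<Rightarrow> (real \<Rightarrow> real) \<Rightarrow> (real \<Rightarrow> real) \<Rightarrow> real" where
  "XD_dist L \<alpha> u v = frac_norm L \<alpha> (\<lambda>x. u x - v x)"

definition XD_topology :: "real \<Rightarrow> real \<Rightarrow> (real \<Rightarrow> real) topology" where
  "XD_topology L \<alpha> = Metric_space.mtopology (XD L \<alpha>) (XD_dist L \<alpha>)"


subsection \<open>The eigenbasis, and that the distance on the fractional power space is a metric\<close>

lemma continuous_mult_integrable:
  assumes w: "integrable (lebesgue_on {0..L}) (w :: real \<Rightarrow> real)" and c: "continuous_on {0..L} c"
  shows "integrable (lebesgue_on {0..L}) (\<lambda>x. w x * c x)"
proof -
  have "bounded (c ` {0..L})"
    using c compact_continuous_image compact_imp_bounded by blast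
  then obtain B where B: "\<forall>x\<in>{0..L}. \<bar>c x\<bar> \<le> B"
    by (auto simp: bounded_iff)
  have m: "c \<in> borel_measurable (lebesgue_on {0..L})"
    by (simp add: c continuous_imp_measurable_on_sets_lebesgue)
  show ?thesis
  proof (rule Bochner_Integration.integrable_bound)
    show "integrable (lebesgue_on {0..L}) (\<lambda>x. B * w x)" using w by simp
    show "(\<lambda>x. w x * c x) \<in> borel_measurable (lebesgue_on {0..L})"
      using m w by (simp add: borel_measurable_times)
    have "norm (w x * c x) \<le> norm (B * w x)" if "x \<in> {0..L}" for x
    proof -
      have "\<bar>c x\<bar> \<le> \<bar>B\<bar>" using B that by force
      then show ?thesis by (simp add: abs_mult mult.commute[of "\<bar>w x\<bar>"] mult_right_mono)
    qed
    then show "AE x in lebesgue_on {0..L}. norm (w x * c x) \<le> norm (B * w x)"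
      by (intro AE_I2) simp
  qed
qed

lemma L2_interval_integrable:
  assumes "u \<in> L2_interval L"
  shows "integrable (lebesgue_on {0..L}) u"
proof (rule Bochner_Integration.integrable_bound)
  show "integrable (lebesgue_on {0..L}) (\<lambda>x. 1 + (u x)\<^sup>2)"
    using assms continuous_imp_integrable_real[of 0 L "\<lambda>_. 1::real"] unfolding L2_interval_def by auto
  show "u \<in> borel_measurable (lebesgue_on {0..L})"
    using assms by (simp add: L2_interval_def)
  have "norm (u x) \<le> norm (1 + (u x)\<^sup>2)" for x
  proof -
    have "0 \<le> (\<bar>u x\<bar> - 1)\<^sup>2" by simp
    then have "2 * \<bar>u x\<bar> \<le> 1 + (u x)\<^sup>2" by (simp add: power2_diff)
    then show ?thesis by simp
  qed
  then show "AE x in lebesgue_on {0..L}. norm (u x) \<le> norm (1 + (u x)\<^sup>2)" by simp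
qed

lemma continuous_in_L2:
  assumes "continuous_on {0..L} u" shows "u \<in> L2_interval L"
  unfolding L2_interval_def
  using assms by (auto intro!: continuous_imp_integrable_real continuous_intros
      simp: continuous_imp_measurable_on_sets_lebesgue)

lemma continuous_eigenfun [continuous_intros]: "continuous_on S (dirichlet_eigenfun L n)"
  unfolding dirichlet_eigenfun_def divide_inverse by (intro continuous_intros)

lemma LINT_FTC:
  fixes F f :: "real \<Rightarrow> real"
  assumes "0 \<le> x" "\<And>y. (F has_real_derivative f y) (at y)" "continuous_on UNIV f"
  shows "(LINT y|lebesgue_on {0..x}. f y) = F x - F 0"
proof -
  have "integrable (lebesgue_on {0..x}) f"
    using assms continuous_imp_integrable_real continuous_on_subset by blast
  then have "(LINT y|lebesgue_on {0..x}. f y) = integral {0..x} f"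
    by (simp add: lebesgue_integral_eq_integral)
  also have "\<dots> = F x - F 0"
    using assms by (intro integral_unique fundamental_theorem_of_calculus)
      (auto intro: has_field_derivative_at_within simp flip: has_real_derivative_iff_has_vector_derivative)
  finally show ?thesis .
qed

lemma dirichlet_op_eigenfun:
  assumes "0 < L"
  shows "dirichlet_op L (dirichlet_eigenfun L n)
           (\<lambda>x. dirichlet_eigenvalue L n * dirichlet_eigenfun L n x)"
proof -
  define k where "k = real (Suc n) * pi / L"
  define u' where "u' x = sqrt (2 / L) * k * cos (k * x)" for x
  have e: "dirichlet_eigenfun L n = (\<lambda>x. sqrt (2 / L) * sin (k * x))"
    by (auto simp: dirichlet_eigenfun_def k_def)
  have l: "dirichlet_eigenvalue L n = k\<^sup>2" by (simp add: dirichlet_eigenvalue_def k_def)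
  have kL: "k * L = real (Suc n) * pi" using assms by (simp add: k_def)
  have d: "(dirichlet_eigenfun L n has_real_derivative u' x) (at x)" for x
    unfolding e u'_def by (auto intro!: derivative_eq_intros)
  have d2: "((\<lambda>x. - u' x) has_real_derivative k\<^sup>2 * dirichlet_eigenfun L n x) (at x)" for x
    unfolding e u'_def by (auto intro!: derivative_eq_intros simp: power2_eq_square)
  have "(LINT y|lebesgue_on {0..x}. k\<^sup>2 * dirichlet_eigenfun L n y) = - u' x - (- u' 0)" if "0 \<le> x" for x
    by (rule LINT_FTC[OF that d2]) (intro continuous_intros)
  then have "\<forall>x\<in>{0..L}. (dirichlet_eigenfun L n has_real_derivative u' x) (at x within {0..L}) \<and>
      u' x = u' 0 - (LINT y|lebesgue_on {0..x}. k\<^sup>2 * dirichlet_eigenfun L n y)"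
    using d by (auto intro: has_field_derivative_at_within)
  moreover have "dirichlet_eigenfun L n L = 0" 
    unfolding e kL by (simp only: sin_npi)
  moreover have "dirichlet_eigenfun L n 0 = 0" by (simp add: e)
  moreover have "(\<lambda>x. k\<^sup>2 * dirichlet_eigenfun L n x) \<in> L2_interval L"
    by (intro continuous_in_L2 continuous_intros)
  ultimately show ?thesis unfolding dirichlet_op_def l by blast
qed

lemma dirichlet_eigenfun_orthonormal:
  assumes "0 < L"
  shows "L2_inner L (dirichlet_eigenfun L m) (dirichlet_eigenfun L n) = (if m = n then 1 else 0)"
proof -
  have *: "(LINT x|lebesgue_on {0..L}. cos (real_of_int j * pi / L * x)) = (if j = 0 then L else 0)" for j
  proof (cases "j = 0")
    case True
    have "(LINT y|lebesgue_on {0..L}. (1::real)) = L - 0"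
      by (rule LINT_FTC) (use assms in auto)
    with True show ?thesis by simp
  next
    case False
    define k where "k = real_of_int j * pi / L"
    have k: "k \<noteq> 0" "k * L = pi * real_of_int j" using False assms by (auto simp: k_def)
    have "((\<lambda>x. sin (k * x) / k) has_real_derivative cos (k * y)) (at y)" for y
      using k by (auto intro!: derivative_eq_intros)
    then have "(LINT x|lebesgue_on {0..L}. cos (k * x)) = sin (k * L) / k - sin (k * 0) / k"
      using assms by (intro LINT_FTC) (auto intro!: continuous_intros)
    also have "\<dots> = 0"
      unfolding k(2) by (simp add: sin_integer_2pi sin_times_pi_eq_0 mult.commute)
    finally show ?thesis using False by (simp add: k_def)
  qed
  let ?c = "\<lambda>j::int. \<lambda>x. cos (real_of_int j * pi / L * x)"
  let ?i = "int m - int n" and ?j = "int m + int n + 2"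
  have s: "sqrt (2/L) * sqrt (2/L) = 2 / L" using assms by simp
  have "dirichlet_eigenfun L m x * dirichlet_eigenfun L n x = (?c ?i x - ?c ?j x) / L" for x
  proof -
    have "dirichlet_eigenfun L m x * dirichlet_eigenfun L n x
        = (sqrt (2 / L) * sqrt (2 / L)) * (sin (real (Suc m) * pi * x / L) * sin (real (Suc n) * pi * x / L))"
      unfolding dirichlet_eigenfun_def by (simp only: ac_simps)
    also have "\<dots> = (?c ?i x - ?c ?j x) / L"
    proof -
      have "real (Suc m) * pi * x / L - real (Suc n) * pi * x / L = real_of_int ?i * pi / L * x"
        and "real (Suc m) * pi * x / L + real (Suc n) * pi * x / L = real_of_int ?j * pi / L * x"
        using assms by (simp_all add: field_simps)
      then show ?thesis unfolding sin_times_sin s by (simp add: diff_divide_distrib)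
    qed
    finally show ?thesis .
  qed
  moreover have int: "integrable (lebesgue_on {0..L}) (?c j)" for j
    by (intro continuous_imp_integrable_real continuous_intros)
  ultimately have "L2_inner L (dirichlet_eigenfun L m) (dirichlet_eigenfun L n)
      = ((LINT x|lebesgue_on {0..L}. ?c ?i x) - (LINT x|lebesgue_on {0..L}. ?c ?j x)) / L"
    unfolding L2_inner_def by (simp only: integral_divide_zero Bochner_Integration.integral_diff)
  then show ?thesis unfolding * using assms by auto
qed

lemma LINT_zero_continuous_imp_AE:
  assumes w: "integrable (lebesgue_on {0..L}) (w :: real \<Rightarrow> real)"
    and z: "\<And>c. continuous_on {0..L} c \<Longrightarrow> (LINT x|lebesgue_on {0..L}. w x * c x) = 0"
  shows "AE x in lebesgue_on {0..L}. w x = 0"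
proof -
  have "(\<lambda>x. sgn (w x)) \<in> borel_measurable (lebesgue_on {0..L})"
    using w by simp
  then have "(\<lambda>x. sgn (w x)) measurable_on {0..L}"
    by (simp add: measurable_on_iff_borel_measurable)
  then obtain N g where N: "negligible N" and g: "\<And>n. continuous_on UNIV (g n)"
    and lim: "\<And>x. x \<notin> N \<Longrightarrow> (\<lambda>n. g n x) \<longlonglongrightarrow> (if x \<in> {0..L} then sgn (w x) else 0)"
    unfolding measurable_on_def by blast
  define h where "h n x = max (-1) (min 1 (g n x))" for n :: nat and x :: real
  have ch: "continuous_on {0..L} (h n)" for n
    unfolding h_def by (intro continuous_intros continuous_on_subset[OF g]) auto
  have hl: "(\<lambda>n. w x * h n x) \<longlonglongrightarrow> \<bar>w x\<bar>" if "x \<notin> N" "x \<in> {0..L}" for x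
  proof -
    have "(\<lambda>n. g n x) \<longlonglongrightarrow> sgn (w x)" using lim[OF that(1)] that(2) by simp
    then have "(\<lambda>n. w x * max (-1) (min 1 (g n x))) \<longlonglongrightarrow> w x * max (-1) (min 1 (sgn (w x)))"
      by (intro tendsto_intros)
    moreover have "w x * max (-1) (min 1 (sgn (w x))) = \<bar>w x\<bar>"
      by (simp add: sgn_if)
    ultimately show ?thesis unfolding h_def by simp
  qed
  have AEN: "AE x in lebesgue_on {0..L}. x \<notin> N"
  proof -
    have "N \<in> null_sets lebesgue" using N negligible_iff_null_sets by blast
    then have "AE x in lebesgue. x \<notin> N" by (rule AE_not_in)
    then show ?thesis by (auto simp: AE_restrict_space_iff elim: eventually_mono)
  qed
  have "(\<lambda>n. LINT x|lebesgue_on {0..L}. w x * h n x) \<longlonglongrightarrow> (LINT x|lebesgue_on {0..L}. \<bar>w x\<bar>)"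
  proof (rule integral_dominated_convergence[where w="\<lambda>x. \<bar>w x\<bar>"])
    show "(\<lambda>x. w x * h n x) \<in> borel_measurable (lebesgue_on {0..L})" for n
      using continuous_mult_integrable[OF w ch] by blast
    show "AE x in lebesgue_on {0..L}. (\<lambda>n. w x * h n x) \<longlonglongrightarrow> \<bar>w x\<bar>"
      using AEN by (rule AE_mp) (intro AE_I2, use hl in auto)
    have "\<bar>w x * h n x\<bar> \<le> \<bar>w x\<bar>" for n x
      using mult_left_mono[of "\<bar>h n x\<bar>" 1 "\<bar>w x\<bar>"] by (simp add: abs_mult h_def)
    then show "AE x in lebesgue_on {0..L}. norm (w x * h n x) \<le> \<bar>w x\<bar>" for n
      by simp
  qed (use w in auto)
  moreover have "(LINT x|lebesgue_on {0..L}. w x * h n x) = 0" for n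
    by (rule z[OF ch])
  ultimately have "(LINT x|lebesgue_on {0..L}. \<bar>w x\<bar>) = 0"
    by (simp add: LIMSEQ_const_iff)
  then show ?thesis using w by (subst (asm) integral_nonneg_eq_0_iff_AE) auto
qed

lemma dirichlet_eigenfun_complete:
  assumes L: "0 < L" and u: "u \<in> L2_interval L"
    and z: "\<And>n. L2_inner L u (dirichlet_eigenfun L n) = 0"
  shows "AE x in lebesgue_on {0..L}. u x = 0"
proof -
  define \<theta> where "\<theta> x = pi * x / L" for x
  let ?I = "\<lambda>f. LINT x|lebesgue_on {0..L}. f x"
  note ui = L2_interval_integrable[OF u]
  have cth: "continuous_on S \<theta>" for S unfolding \<theta>_def by (intro continuous_intros) (use L in auto)
  have int: "integrable (lebesgue_on {0..L}) (\<lambda>x. u x * c x)" if "continuous_on {0..L} c" for c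
    using continuous_mult_integrable[OF ui that] .
  have base: "?I (\<lambda>x. u x * sin (real j * \<theta> x)) = 0" for j
  proof (cases j)
    case (Suc n)
    have "?I (\<lambda>x. u x * (sqrt (2 / L) * sin (real j * \<theta> x))) = 0"
      using z[of n] by (simp add: L2_inner_def dirichlet_eigenfun_def \<theta>_def Suc mult.assoc)
    moreover have "?I (\<lambda>x. u x * (sqrt (2 / L) * sin (real j * \<theta> x)))
        = sqrt (2 / L) * ?I (\<lambda>x. u x * sin (real j * \<theta> x))"
      by (simp only: mult.left_commute[of "u _"] integral_mult_right_zero)
    ultimately show ?thesis using L by simp
  qed simp
  have pow: "?I (\<lambda>x. u x * (sin (real j * \<theta> x) * cos (\<theta> x) ^ k)) = 0" for j k
  proof (induction k arbitrary: j)
    case 0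
    show ?case using base by simp
  next
    case (Suc k)
    show ?case
    proof (cases j)
      case (Suc i)
      let ?s = "\<lambda>j x. u x * (sin (real j * \<theta> x) * cos (\<theta> x) ^ k)"
      have "u x * (sin (real j * \<theta> x) * cos (\<theta> x) ^ Suc k) = (?s (Suc j) x + ?s i x) / 2" for x
      proof -
        have "sin (real j * \<theta> x) * cos (\<theta> x) = (sin (real (Suc j) * \<theta> x) + sin (real i * \<theta> x)) / 2"
          unfolding sin_times_cos Suc by (simp add: algebra_simps)
        then have "u x * ((sin (real j * \<theta> x) * cos (\<theta> x)) * cos (\<theta> x) ^ k) = (?s (Suc j) x + ?s i x) / 2"
          by (simp only:) (simp add: algebra_simps add_divide_distrib)
        then show ?thesis by (simp add: ac_simps)
      qed
      moreover have "integrable (lebesgue_on {0..L}) (?s j)" for j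
        by (intro int continuous_intros cth)
      ultimately have "?I (\<lambda>x. u x * (sin (real j * \<theta> x) * cos (\<theta> x) ^ Suc k)) = (?I (?s (Suc j)) + ?I (?s i)) / 2"
        by (simp only: integral_divide_zero Bochner_Integration.integral_add)
      then show ?thesis by (simp only: Suc.IH) simp
    qed simp
  qed
  define w where "w x = u x * sin (\<theta> x)" for x
  have w: "integrable (lebesgue_on {0..L}) w"
    unfolding w_def by (intro int continuous_intros cth)
  have "AE x in lebesgue_on {0..L}. w x = 0"
  proof (rule LINT_zero_continuous_imp_AE[OF w])
    fix c :: "real \<Rightarrow> real" assume c: "continuous_on {0..L} c"
    let ?C = "?I (\<lambda>x. \<bar>w x\<bar>)"
    have "\<bar>?I (\<lambda>x. w x * c x)\<bar> \<le> e * ?C" if e: "0 < e" for e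
    proof -
      have "continuous_on {-1..1} (\<lambda>y. c (L * arccos y / pi))"
      proof (rule continuous_on_compose2[OF c])
        show "continuous_on {-1..1} (\<lambda>y. L * arccos y / pi)"
          by (intro continuous_intros) auto
        show "(\<lambda>y. L * arccos y / pi) ` {-1..1} \<subseteq> {0..L}"
          using L by (auto simp: arccos_lbound arccos_ubound field_simps)
      qed
      then obtain q where "real_polynomial_function q"
        and qe: "\<And>y. y \<in> {-1..1} \<Longrightarrow> \<bar>c (L * arccos y / pi) - q y\<bar> < e"
        using Stone_Weierstrass_real_polynomial_function[OF _ _ e] compact_Icc by metis
      then obtain a n where q: "q = (\<lambda>y. \<Sum>i\<le>n::nat. a i * y ^ i)"
        unfolding real_polynomial_function_iff_sum by blast
      have qc: "continuous_on {0..L} (\<lambda>x. q (cos (\<theta> x)))"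
        unfolding q by (intro continuous_intros cth)
      have "?I (\<lambda>x. w x * q (cos (\<theta> x))) = ?I (\<lambda>x. \<Sum>i\<le>n. a i * (u x * (sin (real 1 * \<theta> x) * cos (\<theta> x) ^ i)))"
        by (simp add: q w_def sum_distrib_left ac_simps)
      also have "\<dots> = (\<Sum>i\<le>n. ?I (\<lambda>x. a i * (u x * (sin (real 1 * \<theta> x) * cos (\<theta> x) ^ i))))"
        by (intro Bochner_Integration.integral_sum integrable_mult_right int continuous_intros cth)
      also have "\<dots> = 0" by (simp only: integral_mult_right_zero pow) simp
      finally have q0: "?I (\<lambda>x. w x * q (cos (\<theta> x))) = 0" .
      have ap: "\<bar>c x - q (cos (\<theta> x))\<bar> \<le> e" if "x \<in> {0..L}" for x
      proof -
        have "0 \<le> \<theta> x" "\<theta> x \<le> pi" using that L by (auto simp: \<theta>_def field_simps)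
        then have "L * arccos (cos (\<theta> x)) / pi = x" using L by (simp add: arccos_cos \<theta>_def)
        then show ?thesis using qe[of "cos (\<theta> x)"] by simp
      qed
      have "?I (\<lambda>x. w x * c x) = ?I (\<lambda>x. w x * (c x - q (cos (\<theta> x))))"
        using continuous_mult_integrable[OF w c] continuous_mult_integrable[OF w qc] q0
        by (simp add: right_diff_distrib)
      also have "\<bar>\<dots>\<bar> \<le> ?I (\<lambda>x. e * \<bar>w x\<bar>)"
      proof (rule order_trans[OF integral_abs_bound], rule integral_mono)
        show "integrable (lebesgue_on {0..L}) (\<lambda>x. \<bar>w x * (c x - q (cos (\<theta> x)))\<bar>)"
          by (intro integrable_abs continuous_mult_integrable[OF w] continuous_intros c qc)
        show "integrable (lebesgue_on {0..L}) (\<lambda>x. e * \<bar>w x\<bar>)" using w by simp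
        show "\<bar>w x * (c x - q (cos (\<theta> x)))\<bar> \<le> e * \<bar>w x\<bar>" if "x \<in> space (lebesgue_on {0..L})" for x
          using ap[of x] that by (simp add: abs_mult mult.commute[of "\<bar>w x\<bar>"] mult_right_mono)
      qed
      finally show ?thesis by simp
    qed
    then have "\<bar>?I (\<lambda>x. w x * c x)\<bar> \<le> 0"
    proof -
      assume *: "\<And>e. 0 < e \<Longrightarrow> \<bar>?I (\<lambda>x. w x * c x)\<bar> \<le> e * ?C"
      have "((\<lambda>e. e * ?C) \<longlongrightarrow> 0 * ?C) (at_right 0)" by (intro tendsto_intros)
      then show ?thesis
        using * by (intro tendsto_lowerbound[where f="\<lambda>e. e * ?C" and F="at_right 0"])
          (auto simp: eventually_at_filter)
    qed
    then show "?I (\<lambda>x. w x * c x) = 0" by simp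
  qed
  moreover have "AE x in lebesgue_on {0..L}. x \<notin> {0, L}"
  proof -
    have "{0, L} \<in> null_sets lebesgue"
      using negligible_iff_null_sets negligible_finite[of "{0, L}"] by blast
    then have "AE x in lebesgue. x \<notin> {0, L}" by (rule AE_not_in)
    then show ?thesis by (auto simp: AE_restrict_space_iff elim: eventually_mono)
  qed
  ultimately show ?thesis
  proof (rule AE_mp[OF AE_conjI], intro AE_I2 impI)
    fix x assume x: "x \<in> space (lebesgue_on {0..L})" "w x = 0 \<and> x \<notin> {0, L}"
    then have "0 < \<theta> x" "\<theta> x < pi" using L by (auto simp: \<theta>_def field_simps)
    then show "u x = 0" using x sin_gt_zero[of "\<theta> x"] by (auto simp: w_def)
  qed
qed

lemma L2_inner_diff:
  assumes "u \<in> L2_interval L" "v \<in> L2_interval L"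
  shows "L2_inner L (\<lambda>x. u x - v x) (dirichlet_eigenfun L n)
       = L2_inner L u (dirichlet_eigenfun L n) - L2_inner L v (dirichlet_eigenfun L n)"
  unfolding L2_inner_def left_diff_distrib
  using assms by (intro Bochner_Integration.integral_diff continuous_mult_integrable L2_interval_integrable continuous_eigenfun)

lemma sqrt_infsum_triangle:
  fixes a b :: "nat \<Rightarrow> real"
  assumes a: "(\<lambda>n. (a n)\<^sup>2) summable_on UNIV" and b: "(\<lambda>n. (b n)\<^sup>2) summable_on UNIV"
  shows "(\<lambda>n. (a n + b n)\<^sup>2) summable_on UNIV"
    and "sqrt (\<Sum>\<^sub>\<infinity>n. (a n + b n)\<^sup>2) \<le> sqrt (\<Sum>\<^sub>\<infinity>n. (a n)\<^sup>2) + sqrt (\<Sum>\<^sub>\<infinity>n. (b n)\<^sup>2)"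
proof -
  let ?R = "sqrt (\<Sum>\<^sub>\<infinity>n. (a n)\<^sup>2) + sqrt (\<Sum>\<^sub>\<infinity>n. (b n)\<^sup>2)"
  have R: "0 \<le> ?R" by (simp add: infsum_nonneg)
  have fin: "(\<Sum>n\<in>F. (a n + b n)\<^sup>2) \<le> ?R\<^sup>2" if "finite F" for F
  proof -
    have "L2_set (\<lambda>n. a n + b n) F \<le> L2_set a F + L2_set b F"
      by (rule L2_set_triangle_ineq)
    also have "\<dots> \<le> ?R"
      unfolding L2_set_def using that a b by (intro add_mono real_sqrt_le_mono finite_sum_le_infsum) auto
    finally have "(L2_set (\<lambda>n. a n + b n) F)\<^sup>2 \<le> ?R\<^sup>2" by (intro power_mono) auto
    then show ?thesis by (simp add: L2_set_def sum_nonneg)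
  qed
  show s: "(\<lambda>n. (a n + b n)\<^sup>2) summable_on UNIV"
    by (rule nonneg_bdd_above_summable_on) (use fin in \<open>auto simp: bdd_above_def\<close>)
  have "(\<Sum>\<^sub>\<infinity>n. (a n + b n)\<^sup>2) \<le> ?R\<^sup>2"
    by (rule infsum_le_finite_sums[OF s fin])
  then show "sqrt (\<Sum>\<^sub>\<infinity>n. (a n + b n)\<^sup>2) \<le> ?R" using R by (rule real_le_lsqrt[rotated])
qed

lemma Metric_space_XD:
  assumes L: "0 < L"
  shows "Metric_space (XD L \<alpha>) (XD_dist L \<alpha>)"
proof
  have co: "frac_coeff L \<alpha> (\<lambda>x. u x - v x) n = frac_coeff L \<alpha> u n - frac_coeff L \<alpha> v n"
    if "u \<in> XD L \<alpha>" "v \<in> XD L \<alpha>" for u v n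
    using that by (simp add: frac_coeff_def XD_def frac_domain_def L2_inner_diff right_diff_distrib)
  have neg: "frac_coeff L \<alpha> (\<lambda>x. - u x) n = - frac_coeff L \<alpha> u n" for u n
    by (simp add: frac_coeff_def L2_inner_def)
  have su: "(\<lambda>n. (frac_coeff L \<alpha> u n)\<^sup>2) summable_on UNIV" if "u \<in> XD L \<alpha>" for u
    using that by (simp add: XD_def frac_domain_def)
  have sd: "(\<lambda>n. (frac_coeff L \<alpha> (\<lambda>x. u x - v x) n)\<^sup>2) summable_on UNIV"
    if "u \<in> XD L \<alpha>" "v \<in> XD L \<alpha>" for u v
    using sqrt_infsum_triangle(1)[of "frac_coeff L \<alpha> u" "\<lambda>n. - frac_coeff L \<alpha> v n"] su that
    by (simp add: co)
  fix u v w
  show "0 \<le> XD_dist L \<alpha> u v"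
    by (simp add: XD_dist_def frac_norm_def infsum_nonneg)
  show "XD_dist L \<alpha> u v = XD_dist L \<alpha> v u"
    using neg[of "\<lambda>x. u x - v x"] by (simp add: XD_dist_def frac_norm_def)
  show "XD_dist L \<alpha> u v = 0 \<longleftrightarrow> u = v" if uv: "u \<in> XD L \<alpha>" "v \<in> XD L \<alpha>"
  proof
    assume "u = v"
    then show "XD_dist L \<alpha> u v = 0" by (simp add: XD_dist_def frac_norm_def frac_coeff_def L2_inner_def)
  next
    assume "XD_dist L \<alpha> u v = 0"
    then have "(\<Sum>\<^sub>\<infinity>n. (frac_coeff L \<alpha> (\<lambda>x. u x - v x) n)\<^sup>2) \<le> 0"
      by (simp add: XD_dist_def frac_norm_def)
    then have "frac_coeff L \<alpha> (\<lambda>x. u x - v x) n = 0" for n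
      using nonneg_infsum_le_0D[OF _ sd[OF uv], of n] by simp
    then have "L2_inner L (\<lambda>x. u x - v x) (dirichlet_eigenfun L n) = 0" for n
      using L by (auto simp: frac_coeff_def dirichlet_eigenvalue_def)
    moreover have c: "continuous_on {0..L} (\<lambda>x. u x - v x)"
      using uv unfolding XD_def C1_interval_def
      by (intro continuous_intros differentiable_imp_continuous_on) auto
    ultimately have "AE x in lebesgue_on {0..L}. u x - v x = 0"
      using dirichlet_eigenfun_complete[OF L continuous_in_L2[OF c]] by blast
    then have "AE x in lebesgue. x \<in> {0..L} \<longrightarrow> u x - v x = 0"
      by (simp add: AE_restrict_space_iff)
    then obtain N where N: "N \<in> null_sets lebesgue"
        "\<And>x. x \<notin> N \<Longrightarrow> x \<in> {0..L} \<Longrightarrow> u x - v x = 0"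
      by (elim AE_E3) auto
    have "u x = v x" if x: "x \<in> {0..L}" for x
    proof (rule ccontr)
      assume ne: "u x \<noteq> v x"
      have "openin (top_of_set {0..L}) {y\<in>{0..L}. u y - v y \<in> - {0}}"
        using continuous_openin_preimage_gen[OF c, of "-{0}"] by (simp add: vimage_def Int_def open_Compl)
      then obtain d where d: "d > 0" "\<And>y. y \<in> {0..L} \<Longrightarrow> dist y x < d \<Longrightarrow> u y - v y \<noteq> 0"
        using x ne by (force simp: openin_euclidean_subtopology_iff)
      define a b where "a = max 0 (x - d / 2)" and "b = min L (x + d / 2)"
      have ab: "a < b" using x d L by (auto simp: a_def b_def)
      have "{a..b} \<subseteq> N"
      proof
        fix y assume "y \<in> {a..b}"
        then have "y \<in> {0..L}" "dist y x < d"
          using d(1) by (auto simp: a_def b_def dist_real_def)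
        then show "y \<in> N" using N(2) d(2) by blast
      qed
      then have "negligible {a..b}"
        using N(1) negligible_iff_null_sets negligible_subset by blast
      then show False using ab negligible_interval(1)[of a b] by simp
    qed
    moreover have "u x = v x" if "x \<notin> {0..L}" for x using uv that by (simp add: XD_def)
    ultimately show "u = v" by blast
  qed
  show "XD_dist L \<alpha> u w \<le> XD_dist L \<alpha> u v + XD_dist L \<alpha> v w"
    if uvw: "u \<in> XD L \<alpha>" "v \<in> XD L \<alpha>" "w \<in> XD L \<alpha>"
    using sqrt_infsum_triangle(2)[OF sd[OF uvw(1,2)] sd[OF uvw(2,3)]] uvw
    by (simp add: XD_dist_def frac_norm_def co)
qed


section \<open>The skew-product semiflow\<close>

text \<open>The solution on \<open>[0,T)\<close> with values in \<open>X\<^sub>D\<close>: a continuous curve in \<open>X\<^sub>D\<close> that satisfies the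
  equation classically for \<open>0 < t < T\<close>.\<close>
definition dirichlet_solution ::
    "real \<Rightarrow> real \<Rightarrow> nonlinearity \<Rightarrow> (real \<Rightarrow> real) \<Rightarrow> real \<Rightarrow> (real \<Rightarrow> real \<Rightarrow> real) \<Rightarrow> bool" where
  "dirichlet_solution L \<alpha> g u0 T u \<longleftrightarrow>
     0 < T \<and> u 0 = u0 \<and>
     continuous_map (top_of_set {0..<T}) (XD_topology L \<alpha>) u \<and>
     (\<forall>t\<in>{0..<T}. u t 0 = 0 \<and> u t L = 0) \<and>
     (\<forall>t\<in>{0<..<T}. \<forall>x\<in>{0<..<L}.
        (\<lambda>s. u s x) field_differentiable (at t) \<and>
        u t field_differentiable (at x) \<and>
        deriv (u t) field_differentiable (at x) \<and>
        deriv (\<lambda>s. u s x) t = deriv (deriv (u t)) x + g (t, u t x, deriv (u t) x))"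

text \<open>\<open>\<phi>\<^sup>D(t, \<cdot>; u\<^sub>0, g)\<close>, meaningful when \<open>phiD_exists\<close> holds.\<close>
definition phiD_exists :: "real \<Rightarrow> real \<Rightarrow> real \<Rightarrow> (real \<Rightarrow> real) \<Rightarrow> nonlinearity \<Rightarrow> bool" where
  "phiD_exists L \<alpha> t u0 g \<longleftrightarrow> (\<exists>T u. t < T \<and> dirichlet_solution L \<alpha> g u0 T u)"

definition phiD :: "real \<Rightarrow> real \<Rightarrow> real \<Rightarrow> (real \<Rightarrow> real) \<Rightarrow> nonlinearity \<Rightarrow> real \<Rightarrow> real" where
  "phiD L \<alpha> t u0 g = (THE w. \<exists>T u. t < T \<and> dirichlet_solution L \<alpha> g u0 T u \<and> w = u t)"

type_synonym phase_point = "(real \<Rightarrow> real) \<times> nonlinearity"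

definition PiD :: "real \<Rightarrow> real \<Rightarrow> real \<Rightarrow> phase_point \<Rightarrow> phase_point" where
  "PiD L \<alpha> t = (\<lambda>(u0, g). (phiD L \<alpha> t u0 g, time_shift t g))"

definition phase_space :: "real \<Rightarrow> real \<Rightarrow> nonlinearity \<Rightarrow> phase_point topology" where
  "phase_space L \<alpha> f = prod_topology (XD_topology L \<alpha>) (hull_topology f)"

definition positively_invariant :: "real \<Rightarrow> real \<Rightarrow> phase_point set \<Rightarrow> bool" where
  "positively_invariant L \<alpha> N \<longleftrightarrow>
     (\<forall>(u0, g)\<in>N. \<forall>t\<ge>0. phiD_exists L \<alpha> t u0 g \<and> PiD L \<alpha> t (u0, g) \<in> N)"

definition minimal_set :: "real \<Rightarrow> real \<Rightarrow> nonlinearity \<Rightarrow> phase_point set \<Rightarrow> bool" where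
  "minimal_set L \<alpha> f M \<longleftrightarrow>
     M \<noteq> {} \<and> compactin (phase_space L \<alpha> f) M \<and> positively_invariant L \<alpha> M \<and>
     (\<forall>N\<subseteq>M. N \<noteq> {} \<and> compactin (phase_space L \<alpha> f) N \<and> positively_invariant L \<alpha> N \<longrightarrow> N = M)"

text \<open>The two-sided flow on a minimal set \<open>M\<close>: for \<open>t < 0\<close> one follows the backward orbit
  in \<open>M\<close>.\<close>
definition PiD_on ::
    "real \<Rightarrow> real \<Rightarrow> phase_point set \<Rightarrow> real \<Rightarrow> phase_point \<Rightarrow> phase_point" where
  "PiD_on L \<alpha> M t m =
     (if 0 \<le> t then PiD L \<alpha> t m else (THE m'. m' \<in> M \<and> PiD L \<alpha> (- t) m' = m))"

definition boundary_slope :: "real \<Rightarrow> phase_point \<Rightarrow> real \<times> nonlinearity" where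
  "boundary_slope L = (\<lambda>(u0, g). (D_on L u0 0, g))"


section \<open>Flows and topological conjugacy\<close>

definition flow_on :: "'a topology \<Rightarrow> (real \<Rightarrow> 'a \<Rightarrow> 'a) \<Rightarrow> bool" where
  "flow_on X \<Phi> \<longleftrightarrow>
     continuous_map (prod_topology euclideanreal X) X (\<lambda>(t, x). \<Phi> t x) \<and>
     (\<forall>x\<in>topspace X. \<Phi> 0 x = x \<and> (\<forall>s t. \<Phi> (s + t) x = \<Phi> s (\<Phi> t x)))"

definition topologically_conjugate ::
    "'a topology \<Rightarrow> (real \<Rightarrow> 'a \<Rightarrow> 'a) \<Rightarrow> 'b topology \<Rightarrow> (real \<Rightarrow> 'b \<Rightarrow> 'b) \<Rightarrow> bool" where
  "topologically_conjugate X \<Phi> Y \<Psi> \<longleftrightarrow> flow_on X \<Phi> \<and> flow_on Y \<Psi> \<and>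
     (\<exists>h. homeomorphic_map X Y h \<and> (\<forall>t. \<forall>x\<in>topspace X. h (\<Phi> t x) = \<Psi> t (h x)))"

definition minimal_flow :: "'a topology \<Rightarrow> (real \<Rightarrow> 'a \<Rightarrow> 'a) \<Rightarrow> bool" where
  "minimal_flow X \<Phi> \<longleftrightarrow> flow_on X \<Phi> \<and> compact_space X \<and> topspace X \<noteq> {} \<and>
     (\<forall>N\<subseteq>topspace X. N \<noteq> {} \<and> compactin X N \<and> (\<forall>t\<ge>0. \<Phi> t ` N \<subseteq> N) \<longrightarrow> N = topspace X)"

abbreviation real_hull_space :: "nonlinearity \<Rightarrow> (real \<times> nonlinearity) topology" where
  "real_hull_space f \<equiv> prod_topology euclideanreal (hull_topology f)"

definition ap_forced_minimal_flow ::
    "nonlinearity \<Rightarrow> (real \<times> nonlinearity) set \<Rightarrow>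
      (real \<Rightarrow> real \<times> nonlinearity \<Rightarrow> real \<times> nonlinearity) \<Rightarrow> bool" where
  "ap_forced_minimal_flow f K \<psi> \<longleftrightarrow>
     compactin (real_hull_space f) K \<and>
     minimal_flow (subtopology (real_hull_space f) K) \<psi> \<and>
     (\<forall>t. \<forall>(a, g)\<in>K. snd (\<psi> t (a, g)) = time_shift t g)"

end

theory Submission
  imports Defs
begin

text \<open>Only maximum principles and minimality are used, and no theory of the zero number beyond the fact that
  sign alternations of a solution of a linear parabolic inequality do not increase, which is a maximum principle for
  products of its values at several points.

  Suppose first that there is \<open>\<rho>\<close> such that all \<open>u\<close> in \<open>M\<close> vanish at \<open>\<rho>\<close> and have the same strict sign on \<open>(0,\<rho>)\<close>.
  For two elements \<open>u, v\<close> of a fibre of \<open>M\<close>, the difference \<open>u(x) - v(x + b)\<close> has opposite signs at the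
  ends of \<open>[0, \<rho> - b]\<close>. For \<open>b\<close> close to \<open>\<rho>\<close> it changes sign only once; the set of \<open>b\<close> for which
  this is so throughout \<open>M\<close> is closed, and it is open since \<open>M\<close> is compact and invariant. Letting \<open>b\<close> tend to \<open>0\<close>, any
  two elements of a fibre are ordered on \<open>[0,\<rho>]\<close>. The Hopf lemma then shows that equal slopes at \<open>0\<close> force equality, and the
  strong maximum principle that ordered solutions cannot merge, so backward orbits are unique.

  In case (b), minimality and the strong maximum principle allow \<open>\<rho> = L\<close> unless \<open>M\<close> consists of zeros. In case (a), extend the solutions to odd,
  \<open>2L\<close>-periodic functions and consider \<open>u(x) + u(2a - x)\<close>, which satisfies Neumann conditions on \<open>[a, a + L]\<close>. By
  minimality all elements of \<open>M\<close> have the same, finite, number of sign alternations there, so \<open>u(a)\<close> cannot take both signs on \<open>M\<close>,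
  and if it vanishes on all of \<open>M\<close>, then every \<open>u\<close> is odd about \<open>a\<close>. Take the smallest such \<open>a\<close> as \<open>\<rho>\<close>; by the reflections \<open>u\<close>
  is determined by its values on \<open>[0,\<rho>]\<close>.\<close>

section \<open>Maximum principles\<close>

text \<open>The obstacle is openness in the sliding argument: a single change of sign may pass
  through a degenerate zero, which a small perturbation could split. It is enough to find one
  instant at which the zero is simple. To this end the zero set is touched by a slanted line
  \<open>x + \<mu> * t = const\<close>: beyond the line the difference is positive, and a Hopf lemma
  on a region with a slanted side gives a nonzero derivative at the point of contact. Finiteness of
  the number of alternations comes from the long past that every element of M has: many ordered
  points in a bounded interval have small gaps, where the dissipation of the product of values beats
  the lower-order terms, so a product that was bounded long ago is zero now. Solutions are classical
  only for \<open>0 < t\<close> and \<open>0 < x < L\<close>, and no linearised equation with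
  coefficients is formed. Every maximum principle rests on the pointwise inequality
  \<open>|w_t - w_xx| <= C * (|w| + |w_x|)\<close>.\<close>

text \<open>Schwarz's second derivative. The odd extension of a solution has it at \<open>0\<close> and \<open>L\<close>, although nothing is
  known about \<open>u\<^sub>x\<^sub>x\<close> up to the boundary.\<close>
definition has_sym_deriv2 :: "(real \<Rightarrow> real) \<Rightarrow> real \<Rightarrow> real \<Rightarrow> bool" where
  "has_sym_deriv2 v x q \<longleftrightarrow> ((\<lambda>h. (v (x + h) + v (x - h) - 2 * v x) / h\<^sup>2) \<longlongrightarrow> q) (at_right 0)"

lemma has_sym_deriv2_diff:
  assumes "has_sym_deriv2 v x p" "has_sym_deriv2 w x q"
  shows "has_sym_deriv2 (\<lambda>y. v y - w y) x (p - q)"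
  using tendsto_diff[OF assms[unfolded has_sym_deriv2_def]]
  unfolding has_sym_deriv2_def by (simp add: diff_divide_distrib[symmetric] algebra_simps)

lemma has_sym_deriv2_cmult:
  assumes "has_sym_deriv2 v x p"
  shows "has_sym_deriv2 (\<lambda>y. c * v y) x (c * p)"
  using tendsto_mult_left[OF assms[unfolded has_sym_deriv2_def], of c]
  unfolding has_sym_deriv2_def by (simp add: algebra_simps)

lemma has_sym_deriv2_shift:
  assumes "has_sym_deriv2 v (x + b) p"
  shows "has_sym_deriv2 (\<lambda>y. v (y + b)) x p"
  using assms unfolding has_sym_deriv2_def by (simp add: algebra_simps)

lemma has_sym_deriv2_reflect:
  assumes "has_sym_deriv2 v (a - x) p"
  shows "has_sym_deriv2 (\<lambda>y. v (a - y)) x p"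
  using assms unfolding has_sym_deriv2_def by (simp add: algebra_simps)

lemma has_sym_deriv2_cong:
  assumes "has_sym_deriv2 v x p" "0 < \<delta>" "\<And>y. \<bar>y - x\<bar> < \<delta> \<Longrightarrow> w y = v y"
  shows "has_sym_deriv2 w x p"
proof -
  have "\<forall>\<^sub>F h in at_right 0. (v (x + h) + v (x - h) - 2 * v x) / h\<^sup>2 = (w (x + h) + w (x - h) - 2 * w x) / h\<^sup>2"
    unfolding eventually_at_right_field using assms(2,3) by (intro exI[of _ \<delta>]) simp
  with assms(1) show ?thesis unfolding has_sym_deriv2_def using Lim_transform_eventually by fast
qed

lemma has_sym_deriv2_local_min:
  assumes "has_sym_deriv2 v x q" "0 < \<delta>" "\<And>y. \<bar>y - x\<bar> < \<delta> \<Longrightarrow> v x \<le> v y"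
  shows "0 \<le> q"
proof (rule tendsto_lowerbound[OF assms(1)[unfolded has_sym_deriv2_def]])
  have "0 \<le> (v (x + h) + v (x - h) - 2 * v x) / h\<^sup>2" if "0 < h" "h < \<delta>" for h
    using assms(3)[of "x + h"] assms(3)[of "x - h"] that by simp
  then show "\<forall>\<^sub>F h in at_right 0. 0 \<le> (v (x + h) + v (x - h) - 2 * v x) / h\<^sup>2"
    unfolding eventually_at_right_field using assms(2) by blast
qed simp

text \<open>One application of l'Hopital's rule; the new quotient
  \<open>(v' (x + h) - v' (x - h)) / (2 * h)\<close> is the mean of the two one-sided difference
  quotients of \<open>v'\<close> at \<open>x\<close>. So the second derivative is asked for at the
  single point \<open>x\<close>, without continuity.\<close>

lemma has_sym_deriv2_DERIV:
  assumes "0 < \<delta>" and d: "\<And>y. \<bar>y - x\<bar> < \<delta> \<Longrightarrow> (v has_real_derivative v' y) (at y)"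
    and d2: "(v' has_real_derivative q) (at x)"
  shows "has_sym_deriv2 v x q"
  unfolding has_sym_deriv2_def
proof (rule lhopital_right_0[where f' = "\<lambda>h. v' (x + h) - v' (x - h)" and g' = "\<lambda>h. 2 * h"])
  have c: "isCont v x" using d[of x] assms(1) DERIV_isCont by auto
  have "((\<lambda>h. v (x + h) + v (x - h) - 2 * v x) \<longlongrightarrow> v (x + 0) + v (x - 0) - 2 * v x) (at_right 0)"
    by (intro tendsto_intros isCont_tendsto_compose[where g = v]) (use c in auto)
  then show "((\<lambda>h. v (x + h) + v (x - h) - 2 * v x) \<longlongrightarrow> 0) (at_right 0)" by simp
  show "((\<lambda>h::real. h\<^sup>2) \<longlongrightarrow> 0) (at_right 0)" by (auto intro!: tendsto_eq_intros)
  show "\<forall>\<^sub>F h in at_right (0::real). h\<^sup>2 \<noteq> 0" "\<forall>\<^sub>F h in at_right (0::real). 2 * h \<noteq> 0"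
    by (auto simp: eventually_at_right_field intro!: exI[of _ 1])
  show "\<forall>\<^sub>F h in at_right 0. ((\<lambda>h. v (x + h) + v (x - h) - 2 * v x) has_real_derivative v' (x + h) - v' (x - h)) (at h)"
    unfolding eventually_at_right_field
  proof (intro exI[of _ \<delta>] conjI allI impI)
    fix h assume "0 < h" "h < \<delta>"
    then have v: "(v has_real_derivative v' (x + h)) (at (x + h))" "(v has_real_derivative v' (x - h)) (at (x - h))"
      by (auto intro!: d)
    have "((\<lambda>h. v (x + h)) has_real_derivative v' (x + h) * 1) (at h)"
      by (rule DERIV_chain2[where f = v and g = "\<lambda>h. x + h", OF v(1)]) (auto intro!: derivative_eq_intros)
    moreover have "((\<lambda>h. v (x - h)) has_real_derivative v' (x - h) * (- 1)) (at h)"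
      by (rule DERIV_chain2[where f = v and g = "\<lambda>h. x - h", OF v(2)]) (auto intro!: derivative_eq_intros)
    ultimately show "((\<lambda>h. v (x + h) + v (x - h) - 2 * v x) has_real_derivative v' (x + h) - v' (x - h)) (at h)"
      by (auto intro!: derivative_eq_intros)
  qed (use assms in auto)
  show "\<forall>\<^sub>F h in at_right (0::real). ((\<lambda>h. h\<^sup>2) has_real_derivative 2 * h) (at h)"
    by (intro always_eventually allI) (auto intro!: derivative_eq_intros)
  have "((\<lambda>h. (v' (x + h) - v' x) / h) \<longlongrightarrow> q) (at 0)"
    using d2 by (simp add: has_field_derivative_def field_has_derivative_at DERIV_def)
  then have p: "((\<lambda>h. (v' (x + h) - v' x) / h) \<longlongrightarrow> q) (at_right 0)"
    and "((\<lambda>h. (v' (x + h) - v' x) / h) \<longlongrightarrow> q) (at_left 0)"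
    by (auto intro: tendsto_within_subset)
  then have m: "((\<lambda>h. (v' (x - h) - v' x) / - h) \<longlongrightarrow> q) (at_right 0)"
    by (simp add: at_left_minus[of 0] filterlim_filtermap)
  have "((\<lambda>h. ((v' (x + h) - v' x) / h + (v' (x - h) - v' x) / - h) / 2) \<longlongrightarrow> (q + q) / 2) (at_right 0)"
    by (intro tendsto_divide tendsto_add p m tendsto_const) auto
  moreover have "((v' (x + h) - v' x) / h + (v' (x - h) - v' x) / - h) / 2 = (v' (x + h) - v' (x - h)) / (2 * h)" for h
    by (simp add: diff_divide_distrib add_divide_distrib)
  moreover have "(q + q) / 2 = q" by simp
  ultimately show "((\<lambda>h. (v' (x + h) - v' (x - h)) / (2 * h)) \<longlongrightarrow> q) (at_right 0)" by (simp only:)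
qed

text \<open>An extremum may be attained at the final time, where only the past is available for
  comparison. Hence a sign of the time derivative instead of its vanishing.\<close>

lemma DERIV_left_max_nonneg:
  assumes "(f has_real_derivative D) (at t)" "0 < \<delta>" "\<And>s. t - \<delta> < s \<Longrightarrow> s < t \<Longrightarrow> f s \<le> f t"
  shows "0 \<le> D"
proof (rule ccontr)
  assume "\<not> 0 \<le> D"
  then obtain d where "0 < d" "\<And>h. 0 < h \<Longrightarrow> h < d \<Longrightarrow> f t < f (t - h)"
    using DERIV_neg_dec_left[OF assms(1)] by auto
  then have "f t < f (t - min d \<delta> / 2)" using assms(2) by (auto simp: min_def)
  moreover have "f (t - min d \<delta> / 2) \<le> f t" using assms(2) \<open>0 < d\<close> by (intro assms(3)) auto
  ultimately show False by simp
qed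

section \<open>Parabolic differential inequalities and the comparison principle\<close>

text \<open>The inequality \<open>w_t - w_xx >= - C * (|w| + |w_x|)\<close> at one point. The
  absolute values stand for arbitrary bounded coefficients, so that differences of solutions of a
  Lipschitz equation are covered directly.\<close>

definition par_super :: "real \<Rightarrow> (real \<Rightarrow> real \<Rightarrow> real) \<Rightarrow> real \<Rightarrow> real \<Rightarrow> bool" where
  "par_super C w t x \<longleftrightarrow> (\<exists>wt wx wxx. ((\<lambda>s. w s x) has_real_derivative wt) (at t) \<and>
     (w t has_real_derivative wx) (at x) \<and> has_sym_deriv2 (w t) x wxx \<and>
     - (C * (\<bar>w t x\<bar> + \<bar>wx\<bar>)) \<le> wt - wxx)"

text \<open>Two-sided, so that it is inherited by negative multiples; \<open>par_super\<close> is
  not.\<close>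

definition par_ineq :: "real \<Rightarrow> (real \<Rightarrow> real \<Rightarrow> real) \<Rightarrow> real \<Rightarrow> real \<Rightarrow> bool" where
  "par_ineq C w t x \<longleftrightarrow> (\<exists>wt wx wxx. ((\<lambda>s. w s x) has_real_derivative wt) (at t) \<and>
     (w t has_real_derivative wx) (at x) \<and> has_sym_deriv2 (w t) x wxx \<and>
     \<bar>wt - wxx\<bar> \<le> C * (\<bar>w t x\<bar> + \<bar>wx\<bar>))"

lemma par_ineq_imp_super: "par_ineq C w t x \<Longrightarrow> par_super C w t x"
  unfolding par_ineq_def par_super_def by (metis abs_le_D2 minus_le_iff)

lemma par_ineq_cmult:
  assumes "par_ineq C w t x"
  shows "par_ineq C (\<lambda>t x. c * w t x) t x"
proof -
  obtain wt wx wxx where *: "((\<lambda>s. w s x) has_real_derivative wt) (at t)"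
     "(w t has_real_derivative wx) (at x)" "has_sym_deriv2 (w t) x wxx"
     "\<bar>wt - wxx\<bar> \<le> C * (\<bar>w t x\<bar> + \<bar>wx\<bar>)" using assms unfolding par_ineq_def by blast
  have "\<bar>c\<bar> * \<bar>wt - wxx\<bar> \<le> \<bar>c\<bar> * (C * (\<bar>w t x\<bar> + \<bar>wx\<bar>))" using *(4) by (rule mult_left_mono) simp
  then have "\<bar>c * wt - c * wxx\<bar> \<le> C * (\<bar>c * w t x\<bar> + \<bar>c * wx\<bar>)"
    unfolding right_diff_distrib[symmetric] abs_mult distrib_left[symmetric] by (simp only: mult.left_commute)
  then show ?thesis unfolding par_ineq_def
    using DERIV_cmult[OF *(1), of c] DERIV_cmult[OF *(2), of c] has_sym_deriv2_cmult[OF *(3), of c] by blast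
qed

lemma par_ineq_reflect:
  assumes "par_ineq C w t (a - x)"
  shows "par_ineq C (\<lambda>t x. w t (a - x)) t x"
proof -
  obtain wt wx wxx where *: "((\<lambda>s. w s (a - x)) has_real_derivative wt) (at t)"
     "(w t has_real_derivative wx) (at (a - x))" "has_sym_deriv2 (w t) (a - x) wxx"
     "\<bar>wt - wxx\<bar> \<le> C * (\<bar>w t (a - x)\<bar> + \<bar>wx\<bar>)" using assms unfolding par_ineq_def by blast
  have "((\<lambda>x. w t (a - x)) has_real_derivative - wx) (at x)"
    by (rule DERIV_chain2[where f = "w t" and g = "\<lambda>x. a - x" and Db = "-1", OF *(2), THEN DERIV_cong])
      (auto intro!: derivative_eq_intros)
  then show ?thesis unfolding par_ineq_def using *(1,4) has_sym_deriv2_reflect[OF *(3)]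
    by (intro exI[of _ wt] exI[of _ "- wx"] exI[of _ wxx]) auto
qed

text \<open>At a negative minimum of \<open>exp (- (C + 1) * t) * d\<close> over \<open>S\<close>
  the first space derivative vanishes and the second is nonnegative, so the inequality gives
  \<open>C * d <= d_t\<close>, whereas minimality towards the past gives
  \<open>d_t <= (C + 1) * d\<close>. Asking for room inside \<open>S\<close> at the points with
  \<open>d < 0\<close> replaces boundary conditions and admits sets with slanted sides; the room is
  to the past and to both sides, never to the future.\<close>

lemma comparison_principle:
  fixes d :: "real \<Rightarrow> real \<Rightarrow> real"
  assumes S: "compact S" and c: "continuous_on S (\<lambda>(t, x). d t x)"
    and loc: "\<And>t x. (t, x) \<in> S \<Longrightarrow> d t x < 0 \<Longrightarrow> par_super C d t x \<and>
       (\<exists>\<delta>>0. (\<forall>s. t - \<delta> < s \<and> s < t \<longrightarrow> (s, x) \<in> S) \<and> (\<forall>y. \<bar>y - x\<bar> < \<delta> \<longrightarrow> (t, y) \<in> S))"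
    and tx: "(t, x) \<in> S"
  shows "0 \<le> d t x"
proof (rule ccontr)
  assume neg: "\<not> 0 \<le> d t x"
  define e where "e = (\<lambda>(t, x). exp (- (C + 1) * t) * d t x)"
  have "continuous_on S e"
    unfolding e_def split_def using c[unfolded split_def] by (intro continuous_intros)
  then obtain q where "q \<in> S" "\<forall>p\<in>S. e q \<le> e p"
    using continuous_attains_inf[OF S] tx by blast
  then obtain \<tau> y where \<tau>: "(\<tau>, y) \<in> S" and min: "\<And>s z. (s, z) \<in> S \<Longrightarrow> e (\<tau>, y) \<le> e (s, z)"
    by (metis prod.collapse)
  have "e (t, x) < 0" using neg by (simp add: e_def mult_less_0_iff)
  then have "e (\<tau>, y) < 0" using min[OF tx] by simp
  then have dn: "d \<tau> y < 0" by (simp add: e_def mult_less_0_iff)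
  obtain \<delta> wt wx wxx where \<delta>: "0 < \<delta>" "\<And>s. \<tau> - \<delta> < s \<Longrightarrow> s < \<tau> \<Longrightarrow> (s, y) \<in> S"
      "\<And>z. \<bar>z - y\<bar> < \<delta> \<Longrightarrow> (\<tau>, z) \<in> S"
    and w: "((\<lambda>s. d s y) has_real_derivative wt) (at \<tau>)" "(d \<tau> has_real_derivative wx) (at y)"
      "has_sym_deriv2 (d \<tau>) y wxx" "- (C * (\<bar>d \<tau> y\<bar> + \<bar>wx\<bar>)) \<le> wt - wxx"
    using loc[OF \<tau> dn] unfolding par_super_def by blast
  have lm: "d \<tau> y \<le> d \<tau> z" if "\<bar>z - y\<bar> < \<delta>" for z
    using min[OF \<delta>(3)[OF that]] by (simp add: e_def)
  have "wx = 0" using DERIV_local_min[OF w(2) \<delta>(1)] lm by (simp add: abs_minus_commute)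
  moreover have "0 \<le> wxx" using has_sym_deriv2_local_min[OF w(3) \<delta>(1)] lm by blast
  ultimately have 1: "C * d \<tau> y \<le> wt" using w(4) dn by simp
  have "((\<lambda>s. - (exp (- (C + 1) * s) * d s y)) has_real_derivative
      - (exp (- (C + 1) * \<tau>) * (wt - (C + 1) * d \<tau> y))) (at \<tau>)"
    by (auto intro!: derivative_eq_intros w(1) simp: algebra_simps)
  then have "0 \<le> - (exp (- (C + 1) * \<tau>) * (wt - (C + 1) * d \<tau> y))"
  proof (rule DERIV_left_max_nonneg[OF _ \<delta>(1)])
    show "- (exp (- (C + 1) * s) * d s y) \<le> - (exp (- (C + 1) * \<tau>) * d \<tau> y)" if "\<tau> - \<delta> < s" "s < \<tau>" for s
      using min[OF \<delta>(2)[OF that]] by (simp add: e_def)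
  qed
  then have "wt \<le> (C + 1) * d \<tau> y" by (simp add: mult_le_0_iff)
  then show False using 1 dn by (simp add: algebra_simps)
qed

text \<open>\<open>h\<close> is a barrier with \<open>h_t - h_xx <= - C * (|h| + |h_x|)\<close>. The
  triangle inequality splits the lower-order terms of \<open>w\<close> into those of
  \<open>w - h\<close> and those of \<open>h\<close>.\<close>

lemma par_super_diff:
  assumes w: "par_ineq C w t x" and C: "0 \<le> C"
    and h: "((\<lambda>s. h s x) has_real_derivative ht) (at t)" "(h t has_real_derivative hx) (at x)"
      "has_sym_deriv2 (h t) x hxx" "C * (\<bar>h t x\<bar> + \<bar>hx\<bar>) \<le> hxx - ht"
  shows "par_super C (\<lambda>t x. w t x - h t x) t x"
proof -
  obtain wt wx wxx where *: "((\<lambda>s. w s x) has_real_derivative wt) (at t)"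
     "(w t has_real_derivative wx) (at x)" "has_sym_deriv2 (w t) x wxx"
     "\<bar>wt - wxx\<bar> \<le> C * (\<bar>w t x\<bar> + \<bar>wx\<bar>)" using w unfolding par_ineq_def by blast
  have "C * (\<bar>w t x\<bar> + \<bar>wx\<bar>) \<le> C * ((\<bar>w t x - h t x\<bar> + \<bar>wx - hx\<bar>) + (\<bar>h t x\<bar> + \<bar>hx\<bar>))"
    using C by (intro mult_left_mono) auto
  then have "- (C * (\<bar>w t x - h t x\<bar> + \<bar>wx - hx\<bar>)) \<le> (wt - ht) - (wxx - hxx)"
    using *(4) h(4) unfolding distrib_left[of C "\<bar>w t x - h t x\<bar> + \<bar>wx - hx\<bar>"] by linarith
  then show ?thesis unfolding par_super_def
    using DERIV_diff[OF *(1) h(1)] DERIV_diff[OF *(2) h(2)] has_sym_deriv2_diff[OF *(3) h(3)]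
    by (intro exI[of _ "wt - ht"] exI[of _ "wx - hx"] exI[of _ "wxx - hxx"] conjI) auto
qed

section \<open>Barriers: the Hopf lemma and forward persistence of positivity\<close>

text \<open>The region is bounded on the left by the line \<open>x = x0 + \<mu> * (t0 - t)\<close>,
  which reaches \<open>x0\<close> at time \<open>t0\<close>. Since
  \<open>r - x0 <= \<mu> * (t0 - t1)\<close>, it contains at most the point \<open>r\<close> at time
  \<open>t1\<close>, so that no further initial values enter. The barrier
  \<open>\<epsilon> * (exp (A * (x - x0 - \<mu> * (t0 - t))) - 1)\<close> vanishes on the line,
  stays below \<open>w\<close> at \<open>r\<close> and has a positive slope. The slant makes the
  lemma applicable along a moving zero.\<close>

lemma hopf_lemma:
  fixes w :: "real \<Rightarrow> real \<Rightarrow> real"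
  assumes C: "0 \<le> C" and t: "t1 < t0" and x0: "x0 < r" and \<mu>: "0 < \<mu>" "r - x0 \<le> \<mu> * (t0 - t1)"
    and c: "continuous_on ({t1..t0} \<times> {x0..r}) (\<lambda>(t, x). w t x)"
    and nn: "\<And>t x. t1 \<le> t \<Longrightarrow> t \<le> t0 \<Longrightarrow> x \<le> r \<Longrightarrow> x0 + \<mu> * (t0 - t) \<le> x \<Longrightarrow> 0 \<le> w t x"
    and pos: "\<And>t. t1 \<le> t \<Longrightarrow> t \<le> t0 \<Longrightarrow> 0 < w t r"
    and p: "\<And>t x. t1 < t \<Longrightarrow> t \<le> t0 \<Longrightarrow> x0 < x \<Longrightarrow> x < r \<Longrightarrow> par_ineq C w t x"
  shows "\<exists>\<kappa>>0. \<forall>x\<in>{x0..r}. \<kappa> * (x - x0) \<le> w t0 x"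
proof -
  have "continuous_on {t1..t0} (\<lambda>t. w t r)"
    using continuous_on_compose2[OF c, of "{t1..t0}" "\<lambda>t. (t, r)"] x0
    by (force intro: continuous_intros)
  then obtain s where s: "s \<in> {t1..t0}" "\<And>t. t \<in> {t1..t0} \<Longrightarrow> w s r \<le> w t r"
    using continuous_attains_inf[of "{t1..t0}" "\<lambda>t. w t r"] t by auto
  \<comment> \<open>Chosen so that \<open>A * A\<close> dominates both \<open>A * \<mu>\<close>,
    from the time derivative of the barrier, and \<open>C + C * A\<close>, from the lower-order
    terms.\<close>
  define A where "A = \<mu> + 2 * C + 1"
  define \<epsilon> where "\<epsilon> = w s r / exp (A * (r - x0))"
  have A: "1 \<le> A" "A * \<mu> + C + C * A \<le> A * A"
    using C \<mu> by (auto simp: A_def algebra_simps)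
  have \<epsilon>: "0 < \<epsilon>" using pos s(1) by (auto simp: \<epsilon>_def)
  define E where "E t x = exp (A * (x - x0 - \<mu> * (t0 - t)))" for t x
  define h where "h t x = \<epsilon> * (E t x - 1)" for t x
  define S where "S = {(t, x). t1 \<le> t \<and> t \<le> t0 \<and> x \<le> r \<and> x0 + \<mu> * (t0 - t) \<le> x}"
  have sub: "S \<subseteq> {t1..t0} \<times> {x0..r}"
  proof
    fix z assume "z \<in> S"
    then obtain a b where z: "z = (a, b)" "t1 \<le> a" "a \<le> t0" "b \<le> r" "x0 + \<mu> * (t0 - a) \<le> b" by (auto simp: S_def)
    then have "0 \<le> \<mu> * (t0 - a)" using \<mu>(1) by simp
    with z show "z \<in> {t1..t0} \<times> {x0..r}" by auto
  qed
  have "closed S" unfolding S_def split_def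
    by (intro closed_Collect_conj closed_Collect_le continuous_intros)
  moreover have "bounded S" using sub by (rule bounded_subset[rotated]) (intro bounded_Times bounded_closed_interval)
  ultimately have cS: "compact S" by (simp add: compact_eq_bounded_closed)
  have main: "0 \<le> w t x - h t x" if "(t, x) \<in> S" for t x
  proof (rule comparison_principle[where d = "\<lambda>t x. w t x - h t x" and S = S and C = C, OF cS _ _ that])
    show "continuous_on S (\<lambda>(t, x). w t x - h t x)"
      unfolding h_def E_def split_def
      by (intro continuous_intros continuous_on_subset[OF c[unfolded split_def] sub])
  next
    fix t x assume S1: "(t, x) \<in> S" and n: "w t x - h t x < 0"
    have S: "t1 \<le> t" "t \<le> t0" "x \<le> r" "x0 + \<mu> * (t0 - t) \<le> x" using S1 by (auto simp: S_def)
    have nn': "0 \<le> \<mu> * (t0 - t)" using S \<mu> by simp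
    have "x \<noteq> r"
    proof
      assume "x = r"
      have "h t r \<le> \<epsilon> * exp (A * (r - x0))"
        unfolding h_def
      proof (rule mult_left_mono)
        have "A * (r - x0 - \<mu> * (t0 - t)) \<le> A * (r - x0)" using A(1) nn' by (intro mult_left_mono) auto
        then have "E t r \<le> exp (A * (r - x0))" by (simp add: E_def)
        then show "E t r - 1 \<le> exp (A * (r - x0))" by simp
      qed (use \<epsilon> in simp)
      also have "\<dots> = w s r" by (simp add: \<epsilon>_def)
      also have "\<dots> \<le> w t r" using s(2) S by simp
      finally show False using n \<open>x = r\<close> by simp
    qed
    then have xr: "x < r" using S by simp
    have "x \<noteq> x0 + \<mu> * (t0 - t)"
    proof
      assume "x = x0 + \<mu> * (t0 - t)"
      then have "h t x = 0" by (simp add: h_def E_def)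
      with nn[OF S] n show False by simp
    qed
    then have xx: "x0 + \<mu> * (t0 - t) < x" using S by simp
    \<comment> \<open>At time \<open>t1\<close> the region has no point to the left of
      \<open>r\<close>.\<close>
    have tt: "t1 < t" using xx xr \<mu> S(1) by (cases "t = t1") auto
    have x0x: "x0 < x" using xx nn' by linarith
    have E1: "1 \<le> E t x" using xx A by (simp add: E_def)
    have ht: "((\<lambda>s. h s x) has_real_derivative \<epsilon> * (A * \<mu> * E t x)) (at t)"
      and hx: "\<And>t x. (h t has_real_derivative \<epsilon> * (A * E t x)) (at x)"
      and hxx: "((\<lambda>x. \<epsilon> * (A * E t x)) has_real_derivative \<epsilon> * (A * A * E t x)) (at x)"
      unfolding h_def E_def by (auto intro!: derivative_eq_intros)
    have h2: "has_sym_deriv2 (h t) x (\<epsilon> * (A * A * E t x))"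
      by (rule has_sym_deriv2_DERIV[OF zero_less_one hx hxx])
    have "C * (E t x - 1 + A * E t x) \<le> C * (E t x + A * E t x)" using C by (intro mult_left_mono) auto
    also have "\<dots> = (C + C * A) * E t x" by (simp add: algebra_simps)
    also have "\<dots> \<le> (A * A - A * \<mu>) * E t x" using A E1 by (intro mult_right_mono) auto
    finally have "\<epsilon> * (C * (E t x - 1 + A * E t x)) \<le> \<epsilon> * ((A * A - A * \<mu>) * E t x)"
      using \<epsilon> by (intro mult_left_mono) auto
    moreover have ab: "\<bar>h t x\<bar> = \<epsilon> * (E t x - 1)" "\<bar>\<epsilon> * (A * E t x)\<bar> = \<epsilon> * (A * E t x)"
      using E1 A(1) \<epsilon> by (auto simp: h_def)
    ultimately have "C * (\<bar>h t x\<bar> + \<bar>\<epsilon> * (A * E t x)\<bar>) \<le> \<epsilon> * (A * A * E t x) - \<epsilon> * (A * \<mu> * E t x)"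
      unfolding ab by (simp add: algebra_simps)
    then have ps: "par_super C (\<lambda>t x. w t x - h t x) t x"
      by (rule par_super_diff[OF p[OF tt S(2) x0x xr] C ht hx h2])
    \<comment> \<open>Going back in time by \<open>\<delta>\<close> moves the slanted side by
      \<open>\<mu> * \<delta>\<close>; hence the divisor \<open>\<mu> + 1\<close>.\<close>
    define \<delta> where "\<delta> = Min {t - t1, (x - (x0 + \<mu> * (t0 - t))) / (\<mu> + 1), r - x}"
    have \<delta>0: "0 < \<delta>" using tt xx xr \<mu> by (simp add: \<delta>_def)
    have d: "\<delta> \<le> t - t1" "\<delta> \<le> r - x" "\<delta> * (\<mu> + 1) \<le> x - (x0 + \<mu> * (t0 - t))"
    proof -
      have "\<delta> \<le> (x - (x0 + \<mu> * (t0 - t))) / (\<mu> + 1)" by (simp add: \<delta>_def)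
      then show "\<delta> * (\<mu> + 1) \<le> x - (x0 + \<mu> * (t0 - t))" using \<mu>(1) by (simp add: pos_le_divide_eq)
    qed (simp_all add: \<delta>_def)
    have "(s, x) \<in> S" if "t - \<delta> < s" "s < t" for s
    proof -
      have "\<mu> * (t0 - s) \<le> \<mu> * (t0 - t) + \<mu> * \<delta>" using that \<mu>
        by (simp add: distrib_left[symmetric])
      then show ?thesis using that S d \<delta>0 by (simp add: S_def algebra_simps)
    qed
    moreover have "(t, y) \<in> S" if "\<bar>y - x\<bar> < \<delta>" for y
    proof -
      have "0 \<le> \<delta> * \<mu>" using \<delta>0 \<mu> by simp
      then have "\<delta> \<le> x - (x0 + \<mu> * (t0 - t))" using d(3) by (simp add: algebra_simps)
      then show ?thesis using that S d by (simp add: S_def abs_less_iff)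
    qed
    ultimately show "par_super C (\<lambda>t x. w t x - h t x) t x \<and>
       (\<exists>\<delta>>0. (\<forall>s. t - \<delta> < s \<and> s < t \<longrightarrow> (s, x) \<in> S) \<and> (\<forall>y. \<bar>y - x\<bar> < \<delta> \<longrightarrow> (t, y) \<in> S))"
      using ps \<delta>0 by blast
  qed
  have "\<epsilon> * A * (x - x0) \<le> w t0 x" if "x \<in> {x0..r}" for x
  proof -
    have "A * (x - x0) \<le> exp (A * (x - x0)) - 1" using exp_ge_add_one_self[of "A * (x - x0)"] by linarith
    then have "\<epsilon> * A * (x - x0) \<le> h t0 x"
      using mult_left_mono[of "A * (x - x0)" "exp (A * (x - x0)) - 1" \<epsilon>] \<epsilon> by (simp add: h_def E_def mult.assoc)
    also have "\<dots> \<le> w t0 x" using main[of t0 x] that t by (simp add: S_def)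
    finally show ?thesis .
  qed
  then show ?thesis using \<epsilon> A by (intro exI[of _ "\<epsilon> * A"]) auto
qed

text \<open>The strong maximum principle below looks back from a positive value; here positivity is
  carried forward at a fixed point. The barrier is
  \<open>m * exp (- \<Lambda> * (t - t0)) * (z x)\<^sup>2\<close> with the bump
  \<open>z x = 1 - ((x - r) / \<epsilon>)\<^sup>2\<close>: where \<open>z\<close> is small, the
  square has a small gradient and a positive second derivative; elsewhere the decay rate
  \<open>\<Lambda>\<close> absorbs all other terms.\<close>

lemma positivity_persists:
  fixes w :: "real \<Rightarrow> real \<Rightarrow> real"
  assumes C: "0 \<le> C" and t: "t0 \<le> t1" and r: "p < r" "r < q"
    and c: "continuous_on ({t0..t1} \<times> {p..q}) (\<lambda>(t, x). w t x)"
    and nn: "\<And>t x. t0 \<le> t \<Longrightarrow> t \<le> t1 \<Longrightarrow> p \<le> x \<Longrightarrow> x \<le> q \<Longrightarrow> 0 \<le> w t x"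
    and pos: "0 < w t0 r"
    and pi: "\<And>t x. t0 < t \<Longrightarrow> t \<le> t1 \<Longrightarrow> p < x \<Longrightarrow> x < q \<Longrightarrow> par_ineq C w t x"
  shows "0 < w t1 r"
proof -
  have ct: "continuous_on {p..q} (w t0)"
    using continuous_on_compose2[OF c, of "{p..q}" "\<lambda>x. (t0, x)"] t
    by (force intro: continuous_intros)
  define m where "m = w t0 r / 2"
  have m: "0 < m" using pos by (simp add: m_def)
  obtain e where e: "0 < e" "\<And>x. x \<in> {p..q} \<Longrightarrow> dist x r < e \<Longrightarrow> dist (w t0 x) (w t0 r) < m"
    using ct r m unfolding continuous_on_iff by (metis atLeastAtMost_iff less_imp_le)
  define \<epsilon> where "\<epsilon> = Min {e / 2, (r - p) / 2, (q - r) / 2}"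
  have \<epsilon>: "0 < \<epsilon>" "\<epsilon> < e" "p < r - \<epsilon>" "r + \<epsilon> < q"
    using e(1) r by (auto simp: \<epsilon>_def min_def field_simps)
  have wm: "m \<le> w t0 x" if "\<bar>x - r\<bar> \<le> \<epsilon>" for x
  proof -
    have "x \<in> {p..q}" "dist x r < e" using that \<epsilon> by (auto simp: dist_real_def abs_le_iff)
    then have "\<bar>w t0 x - w t0 r\<bar> < m" using e(2) by (simp add: dist_real_def)
    then show ?thesis unfolding m_def abs_less_iff by linarith
  qed
  \<comment> \<open>\<open>k\<close> collects the unfavourable coefficients of \<open>z\<close>:
    \<open>12 / \<epsilon>\<^sup>2\<close> from the second derivative of the squared bump and
    \<open>4 * C / \<epsilon>\<close> from its gradient. Completing the square in
    \<open>8 / \<epsilon>\<^sup>2 - k * z\<close> then dictates the second summand of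
    \<open>\<Lambda>\<close>; the first pays for \<open>C * (z x)\<^sup>2\<close>.\<close>
  define k where "k = 12 / \<epsilon>\<^sup>2 + 4 * C / \<epsilon>"
  define \<Lambda> where "\<Lambda> = C + k\<^sup>2 * \<epsilon>\<^sup>2 / 32"
  define z where "z x = 1 - ((x - r) / \<epsilon>)\<^sup>2" for x
  define z' where "z' x = - (2 * ((x - r) / \<epsilon>) / \<epsilon>)" for x
  define E where "E t = m * exp (- \<Lambda> * (t - t0))" for t
  define h where "h t x = E t * (z x)\<^sup>2" for t x
  have E0: "0 < E t" for t using m by (simp add: E_def)
  have \<Lambda>0: "0 \<le> \<Lambda>" using C by (simp add: \<Lambda>_def)
  have z: "(z has_real_derivative z' x) (at x)" for x
    unfolding z_def z'_def using \<epsilon>(1) by (auto intro!: derivative_eq_intros)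
  have zd: "(z' has_real_derivative - (2 / \<epsilon>\<^sup>2)) (at x)" for x
    unfolding z'_def using \<epsilon>(1) by (auto intro!: derivative_eq_intros simp: power2_eq_square)
  have main: "0 \<le> w t x - h t x" if "(t, x) \<in> {t0..t1} \<times> {r - \<epsilon>..r + \<epsilon>}" for t x
  proof (rule comparison_principle[where d = "\<lambda>t x. w t x - h t x" and C = C, OF _ _ _ that])
    show "compact ({t0..t1} \<times> {r - \<epsilon>..r + \<epsilon>})" by (intro compact_Times compact_Icc)
    show "continuous_on ({t0..t1} \<times> {r - \<epsilon>..r + \<epsilon>}) (\<lambda>(t, x). w t x - h t x)"
      unfolding h_def E_def z_def split_def divide_inverse
      by (intro continuous_intros continuous_on_subset[OF c[unfolded split_def]]) (use \<epsilon> in auto)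
  next
    fix t x assume S: "(t, x) \<in> {t0..t1} \<times> {r - \<epsilon>..r + \<epsilon>}" and n: "w t x - h t x < 0"
    have xb: "\<bar>x - r\<bar> \<le> \<epsilon>" using S by auto
    have z01: "0 \<le> z x" "z x \<le> 1"
      using xb \<epsilon> by (auto simp: z_def power_divide abs_le_square_iff[of "x - r" \<epsilon>, symmetric])
    have "\<bar>x - r\<bar> \<noteq> \<epsilon>"
    proof
      assume *: "\<bar>x - r\<bar> = \<epsilon>"
      have "(x - r)\<^sup>2 = \<epsilon>\<^sup>2" using * power2_abs[of "x - r"] by simp
      then have "h t x = 0" using \<epsilon>(1) by (simp add: h_def z_def power_divide)
      then show False using n nn[of t x] S \<epsilon> by auto
    qed
    then have xb': "\<bar>x - r\<bar> < \<epsilon>" using xb by simp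
    have "t \<noteq> t0"
    proof
      assume "t = t0"
      have "h t0 x \<le> m" using z01 m mult_left_mono[of "(z x)\<^sup>2" 1 m] by (simp add: h_def E_def power_le_one)
      also have "\<dots> \<le> w t0 x" using wm xb by blast
      finally show False using n \<open>t = t0\<close> by simp
    qed
    then have t': "t0 < t" "t \<le> t1" using S by auto
    have ht: "((\<lambda>s. h s x) has_real_derivative - \<Lambda> * h t x) (at t)"
      unfolding h_def E_def by (auto intro!: derivative_eq_intros)
    have hx: "(h t has_real_derivative E t * (2 * z x * z' x)) (at x)" for t x
      unfolding h_def by (auto intro!: derivative_eq_intros z)
    have hxx: "((\<lambda>x. E t * (2 * z x * z' x)) has_real_derivative
        E t * (2 * z' x * z' x + 2 * z x * (- (2 / \<epsilon>\<^sup>2)))) (at x)"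
      by (auto intro!: derivative_eq_intros z zd simp: algebra_simps)
    have h2: "has_sym_deriv2 (h t) x (E t * (2 * z' x * z' x + 2 * z x * (- (2 / \<epsilon>\<^sup>2))))"
      by (rule has_sym_deriv2_DERIV[OF zero_less_one hx hxx])
    have z'2: "z' x * z' x = 4 * (1 - z x) / \<epsilon>\<^sup>2"
      by (simp add: z'_def z_def power2_eq_square) (simp add: algebra_simps)
    have "\<bar>x - r\<bar> / \<epsilon> \<le> 1" using xb \<epsilon> by simp
    then have z'1: "\<bar>z' x\<bar> \<le> 2 / \<epsilon>"
      using \<epsilon>(1) by (simp add: z'_def abs_mult field_simps)
    have "C * (2 * z x * \<bar>z' x\<bar>) \<le> C * (2 * z x * (2 / \<epsilon>))"
      using C z01 z'1 by (intro mult_left_mono) auto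
    then have 1: "C * ((z x)\<^sup>2 + 2 * z x * \<bar>z' x\<bar>) \<le> C * (z x)\<^sup>2 + 4 * C / \<epsilon> * z x"
      by (simp add: algebra_simps)
    have "(16 / \<epsilon> - k * \<epsilon> * z x)\<^sup>2 / 32 = 8 / \<epsilon>\<^sup>2 - k * z x + k\<^sup>2 * \<epsilon>\<^sup>2 / 32 * (z x)\<^sup>2"
      using \<epsilon>(1) by (simp add: power2_diff power_divide power_mult_distrib add_divide_distrib diff_divide_distrib)
    then have "0 \<le> 8 / \<epsilon>\<^sup>2 - k * z x + k\<^sup>2 * \<epsilon>\<^sup>2 / 32 * (z x)\<^sup>2"
      by (metis zero_le_divide_iff zero_le_numeral zero_le_power2)
    moreover have "k * z x = 12 / \<epsilon>\<^sup>2 * z x + 4 * C / \<epsilon> * z x" by (simp add: k_def algebra_simps)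
    moreover have "\<Lambda> * (z x)\<^sup>2 = C * (z x)\<^sup>2 + k\<^sup>2 * \<epsilon>\<^sup>2 / 32 * (z x)\<^sup>2" by (simp add: \<Lambda>_def algebra_simps)
    moreover have "2 * z' x * z' x + 2 * z x * (- (2 / \<epsilon>\<^sup>2)) = 8 / \<epsilon>\<^sup>2 - 12 / \<epsilon>\<^sup>2 * z x"
      unfolding mult.assoc[of 2] z'2 by (simp add: right_diff_distrib diff_divide_distrib)
    ultimately have "C * ((z x)\<^sup>2 + 2 * z x * \<bar>z' x\<bar>)
        \<le> (2 * z' x * z' x + 2 * z x * (- (2 / \<epsilon>\<^sup>2))) + \<Lambda> * (z x)\<^sup>2"
      using 1 by linarith
    then have "E t * (C * ((z x)\<^sup>2 + 2 * z x * \<bar>z' x\<bar>))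
        \<le> E t * ((2 * z' x * z' x + 2 * z x * (- (2 / \<epsilon>\<^sup>2))) + \<Lambda> * (z x)\<^sup>2)"
      using E0[of t] by (intro mult_left_mono) auto
    moreover have "\<bar>h t x\<bar> + \<bar>E t * (2 * z x * z' x)\<bar> = E t * ((z x)\<^sup>2 + 2 * z x * \<bar>z' x\<bar>)"
      using E0[of t] z01 by (simp add: h_def abs_mult algebra_simps)
    ultimately have "C * (\<bar>h t x\<bar> + \<bar>E t * (2 * z x * z' x)\<bar>)
      \<le> E t * (2 * z' x * z' x + 2 * z x * (- (2 / \<epsilon>\<^sup>2))) - (- \<Lambda> * h t x)"
      by (simp add: h_def algebra_simps)
    then have ps: "par_super C (\<lambda>t x. w t x - h t x) t x"
      using xb' \<epsilon> by (intro par_super_diff[OF pi[OF t'] C ht hx h2]) (auto simp: abs_less_iff)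
    define \<delta> where "\<delta> = min (t - t0) (\<epsilon> - \<bar>x - r\<bar>)"
    have "0 < \<delta>" using t' xb' by (simp add: \<delta>_def)
    moreover have "(s, x) \<in> {t0..t1} \<times> {r - \<epsilon>..r + \<epsilon>}" if "t - \<delta> < s" "s < t" for s
      using that S t' by (auto simp: \<delta>_def)
    moreover have "(t, y) \<in> {t0..t1} \<times> {r - \<epsilon>..r + \<epsilon>}" if "\<bar>y - x\<bar> < \<delta>" for y
    proof -
      have "\<bar>y - x\<bar> < \<epsilon> - \<bar>x - r\<bar>" using that by (simp add: \<delta>_def)
      then show ?thesis using S by auto
    qed
    ultimately show "par_super C (\<lambda>t x. w t x - h t x) t x \<and>
       (\<exists>\<delta>>0. (\<forall>s. t - \<delta> < s \<and> s < t \<longrightarrow> (s, x) \<in> {t0..t1} \<times> {r - \<epsilon>..r + \<epsilon>}) \<and>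
        (\<forall>y. \<bar>y - x\<bar> < \<delta> \<longrightarrow> (t, y) \<in> {t0..t1} \<times> {r - \<epsilon>..r + \<epsilon>}))"
      using ps by blast
  qed
  have "h t1 r \<le> w t1 r" using main[of t1 r] t \<epsilon> by simp
  moreover have "0 < h t1 r" using E0[of t1] by (simp add: h_def z_def)
  ultimately show ?thesis by linarith
qed

section \<open>Alternations of sign\<close>

text \<open>The product of \<open>w\<close> (with alternating signs) over an ordered tuple of \<open>K + 1\<close> points satisfies a parabolic inequality
  in the tuple; relative to this weight it obeys a maximum principle, because the product vanishes where two neighbouring
  points collide. The middle sum is concave in the gaps: for many points, hence small gaps, it makes the
  weight a strict supersolution, with exponential decay.\<close>
definition gap_weight :: "real \<Rightarrow> real \<Rightarrow> real \<Rightarrow> nat \<Rightarrow> (nat \<Rightarrow> real) \<Rightarrow> real" where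
  "gap_weight A e c K x = 1 + (\<Sum>j<K. 1 - exp (- A * (x (Suc j) - x j))) + e * (\<Sum>j\<le>K. (x j - c)\<^sup>2)"

lemma fun_upd_deriv: "((\<lambda>y. (x(i := y)) j) has_real_derivative of_bool (j = i)) (at y)"
  by (cases "j = i") (auto intro!: derivative_eq_intros)

text \<open>A point is the right end of one gap and the left end of the next. The indicators spare
  separate formulas for the two outermost points.\<close>

lemma gap_weight_deriv:
  assumes "i \<le> K"
  shows "((\<lambda>y. gap_weight A e c K (x(i := y))) has_real_derivative
    (\<Sum>j<K. A * exp (- A * ((x(i := y)) (Suc j) - (x(i := y)) j)) * (of_bool (Suc j = i) - of_bool (j = i)))
      + 2 * e * (y - c)) (at y)"
proof -
  have "((\<lambda>y. 1 - exp (- A * ((x(i := y)) (Suc j) - (x(i := y)) j))) has_real_derivative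
      A * exp (- A * ((x(i := y)) (Suc j) - (x(i := y)) j)) * (of_bool (Suc j = i) - of_bool (j = i))) (at y)" for j
    by (rule derivative_eq_intros fun_upd_deriv refl)+ (simp add: mult_ac)
  then have 1: "((\<lambda>y. \<Sum>j<K. 1 - exp (- A * ((x(i := y)) (Suc j) - (x(i := y)) j))) has_real_derivative
      (\<Sum>j<K. A * exp (- A * ((x(i := y)) (Suc j) - (x(i := y)) j)) * (of_bool (Suc j = i) - of_bool (j = i)))) (at y)"
    by (rule DERIV_sum)
  have "((\<lambda>y. ((x(i := y)) j - c)\<^sup>2) has_real_derivative 2 * ((x(i := y)) j - c) * of_bool (j = i)) (at y)" for j
    by (rule derivative_eq_intros fun_upd_deriv refl)+ simp
  then have "((\<lambda>y. \<Sum>j\<le>K. ((x(i := y)) j - c)\<^sup>2) has_real_derivative (\<Sum>j\<le>K. 2 * ((x(i := y)) j - c) * of_bool (j = i))) (at y)"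
    by (rule DERIV_sum)
  moreover have "(\<Sum>j\<le>K. 2 * ((x(i := y)) j - c) * of_bool (j = i)) = 2 * (y - c)"
    using assms by (subst sum.remove[of _ i]) (auto intro: sum.neutral)
  ultimately have 2: "((\<lambda>y. \<Sum>j\<le>K. ((x(i := y)) j - c)\<^sup>2) has_real_derivative 2 * (y - c)) (at y)" by (simp only:)
  show ?thesis unfolding gap_weight_def
    by (rule DERIV_cong[OF DERIV_add[OF DERIV_add[OF DERIV_const 1] DERIV_cmult[OF 2]]]) simp
qed

lemma gap_weight_deriv2:
  "((\<lambda>y. (\<Sum>j<K. A * exp (- A * ((x(i := y)) (Suc j) - (x(i := y)) j)) * (of_bool (Suc j = i) - of_bool (j = i)))
      + 2 * e * (y - c)) has_real_derivative
    (\<Sum>j<K. - (A * A * exp (- A * ((x(i := y)) (Suc j) - (x(i := y)) j)) * (of_bool (Suc j = i) + of_bool (j = i))))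
      + 2 * e) (at y)"
proof -
  have "((\<lambda>y. (\<Sum>j<K. A * exp (- A * ((x(i := y)) (Suc j) - (x(i := y)) j)) * (of_bool (Suc j = i) - of_bool (j = i)))
      + 2 * e * (y - c)) has_real_derivative
    (\<Sum>j<K. A * (exp (- A * ((x(i := y)) (Suc j) - (x(i := y)) j)) * (- A * (of_bool (Suc j = i) - of_bool (j = i)))) * (of_bool (Suc j = i) - of_bool (j = i)))
      + 2 * e * (1 - 0)) (at y)"
    by (rule derivative_eq_intros refl fun_upd_deriv)+ (simp add: mult_ac)
  moreover have "(A * (exp (- A * ((x(i := y)) (Suc j) - (x(i := y)) j)) * (- A * (of_bool (Suc j = i) - of_bool (j = i)))) * (of_bool (Suc j = i) - of_bool (j = i)))
     = - (A * A * exp (- A * ((x(i := y)) (Suc j) - (x(i := y)) j)) * (of_bool (Suc j = i) + of_bool (j = i)))" for j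
    by (auto simp: of_bool_def)
  moreover have "2 * e * (1 - 0) = 2 * e" by simp
  ultimately show ?thesis by (simp only:)
qed

text \<open>Every gap is counted by each of its two end points. This is the origin of both factors 2
  in \<open>2 * C * A - 2 * A\<^sup>2\<close> below.\<close>

lemma sum_of_bool_gaps:
  "(\<Sum>i\<le>K. \<Sum>j<K. b j * (of_bool (Suc j = i) + of_bool (j = i))) = 2 * (\<Sum>j<K. b j :: real)"
proof -
  have "(\<Sum>i\<le>K. \<Sum>j<K. b j * (of_bool (Suc j = i) + of_bool (j = i)))
      = (\<Sum>j<K. b j * (\<Sum>i\<le>K. of_bool (Suc j = i) + of_bool (j = i)))"
    by (subst sum.swap) (simp add: sum_distrib_left)
  also have "\<dots> = (\<Sum>j<K. b j * 2)"
  proof (rule sum.cong[OF refl])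
    fix j assume "j \<in> {..<K}"
    then have "(\<Sum>i\<le>K. of_bool (Suc j = i)) = (1::real)" "(\<Sum>i\<le>K. of_bool (j = i)) = (1::real)"
      by (auto simp: of_bool_def)
    then show "b j * (\<Sum>i\<le>K. of_bool (Suc j = i) + of_bool (j = i)) = b j * 2"
      by (simp add: sum.distrib)
  qed
  finally show ?thesis by (simp add: sum_distrib_left mult.commute)
qed

section \<open>Ordered tuples and the multi-point maximum principle\<close>

text \<open>A tuple of \<open>K + 1\<close> points is stored in the initial segment of a sequence,
  and all coordinates are confined to the interval, so that compactness is Tychonoff's theorem. The
  order is weak to keep the set closed.\<close>

definition config :: "real \<Rightarrow> real \<Rightarrow> nat \<Rightarrow> (nat \<Rightarrow> real) set" where
  "config l r K = {x. (\<forall>i. x i \<in> {l..r}) \<and> (\<forall>i<K. x i \<le> x (Suc i))}"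

lemma compact_config: "compact (config l r K)"
proof -
  have "compactin (product_topology (\<lambda>i. euclidean) UNIV) (PiE (UNIV :: nat set) (\<lambda>_. {l..r}))"
    by (simp add: compactin_PiE)
  then have "compact {x. \<forall>i::nat. x i \<in> {l..r}}"
    by (simp add: euclidean_product_topology PiE_UNIV_domain Pi_def)
  moreover have "closed {x::nat \<Rightarrow> real. \<forall>i<K. x i \<le> x (Suc i)}"
  proof -
    have "closed {x::nat \<Rightarrow> real. x i \<le> x (Suc i)}" for i
      by (intro closed_Collect_le continuous_on_product_coordinates)
    then have "closed (\<Inter>i<K. {x::nat \<Rightarrow> real. x i \<le> x (Suc i)})" by blast
    moreover have "(\<Inter>i<K. {x::nat \<Rightarrow> real. x i \<le> x (Suc i)}) = {x. \<forall>i<K. x i \<le> x (Suc i)}" by auto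
    ultimately show ?thesis by simp
  qed
  ultimately have "compact ({x. \<forall>i::nat. x i \<in> {l..r}} \<inter> {x. \<forall>i<K. x i \<le> x (Suc i)})"
    by (rule compact_Int_closed)
  then show ?thesis by (simp add: config_def Collect_conj_eq)
qed

text \<open>The truncation at 0 makes the product positive exactly where the signs alternate
  beginning with \<open>s\<close>; where two neighbours collide it vanishes.\<close>

definition alt_prod :: "(real \<Rightarrow> real) \<Rightarrow> real \<Rightarrow> nat \<Rightarrow> (nat \<Rightarrow> real) \<Rightarrow> real" where
  "alt_prod w s K x = (\<Prod>i\<le>K. max 0 (s * (-1) ^ i * w (x i)))"

lemma gap_weight_ge_1:
  assumes "x \<in> config l r K" "0 \<le> A" "0 \<le> e"
  shows "1 \<le> gap_weight A e c K x"
proof -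
  have "0 \<le> (\<Sum>j<K. 1 - exp (- A * (x (Suc j) - x j)))"
    using assms by (intro sum_nonneg) (auto simp: config_def)
  moreover have "0 \<le> e * (\<Sum>j\<le>K. (x j - c)\<^sup>2)" using assms by (simp add: sum_nonneg)
  ultimately show ?thesis by (simp add: gap_weight_def)
qed

text \<open>The quotient of product and weight, damped by \<open>exp (- B * (t - t1))\<close>, is
  maximised over times and tuples. At a maximum above \<open>Y\<close> every factor, with the other
  points frozen, satisfies first and second order conditions relative to the weight. The
  \<open>K + 1\<close> parabolic inequalities, each divided by its factor, are added; the sum bounds
  the logarithmic time derivative of the product through the left side of \<open>num\<close>, hence
  strictly by \<open>B\<close>, against maximality in time. A negative \<open>B\<close> means decay.
  An outermost point cannot lie on the boundary: either the sign is wrong there, or the Neumann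
  condition applies and the weight strictly decreases as the point moves inwards.\<close>

lemma multipoint_maximum_principle:
  fixes w :: "real \<Rightarrow> real \<Rightarrow> real"
  assumes C: "0 \<le> C" and t01: "t1 \<le> t0" and lr: "l < r" and A: "0 < A" and e: "0 < e"
    and c: "continuous_on ({t1..t0} \<times> {l..r}) (\<lambda>(t, x). w t x)"
    and p: "\<And>t x. t1 < t \<Longrightarrow> t \<le> t0 \<Longrightarrow> l < x \<Longrightarrow> x < r \<Longrightarrow> par_ineq C w t x"
    and left: "\<And>t. t1 < t \<Longrightarrow> t \<le> t0 \<Longrightarrow> s * w t l \<le> 0 \<or> (w t has_real_derivative 0) (at l within {l..r})"
    and right: "\<And>t. t1 < t \<Longrightarrow> t \<le> t0 \<Longrightarrow> s * (-1) ^ K * w t r \<le> 0 \<or> (w t has_real_derivative 0) (at r within {l..r})"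
    and num: "\<And>x. x \<in> config l r K \<Longrightarrow>
       (2 * C * A - 2 * A\<^sup>2) * (\<Sum>j<K. exp (- A * (x (Suc j) - x j))) + real (Suc K) * (e * (2 + C * (r - l)))
         + C * real (Suc K) * gap_weight A e ((l + r) / 2) K x < B * gap_weight A e ((l + r) / 2) K x"
    and Y: "0 \<le> Y" "\<And>x. x \<in> config l r K \<Longrightarrow> alt_prod (w t1) s K x \<le> Y * gap_weight A e ((l + r) / 2) K x"
    and s: "\<bar>s\<bar> = 1"
    and x: "x \<in> config l r K"
  shows "alt_prod (w t0) s K x \<le> exp (B * (t0 - t1)) * Y * gap_weight A e ((l + r) / 2) K x"
proof (rule ccontr)
  assume neg: "\<not> ?thesis"
  let ?\<Psi> = "gap_weight A e ((l + r) / 2) K"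
  have \<Psi>1: "1 \<le> ?\<Psi> x" if "x \<in> config l r K" for x
    using that A e by (intro gap_weight_ge_1) auto
  have \<Psi>0: "0 < ?\<Psi> x" if "x \<in> config l r K" for x using \<Psi>1[OF that] by simp
  define H where "H = (\<lambda>(t, x). exp (- B * (t - t1)) * alt_prod (w t) s K x / ?\<Psi> x)"
  let ?S = "{t1..t0} \<times> config l r K"
  have cx: "continuous_on ?S (\<lambda>z. snd z i)" for i
    by (rule continuous_on_compose2[OF continuous_on_product_coordinates[of i] continuous_on_snd[OF continuous_on_id]]) auto
  have "continuous_on ?S (\<lambda>z. (\<lambda>(t, x). w t x) (fst z, snd z i))" for i
    by (rule continuous_on_compose2[OF c], intro continuous_intros cx) (auto simp: config_def)
  then have "continuous_on ?S (\<lambda>z. w (fst z) (snd z i))" for i by simp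
  moreover have "continuous_on ?S (\<lambda>z. ?\<Psi> (snd z))"
    unfolding gap_weight_def by (intro continuous_intros cx)
  moreover have "\<forall>z\<in>?S. ?\<Psi> (snd z) \<noteq> 0" using \<Psi>0 by force
  ultimately have "continuous_on ?S H"
    unfolding H_def alt_prod_def split_def by (intro continuous_intros)
  moreover have "compact ?S" by (intro compact_Times compact_Icc compact_config)
  moreover have "?S \<noteq> {}" using t01 x by auto
  ultimately obtain z where "z \<in> ?S" "\<forall>y\<in>?S. H y \<le> H z"
    using continuous_attains_sup by blast
  then obtain \<tau> \<xi> where \<tau>: "t1 \<le> \<tau>" "\<tau> \<le> t0" and \<xi>: "\<xi> \<in> config l r K"
    and max: "\<And>t x. t1 \<le> t \<Longrightarrow> t \<le> t0 \<Longrightarrow> x \<in> config l r K \<Longrightarrow> H (t, x) \<le> H (\<tau>, \<xi>)" by auto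
  have "exp (- B * (t0 - t1)) * (exp (B * (t0 - t1)) * Y * ?\<Psi> x) < exp (- B * (t0 - t1)) * alt_prod (w t0) s K x"
    using neg by (intro mult_strict_left_mono) auto
  moreover have "exp (- B * (t0 - t1)) * (exp (B * (t0 - t1)) * Y * ?\<Psi> x) = Y * ?\<Psi> x"
    by (simp add: exp_minus mult.assoc)
  ultimately have "Y * ?\<Psi> x < exp (- B * (t0 - t1)) * alt_prod (w t0) s K x" by (simp only:)
  then have "Y < H (t0, x)"
    using \<Psi>0[OF x] by (simp add: H_def pos_less_divide_eq)
  also have "\<dots> \<le> H (\<tau>, \<xi>)" using max t01 x by simp
  finally have HY: "Y < H (\<tau>, \<xi>)" .
  have "\<tau> \<noteq> t1" 
  proof
    assume "\<tau> = t1"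
    then have "H (\<tau>, \<xi>) \<le> Y" using Y(2)[OF \<xi>] \<Psi>0[OF \<xi>] by (simp add: H_def pos_divide_le_eq)
    with HY show False by simp
  qed
  with \<tau> have \<tau>1: "t1 < \<tau>" by simp
  define a where "a i t = s * (-1) ^ i * w t (\<xi> i)" for i t
  have "0 < H (\<tau>, \<xi>)" using HY Y(1) by simp
  then have ap: "0 < alt_prod (w \<tau>) s K \<xi>" using \<Psi>0[OF \<xi>] by (simp add: H_def zero_less_divide_iff zero_less_mult_iff)
  have a0: "0 < a i \<tau>" if "i \<le> K" for i
  proof (rule ccontr)
    assume "\<not> 0 < a i \<tau>"
    then have "max 0 (s * (-1) ^ i * w \<tau> (\<xi> i)) = 0" by (simp add: a_def)
    then have "alt_prod (w \<tau>) s K \<xi> = 0" unfolding alt_prod_def using that by (intro prod_zero) auto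
    with ap show False by simp
  qed
  have \<xi>in: "\<xi> i \<in> {l..r}" for i using \<xi> by (simp add: config_def)
  \<comment> \<open>Neighbouring values have opposite strict signs, so the points are
    distinct.\<close>
  have strict: "\<xi> i < \<xi> (Suc i)" if "i < K" for i
  proof -
    have "\<xi> i \<noteq> \<xi> (Suc i)"
    proof
      assume "\<xi> i = \<xi> (Suc i)"
      then have "a (Suc i) \<tau> = - a i \<tau>" by (simp add: a_def)
      with a0[of i] a0[of "Suc i"] that show False by simp
    qed
    moreover have "\<xi> i \<le> \<xi> (Suc i)" using \<xi> that by (simp add: config_def)
    ultimately show ?thesis by simp
  qed
  \<comment> \<open>Only the \<open>i\<close>-th point moves. The truncation is dropped on the left,
    so that both sides can be differentiated; equality holds at \<open>y = \<xi> i\<close>.\<close>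
  have var: "s * (-1) ^ i * w \<tau> y * ?\<Psi> \<xi> \<le> a i \<tau> * ?\<Psi> (\<xi>(i := y))"
    if i: "i \<le> K" and y: "\<xi>(i := y) \<in> config l r K" for i y
  proof -
    define P where "P = (\<Prod>j\<in>{..K} - {i}. max 0 (s * (-1) ^ j * w \<tau> (\<xi> j)))"
    have P: "0 < P" unfolding P_def
    proof (rule prod_pos)
      fix j assume "j \<in> {..K} - {i}"
      then show "0 < max 0 (s * (-1) ^ j * w \<tau> (\<xi> j))" using a0[of j] by (simp add: a_def)
    qed
    have "alt_prod (w \<tau>) s K (\<xi>(i := y)) = max 0 (s * (-1) ^ i * w \<tau> y) * P"
      unfolding alt_prod_def P_def using i by (subst prod.remove[of _ i]) (auto intro!: prod.cong)
    moreover have "alt_prod (w \<tau>) s K \<xi> = a i \<tau> * P"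
      unfolding alt_prod_def P_def using i a0[OF i] by (subst prod.remove[of _ i]) (auto simp: a_def)
    moreover have fr: "alt_prod (w \<tau>) s K (\<xi>(i := y)) / ?\<Psi> (\<xi>(i := y)) \<le> alt_prod (w \<tau>) s K \<xi> / ?\<Psi> \<xi>"
      using max[OF \<tau> y] unfolding H_def prod.case times_divide_eq_right[symmetric]
      by (rule mult_left_le_imp_le) simp
    moreover have "alt_prod (w \<tau>) s K (\<xi>(i := y)) * ?\<Psi> \<xi> \<le> alt_prod (w \<tau>) s K \<xi> * ?\<Psi> (\<xi>(i := y))"
      using fr by (simp only: pos_divide_le_eq[OF \<Psi>0[OF y]] times_divide_eq_left pos_le_divide_eq[OF \<Psi>0[OF \<xi>]])
    ultimately have "P * (max 0 (s * (-1) ^ i * w \<tau> y) * ?\<Psi> \<xi>) \<le> P * (a i \<tau> * ?\<Psi> (\<xi>(i := y)))"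
      by (simp only: mult_ac)
    then have "max 0 (s * (-1) ^ i * w \<tau> y) * ?\<Psi> \<xi> \<le> a i \<tau> * ?\<Psi> (\<xi>(i := y))"
      using P by (simp only: mult_le_cancel_left_pos)
    moreover have "s * (-1) ^ i * w \<tau> y * ?\<Psi> \<xi> \<le> max 0 (s * (-1) ^ i * w \<tau> y) * ?\<Psi> \<xi>"
      using \<Psi>0[OF \<xi>] by (intro mult_right_mono) auto
    ultimately show ?thesis by simp
  qed
  \<comment> \<open>\<open>G i\<close> and \<open>GG i\<close> are the first and second derivatives
    of the weight with respect to the \<open>i\<close>-th point at \<open>\<xi>\<close>;
    \<open>E j\<close> is the exponential of the \<open>j\<close>-th gap.\<close>
  define E where "E j = exp (- A * (\<xi> (Suc j) - \<xi> j))" for j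
  define G where "G i = (\<Sum>j<K. A * E j * (of_bool (Suc j = i) - of_bool (j = i))) + 2 * e * (\<xi> i - (l + r) / 2)" for i
  define GG where "GG i = (\<Sum>j<K. - (A * A * E j * (of_bool (Suc j = i) + of_bool (j = i)))) + 2 * e" for i
  have E0: "0 < E j" for j by (simp add: E_def)
  have "\<xi>(i := \<xi> i) = \<xi>" for i by simp
  then have dG: "((\<lambda>y. ?\<Psi> (\<xi>(i := y))) has_real_derivative G i) (at (\<xi> i))" if "i \<le> K" for i
    using gap_weight_deriv[OF that, of A e "(l + r) / 2" \<xi> "\<xi> i"] by (simp add: G_def E_def)
  have conf_upd: "\<xi>(i := y) \<in> config l r K"
    if "y \<in> {l..r}" "\<And>j. Suc j = i \<Longrightarrow> j < K \<Longrightarrow> \<xi> j \<le> y" "i < K \<Longrightarrow> y \<le> \<xi> (Suc i)" for i y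
    unfolding config_def
  proof (intro CollectI conjI allI impI)
    show "(\<xi>(i := y)) j \<in> {l..r}" for j using \<xi>in[of j] that(1) by simp
    fix j assume j: "j < K"
    then have "\<xi> j \<le> \<xi> (Suc j)" using strict[of j] by simp
    then show "(\<xi>(i := y)) j \<le> (\<xi>(i := y)) (Suc j)" using that(2)[of j] that(3) j by auto
  qed
  have "\<xi> 0 \<noteq> l"
  proof
    assume l: "\<xi> 0 = l"
    have "0 < s * w \<tau> l" using a0[of 0] l by (simp add: a_def)
    then have d: "(w \<tau> has_real_derivative 0) (at l within {l..r})" using left[OF \<tau>1 \<tau>(2)] by auto
    define q where "q y = a 0 \<tau> * ?\<Psi> (\<xi>(0 := y)) - ?\<Psi> \<xi> * s * w \<tau> y" for y
    have g: "((\<lambda>y. ?\<Psi> (\<xi>(0 := y))) has_real_derivative G 0) (at l within {l..r})"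
      using dG[of 0] l has_field_derivative_at_within by simp blast
    have "(q has_real_derivative a 0 \<tau> * G 0) (at l within {l..r})"
      unfolding q_def by (rule DERIV_cong[OF DERIV_diff[OF DERIV_cmult[OF g] DERIV_cmult[OF d]]]) simp
    \<comment> \<open>Moving the leftmost point inwards shortens the first gap, if there is one, and
      approaches the centre. The centre term makes the inequality strict, also for
      \<open>K = 0\<close>.\<close>
    moreover have "G 0 < 0"
    proof -
      have "(\<Sum>j<K. A * E j * (of_bool (Suc j = 0) - of_bool (j = 0))) \<le> 0"
        using A E0 by (intro sum_nonpos) (auto simp: of_bool_def less_imp_le)
      moreover have "2 * e * (\<xi> 0 - (l + r) / 2) < 0" using l lr e by (simp add: mult_less_0_iff)
      ultimately show ?thesis by (simp add: G_def)
    qed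
    then have "a 0 \<tau> * G 0 < 0" using a0[of 0] by (simp add: mult_pos_neg)
    ultimately obtain \<delta> where \<delta>: "0 < \<delta>" "\<And>h. 0 < h \<Longrightarrow> l + h \<in> {l..r} \<Longrightarrow> h < \<delta> \<Longrightarrow> q (l + h) < q l"
      using has_real_derivative_neg_dec_right by metis
    define h where "h = min (\<delta> / 2) (if K = 0 then r - l else min (r - l) (\<xi> 1 - \<xi> 0))"
    have h: "0 < h" "h < \<delta>" "l + h \<le> r" using \<delta>(1) lr strict[of 0] by (auto simp: h_def min_def)
    have "\<xi>(0 := l + h) \<in> config l r K"
      using h by (intro conf_upd) (auto simp: h_def l min_def split: if_splits)
    from var[OF _ this] have "0 \<le> q (l + h)" by (simp add: q_def mult_ac)
    moreover have "q l = 0" using l[symmetric] by (simp add: q_def a_def)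
    ultimately show False using \<delta>(2)[of h] h by simp
  qed
  then have l\<xi>: "l < \<xi> 0" using \<xi>in[of 0] by simp
  have "\<xi> K \<noteq> r"
  proof
    assume rr: "\<xi> K = r"
    have "0 < s * (-1) ^ K * w \<tau> r" using a0[of K] rr by (simp add: a_def)
    then have d: "(w \<tau> has_real_derivative 0) (at r within {l..r})" using right[OF \<tau>1 \<tau>(2)] by auto
    define q where "q y = a K \<tau> * ?\<Psi> (\<xi>(K := y)) - ?\<Psi> \<xi> * (s * (-1) ^ K) * w \<tau> y" for y
    have g: "((\<lambda>y. ?\<Psi> (\<xi>(K := y))) has_real_derivative G K) (at r within {l..r})"
      using dG[of K] rr has_field_derivative_at_within by simp blast
    have "(q has_real_derivative a K \<tau> * G K) (at r within {l..r})"
      unfolding q_def by (rule DERIV_cong[OF DERIV_diff[OF DERIV_cmult[OF g] DERIV_cmult[OF d]]]) simp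
    moreover have "0 < G K"
    proof -
      have "0 \<le> (\<Sum>j<K. A * E j * (of_bool (Suc j = K) - of_bool (j = K)))"
        using A E0 by (intro sum_nonneg) (auto simp: of_bool_def less_imp_le)
      moreover have "0 < 2 * e * (\<xi> K - (l + r) / 2)" using rr lr e by simp
      ultimately show ?thesis by (simp add: G_def)
    qed
    then have "0 < a K \<tau> * G K" using a0[of K] by simp
    ultimately obtain \<delta> where \<delta>: "0 < \<delta>" "\<And>h. 0 < h \<Longrightarrow> r - h \<in> {l..r} \<Longrightarrow> h < \<delta> \<Longrightarrow> q (r - h) < q r"
      using has_real_derivative_pos_inc_left by metis
    define h where "h = min (\<delta> / 2) (if K = 0 then r - l else min (r - l) (\<xi> K - \<xi> (K - 1)))"
    have h: "0 < h" "h < \<delta>" "l \<le> r - h" using \<delta>(1) lr strict[of "K - 1"] by (auto simp: h_def min_def)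
    have "\<xi>(K := r - h) \<in> config l r K"
      using h by (intro conf_upd) (auto simp: h_def rr min_def split: if_splits)
    from var[OF _ this] have "0 \<le> q (r - h)" by (simp add: q_def mult_ac)
    moreover have "q r = 0" using rr[symmetric] by (simp add: q_def a_def)
    ultimately show False using \<delta>(2)[of h] h by simp
  qed
  then have \<xi>r: "\<xi> K < r" using \<xi>in[of K] by simp
  have inside: "l < \<xi> i \<and> \<xi> i < r" if "i \<le> K" for i
  proof
    show "l < \<xi> i"
    proof (cases i)
      case (Suc j)
      then show ?thesis using strict[of j] that \<xi>in[of j] by auto
    qed (simp add: l\<xi>)
    show "\<xi> i < r"
    proof (cases "i = K")
      case False
      then show ?thesis using strict[of i] that \<xi>in[of "Suc i"] by auto
    qed (simp add: \<xi>r)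
  qed
  \<comment> \<open>The first-order condition trades \<open>w_x\<close> for \<open>G i\<close> and
    the second-order condition trades \<open>w_xx\<close> for \<open>GG i\<close>, so that the bound
    for the logarithmic derivative of the \<open>i\<close>-th factor is in terms of the
    weight.\<close>
  have "\<exists>d. ((\<lambda>t. a i t) has_real_derivative d) (at \<tau>) \<and>
      d * ?\<Psi> \<xi> \<le> a i \<tau> * (GG i + C * \<bar>G i\<bar> + C * ?\<Psi> \<xi>)" if i: "i \<le> K" for i
  proof -
    obtain wt wx wxx where w: "((\<lambda>s. w s (\<xi> i)) has_real_derivative wt) (at \<tau>)"
      "(w \<tau> has_real_derivative wx) (at (\<xi> i))" "has_sym_deriv2 (w \<tau>) (\<xi> i) wxx"
      "\<bar>wt - wxx\<bar> \<le> C * (\<bar>w \<tau> (\<xi> i)\<bar> + \<bar>wx\<bar>)"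
      using p[OF \<tau>1 \<tau>(2)] inside[OF i] unfolding par_ineq_def by blast
    define \<sigma> where "\<sigma> = s * (-1) ^ i"
    have \<sigma>: "\<bar>\<sigma>\<bar> = 1" using s by (simp add: \<sigma>_def abs_mult power_abs)
    define q where "q y = a i \<tau> * ?\<Psi> (\<xi>(i := y)) - ?\<Psi> \<xi> * \<sigma> * w \<tau> y" for y
    have qx: "(q has_real_derivative a i \<tau> * G i - ?\<Psi> \<xi> * \<sigma> * wx) (at (\<xi> i))"
      unfolding q_def by (intro DERIV_diff DERIV_cmult dG[OF i] w(2))
    have g1: "\<And>y. ((\<lambda>y. ?\<Psi> (\<xi>(i := y))) has_real_derivative
        (\<Sum>j<K. A * exp (- A * ((\<xi>(i := y)) (Suc j) - (\<xi>(i := y)) j)) * (of_bool (Suc j = i) - of_bool (j = i)))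
      + 2 * e * (y - (l + r) / 2)) (at y)" by (rule gap_weight_deriv[OF i])
    have "has_sym_deriv2 (\<lambda>y. ?\<Psi> (\<xi>(i := y))) (\<xi> i) (GG i)"
      using has_sym_deriv2_DERIV[OF zero_less_one g1 gap_weight_deriv2[where y = "\<xi> i"]]
      by (simp add: GG_def E_def)
    then have qxx: "has_sym_deriv2 q (\<xi> i) (a i \<tau> * GG i - ?\<Psi> \<xi> * \<sigma> * wxx)"
      unfolding q_def by (intro has_sym_deriv2_diff has_sym_deriv2_cmult w(3))
    define \<delta> where "\<delta> = Min {\<xi> i - l, r - \<xi> i, if i = 0 then 1 else \<xi> i - \<xi> (i - 1), if i = K then 1 else \<xi> (Suc i) - \<xi> i}"
    have \<delta>: "0 < \<delta>" using inside[OF i] strict[of i] strict[of "i - 1"] i by (auto simp: \<delta>_def)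
    have lm: "q (\<xi> i) \<le> q y" if "\<bar>y - \<xi> i\<bar> < \<delta>" for y
    proof -
      have y: "\<bar>y - \<xi> i\<bar> < \<xi> i - l" "\<bar>y - \<xi> i\<bar> < r - \<xi> i" "i \<noteq> 0 \<Longrightarrow> \<bar>y - \<xi> i\<bar> < \<xi> i - \<xi> (i - 1)"
        "i \<noteq> K \<Longrightarrow> \<bar>y - \<xi> i\<bar> < \<xi> (Suc i) - \<xi> i"
        using that by (auto simp: \<delta>_def split: if_splits)
      have "\<xi>(i := y) \<in> config l r K"
      proof (rule conf_upd)
        show "y \<in> {l..r}" using y(1,2) by auto
        show "\<xi> j \<le> y" if "Suc j = i" for j using y(3) that by auto
        show "y \<le> \<xi> (Suc i)" if "i < K" using y(4) that by auto
      qed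
      from var[OF i this] have "0 \<le> q y" by (simp add: q_def \<sigma>_def mult_ac)
      moreover have "q (\<xi> i) = 0" by (simp add: q_def a_def \<sigma>_def)
      ultimately show ?thesis by simp
    qed
    have x1: "?\<Psi> \<xi> * \<sigma> * wx = a i \<tau> * G i"
      using DERIV_local_min[OF qx \<delta>] lm by (simp add: abs_minus_commute)
    have x2: "?\<Psi> \<xi> * \<sigma> * wxx \<le> a i \<tau> * GG i"
      using has_sym_deriv2_local_min[OF qxx \<delta>] lm by simp
    have "?\<Psi> \<xi> * \<bar>wx\<bar> = \<bar>?\<Psi> \<xi> * \<sigma> * wx\<bar>" using \<Psi>0[OF \<xi>] \<sigma> by (simp add: abs_mult)
    also have "\<dots> = a i \<tau> * \<bar>G i\<bar>" using a0[OF i] by (simp add: x1 abs_mult)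
    finally have x3: "?\<Psi> \<xi> * \<bar>wx\<bar> = a i \<tau> * \<bar>G i\<bar>" .
    have x4: "\<bar>w \<tau> (\<xi> i)\<bar> = a i \<tau>" using a0[OF i] \<sigma> by (simp add: a_def \<sigma>_def[symmetric]) (metis abs_mult abs_of_pos mult_1)
    have "\<sigma> * wt \<le> \<sigma> * wxx + \<bar>\<sigma> * (wt - wxx)\<bar>" by (simp add: right_diff_distrib)
    also have "\<dots> \<le> \<sigma> * wxx + C * (a i \<tau> + \<bar>wx\<bar>)" using w(4) \<sigma> by (simp add: abs_mult x4)
    finally have "?\<Psi> \<xi> * (\<sigma> * wt) \<le> ?\<Psi> \<xi> * (\<sigma> * wxx + C * (a i \<tau> + \<bar>wx\<bar>))"
      using \<Psi>0[OF \<xi>] by (intro mult_left_mono) auto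
    also have "\<dots> = ?\<Psi> \<xi> * \<sigma> * wxx + C * (?\<Psi> \<xi> * a i \<tau>) + C * (?\<Psi> \<xi> * \<bar>wx\<bar>)" by (simp add: algebra_simps)
    also have "\<dots> \<le> a i \<tau> * (GG i + C * \<bar>G i\<bar> + C * ?\<Psi> \<xi>)" using x2 unfolding x3 by (simp add: algebra_simps)
    finally have "(\<sigma> * wt) * ?\<Psi> \<xi> \<le> a i \<tau> * (GG i + C * \<bar>G i\<bar> + C * ?\<Psi> \<xi>)" by (simp add: mult_ac)
    moreover have "((\<lambda>t. a i t) has_real_derivative \<sigma> * wt) (at \<tau>)"
      unfolding a_def \<sigma>_def by (intro DERIV_cmult w(1))
    ultimately show ?thesis by blast
  qed
  then obtain d where d: "\<And>i. i \<le> K \<Longrightarrow> ((\<lambda>t. a i t) has_real_derivative d i) (at \<tau>)"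
      "\<And>i. i \<le> K \<Longrightarrow> d i * ?\<Psi> \<xi> \<le> a i \<tau> * (GG i + C * \<bar>G i\<bar> + C * ?\<Psi> \<xi>)"
    by metis
  have S1: "(\<Sum>i\<le>K. GG i) = - (2 * A\<^sup>2 * (\<Sum>j<K. E j)) + real (Suc K) * (2 * e)"
  proof -
    have "(\<Sum>i\<le>K. GG i) = - (\<Sum>i\<le>K. \<Sum>j<K. (A * A * E j) * (of_bool (Suc j = i) + of_bool (j = i))) + real (Suc K) * (2 * e)"
      unfolding GG_def by (simp add: sum.distrib sum_negf sum_subtractf)
    then show ?thesis unfolding sum_of_bool_gaps by (simp add: sum_distrib_left power2_eq_square mult.assoc)
  qed
  have S2: "(\<Sum>i\<le>K. \<bar>G i\<bar>) \<le> 2 * A * (\<Sum>j<K. E j) + real (Suc K) * (e * (r - l))"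
  proof -
    have "\<bar>G i\<bar> \<le> (\<Sum>j<K. A * E j * (of_bool (Suc j = i) + of_bool (j = i))) + e * (r - l)" for i
    proof -
      have "\<bar>\<Sum>j<K. A * E j * (of_bool (Suc j = i) - of_bool (j = i))\<bar> \<le> (\<Sum>j<K. A * E j * (of_bool (Suc j = i) + of_bool (j = i)))"
      proof (rule order_trans[OF sum_abs], rule sum_mono)
        fix j show "\<bar>A * E j * (of_bool (Suc j = i) - of_bool (j = i))\<bar> \<le> A * E j * (of_bool (Suc j = i) + of_bool (j = i))"
          using A E0[of j] by (auto simp: of_bool_def abs_mult)
      qed
      moreover have "\<bar>2 * e * (\<xi> i - (l + r) / 2)\<bar> \<le> e * (r - l)"
      proof -
        have "\<bar>2 * (\<xi> i - (l + r) / 2)\<bar> \<le> r - l" using \<xi>in[of i] by (auto simp: abs_le_iff field_simps)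
        then have "e * \<bar>2 * (\<xi> i - (l + r) / 2)\<bar> \<le> e * (r - l)" using e by (intro mult_left_mono) auto
        moreover have "\<bar>2 * e * (\<xi> i - (l + r) / 2)\<bar> = e * \<bar>2 * (\<xi> i - (l + r) / 2)\<bar>"
          using e by (simp only: abs_mult mult_ac abs_of_pos)
        ultimately show ?thesis by simp
      qed
      ultimately show ?thesis unfolding G_def by linarith
    qed
    then have "(\<Sum>i\<le>K. \<bar>G i\<bar>) \<le> (\<Sum>i\<le>K. (\<Sum>j<K. A * E j * (of_bool (Suc j = i) + of_bool (j = i))) + e * (r - l))"
      by (intro sum_mono) auto
    also have "\<dots> = 2 * A * (\<Sum>j<K. E j) + real (Suc K) * (e * (r - l))"
      by (simp only: sum.distrib sum_of_bool_gaps) (simp add: sum_distrib_left mult.assoc)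
    finally show ?thesis .
  qed
  have "(\<Sum>i\<le>K. d i / a i \<tau>) * ?\<Psi> \<xi> = (\<Sum>i\<le>K. d i * ?\<Psi> \<xi> / a i \<tau>)"
    by (simp add: sum_distrib_right)
  also have "\<dots> \<le> (\<Sum>i\<le>K. GG i + C * \<bar>G i\<bar> + C * ?\<Psi> \<xi>)"
    using d(2) a0 by (intro sum_mono) (simp add: pos_divide_le_eq mult.commute)
  also have "\<dots> = (\<Sum>i\<le>K. GG i) + C * (\<Sum>i\<le>K. \<bar>G i\<bar>) + C * real (Suc K) * ?\<Psi> \<xi>"
    by (simp add: sum.distrib sum_distrib_left)
  also have "\<dots> \<le> (- (2 * A\<^sup>2 * (\<Sum>j<K. E j)) + real (Suc K) * (2 * e))
      + C * (2 * A * (\<Sum>j<K. E j) + real (Suc K) * (e * (r - l))) + C * real (Suc K) * ?\<Psi> \<xi>"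
    unfolding S1 using mult_left_mono[OF S2 C] by linarith
  also have "\<dots> = (2 * C * A - 2 * A\<^sup>2) * (\<Sum>j<K. E j) + real (Suc K) * (e * (2 + C * (r - l))) + C * real (Suc K) * ?\<Psi> \<xi>"
    by (simp add: algebra_simps)
  also have "\<dots> < B * ?\<Psi> \<xi>" using num[OF \<xi>] unfolding E_def .
  finally have lt: "(\<Sum>i\<le>K. d i / a i \<tau>) < B" using \<Psi>0[OF \<xi>] by simp
  define Lg where "Lg t = - B * (t - t1) + (\<Sum>i\<le>K. ln (a i t))" for t
  have "(Lg has_real_derivative - B + (\<Sum>i\<le>K. d i / a i \<tau>)) (at \<tau>)"
    unfolding Lg_def using a0
    by (auto intro!: derivative_eq_intros d(1) sum.cong simp: field_simps)
  moreover have "\<exists>\<delta>>0. \<forall>t. \<tau> - \<delta> < t \<and> t < \<tau> \<longrightarrow> Lg t \<le> Lg \<tau>"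
  proof -
    have "\<forall>\<^sub>F t in at \<tau>. \<forall>i\<in>{..K}. 0 < a i t"
    proof (rule eventually_ball_finite)
      show "\<forall>i\<in>{..K}. \<forall>\<^sub>F t in at \<tau>. 0 < a i t"
        using d(1)[THEN DERIV_isCont] a0 by (auto simp: isCont_def intro: order_tendstoD)
    qed simp
    then obtain \<delta> where \<delta>: "0 < \<delta>" "\<And>t i. t \<noteq> \<tau> \<Longrightarrow> dist t \<tau> < \<delta> \<Longrightarrow> i \<le> K \<Longrightarrow> 0 < a i t"
      unfolding eventually_at by auto
    have "Lg t \<le> Lg \<tau>" if t: "\<tau> - min \<delta> (\<tau> - t1) < t" "t < \<tau>" for t
    proof -
      have at: "0 < a i t" if "i \<le> K" for i using \<delta>(2)[of t i] t that by (simp add: dist_real_def)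
      have t1t: "t1 \<le> t" "t \<le> t0" using t \<tau> by auto
      have F: "alt_prod (w t) s K \<xi> = (\<Prod>i\<le>K. a i t)" "alt_prod (w \<tau>) s K \<xi> = (\<Prod>i\<le>K. a i \<tau>)"
        unfolding alt_prod_def using at a0 by (auto intro!: prod.cong simp: a_def max_def less_le_not_le)
      have "exp (Lg t) = exp (- B * (t - t1)) * (\<Prod>i\<le>K. a i t)" 
        unfolding Lg_def exp_add using at by (simp add: exp_sum)
      also have "\<dots> \<le> exp (- B * (\<tau> - t1)) * (\<Prod>i\<le>K. a i \<tau>)"
        using max[OF t1t \<xi>] \<Psi>0[OF \<xi>] unfolding H_def prod.case F by (simp add: divide_le_cancel)
      also have "\<dots> = exp (Lg \<tau>)" unfolding Lg_def exp_add using a0 by (simp add: exp_sum)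
      finally show ?thesis by simp
    qed
    then show ?thesis using \<delta>(1) \<tau>1 by (intro exI[of _ "min \<delta> (\<tau> - t1)"]) auto
  qed
  ultimately have "0 \<le> - B + (\<Sum>i\<le>K. d i / a i \<tau>)" using DERIV_left_max_nonneg by blast
  then show False using lt by simp
qed

section \<open>Counting sign alternations\<close>

text \<open>At least \<open>n\<close> alternations, witnessed by \<open>n + 1\<close> ordered
  points, where \<open>s\<close> is the sign at the first point. Zeros never serve as witnesses, so
  an alternation survives small perturbations of \<open>w\<close>.\<close>

definition sign_changes :: "(real \<Rightarrow> real) \<Rightarrow> real \<Rightarrow> real \<Rightarrow> real \<Rightarrow> nat \<Rightarrow> bool" where
  "sign_changes w l r s n \<longleftrightarrow>
     (\<exists>x. (\<forall>i\<le>n. x i \<in> {l..r} \<and> 0 < s * (-1) ^ i * w (x i)) \<and> (\<forall>i<n. x i < x (Suc i)))"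

lemma sign_changes_iff:
  "sign_changes w l r s K \<longleftrightarrow> (\<exists>x\<in>config l r K. 0 < alt_prod w s K x)"
proof
  assume "sign_changes w l r s K"
  then obtain x where x: "\<And>i. i \<le> K \<Longrightarrow> x i \<in> {l..r} \<and> 0 < s * (-1) ^ i * w (x i)" "\<And>i. i < K \<Longrightarrow> x i < x (Suc i)"
    unfolding sign_changes_def by blast
  \<comment> \<open>The finite tuple is continued to a sequence by repeating its last point.\<close>
  have "(\<lambda>i. x (min i K)) \<in> config l r K"
    unfolding config_def using x(1) x(2) by (auto simp: less_imp_le Suc_le_eq min_def)
  moreover have "0 < alt_prod w s K (\<lambda>i. x (min i K))"
    unfolding alt_prod_def
  proof (rule prod_pos)
    fix i assume "i \<in> {..K}"
    then show "0 < max 0 (s * (-1) ^ i * w (x (min i K)))" using x(1)[of i] by (simp add: min_def less_max_iff_disj)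
  qed
  ultimately show "\<exists>x\<in>config l r K. 0 < alt_prod w s K x" by blast
next
  assume "\<exists>x\<in>config l r K. 0 < alt_prod w s K x"
  then obtain x where x: "x \<in> config l r K" and p: "0 < alt_prod w s K x" by blast
  have pos: "0 < s * (-1) ^ i * w (x i)" if "i \<le> K" for i
  proof (rule ccontr)
    assume "\<not> 0 < s * (-1) ^ i * w (x i)"
    then have "alt_prod w s K x = 0" unfolding alt_prod_def using that by (intro prod_zero) (auto intro!: bexI[of _ i])
    with p show False by simp
  qed
  have "x i < x (Suc i)" if "i < K" for i
  proof -
    have "x i \<noteq> x (Suc i)" using pos[of i] pos[of "Suc i"] that by auto
    then show ?thesis using x that by (simp add: config_def order_less_le)
  qed
  then show "sign_changes w l r s K" unfolding sign_changes_def using x pos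
    by (intro exI[of _ x]) (auto simp: config_def)
qed

text \<open>With \<open>Y = 0\<close> the multi-point principle says that a product which vanishes
  initially stays zero. Any growth rate is harmless then, so \<open>B\<close> is simply taken large
  and \<open>A = e = 1\<close>. At an end without a Neumann condition, the boundary value must not
  have the sign of the outermost alternation point.\<close>

lemma sign_changes_antimono:
  fixes w :: "real \<Rightarrow> real \<Rightarrow> real"
  assumes C: "0 \<le> C" and t01: "t1 \<le> t0" and lr: "l < r"
    and c: "continuous_on ({t1..t0} \<times> {l..r}) (\<lambda>(t, x). w t x)"
    and p: "\<And>t x. t1 < t \<Longrightarrow> t \<le> t0 \<Longrightarrow> l < x \<Longrightarrow> x < r \<Longrightarrow> par_ineq C w t x"
    and left: "\<And>t. t1 < t \<Longrightarrow> t \<le> t0 \<Longrightarrow> s * w t l \<le> 0 \<or> (w t has_real_derivative 0) (at l within {l..r})"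
    and right: "\<And>t. t1 < t \<Longrightarrow> t \<le> t0 \<Longrightarrow> s * (-1) ^ K * w t r \<le> 0 \<or> (w t has_real_derivative 0) (at r within {l..r})"
    and s: "\<bar>s\<bar> = 1" and sc: "sign_changes (w t0) l r s K"
  shows "sign_changes (w t1) l r s K"
proof (rule ccontr)
  assume n: "\<not> ?thesis"
  let ?\<Psi> = "gap_weight 1 1 ((l + r) / 2) K"
  define B where "B = 2 * C * real K + real (Suc K) * (1 * (2 + C * (r - l))) + C * real (Suc K) + 1"
  have num: "(2 * C * 1 - 2 * 1\<^sup>2) * (\<Sum>j<K. exp (- 1 * (x (Suc j) - x j))) + real (Suc K) * (1 * (2 + C * (r - l)))
         + C * real (Suc K) * ?\<Psi> x < B * ?\<Psi> x" if x: "x \<in> config l r K" for x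
  proof -
    let ?S = "\<Sum>j<K. exp (- 1 * (x (Suc j) - x j))"
    have "?S \<le> (\<Sum>j<K. 1)" using x by (intro sum_mono) (auto simp: config_def)
    moreover have S0: "0 \<le> ?S" by (intro sum_nonneg) auto
    ultimately have "(2 * C) * ?S \<le> (2 * C) * real K" using C by (intro mult_left_mono) auto
    then have 1: "(2 * C * 1 - 2 * 1\<^sup>2) * ?S \<le> 2 * C * real K" using S0 unfolding left_diff_distrib by simp
    have \<Psi>: "1 \<le> ?\<Psi> x" using x by (rule gap_weight_ge_1) auto
    have "0 \<le> 2 * C * real K + real (Suc K) * (1 * (2 + C * (r - l)))" using C lr by simp
    then have "2 * C * real K + real (Suc K) * (1 * (2 + C * (r - l)))
       \<le> (2 * C * real K + real (Suc K) * (1 * (2 + C * (r - l)))) * ?\<Psi> x"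
      using mult_left_mono[OF \<Psi>, of "2 * C * real K + real (Suc K) * (1 * (2 + C * (r - l)))"] by simp
    moreover have "B * ?\<Psi> x = (2 * C * real K + real (Suc K) * (1 * (2 + C * (r - l)))) * ?\<Psi> x + C * real (Suc K) * ?\<Psi> x + ?\<Psi> x"
      unfolding B_def by (simp only: distrib_right mult_1_left)
    ultimately show ?thesis using 1 \<Psi> by linarith
  qed
  obtain x where x: "x \<in> config l r K" "0 < alt_prod (w t0) s K x" using sc sign_changes_iff by blast
  have "alt_prod (w t0) s K x \<le> exp (B * (t0 - t1)) * 0 * ?\<Psi> x"
  proof (rule multipoint_maximum_principle[OF C t01 lr zero_less_one zero_less_one c p left right num order_refl _ s x(1)])
    fix x assume "x \<in> config l r K"
    then have "\<not> 0 < alt_prod (w t1) s K x" using n sign_changes_iff by blast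
    then show "alt_prod (w t1) s K x \<le> 0 * ?\<Psi> x" by simp
  qed auto
  then show False using x(2) by simp
qed

text \<open>If the gaps are so short that their exponentials average at least \<open>1 / 2\<close>,
  the negative term is of order \<open>A\<^sup>2 * K\<close>. It has to beat
  \<open>C * real (Suc K)\<close> times a weight of order \<open>K\<close>. So
  \<open>A\<^sup>2\<close> is taken proportional to \<open>K\<close>, which leaves
  \<open>A * (r - l)\<close> small against \<open>K\<close> for large \<open>K\<close>.\<close>

lemma gap_weight_dissipative:
  assumes C: "0 \<le> C" and lr: "l < r"
  obtains K A e where "0 < A" "0 < e"
    "\<And>x. x \<in> config l r K \<Longrightarrow>
       (2 * C * A - 2 * A\<^sup>2) * (\<Sum>j<K. exp (- A * (x (Suc j) - x j))) + real (Suc K) * (e * (2 + C * (r - l)))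
         + C * real (Suc K) * gap_weight A e ((l + r) / 2) K x < - 1 * gap_weight A e ((l + r) / 2) K x"
proof -
  define D where "D = r - l"
  have D: "0 < D" using lr by (simp add: D_def)
  \<comment> \<open>\<open>100 * D\<^sup>2 * (C + 1) <= K\<close> is what
    \<open>2 * (A * D) <= K\<close> amounts to for the \<open>A\<close> below, and
    \<open>C <= K\<close> yields \<open>2 * C <= A\<close>.\<close>
  obtain K where K: "1 + C + 100 * D\<^sup>2 * (C + 1) \<le> real K" using real_arch_simple by blast
  \<comment> \<open>With the factor 5 the negative term is \<open>12.5\<close> times
    \<open>(C + 1) * (real K * real K)\<close>, while all others add up to at most 12 times this:
    the weight is at most \<open>2 * real (Suc K)\<close>, and \<open>real (Suc K)\<close> at most
    \<open>2 * real K\<close>.\<close>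
  define A where "A = 5 * sqrt ((C + 1) * real K)"
  \<comment> \<open>Makes both \<open>e * (2 + C * D)\<close> and \<open>e * D\<^sup>2\<close> at
    most 1.\<close>
  define e where "e = 1 / (2 + C * D + D\<^sup>2)"
  have CD: "0 \<le> C * D" "0 \<le> D\<^sup>2" "0 \<le> D\<^sup>2 * (C + 1)" using C D by auto
  have K1: "1 \<le> real K" "C \<le> real K" "100 * D\<^sup>2 * (C + 1) \<le> real K" using K C CD by linarith+
  have den: "0 < 2 + C * D + D\<^sup>2" using CD by linarith
  have e0: "0 < e" using den by (simp add: e_def)
  have "e * (2 + C * D + D\<^sup>2) = 1" using den by (simp add: e_def)
  then have e1: "e * (2 + C * D) + e * D\<^sup>2 = 1" by (simp only: distrib_left)
  have "e * (2 + C * D) \<le> 1" "e * D\<^sup>2 \<le> 1" using e1 e0 CD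
    mult_nonneg_nonneg[of e "2 + C * D"] mult_nonneg_nonneg[of e "D\<^sup>2"] by linarith+
  note e2 = this
  have CK: "0 < (C + 1) * real K" using C K1 by simp
  have A0: "0 < A" using CK by (simp add: A_def)
  have A2: "A\<^sup>2 = 25 * ((C + 1) * real K)" using CK by (simp add: A_def power_mult_distrib)
  have A2C: "2 * C \<le> A"
  proof (rule power2_le_imp_le)
    have "C * C \<le> (C + 1) * real K" using C K1 by (intro mult_mono) auto
    then have "4 * (C * C) \<le> 25 * ((C + 1) * real K)" using CK by linarith
    then show "(2 * C)\<^sup>2 \<le> A\<^sup>2" unfolding A2 by (simp add: power2_eq_square)
  qed (use A0 in simp)
  have AD: "2 * (A * D) \<le> real K"
  proof (rule power2_le_imp_le)
    have "100 * D\<^sup>2 * (C + 1) * real K \<le> real K * real K" using K1 by (intro mult_right_mono) auto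
    then have "4 * (25 * ((C + 1) * real K) * D\<^sup>2) \<le> real K * real K" by (simp add: algebra_simps)
    moreover have "(2 * (A * D))\<^sup>2 = 4 * (A\<^sup>2 * D\<^sup>2)" by (simp add: power_mult_distrib)
    ultimately show "(2 * (A * D))\<^sup>2 \<le> (real K)\<^sup>2" unfolding A2 by (simp only: power2_eq_square[of "real K"])
  qed simp
  show thesis
  proof (rule that[OF A0 e0])
    fix x assume x: "x \<in> config l r K"
    let ?S = "\<Sum>j<K. exp (- A * (x (Suc j) - x j))" and ?\<Psi> = "gap_weight A e ((l + r) / 2) K x"
    have S0: "0 \<le> ?S" by (intro sum_nonneg) auto
    have "A * (x K - x 0) \<le> A * D"
      using x A0 unfolding D_def config_def by (intro mult_left_mono) (auto intro: diff_mono)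
    moreover have "(\<Sum>j<K. 1 - A * (x (Suc j) - x j)) \<le> ?S"
    proof (rule sum_mono)
      fix j
      have "1 + - A * (x (Suc j) - x j) \<le> exp (- A * (x (Suc j) - x j))" by (rule exp_ge_add_one_self)
      then show "1 - A * (x (Suc j) - x j) \<le> exp (- A * (x (Suc j) - x j))" by linarith
    qed
    moreover have "(\<Sum>j<K. 1 - A * (x (Suc j) - x j)) = real K - A * (x K - x 0)"
      using sum_lessThan_telescope[of x K] by (subst sum_subtractf) (simp flip: sum_distrib_left)
    ultimately have S: "real K / 2 \<le> ?S" using AD by linarith
    have "(\<Sum>j\<le>K. (x j - (l + r) / 2)\<^sup>2) \<le> (\<Sum>j\<le>K. D\<^sup>2)"
    proof (rule sum_mono)
      fix j
      have "l \<le> x j" "x j \<le> r" using x by (auto simp: config_def)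
      then have "\<bar>x j - (l + r) / 2\<bar> \<le> D" using lr unfolding abs_le_iff D_def by (simp add: field_simps)
      then have "\<bar>x j - (l + r) / 2\<bar> \<le> \<bar>D\<bar>" by linarith
      then show "(x j - (l + r) / 2)\<^sup>2 \<le> D\<^sup>2" by (simp add: abs_le_square_iff)
    qed
    then have "e * (\<Sum>j\<le>K. (x j - (l + r) / 2)\<^sup>2) \<le> e * (real (Suc K) * D\<^sup>2)" using e0 by (intro mult_left_mono) auto
    also have "\<dots> = real (Suc K) * (e * D\<^sup>2)" by simp
    also have "\<dots> \<le> real (Suc K) * 1" using e2 by (intro mult_left_mono) auto
    finally have \<Psi>: "?\<Psi> \<le> 2 * real (Suc K)"
      using S0 unfolding gap_weight_def by (simp add: sum_subtractf)
    have \<Psi>1: "1 \<le> ?\<Psi>" using x A0 e0 by (intro gap_weight_ge_1) auto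
    have "(2 * C * A - 2 * A\<^sup>2) * ?S \<le> (- A\<^sup>2) * ?S"
      using A2C A0 S0 mult_right_mono[OF A2C, of A] by (intro mult_right_mono) (auto simp: power2_eq_square)
    also have "\<dots> \<le> (- A\<^sup>2) * (real K / 2)" using S by (intro mult_left_mono_neg) auto
    also have "\<dots> = - (12.5 * ((C + 1) * (real K * real K)))" by (simp add: A2)
    finally have 1: "(2 * C * A - 2 * A\<^sup>2) * ?S \<le> - (12.5 * ((C + 1) * (real K * real K)))" .
    have 2: "real (Suc K) * (e * (2 + C * (r - l))) \<le> real (Suc K)"
      using e2(1) mult_left_mono[OF e2(1), of "real (Suc K)"] by (simp add: D_def)
    have "(C * real (Suc K) + 1) * ?\<Psi> \<le> ((C + 1) * real (Suc K)) * (2 * real (Suc K))"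
      using C \<Psi> \<Psi>1 by (intro mult_mono) (auto simp: algebra_simps)
    then have 3: "C * real (Suc K) * ?\<Psi> + ?\<Psi> \<le> 2 * ((C + 1) * (real (Suc K) * real (Suc K)))" by (simp add: algebra_simps)
    have "1 * real (Suc K) \<le> (C + 1) * real (Suc K) * real (Suc K)"
      using C by (intro mult_right_mono) (auto simp: algebra_simps)
    then have 4: "real (Suc K) \<le> (C + 1) * (real (Suc K) * real (Suc K))" by (simp only: mult_1_left mult.assoc)
    have "(C + 1) * (real (Suc K) * real (Suc K)) \<le> (C + 1) * ((2 * real K) * (2 * real K))"
      using C K1 by (intro mult_left_mono mult_mono) auto
    then have 5: "(C + 1) * (real (Suc K) * real (Suc K)) \<le> 4 * ((C + 1) * (real K * real K))" by simp
    have "0 < (C + 1) * (real K * real K)" using C K1 by simp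
    then show "(2 * C * A - 2 * A\<^sup>2) * ?S + real (Suc K) * (e * (2 + C * (r - l)))
         + C * real (Suc K) * ?\<Psi> < - 1 * ?\<Psi>" using 1 2 3 4 5 by linarith
  qed
qed

text \<open>\<open>W n\<close> runs for time \<open>n\<close> and ends in \<open>v\<close>:
  \<open>v\<close> has bounded pasts of every length. With decay rate \<open>B = - 1\<close> a
  product bounded at the start is at most a constant times \<open>exp (- real n)\<close> at the end,
  hence zero. \<open>K\<close> depends on \<open>C\<close>, \<open>l\<close> and \<open>r\<close>
  alone.\<close>

lemma sign_changes_bounded:
  assumes C: "0 \<le> C" and lr: "l < r"
  obtains K where "\<And>s v Bd W. \<bar>s\<bar> = 1 \<Longrightarrow> (\<And>n. W n (real n) = v) \<Longrightarrow>
    (\<And>n x. x \<in> {l..r} \<Longrightarrow> \<bar>W n 0 x\<bar> \<le> Bd) \<Longrightarrow>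
    (\<And>n. continuous_on ({0..real n} \<times> {l..r}) (\<lambda>(t, x). W n t x)) \<Longrightarrow>
    (\<And>n t x. 0 < t \<Longrightarrow> t \<le> real n \<Longrightarrow> l < x \<Longrightarrow> x < r \<Longrightarrow> par_ineq C (W n) t x) \<Longrightarrow>
    (\<And>n t. 0 < t \<Longrightarrow> t \<le> real n \<Longrightarrow> W n t l = 0 \<or> (W n t has_real_derivative 0) (at l within {l..r})) \<Longrightarrow>
    (\<And>n t. 0 < t \<Longrightarrow> t \<le> real n \<Longrightarrow> W n t r = 0 \<or> (W n t has_real_derivative 0) (at r within {l..r})) \<Longrightarrow>
    \<not> sign_changes v l r s K"
proof -
  obtain K A e where A: "0 < A" "0 < e" and num: "\<And>x. x \<in> config l r K \<Longrightarrow>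
       (2 * C * A - 2 * A\<^sup>2) * (\<Sum>j<K. exp (- A * (x (Suc j) - x j))) + real (Suc K) * (e * (2 + C * (r - l)))
         + C * real (Suc K) * gap_weight A e ((l + r) / 2) K x < - 1 * gap_weight A e ((l + r) / 2) K x"
    by (rule gap_weight_dissipative[OF C lr], rule that)
  show thesis
  proof (rule that[of K], rule notI)
    fix s Bd :: real and v :: "real \<Rightarrow> real" and W :: "nat \<Rightarrow> real \<Rightarrow> real \<Rightarrow> real"
    assume s: "\<bar>s\<bar> = 1" and v: "\<And>n. W n (real n) = v"
      and Bd: "\<And>n x. x \<in> {l..r} \<Longrightarrow> \<bar>W n 0 x\<bar> \<le> Bd"
      and c: "\<And>n. continuous_on ({0..real n} \<times> {l..r}) (\<lambda>(t, x). W n t x)"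
      and p: "\<And>n t x. 0 < t \<Longrightarrow> t \<le> real n \<Longrightarrow> l < x \<Longrightarrow> x < r \<Longrightarrow> par_ineq C (W n) t x"
      and left: "\<And>n t. 0 < t \<Longrightarrow> t \<le> real n \<Longrightarrow> W n t l = 0 \<or> (W n t has_real_derivative 0) (at l within {l..r})"
      and right: "\<And>n t. 0 < t \<Longrightarrow> t \<le> real n \<Longrightarrow> W n t r = 0 \<or> (W n t has_real_derivative 0) (at r within {l..r})"
      and sc: "sign_changes v l r s K"
    let ?\<Psi> = "gap_weight A e ((l + r) / 2) K"
    obtain x where x: "x \<in> config l r K" "0 < alt_prod v s K x" using sc sign_changes_iff by blast
    define Y where "Y = \<bar>Bd\<bar> ^ Suc K"
    have Y: "0 \<le> Y" by (simp add: Y_def)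
    have le: "alt_prod v s K x \<le> exp (- 1 * (real n - 0)) * Y * ?\<Psi> x" for n
    proof -
      have "alt_prod (W n (real n)) s K x \<le> exp (- 1 * (real n - 0)) * Y * ?\<Psi> x"
      proof (rule multipoint_maximum_principle[OF C _ lr A c p _ _ num Y _ s x(1)])
        fix x assume x: "x \<in> config l r K"
        have "alt_prod (W n 0) s K x \<le> (\<Prod>i\<le>K. \<bar>Bd\<bar>)"
          unfolding alt_prod_def
        proof (intro prod_mono conjI)
          fix i
          have "s * (-1) ^ i * W n 0 (x i) \<le> \<bar>s * (-1) ^ i * W n 0 (x i)\<bar>" by simp
          also have "\<dots> = \<bar>W n 0 (x i)\<bar>" using s by (simp add: abs_mult power_abs)
          also have "\<dots> \<le> \<bar>Bd\<bar>" using Bd[of "x i" n] x by (simp add: config_def)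
          finally show "max 0 (s * (-1) ^ i * W n 0 (x i)) \<le> \<bar>Bd\<bar>" by simp
        qed simp
        also have "\<dots> = Y * 1" by (simp add: Y_def)
        also have "\<dots> \<le> Y * ?\<Psi> x" using Y gap_weight_ge_1[OF x] A by (intro mult_left_mono) auto
        finally show "alt_prod (W n 0) s K x \<le> Y * ?\<Psi> x" .
      next
        fix t assume t: "0 < t" "t \<le> real n"
        show "s * W n t l \<le> 0 \<or> (W n t has_real_derivative 0) (at l within {l..r})" using left[OF t] by auto
        show "s * (- 1) ^ K * W n t r \<le> 0 \<or> (W n t has_real_derivative 0) (at r within {l..r})" using right[OF t] by auto
      qed auto
      then show ?thesis by (simp only: v)
    qed
    have "((\<lambda>n. exp (- 1 * (real n - 0)) * Y * ?\<Psi> x) \<longlongrightarrow> 0 * Y * ?\<Psi> x) sequentially"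
    proof (intro tendsto_intros)
      have "(\<lambda>n. inverse (exp 1) ^ n) \<longlonglongrightarrow> (0::real)" by (intro LIMSEQ_power_zero) (simp add: inverse_less_1_iff)
      moreover have "exp (- 1 * (real n - 0)) = inverse (exp (1::real)) ^ n" for n
        by (simp add: exp_minus power_inverse exp_of_nat_mult[symmetric])
      ultimately show "(\<lambda>n. exp (- 1 * (real n - 0))) \<longlonglongrightarrow> (0::real)" by simp
    qed
    then have "alt_prod v s K x \<le> 0 * Y * ?\<Psi> x"
      by (rule tendsto_lowerbound) (use le in auto)
    with x show False by simp
  qed
qed

lemma sign_changes_1_iff:
  "sign_changes w l r 1 (Suc 0) \<longleftrightarrow> (\<exists>x\<in>{l..r}. \<exists>y\<in>{l..r}. x < y \<and> 0 < w x \<and> w y < 0)"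
proof
  assume "sign_changes w l r 1 (Suc 0)"
  then obtain x where x: "\<And>i. i \<le> Suc 0 \<Longrightarrow> x i \<in> {l..r} \<and> 0 < 1 * (-1) ^ i * w (x i)" "\<And>i. i < Suc 0 \<Longrightarrow> x i < x (Suc i)"
    unfolding sign_changes_def by blast
  then show "\<exists>x\<in>{l..r}. \<exists>y\<in>{l..r}. x < y \<and> 0 < w x \<and> w y < 0"
    using x(1)[of 0] x(1)[of "Suc 0"] x(2)[of 0] by (intro bexI[of _ "x 0"] bexI[of _ "x 1"]) auto
next
  assume "\<exists>x\<in>{l..r}. \<exists>y\<in>{l..r}. x < y \<and> 0 < w x \<and> w y < 0"
  then obtain x y where "x \<in> {l..r}" "y \<in> {l..r}" "x < y" "0 < w x" "w y < 0" by blast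
  then show "sign_changes w l r 1 (Suc 0)"
    unfolding sign_changes_def by (intro exI[of _ "\<lambda>i. if i = 0 then x else y"]) (auto simp: le_Suc_eq)
qed

section \<open>The strong maximum principle and simple zeros\<close>

text \<open>By continuity \<open>w\<close> is positive at \<open>r\<close> for a short time before
  \<open>t0\<close>. Over this time the Hopf lemma is applied on \<open>{a..r}\<close> and, after
  replacing \<open>x\<close> by \<open>a + b - x\<close>, on \<open>{r..b}\<close>. The linear
  bounds yield positivity inside and also strict slopes at ends where \<open>w\<close>
  vanishes.\<close>

lemma strong_maximum_principle:
  fixes w :: "real \<Rightarrow> real \<Rightarrow> real"
  assumes C: "0 \<le> C" and t: "t1 < t0" and r: "a < r" "r < b"
    and c: "continuous_on ({t1..t0} \<times> {a..b}) (\<lambda>(t, x). w t x)"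
    and nn: "\<And>t x. t1 \<le> t \<Longrightarrow> t \<le> t0 \<Longrightarrow> a \<le> x \<Longrightarrow> x \<le> b \<Longrightarrow> 0 \<le> w t x"
    and pos: "0 < w t0 r"
    and p: "\<And>t x. t1 < t \<Longrightarrow> t \<le> t0 \<Longrightarrow> a < x \<Longrightarrow> x < b \<Longrightarrow> par_ineq C w t x"
  shows "\<exists>\<kappa>>0. (\<forall>x\<in>{a..r}. \<kappa> * (x - a) \<le> w t0 x) \<and> (\<forall>x\<in>{r..b}. \<kappa> * (b - x) \<le> w t0 x)"
proof -
  have "continuous_on {t1..t0} (\<lambda>t. w t r)"
    using continuous_on_compose2[OF c, of "{t1..t0}" "\<lambda>t. (t, r)"] r
    by (force intro: continuous_intros)
  then obtain d where d: "0 < d" "\<And>t. t \<in> {t1..t0} \<Longrightarrow> dist t t0 < d \<Longrightarrow> dist (w t r) (w t0 r) < w t0 r"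
    using pos t unfolding continuous_on_iff by (metis atLeastAtMost_iff less_imp_le order_refl)
  define t2 where "t2 = max t1 (t0 - d / 2)"
  have t2: "t1 \<le> t2" "t2 < t0" "t0 - t2 < d" using d(1) t by (auto simp: t2_def)
  have pos': "0 < w t r" if "t2 \<le> t" "t \<le> t0" for t
    using d(2)[of t] that t2 by (force simp: dist_real_def)
  have 1: "\<exists>\<kappa>>0. \<forall>x\<in>{a..r}. \<kappa> * (x - a) \<le> w t0 x"
  proof (rule hopf_lemma[OF C t2(2) r(1), where \<mu> = "(r - a) / (t0 - t2)"])
    show "continuous_on ({t2..t0} \<times> {a..r}) (\<lambda>(t, x). w t x)"
      by (rule continuous_on_subset[OF c]) (use t2 r in auto)
    show "0 < (r - a) / (t0 - t2)" "r - a \<le> (r - a) / (t0 - t2) * (t0 - t2)" using r t2 by auto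
    fix t x assume "t2 \<le> t" "t \<le> t0" "x \<le> r" and x: "a + (r - a) / (t0 - t2) * (t0 - t) \<le> x"
    moreover have "0 \<le> (r - a) / (t0 - t2) * (t0 - t)" using r t2 \<open>t \<le> t0\<close> by simp
    then have "a \<le> x" using x by linarith
    ultimately show "0 \<le> w t x" using t2 r by (intro nn) linarith+
  qed (use p pos' t2 r in auto)
  have "\<exists>\<kappa>>0. \<forall>x\<in>{a..a + b - r}. \<kappa> * (x - a) \<le> w t0 (a + b - x)"
  proof (rule hopf_lemma[OF C t2(2), where \<mu> = "(b - r) / (t0 - t2)" and w = "\<lambda>t x. w t (a + b - x)"])
    have "continuous_on ({t2..t0} \<times> {a..a + b - r}) (\<lambda>z. (\<lambda>(t, x). w t x) (fst z, a + b - snd z))"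
      by (rule continuous_on_compose2[OF c]) (use t2 r in \<open>auto intro!: continuous_intros\<close>)
    then show "continuous_on ({t2..t0} \<times> {a..a + b - r}) (\<lambda>(t, x). w t (a + b - x))" by (simp add: split_def)
    show "a < a + b - r" using r by simp
    show "0 < (b - r) / (t0 - t2)" "a + b - r - a \<le> (b - r) / (t0 - t2) * (t0 - t2)" using r t2 by auto
    show "par_ineq C (\<lambda>t x. w t (a + b - x)) t x" if "t2 < t" "t \<le> t0" "a < x" "x < a + b - r" for t x
      using that t2 r by (intro par_ineq_reflect p) auto
    fix t x assume "t2 \<le> t" "t \<le> t0" "x \<le> a + b - r" and x: "a + (b - r) / (t0 - t2) * (t0 - t) \<le> x"
    moreover have "0 \<le> (b - r) / (t0 - t2) * (t0 - t)" using r t2 \<open>t \<le> t0\<close> by simp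
    then have "a \<le> x" using x by linarith
    ultimately show "0 \<le> w t (a + b - x)" using t2 r by (intro nn) linarith+
  qed (use pos' in simp)
  then obtain \<kappa>2 where k2: "0 < \<kappa>2" "\<And>x. x \<in> {a..a + b - r} \<Longrightarrow> \<kappa>2 * (x - a) \<le> w t0 (a + b - x)" by blast
  have 2: "\<kappa>2 * (b - x) \<le> w t0 x" if "x \<in> {r..b}" for x
    using k2(2)[of "a + b - x"] that by (simp add: algebra_simps)
  obtain \<kappa>1 where k1: "0 < \<kappa>1" "\<And>x. x \<in> {a..r} \<Longrightarrow> \<kappa>1 * (x - a) \<le> w t0 x" using 1 by blast
  have "min \<kappa>1 \<kappa>2 * (x - a) \<le> w t0 x" if "x \<in> {a..r}" for x
    using k1(2)[OF that] that mult_right_mono[of "min \<kappa>1 \<kappa>2" \<kappa>1 "x - a"] by auto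
  moreover have "min \<kappa>1 \<kappa>2 * (b - x) \<le> w t0 x" if "x \<in> {r..b}" for x
    using 2[OF that] that mult_right_mono[of "min \<kappa>1 \<kappa>2" \<kappa>2 "b - x"] by auto
  ultimately show ?thesis using k1(1) k2(1) by (intro exI[of _ "min \<kappa>1 \<kappa>2"]) auto
qed

lemma slope_lower_bound:
  fixes v :: "real \<Rightarrow> real"
  assumes "(v has_real_derivative D) (at a within {a..b})" "a < r" "r \<le> b"
    "v a = 0" "\<And>x. x \<in> {a..r} \<Longrightarrow> \<kappa> * (x - a) \<le> v x"
  shows "\<kappa> \<le> D"
proof -
  have "((\<lambda>x. v x - \<kappa> * (x - a)) has_real_derivative D - \<kappa>) (at a within {a..b})"
    by (auto intro!: derivative_eq_intros assms(1))
  note d = this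
  have "\<not> D - \<kappa> < 0"
  proof
    assume "D - \<kappa> < 0"
    then obtain \<delta> where \<delta>: "0 < \<delta>" "\<And>h. 0 < h \<Longrightarrow> a + h \<in> {a..b} \<Longrightarrow> h < \<delta> \<Longrightarrow> v (a + h) - \<kappa> * (a + h - a) < v a - \<kappa> * (a - a)"
      using has_real_derivative_neg_dec_right[OF d] by blast
    define h where "h = min (\<delta> / 2) (r - a)"
    have h: "0 < h" "h < \<delta>" "a + h \<in> {a..r}" using \<delta>(1) assms(2) by (auto simp: h_def min_def)
    then show False using \<delta>(2)[of h] assms(3,4) assms(5)[of "a + h"] by simp
  qed
  then show ?thesis by simp
qed

text \<open>A zero maximising \<open>x + \<mu> * t\<close> is chosen. To the right of the line
  through it the function is positive, so the Hopf lemma with a slanted side gives a positive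
  derivative there, and the function is negative immediately to the left of the zero. Since no
  alternation from plus to minus exists, it is nowhere positive further left, and the strong maximum
  principle makes it strictly negative.\<close>

lemma unique_simple_zero:
  fixes w :: "real \<Rightarrow> real \<Rightarrow> real"
  assumes C: "0 \<le> C" and R: "0 < R"
    and c: "continuous_on ({0..1} \<times> {0..R}) (\<lambda>(t, x). w t x)"
    and p: "\<And>t x. 0 < t \<Longrightarrow> t \<le> 1 \<Longrightarrow> 0 < x \<Longrightarrow> x < R \<Longrightarrow> par_ineq C w t x"
    and left: "\<And>t. t \<in> {0..1} \<Longrightarrow> w t 0 < 0" and right: "\<And>t. t \<in> {0..1} \<Longrightarrow> 0 < w t R"
    and ns: "\<And>t. t \<in> {0..1} \<Longrightarrow> \<not> sign_changes (w t) 0 R 1 (Suc 0)"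
  obtains t0 z \<kappa> where "0 < t0" "t0 \<le> 1" "0 < z" "z < R" "w t0 z = 0" "0 < \<kappa>"
    "\<And>x. 0 \<le> x \<Longrightarrow> x < z \<Longrightarrow> w t0 x < 0" "\<And>x. x \<in> {z..R} \<Longrightarrow> \<kappa> * (x - z) \<le> w t0 x"
proof -
  let ?S = "{0..1::real} \<times> {0..R}"
  have cx: "continuous_on {0..R} (w t)" if "t \<in> {0..1}" for t
    using continuous_on_compose2[OF c, of "{0..R}" "\<lambda>x. (t, x)"] that by (force intro: continuous_intros)
  have ct: "continuous_on {0..1} (\<lambda>t. w t x)" if "x \<in> {0..R}" for x
    using continuous_on_compose2[OF c, of "{0..1}" "\<lambda>t. (t, x)"] that by (force intro: continuous_intros)
  define Z where "Z = {z \<in> ?S. (\<lambda>(t, x). w t x) z = 0}"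
  have "closed Z" unfolding Z_def
    by (rule continuous_closed_preimage_constant[OF c]) (intro closed_Times closed_real_atLeastAtMost)
  moreover have "compact ?S" by (intro compact_Times compact_Icc)
  moreover have "?S \<inter> Z = Z" by (auto simp: Z_def)
  ultimately have cZ: "compact Z" using compact_Int_closed[of ?S Z] by (simp only:)
  have zero: "\<exists>x\<in>{0..R}. w t x = 0" if "t \<in> {0..1}" for t
    using IVT'[of "w t" 0 0 R] left[OF that] right[OF that] cx[OF that] R by force
  \<comment> \<open>Larger than \<open>R\<close>, so that any zero at time 1 beats every zero at
    time 0; the maximiser therefore has \<open>0 < t0\<close>.\<close>
  define \<mu> where "\<mu> = R + 1"
  obtain x0 where "x0 \<in> {0..R}" "w 0 x0 = 0" using zero[of 0] by auto
  then have "(0, x0) \<in> Z" by (simp add: Z_def)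
  then have "Z \<noteq> {}" by blast
  moreover have "continuous_on Z (\<lambda>y. snd y + \<mu> * fst y)" by (intro continuous_intros)
  ultimately obtain q where q: "q \<in> Z" "\<forall>y\<in>Z. snd y + \<mu> * fst y \<le> snd q + \<mu> * fst q"
    using continuous_attains_sup[OF cZ] by blast
  define t0 z where "t0 = fst q" and "z = snd q"
  have tz: "t0 \<in> {0..1}" "z \<in> {0..R}" "w t0 z = 0" using q(1) by (auto simp: Z_def t0_def z_def)
  have max: "x + \<mu> * t \<le> z + \<mu> * t0" if "t \<in> {0..1}" "x \<in> {0..R}" "w t x = 0" for t x
    using q(2) that by (force simp: Z_def t0_def z_def)
  have z0: "0 < z" "z < R" using tz left[of t0] right[of t0] by (cases "z = 0"; cases "z = R"; force)+
  have t00: "0 < t0"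
  proof (rule ccontr)
    assume "\<not> 0 < t0"
    then have "t0 = 0" using tz by simp
    obtain x where "x \<in> {0..R}" "w 1 x = 0" using zero[of 1] by auto
    then have "x + \<mu> * 1 \<le> z" using max[of 1 x] \<open>t0 = 0\<close> by simp
    then show False using \<open>x \<in> {0..R}\<close> z0 by (simp add: \<mu>_def)
  qed
  have \<mu>0: "0 < \<mu>" using R by (simp add: \<mu>_def)
  have rpos: "0 < w t x" if t: "t \<in> {0..1}" and x: "x \<in> {0..R}" "z + \<mu> * (t0 - t) < x" for t x
  proof (rule ccontr)
    assume "\<not> 0 < w t x"
    then obtain y where "x \<le> y" "y \<le> R" "w t y = 0"
      using IVT'[of "w t" x 0 R] right[OF t] x continuous_on_subset[OF cx[OF t], of "{x..R}"] by force
    then show False using max[OF t, of y] x by (simp add: algebra_simps)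
  qed
  have nonneg: "0 \<le> w t x" if t: "t \<in> {0..1}" and x: "x \<in> {0..R}" "z + \<mu> * (t0 - t) \<le> x" for t x
  proof (cases "z + \<mu> * (t0 - t) < x")
    case True
    then show ?thesis using rpos[OF t x(1)] by simp
  next
    case False
    show ?thesis
    proof (rule ccontr)
      assume n: "\<not> 0 \<le> w t x"
      then have "x \<noteq> R" using right[OF t] by auto
      obtain y where y: "x \<le> y" "y \<le> R" "w t y = 0"
        using IVT'[of "w t" x 0 R] right[OF t] x n continuous_on_subset[OF cx[OF t], of "{x..R}"] by force
      then have "x < y" using n by (cases "x = y") auto
      then show False using rpos[OF t, of y] x y by auto
    qed
  qed
  \<comment> \<open>The slanted side has to meet \<open>x = R\<close> at time \<open>t1\<close>. If
    \<open>t1\<close> is cut off at 0, the slope is raised from \<open>\<mu>\<close> to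
    \<open>\<mu>'\<close>, which only shrinks the region.\<close>
  define t1 where "t1 = max 0 (t0 - (R - z) / \<mu>)"
  have t1: "0 \<le> t1" "t1 < t0" using t00 z0 \<mu>0 by (auto simp: t1_def)
  have "t0 - t1 \<le> (R - z) / \<mu>" by (simp add: t1_def)
  then have tR: "\<mu> * (t0 - t1) \<le> R - z" using \<mu>0 by (simp add: pos_le_divide_eq mult.commute)
  define \<mu>' where "\<mu>' = (R - z) / (t0 - t1)"
  have \<mu>': "\<mu> \<le> \<mu>'" "\<mu>' * (t0 - t1) = R - z" using tR t1 by (auto simp: \<mu>'_def pos_le_divide_eq)
  have "\<exists>\<kappa>>0. \<forall>x\<in>{z..R}. \<kappa> * (x - z) \<le> w t0 x"
  proof (rule hopf_lemma[OF C t1(2) z0(2), where \<mu> = \<mu>'])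
    show "continuous_on ({t1..t0} \<times> {z..R}) (\<lambda>(t, x). w t x)"
      by (rule continuous_on_subset[OF c]) (use t1 z0 tz in auto)
    fix t x assume t: "t1 \<le> t" "t \<le> t0" and x: "x \<le> R" "z + \<mu>' * (t0 - t) \<le> x"
    have "\<mu> * (t0 - t) \<le> \<mu>' * (t0 - t)" "0 \<le> \<mu> * (t0 - t)" using \<mu>' \<mu>0 t by (auto intro: mult_right_mono)
    then show "0 \<le> w t x" using t x t1 tz z0 by (intro nonneg) auto
  qed (use \<mu>' \<mu>0 right p t1 tz z0 in auto)
  then obtain \<kappa> where \<kappa>: "0 < \<kappa>" "\<And>x. x \<in> {z..R} \<Longrightarrow> \<kappa> * (x - z) \<le> w t0 x" by blast
  have neg: "w t0 x < 0" if x: "0 \<le> x" "x < z" for x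
  proof -
    \<comment> \<open>A negative value at \<open>a\<close> and no alternation from plus to minus
      leave only nonpositive values to the left of \<open>a\<close>.\<close>
    have np: "w t y \<le> 0" if "t \<in> {0..1}" "0 \<le> y" "y \<le> a" "w t a < 0" "a \<le> R" for t y a
    proof (rule ccontr)
      assume n: "\<not> w t y \<le> 0"
      then have "y < a" using that by (cases "y = a") auto
      then have "sign_changes (w t) 0 R 1 (Suc 0)"
        unfolding sign_changes_1_iff using that n by (intro bexI[of _ y] bexI[of _ a]) auto
      with ns[OF that(1)] show False by simp
    qed
    obtain wx where wx: "(w t0 has_real_derivative wx) (at z)"
      using p[OF t00 _ z0] tz unfolding par_ineq_def by auto
    have "(w t0 has_real_derivative wx) (at z within {z..R})" using wx by (rule has_field_derivative_at_within)
    then have "\<kappa> \<le> wx" by (rule slope_lower_bound[where r = R]) (use z0 tz \<kappa> in auto)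
    then obtain d where d: "0 < d" "\<And>h. 0 < h \<Longrightarrow> h < d \<Longrightarrow> w t0 (z - h) < w t0 z"
      using DERIV_pos_inc_left[OF wx] \<kappa>(1) by auto
    \<comment> \<open>\<open>z - h / 2\<close> is the right end of the region, where the sign
      persists for a short time into the past; \<open>z - h\<close> is the inner point at which the
      value at time \<open>t0\<close> is strictly negative.\<close>
    define h where "h = min (d / 2) ((z - x) / 2)"
    have h: "0 < h" "h < d" "x < z - h" using d(1) x by (auto simp: h_def min_def field_simps)
    have r: "w t0 (z - h) < 0" and a: "w t0 (z - h / 2) < 0" using d(2)[of h] d(2)[of "h / 2"] h tz by auto
    have aR: "z - h / 2 \<in> {0..R}" using h x z0 by auto
    obtain e where e: "0 < e" "\<And>t. t \<in> {0..1} \<Longrightarrow> dist t t0 < e \<Longrightarrow> dist (w t (z - h / 2)) (w t0 (z - h / 2)) < - w t0 (z - h / 2)"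
      using ct[OF aR] tz(1) a unfolding continuous_on_iff by (metis neg_0_less_iff_less)
    define t2 where "t2 = max 0 (t0 - e / 2)"
    have t2: "0 \<le> t2" "t2 < t0" "t0 - t2 < e" using e(1) t00 by (auto simp: t2_def)
    have neg: "w t (z - h / 2) < 0" if "t2 \<le> t" "t \<le> t0" for t
      using e(2)[of t] that t2 tz by (force simp: dist_real_def)
    have "\<exists>\<kappa>>0. (\<forall>y\<in>{0..z - h}. \<kappa> * (y - 0) \<le> -1 * w t0 y) \<and> (\<forall>y\<in>{z - h..z - h / 2}. \<kappa> * (z - h / 2 - y) \<le> -1 * w t0 y)"
    proof (rule strong_maximum_principle[OF C t2(2)])
      show "0 < z - h" "z - h < z - h / 2" using h x by auto
      show "0 < -1 * w t0 (z - h)" using r by simp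
      show "continuous_on ({t2..t0} \<times> {0..z - h / 2}) (\<lambda>(t, x). -1 * w t x)"
        unfolding split_def
        by (intro continuous_on_mult_left continuous_on_subset[OF c[unfolded split_def]]) (use t2 tz aR in auto)
      show "0 \<le> -1 * w t y" if "t2 \<le> t" "t \<le> t0" "0 \<le> y" "y \<le> z - h / 2" for t y
        using np[of t y "z - h / 2"] neg[of t] that t2 tz aR by auto
      show "par_ineq C (\<lambda>t x. -1 * w t x) t y" if "t2 < t" "t \<le> t0" "0 < y" "y < z - h / 2" for t y
        using that t2 tz aR by (intro par_ineq_cmult p) auto
    qed
    then obtain \<kappa>' where \<kappa>': "0 < \<kappa>'" "\<And>y. y \<in> {0..z - h} \<Longrightarrow> \<kappa>' * y \<le> - w t0 y" by auto
    show ?thesis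
    proof (cases "x = 0")
      case True
      then show ?thesis using left[OF tz(1)] by simp
    next
      case False
      then have "0 < \<kappa>' * x" using x \<kappa>'(1) by simp
      then show ?thesis using \<kappa>'(2)[of x] x h by auto
    qed
  qed
  show thesis using that[of t0 z \<kappa>] t00 tz z0 \<kappa> neg by auto
qed

section \<open>Minimal semiflows of a Dirichlet problem\<close>

text \<open>The tube lemma for a strict inequality, on a parameter set that need not be
  open.\<close>

lemma tube_pos:
  fixes f :: "'a::topological_space \<Rightarrow> 'b::topological_space \<Rightarrow> real"
  assumes c: "continuous_on (S \<times> X) (\<lambda>(s, x). f s x)" and X: "compact X" and s: "s \<in> S"
    and pos: "\<And>x. x \<in> X \<Longrightarrow> 0 < f s x"
  shows "\<exists>T. open T \<and> s \<in> T \<and> (\<forall>s'\<in>T \<inter> S. \<forall>x\<in>X. 0 < f s' x)"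
proof -
  have "\<exists>A B. open A \<and> open B \<and> s \<in> A \<and> x \<in> B \<and> (\<forall>s'\<in>A \<inter> S. \<forall>x'\<in>B \<inter> X. 0 < f s' x')" if x: "x \<in> X" for x
  proof -
    obtain A where A: "open A" "(s, x) \<in> A" "\<And>z. z \<in> S \<times> X \<Longrightarrow> z \<in> A \<Longrightarrow> (\<lambda>(s, x). f s x) z \<in> {0<..}"
      using c s x pos[OF x] unfolding continuous_on_topological
      by (metis (no_types, lifting) SigmaI case_prod_conv greaterThan_iff open_greaterThan)
    obtain B B' where "open B" "open B'" "(s, x) \<in> B \<times> B'" "B \<times> B' \<subseteq> A"
      using open_prod_elim[OF A(1,2)] by metis
    then show ?thesis using A(3) by (intro exI[of _ B] exI[of _ B']) auto
  qed
  then obtain A B where AB: "\<And>x. x \<in> X \<Longrightarrow> open (A x) \<and> open (B x) \<and> s \<in> A x \<and> x \<in> B x \<and> (\<forall>s'\<in>A x \<inter> S. \<forall>x'\<in>B x \<inter> X. 0 < f s' x')"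
    by metis
  obtain F where F: "F \<subseteq> X" "finite F" "X \<subseteq> (\<Union>x\<in>F. B x)"
    using compactE_image[OF X, of X B] AB by blast
  show ?thesis
    using F AB by (intro exI[of _ "\<Inter>x\<in>F. A x"]) (blast intro: open_INT)
qed

text \<open>A finite subcover and the least of its radii, which \<open>mono\<close> allows to use
  everywhere.\<close>

lemma compact_uniform_radius:
  assumes S: "compact S"
    and loc: "\<And>z. z \<in> S \<Longrightarrow> \<exists>T \<delta>. open T \<and> z \<in> T \<and> 0 < \<delta> \<and> (\<forall>z'\<in>S \<inter> T. P \<delta> z')"
    and mono: "\<And>\<delta> \<delta>' z. P \<delta> z \<Longrightarrow> 0 < \<delta>' \<Longrightarrow> \<delta>' \<le> \<delta> \<Longrightarrow> P \<delta>' z"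
  shows "\<exists>\<delta>>0::real. \<forall>z\<in>S. P \<delta> z"
proof -
  obtain T \<delta> where T: "\<And>z. z \<in> S \<Longrightarrow> open (T z) \<and> z \<in> T z \<and> 0 < \<delta> z \<and> (\<forall>z'\<in>S \<inter> T z. P (\<delta> z) z')"
    using loc by metis
  obtain F where F: "F \<subseteq> S" "finite F" "S \<subseteq> (\<Union>z\<in>F. T z)"
    using compactE_image[OF S, of S T] T by blast
  define d where "d = Min (insert 1 (\<delta> ` F))"
  have d: "0 < d" "\<And>z. z \<in> F \<Longrightarrow> d \<le> \<delta> z" using F T by (auto simp: d_def subset_eq)
  have "P d z" if z: "z \<in> S" for z
  proof -
    obtain y where "y \<in> F" "z \<in> T y" using F z by blast
    then show ?thesis using mono[of "\<delta> y" z d] T[of y] F d z by blast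
  qed
  then show ?thesis using d(1) by blast
qed

text \<open>\<open>\<pi> m\<close> is the coordinate in the hull and \<open>G (\<pi> m)\<close> the
  nonlinearity at time 0: all time dependence of the equation is carried by
  \<open>\<pi> (\<Phi> t m)\<close>. Elements of one fibre see the same nonlinearity at all times,
  which makes their difference obey a parabolic inequality. \<open>C\<close> is a Lipschitz constant
  on the range \<open>\<beta>\<close> of profiles and slopes, uniform over \<open>M\<close>.\<close>

locale minimal_dirichlet_flow =
  fixes M :: "'m::topological_space set" and \<Phi> :: "real \<Rightarrow> 'm \<Rightarrow> 'm" and \<pi> :: "'m \<Rightarrow> 'g"
    and U Ux :: "'m \<Rightarrow> real \<Rightarrow> real" and G :: "'g \<Rightarrow> real \<Rightarrow> real \<Rightarrow> real" and L C \<beta> :: real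
  assumes L: "0 < L" and C: "0 \<le> C"
    and compact_M: "compact M" and M_ne: "M \<noteq> {}"
    and \<Phi>_in: "\<And>m t. m \<in> M \<Longrightarrow> 0 \<le> t \<Longrightarrow> \<Phi> t m \<in> M"
    and \<Phi>_0: "\<And>m. m \<in> M \<Longrightarrow> \<Phi> 0 m = m"
    and \<Phi>_add: "\<And>m s t. m \<in> M \<Longrightarrow> 0 \<le> s \<Longrightarrow> 0 \<le> t \<Longrightarrow> \<Phi> (s + t) m = \<Phi> s (\<Phi> t m)"
    and \<Phi>_cont: "continuous_on ({0..} \<times> M) (\<lambda>(t, m). \<Phi> t m)"
    and minimal: "\<And>N. N \<subseteq> M \<Longrightarrow> N \<noteq> {} \<Longrightarrow> compact N \<Longrightarrow> (\<And>m t. m \<in> N \<Longrightarrow> 0 \<le> t \<Longrightarrow> \<Phi> t m \<in> N) \<Longrightarrow> N = M"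
    and fibre: "\<And>m m' t. m \<in> M \<Longrightarrow> m' \<in> M \<Longrightarrow> 0 \<le> t \<Longrightarrow> \<pi> (\<Phi> t m) = \<pi> (\<Phi> t m') \<longleftrightarrow> \<pi> m = \<pi> m'"
    and fibre_compact: "compact {(m, m'). m \<in> M \<and> m' \<in> M \<and> \<pi> m = \<pi> m'}"
    and U_cont: "continuous_on (M \<times> {0..L}) (\<lambda>(m, x). U m x)"
    and Ux_cont: "continuous_on (M \<times> {0..L}) (\<lambda>(m, x). Ux m x)"
    and U_deriv: "\<And>m x. m \<in> M \<Longrightarrow> x \<in> {0..L} \<Longrightarrow> (U m has_real_derivative Ux m x) (at x within {0..L})"
    and U_0: "\<And>m. m \<in> M \<Longrightarrow> U m 0 = 0" and U_L: "\<And>m. m \<in> M \<Longrightarrow> U m L = 0"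
    and U_bound: "\<And>m x. m \<in> M \<Longrightarrow> x \<in> {0..L} \<Longrightarrow> \<bar>U m x\<bar> \<le> \<beta> \<and> \<bar>Ux m x\<bar> \<le> \<beta>"
    and lipschitz: "\<And>m u v p q. m \<in> M \<Longrightarrow> \<bar>u\<bar> \<le> \<beta> \<Longrightarrow> \<bar>v\<bar> \<le> \<beta> \<Longrightarrow> \<bar>p\<bar> \<le> \<beta> \<Longrightarrow> \<bar>q\<bar> \<le> \<beta> \<Longrightarrow>
        \<bar>G (\<pi> m) u p - G (\<pi> m) v q\<bar> \<le> C * (\<bar>u - v\<bar> + \<bar>p - q\<bar>)"
    and G_0: "\<And>m p. m \<in> M \<Longrightarrow> G (\<pi> m) 0 p = 0"
    and pde: "\<And>m t x. m \<in> M \<Longrightarrow> 0 < t \<Longrightarrow> 0 < x \<Longrightarrow> x < L \<Longrightarrow> \<exists>ut uxx.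
        ((\<lambda>s. U (\<Phi> s m) x) has_real_derivative ut) (at t) \<and> has_sym_deriv2 (U (\<Phi> t m)) x uxx \<and>
        ut = uxx + G (\<pi> (\<Phi> t m)) (U (\<Phi> t m) x) (Ux (\<Phi> t m) x)"
begin

lemma \<Phi>_cont_time:
  assumes "m \<in> M" shows "continuous_on {0..} (\<lambda>t. \<Phi> t m)"
proof -
  have "continuous_on {0..} (\<lambda>t. (\<lambda>(t, m). \<Phi> t m) (t, m))"
    by (intro continuous_on_compose2[OF \<Phi>_cont] continuous_on_Pair continuous_on_id continuous_on_const) (use assms in auto)
  then show ?thesis by simp
qed

lemma \<Phi>_cont_space:
  assumes "0 \<le> t" shows "continuous_on M (\<Phi> t)"
proof -
  have "continuous_on M (\<lambda>m. (\<lambda>(t, m). \<Phi> t m) (t, m))"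
    by (intro continuous_on_compose2[OF \<Phi>_cont] continuous_on_Pair continuous_on_id continuous_on_const) (use assms in auto)
  then show ?thesis by simp
qed

text \<open>The image is compact and positively invariant, so minimality applies. Every element thus
  has pasts of every length, which the maximum principles require; their uniqueness comes much
  later.\<close>

lemma \<Phi>_surj:
  assumes "0 \<le> t" shows "\<Phi> t ` M = M"
proof (rule minimal)
  show "\<Phi> t ` M \<subseteq> M" using \<Phi>_in assms by auto
  show "\<Phi> t ` M \<noteq> {}" using M_ne by simp
  show "compact (\<Phi> t ` M)" by (intro compact_continuous_image \<Phi>_cont_space assms compact_M)
  fix m and s :: real assume m: "m \<in> \<Phi> t ` M" and s: "0 \<le> s"
  then obtain k where k: "k \<in> M" "m = \<Phi> t k" by blast
  have "\<Phi> s m = \<Phi> t (\<Phi> s k)"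
    using \<Phi>_add[OF k(1) s assms] \<Phi>_add[OF k(1) assms s] k(2) by (simp add: add.commute)
  then show "\<Phi> s m \<in> \<Phi> t ` M" using \<Phi>_in[OF k(1) s] by blast
qed

lemma \<Phi>_preimage:
  assumes "m \<in> M" "0 \<le> t" obtains k where "k \<in> M" "\<Phi> t k = m"
proof -
  have "m \<in> \<Phi> t ` M" using assms(1) by (simp only: \<Phi>_surj[OF assms(2)])
  then show thesis using that by (elim imageE) simp
qed

lemma U_deriv_at:
  assumes "m \<in> M" "0 < x" "x < L" shows "(U m has_real_derivative Ux m x) (at x)"
proof -
  have "at x within {0..L} = at x" using assms by (intro at_within_interior) simp
  then show ?thesis using U_deriv[of m x] assms by simp
qed

lemma traj_cont:
  assumes "m \<in> M" shows "continuous_on ({0..} \<times> {0..L}) (\<lambda>(t, x). U (\<Phi> t m) x)"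
proof -
  have c: "continuous_on ({0..} \<times> {0..L}) (\<lambda>z. \<Phi> (fst z) m)"
    by (rule continuous_on_compose2[OF \<Phi>_cont_time[OF assms] continuous_on_fst[OF continuous_on_id]]) auto
  have "(\<lambda>z. (\<Phi> (fst z) m, snd z)) ` ({0..} \<times> {0..L}) \<subseteq> M \<times> {0..L}"
    using \<Phi>_in[OF assms] by auto
  then have "continuous_on ({0..} \<times> {0..L}) (\<lambda>z. (\<lambda>(m, x). U m x) (\<Phi> (fst z) m, snd z))"
    by (rule continuous_on_compose2[OF U_cont continuous_on_Pair[OF c continuous_on_snd[OF continuous_on_id]]])
  then show ?thesis by (simp only: split_def fst_conv snd_conv)
qed

text \<open>The nonlinearity does not depend on \<open>x\<close>, so a translate of a solution is a
  solution; in one fibre both solve the same equation.\<close>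

lemma par_ineq_shift_diff:
  assumes m: "m1 \<in> M" "m2 \<in> M" "\<pi> m1 = \<pi> m2" and t: "0 < t" and x: "0 < x" "x < L" "0 < x + b" "x + b < L"
  shows "par_ineq C (\<lambda>t x. U (\<Phi> t m1) x - U (\<Phi> t m2) (x + b)) t x"
proof -
  obtain a1 b1 where 1: "((\<lambda>s. U (\<Phi> s m1) x) has_real_derivative a1) (at t)" "has_sym_deriv2 (U (\<Phi> t m1)) x b1"
     "a1 = b1 + G (\<pi> (\<Phi> t m1)) (U (\<Phi> t m1) x) (Ux (\<Phi> t m1) x)" using pde[OF m(1) t x(1,2)] by blast
  obtain a2 b2 where 2: "((\<lambda>s. U (\<Phi> s m2) (x + b)) has_real_derivative a2) (at t)" "has_sym_deriv2 (U (\<Phi> t m2)) (x + b) b2"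
     "a2 = b2 + G (\<pi> (\<Phi> t m2)) (U (\<Phi> t m2) (x + b)) (Ux (\<Phi> t m2) (x + b))" using pde[OF m(2) t x(3,4)] by blast
  have in': "\<Phi> t m1 \<in> M" "\<Phi> t m2 \<in> M" using \<Phi>_in m t by auto
  have \<pi>: "\<pi> (\<Phi> t m1) = \<pi> (\<Phi> t m2)" using fibre[OF m(1,2), of t] m(3) t by simp
  have d1: "(U (\<Phi> t m1) has_real_derivative Ux (\<Phi> t m1) x) (at x)" using U_deriv_at in' x by auto
  have d2: "((\<lambda>y. U (\<Phi> t m2) (y + b)) has_real_derivative Ux (\<Phi> t m2) (x + b)) (at x)"
    using U_deriv_at[OF in'(2) x(3,4)] by (simp add: DERIV_shift)
  have "\<bar>(a1 - a2) - (b1 - b2)\<bar> \<le> C * (\<bar>U (\<Phi> t m1) x - U (\<Phi> t m2) (x + b)\<bar> + \<bar>Ux (\<Phi> t m1) x - Ux (\<Phi> t m2) (x + b)\<bar>)"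
    using lipschitz[OF in'(2), of "U (\<Phi> t m1) x" "U (\<Phi> t m2) (x + b)" "Ux (\<Phi> t m1) x" "Ux (\<Phi> t m2) (x + b)"]
      U_bound[OF in'(1), of x] U_bound[OF in'(2), of "x + b"] x by (simp add: 1(3) 2(3) \<pi>)
  then show ?thesis unfolding par_ineq_def
    using DERIV_diff[OF 1(1) 2(1)] DERIV_diff[OF d1 d2] has_sym_deriv2_diff[OF 1(2) has_sym_deriv2_shift[OF 2(2)]]
    by (intro exI conjI)
qed

text \<open>\<open>G\<close> vanishes at \<open>u = 0\<close> for every slope, so it is bounded by
  \<open>C\<close> times the modulus of \<open>u\<close>.\<close>

lemma par_ineq_single:
  assumes m: "m \<in> M" and t: "0 < t" and x: "0 < x" "x < L"
  shows "par_ineq C (\<lambda>t. U (\<Phi> t m)) t x"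
proof -
  obtain a b where 1: "((\<lambda>s. U (\<Phi> s m) x) has_real_derivative a) (at t)" "has_sym_deriv2 (U (\<Phi> t m)) x b"
     "a = b + G (\<pi> (\<Phi> t m)) (U (\<Phi> t m) x) (Ux (\<Phi> t m) x)" using pde[OF m(1) t x(1,2)] by blast
  have in': "\<Phi> t m \<in> M" using \<Phi>_in m t by auto
  have d1: "(U (\<Phi> t m) has_real_derivative Ux (\<Phi> t m) x) (at x)" using U_deriv_at in' x by auto
  have "0 \<le> \<beta>" using U_bound[OF in', of x] x by auto
  then have "\<bar>a - b\<bar> \<le> C * (\<bar>U (\<Phi> t m) x\<bar> + \<bar>Ux (\<Phi> t m) x - Ux (\<Phi> t m) x\<bar>)"
    using lipschitz[OF in', of "U (\<Phi> t m) x" 0 "Ux (\<Phi> t m) x" "Ux (\<Phi> t m) x"] G_0[OF in']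
      U_bound[OF in', of x] x by (simp add: 1(3))
  also have "\<dots> \<le> C * (\<bar>U (\<Phi> t m) x\<bar> + \<bar>Ux (\<Phi> t m) x\<bar>)" using C by (intro mult_left_mono) auto
  finally show ?thesis unfolding par_ineq_def using 1 d1 by blast
qed

text \<open>The common zero \<open>\<rho>\<close> acts as a Dirichlet boundary for the shorter
  interval.\<close>

lemma order_preserved:
  assumes m: "m1 \<in> M" "m2 \<in> M" "\<pi> m1 = \<pi> m2" and s: "\<bar>s\<bar> = 1" and \<rho>: "0 < \<rho>" "\<rho> \<le> L"
    and z: "\<And>m. m \<in> M \<Longrightarrow> U m \<rho> = 0"
    and le: "\<And>x. x \<in> {0..\<rho>} \<Longrightarrow> s * U m1 x \<le> s * U m2 x"
    and t: "0 \<le> t" and x: "x \<in> {0..\<rho>}"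
  shows "s * U (\<Phi> t m1) x \<le> s * U (\<Phi> t m2) x"
proof -
  let ?d = "\<lambda>t x. s * (U (\<Phi> t m2) x - U (\<Phi> t m1) x)"
  have "0 \<le> ?d t x"
  proof (rule comparison_principle[where d = ?d and S = "{0..t} \<times> {0..\<rho>}" and C = C])
    show "compact ({0..t} \<times> {0..\<rho>})" by (intro compact_Times compact_Icc)
    show "continuous_on ({0..t} \<times> {0..\<rho>}) (\<lambda>(t, x). ?d t x)"
    proof -
      have "{0..t} \<times> {0..\<rho>} \<subseteq> {0..} \<times> {0..L}" using \<rho> by auto
      note c = continuous_on_subset[OF traj_cont this, unfolded split_def]
      show ?thesis unfolding split_def by (intro continuous_on_mult_left continuous_on_diff c m)
    qed
    show "(t, x) \<in> {0..t} \<times> {0..\<rho>}" using t x by auto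
    fix \<tau> y assume S: "(\<tau>, y) \<in> {0..t} \<times> {0..\<rho>}" and n: "?d \<tau> y < 0"
    have \<tau>: "0 \<le> \<tau>" "y \<in> {0..\<rho>}" using S by auto
    have "\<tau> \<noteq> 0"
    proof
      assume "\<tau> = 0"
      then show False using n le[OF \<tau>(2)] by (simp add: \<Phi>_0[OF m(1)] \<Phi>_0[OF m(2)] right_diff_distrib)
    qed
    moreover have "y \<noteq> 0" using n U_0[OF \<Phi>_in[OF m(1) \<tau>(1)]] U_0[OF \<Phi>_in[OF m(2) \<tau>(1)]] by (metis diff_self mult_zero_right order_less_irrefl)
    moreover have "y \<noteq> \<rho>" using n z[OF \<Phi>_in[OF m(1) \<tau>(1)]] z[OF \<Phi>_in[OF m(2) \<tau>(1)]] by (metis diff_self mult_zero_right order_less_irrefl)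
    ultimately have y: "0 < \<tau>" "\<tau> \<le> t" "0 < y" "y < \<rho>" using S by auto
    have "par_ineq C (\<lambda>t x. s * (U (\<Phi> t m2) x - U (\<Phi> t m1) (x + 0))) \<tau> y"
      by (rule par_ineq_cmult, rule par_ineq_shift_diff) (use m y \<rho> in auto)
    then have "par_super C ?d \<tau> y" by (simp add: par_ineq_imp_super)
    moreover define \<delta> where "\<delta> = Min {\<tau>, y, \<rho> - y}"
    then have \<delta>: "0 < \<delta>" "\<delta> \<le> \<tau>" "\<delta> \<le> y" "\<delta> \<le> \<rho> - y" using y by auto
    have "(a, y) \<in> {0..t} \<times> {0..\<rho>}" if "\<tau> - \<delta> < a" "a < \<tau>" for a using that \<delta> y by auto
    moreover have "(\<tau>, z) \<in> {0..t} \<times> {0..\<rho>}" if "\<bar>z - y\<bar> < \<delta>" for z using that \<delta> y by auto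
    ultimately show "par_super C ?d \<tau> y \<and> (\<exists>\<delta>>0. (\<forall>s. \<tau> - \<delta> < s \<and> s < \<tau> \<longrightarrow> (s, y) \<in> {0..t} \<times> {0..\<rho>}) \<and>
        (\<forall>ya. \<bar>ya - y\<bar> < \<delta> \<longrightarrow> (\<tau>, ya) \<in> {0..t} \<times> {0..\<rho>}))"
      using \<delta>(1) by blast
  qed
  then show ?thesis by (simp add: right_diff_distrib)
qed

end

section \<open>Ordering on an interval where the solutions have a sign\<close>

locale signed_dirichlet_flow = minimal_dirichlet_flow +
  fixes s \<rho> :: real
  assumes s: "\<bar>s\<bar> = 1" and \<rho>: "0 < \<rho>" "\<rho> \<le> L"
    and U_\<rho>: "\<And>m. m \<in> M \<Longrightarrow> U m \<rho> = 0"
    and U_pos: "\<And>m x. m \<in> M \<Longrightarrow> 0 < x \<Longrightarrow> x < \<rho> \<Longrightarrow> 0 < s * U m x"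
begin

lemma U_nonneg: "m \<in> M \<Longrightarrow> x \<in> {0..\<rho>} \<Longrightarrow> 0 \<le> s * U m x"
  using U_pos[of m x] U_0[of m] U_\<rho>[of m] by (cases "x = 0"; cases "x = \<rho>") auto

lemma U_deriv_\<rho>: "m \<in> M \<Longrightarrow> x \<in> {0..\<rho>} \<Longrightarrow> (U m has_real_derivative Ux m x) (at x within {0..\<rho>})"
  using \<rho> by (intro has_field_derivative_subset[OF U_deriv]) auto

text \<open>The strong maximum principle on a past of \<open>m\<close> of length 1; its linear
  bounds at both ends pass to the slopes.\<close>

lemma boundary_slopes:
  assumes m: "m \<in> M"
  shows "0 < s * Ux m 0" "s * Ux m \<rho> < 0"
proof -
  obtain k where k: "k \<in> M" "\<Phi> 1 k = m" using \<Phi>_preimage[OF m, of 1] by auto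
  let ?w = "\<lambda>t x. s * U (\<Phi> t k) x"
  have "\<exists>\<kappa>>0. (\<forall>x\<in>{0..\<rho> / 2}. \<kappa> * (x - 0) \<le> ?w 1 x) \<and> (\<forall>x\<in>{\<rho> / 2..\<rho>}. \<kappa> * (\<rho> - x) \<le> ?w 1 x)"
  proof (rule strong_maximum_principle[OF C, where w = ?w])
    show "(0::real) < 1" "0 < \<rho> / 2" "\<rho> / 2 < \<rho>" using \<rho> by auto
    have sub: "{0..1} \<times> {0..\<rho>} \<subseteq> {0..} \<times> {0..L}" using \<rho> by auto
    show "continuous_on ({0..1} \<times> {0..\<rho>}) (\<lambda>(t, x). ?w t x)"
      unfolding split_def
      by (rule continuous_on_mult_left) (rule continuous_on_subset[OF traj_cont[OF k(1), unfolded split_def] sub])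
    show "0 \<le> ?w t x" if "0 \<le> t" "t \<le> 1" "0 \<le> x" "x \<le> \<rho>" for t x
      using U_nonneg[OF \<Phi>_in[OF k(1) that(1)], of x] that by simp
    show "0 < ?w 1 (\<rho> / 2)" using U_pos[OF m, of "\<rho> / 2"] \<rho> k by simp
    show "par_ineq C ?w t x" if "0 < t" "t \<le> 1" "0 < x" "x < \<rho>" for t x
      by (rule par_ineq_cmult, rule par_ineq_single) (use that k \<rho> in auto)
  qed
  then obtain \<kappa> where \<kappa>: "0 < \<kappa>" "\<And>x. x \<in> {0..\<rho> / 2} \<Longrightarrow> \<kappa> * x \<le> s * U m x"
    "\<And>x. x \<in> {\<rho> / 2..\<rho>} \<Longrightarrow> \<kappa> * (\<rho> - x) \<le> s * U m x" using k by auto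
  have d: "((\<lambda>x. s * U m x) has_real_derivative s * Ux m x) (at x within {0..\<rho>})" if "x \<in> {0..\<rho>}" for x
    by (intro DERIV_cmult U_deriv_\<rho> m that)
  have "\<kappa> \<le> s * Ux m 0"
    by (rule slope_lower_bound[OF d, where r = "\<rho> / 2"]) (use \<rho> \<kappa> m in \<open>auto simp: U_0\<close>)
  then show "0 < s * Ux m 0" using \<kappa>(1) by simp
  \<comment> \<open>The slope at \<open>\<rho>\<close> is read off at a left end after replacing
    \<open>x\<close> by \<open>\<rho> - x\<close>.\<close>
  have "((\<lambda>x. s * U m x) has_real_derivative s * Ux m \<rho>) (at (\<rho> - 0) within (-) \<rho> ` {0..\<rho>})"
    using d[of \<rho>] \<rho> by simp
  then have "((\<lambda>x. s * U m x) \<circ> (-) \<rho> has_real_derivative s * Ux m \<rho> * (- 1)) (at 0 within {0..\<rho>})"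
    by (rule DERIV_image_chain) (auto intro!: derivative_eq_intros)
  then have "((\<lambda>x. s * U m (\<rho> - x)) has_real_derivative s * Ux m \<rho> * (- 1)) (at 0 within {0..\<rho>})"
    by (simp add: o_def)
  then have "\<kappa> \<le> s * Ux m \<rho> * (- 1)"
  proof (rule slope_lower_bound[where r = "\<rho> / 2"])
    show "\<kappa> * (x - 0) \<le> s * U m (\<rho> - x)" if "x \<in> {0..\<rho> / 2}" for x
      using \<kappa>(3)[of "\<rho> - x"] that by simp
  qed (use \<rho> U_\<rho> m in auto)
  then show "s * Ux m \<rho> < 0" using \<kappa>(1) by simp
qed

text \<open>Compactness of \<open>M\<close> and joint continuity of \<open>Ux\<close> extend the
  signs of the boundary slopes to strips of a common width.\<close>

lemma uniform_slopes:
  obtains \<delta> where "0 < \<delta>" "\<delta> < \<rho>" "\<And>m x. m \<in> M \<Longrightarrow> x \<in> {0..\<delta>} \<Longrightarrow> 0 < s * Ux m x"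
    "\<And>m x. m \<in> M \<Longrightarrow> x \<in> {\<rho> - \<delta>..\<rho>} \<Longrightarrow> s * Ux m x < 0"
proof -
  have cc: "continuous_on (X \<times> M) (\<lambda>(x, m). c * Ux m x)" if "X \<subseteq> {0..L}" for X c
  proof -
    have "continuous_on (X \<times> M) (\<lambda>z. (\<lambda>(m, x). Ux m x) (snd z, fst z))"
      by (rule continuous_on_compose2[OF Ux_cont continuous_on_Pair[OF continuous_on_snd[OF continuous_on_id] continuous_on_fst[OF continuous_on_id]]])
        (use that in auto)
    then show ?thesis unfolding split_def by (intro continuous_on_mult_left) simp
  qed
  obtain T1 where T1: "open T1" "0 \<in> T1" "\<And>x m. x \<in> T1 \<inter> {0..L} \<Longrightarrow> m \<in> M \<Longrightarrow> 0 < s * Ux m x"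
    using tube_pos[OF cc[of "{0..L}" s] compact_M, of 0] boundary_slopes(1) L by auto
  obtain T2 where T2: "open T2" "\<rho> \<in> T2" "\<And>x m. x \<in> T2 \<inter> {0..L} \<Longrightarrow> m \<in> M \<Longrightarrow> 0 < (- s) * Ux m x"
    using tube_pos[OF cc[of "{0..L}" "- s"] compact_M, of \<rho>] boundary_slopes(2) \<rho> by auto
  obtain e1 where e1: "0 < e1" "ball 0 e1 \<subseteq> T1" using T1 openE by metis
  obtain e2 where e2: "0 < e2" "ball \<rho> e2 \<subseteq> T2" using T2 openE by metis
  define \<delta> where "\<delta> = Min {e1 / 2, e2 / 2, \<rho> / 2}"
  have \<delta>: "0 < \<delta>" "\<delta> < e1" "\<delta> < e2" "\<delta> < \<rho>" using e1 e2 \<rho> by (auto simp: \<delta>_def min_def)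
  show thesis
  proof (rule that[of \<delta>])
    fix m x assume m: "m \<in> M"
    show "0 < s * Ux m x" if "x \<in> {0..\<delta>}"
    proof (rule T1(3)[OF _ m])
      have "x \<in> ball 0 e1" using that \<delta> by (auto simp: dist_real_def)
      then show "x \<in> T1 \<inter> {0..L}" using that \<delta> \<rho> e1 by auto
    qed
    show "s * Ux m x < 0" if "x \<in> {\<rho> - \<delta>..\<rho>}"
    proof -
      have "x \<in> ball \<rho> e2" using that \<delta> by (auto simp: dist_real_def)
      then have "0 < (- s) * Ux m x" using that \<delta> \<rho> e2 by (intro T2(3)[OF _ m]) auto
      then show ?thesis by simp
    qed
  qed (use \<delta> in auto)
qed

definition pairs :: "('a \<times> 'a) set" where
  "pairs = {(m, m'). m \<in> M \<and> m' \<in> M \<and> \<pi> m = \<pi> m'}"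

section \<open>Sliding one profile along another\<close>

definition sliding :: "'a \<Rightarrow> 'a \<Rightarrow> real \<Rightarrow> real \<Rightarrow> real" where
  "sliding m m' b x = s * (U m x - U m' (x + b))"

text \<open>The single sign change of the difference of a profile and a translate, which goes from negative to positive.\<close>
definition slid :: "real \<Rightarrow> bool" where
  "slid b \<longleftrightarrow> (\<forall>(m, m')\<in>pairs. \<not> sign_changes (sliding m m' b) 0 (\<rho> - b) 1 (Suc 0))"

text \<open>The end values have strict signs, negative on the left and positive on the right,
  opposite to those of an alternation from plus to minus. This is the boundary condition under which
  such alternations cannot be created.\<close>

lemma sliding_left: "m \<in> M \<Longrightarrow> m' \<in> M \<Longrightarrow> 0 < b \<Longrightarrow> b < \<rho> \<Longrightarrow> sliding m m' b 0 < 0"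
  using U_pos[of m' b] U_0[of m] by (simp add: sliding_def right_diff_distrib)

lemma sliding_right: "m \<in> M \<Longrightarrow> m' \<in> M \<Longrightarrow> 0 < b \<Longrightarrow> b < \<rho> \<Longrightarrow> 0 < sliding m m' b (\<rho> - b)"
  using U_pos[of m "\<rho> - b"] U_\<rho>[of m'] by (simp add: sliding_def)

lemma sliding_deriv:
  assumes "m \<in> M" "m' \<in> M" "0 < x" "0 < x + b" "x < \<rho>" "x + b < \<rho>"
  shows "(sliding m m' b has_real_derivative s * (Ux m x - Ux m' (x + b))) (at x)"
proof -
  have "((\<lambda>y. U m' (y + b)) has_real_derivative Ux m' (x + b)) (at x)"
    using U_deriv_at[of m' "x + b"] assms \<rho> by (simp add: DERIV_shift)
  moreover have "(U m has_real_derivative Ux m x) (at x)" using assms \<rho> by (intro U_deriv_at) auto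
  ultimately show ?thesis unfolding sliding_def by (intro DERIV_cmult DERIV_diff)
qed

lemma sliding_cont: "m \<in> M \<Longrightarrow> m' \<in> M \<Longrightarrow> 0 < b \<Longrightarrow> b < \<rho> \<Longrightarrow> continuous_on {0..\<rho> - b} (sliding m m' b)"
proof -
  have c: "continuous_on {0..\<rho>} (U k)" if "k \<in> M" for k
    using U_deriv_\<rho>[OF that] DERIV_continuous_on by blast
  assume "m \<in> M" "m' \<in> M" "0 < b" "b < \<rho>"
  then show ?thesis unfolding sliding_def
    by (intro continuous_intros continuous_on_subset[OF c] continuous_on_compose2[OF c[of m']]) auto
qed

lemma sliding_traj_cont:
  assumes m: "m \<in> M" "m' \<in> M" and b: "0 < b" "b < \<rho>"
  shows "continuous_on ({0..t} \<times> {0..\<rho> - b}) (\<lambda>(t, x). sliding (\<Phi> t m) (\<Phi> t m') b x)"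
proof -
  have "{0..t} \<times> {0..\<rho> - b} \<subseteq> {0..} \<times> {0..L}" using b \<rho> by auto
  note c1 = continuous_on_subset[OF traj_cont[OF m(1)] this, unfolded split_def]
  have "continuous_on ({0..t} \<times> {0..\<rho> - b}) (\<lambda>z. (\<lambda>(t, x). U (\<Phi> t m') x) (fst z, snd z + b))"
  proof (rule continuous_on_compose2[OF traj_cont[OF m(2)]])
    show "continuous_on ({0..t} \<times> {0..\<rho> - b}) (\<lambda>z. (fst z, snd z + b))" by (intro continuous_intros)
  qed (use b \<rho> in auto)
  then show ?thesis unfolding split_def sliding_def
    by (intro continuous_on_mult_left continuous_on_diff c1) simp
qed

lemma sliding_par_ineq:
  assumes m: "m \<in> M" "m' \<in> M" "\<pi> m = \<pi> m'" and b: "0 < b" and t: "0 < t" and x: "0 < x" "x < \<rho> - b"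
  shows "par_ineq C (\<lambda>t x. sliding (\<Phi> t m) (\<Phi> t m') b x) t x"
  unfolding sliding_def by (rule par_ineq_cmult, rule par_ineq_shift_diff) (use m b t x \<rho> in auto)

lemma sliding_persists:
  assumes m: "m \<in> M" "m' \<in> M" "\<pi> m = \<pi> m'" and b: "0 < b" "b < \<rho>" and t: "0 \<le> t1" "t1 \<le> t2"
    and ns: "\<not> sign_changes (sliding (\<Phi> t1 m) (\<Phi> t1 m') b) 0 (\<rho> - b) 1 (Suc 0)"
  shows "\<not> sign_changes (sliding (\<Phi> t2 m) (\<Phi> t2 m') b) 0 (\<rho> - b) 1 (Suc 0)"
proof
  assume "sign_changes (sliding (\<Phi> t2 m) (\<Phi> t2 m') b) 0 (\<rho> - b) 1 (Suc 0)"
  then have "sign_changes (sliding (\<Phi> t1 m) (\<Phi> t1 m') b) 0 (\<rho> - b) 1 (Suc 0)"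
  proof (rule sign_changes_antimono[OF C t(2), where w = "\<lambda>t. sliding (\<Phi> t m) (\<Phi> t m') b", rotated -1])
    show "continuous_on ({t1..t2} \<times> {0..\<rho> - b}) (\<lambda>(t, x). sliding (\<Phi> t m) (\<Phi> t m') b x)"
      by (rule continuous_on_subset[OF sliding_traj_cont[OF m(1,2) b, of t2]]) (use t in auto)
    fix t assume t': "t1 < t" "t \<le> t2"
    then have t'': "0 \<le> t" using t by simp
    show "1 * sliding (\<Phi> t m) (\<Phi> t m') b 0 \<le> 0 \<or> (sliding (\<Phi> t m) (\<Phi> t m') b has_real_derivative 0) (at 0 within {0..\<rho> - b})"
      using sliding_left[OF \<Phi>_in[OF m(1) t''] \<Phi>_in[OF m(2) t''] b] by simp
    show "1 * (-1) ^ Suc 0 * sliding (\<Phi> t m) (\<Phi> t m') b (\<rho> - b) \<le> 0 \<or> (sliding (\<Phi> t m) (\<Phi> t m') b has_real_derivative 0) (at (\<rho> - b) within {0..\<rho> - b})"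
      using sliding_right[OF \<Phi>_in[OF m(1) t''] \<Phi>_in[OF m(2) t''] b] by simp
    show "par_ineq C (\<lambda>t. sliding (\<Phi> t m) (\<Phi> t m') b) t x" if "0 < x" "x < \<rho> - b" for x
      using sliding_par_ineq[OF m b(1) _ that] t' t by simp
  qed (use b in auto)
  with ns show False by simp
qed

text \<open>For \<open>b = \<rho> - \<delta>\<close> the left strip of one profile faces the right
  strip of the other. After multiplication by \<open>s\<close> the first increases and the second
  decreases, so the difference is increasing.\<close>

lemma slid_near_\<rho>: "\<exists>b. 0 < b \<and> b < \<rho> \<and> slid b"
proof -
  obtain \<delta> where \<delta>: "0 < \<delta>" "\<delta> < \<rho>" "\<And>m x. m \<in> M \<Longrightarrow> x \<in> {0..\<delta>} \<Longrightarrow> 0 < s * Ux m x"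
    "\<And>m x. m \<in> M \<Longrightarrow> x \<in> {\<rho> - \<delta>..\<rho>} \<Longrightarrow> s * Ux m x < 0" using uniform_slopes by blast
  have "slid (\<rho> - \<delta>)"
    unfolding slid_def sign_changes_1_iff
  proof (clarify)
    fix m m' x y assume mm: "(m, m') \<in> pairs" and xy: "x \<in> {0..\<rho> - (\<rho> - \<delta>)}" "y \<in> {0..\<rho> - (\<rho> - \<delta>)}" "x < y"
      and w: "0 < sliding m m' (\<rho> - \<delta>) x" "sliding m m' (\<rho> - \<delta>) y < 0"
    have m: "m \<in> M" "m' \<in> M" using mm by (auto simp: pairs_def)
    have "sliding m m' (\<rho> - \<delta>) x < sliding m m' (\<rho> - \<delta>) y"
    proof (rule DERIV_pos_imp_increasing_open[OF xy(3)])
      fix z assume z: "x < z" "z < y"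
      have "(sliding m m' (\<rho> - \<delta>) has_real_derivative s * (Ux m z - Ux m' (z + (\<rho> - \<delta>)))) (at z)"
        by (rule sliding_deriv) (use m z xy \<delta> in auto)
      moreover have "0 < s * (Ux m z - Ux m' (z + (\<rho> - \<delta>)))"
        using \<delta>(3)[OF m(1), of z] \<delta>(4)[OF m(2), of "z + (\<rho> - \<delta>)"] z xy by (simp add: right_diff_distrib)
      ultimately show "\<exists>d. (sliding m m' (\<rho> - \<delta>) has_real_derivative d) (at z) \<and> 0 < d" by blast
    next
      show "continuous_on {x..y} (sliding m m' (\<rho> - \<delta>))"
        by (rule continuous_on_subset[OF sliding_cont[OF m]]) (use \<delta> xy in auto)
    qed
    then show False using w by simp
  qed
  then show ?thesis using \<delta> by (intro exI[of _ "\<rho> - \<delta>"]) auto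
qed

text \<open>An alternation is witnessed by strict inequalities at two points. As the difference is
  positive at \<open>\<rho> - b\<close>, the second point is not the end point and stays in the
  domain when \<open>b\<close> changes slightly.\<close>

lemma not_slid_open:
  assumes b: "0 < b" "b < \<rho>" and n: "\<not> slid b"
  shows "\<exists>\<epsilon>>0. \<forall>b'. \<bar>b' - b\<bar> < \<epsilon> \<longrightarrow> \<not> slid b'"
proof -
  obtain m m' x y where mm: "(m, m') \<in> pairs" and xy: "x \<in> {0..\<rho> - b}" "y \<in> {0..\<rho> - b}" "x < y"
    and w: "0 < sliding m m' b x" "sliding m m' b y < 0"
    using n unfolding slid_def sign_changes_1_iff by blast
  have m: "m \<in> M" "m' \<in> M" using mm by (auto simp: pairs_def)
  have y: "y < \<rho> - b" using sliding_right[OF m b] w xy by (cases "y = \<rho> - b") auto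
  have cU: "isCont (U m') z" if "0 < z" "z < \<rho>" for z
    using U_deriv_at[OF m(2), of z] that \<rho> DERIV_isCont by auto
  have c: "((\<lambda>b'. sliding m m' b' z) \<longlongrightarrow> sliding m m' b z) (at b)" if "0 \<le> z" "z < \<rho> - b" for z
    unfolding sliding_def
    by (intro tendsto_intros isCont_tendsto_compose[OF cU]) (use that b in auto)
  have "\<forall>\<^sub>F b' in at b. 0 < sliding m m' b' x" "\<forall>\<^sub>F b' in at b. sliding m m' b' y < 0"
    using order_tendstoD(1)[OF c[of x] w(1)] order_tendstoD(2)[OF c[of y] w(2)] xy y by auto
  then have "\<forall>\<^sub>F b' in at b. 0 < sliding m m' b' x \<and> sliding m m' b' y < 0" by eventually_elim simp
  then obtain e where e: "0 < e" "\<And>b'. b' \<noteq> b \<Longrightarrow> dist b' b < e \<Longrightarrow> 0 < sliding m m' b' x \<and> sliding m m' b' y < 0"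
    unfolding eventually_at by auto
  have "\<not> slid b'" if b': "\<bar>b' - b\<bar> < min e (\<rho> - b - y)" for b'
  proof -
    have "0 < sliding m m' b' x \<and> sliding m m' b' y < 0"
      using e(2)[of b'] b' w by (cases "b' = b") (auto simp: dist_real_def)
    moreover have "x \<in> {0..\<rho> - b'}" "y \<in> {0..\<rho> - b'}" using xy b' by auto
    ultimately show ?thesis using mm xy(3) unfolding slid_def sign_changes_1_iff by blast
  qed
  then show ?thesis using e(1) y by (intro exI[of _ "min e (\<rho> - b - y)"]) auto
qed

lemma compact_pairs: "compact pairs"
  using fibre_compact by (simp add: pairs_def)

lemma pairs_flow: "(k, k') \<in> pairs \<Longrightarrow> 0 \<le> t \<Longrightarrow> (\<Phi> t k, \<Phi> t k') \<in> pairs"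
  using \<Phi>_in fibre by (auto simp: pairs_def)

text \<open>The second argument is clamped to \<open>{0..\<rho>}\<close> so that the domain does not depend on the shift.\<close>
lemma clamped_sliding_cont:
  fixes H :: "_ \<Rightarrow> real \<Rightarrow> real"
  assumes H: "continuous_on (M \<times> {0..L}) (\<lambda>(m, x). H m x)" and t: "0 \<le> t"
  shows "continuous_on (((M \<times> M) \<times> UNIV) \<times> {0..\<rho>})
    (\<lambda>(q, x). c * (H (\<Phi> t (fst (fst q))) x - H (\<Phi> t (snd (fst q))) (max 0 (min \<rho> (x + snd q)))))"
proof -
  let ?D = "((M \<times> M) \<times> (UNIV :: real set)) \<times> {0..\<rho>}"
  have 1: "continuous_on ?D (\<lambda>z. \<Phi> t (fst (fst (fst z))))" 
    by (rule continuous_on_compose2[OF \<Phi>_cont_space[OF t]]) (intro continuous_intros, auto)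
  have 2: "continuous_on ?D (\<lambda>z. \<Phi> t (snd (fst (fst z))))" 
    by (rule continuous_on_compose2[OF \<Phi>_cont_space[OF t]]) (intro continuous_intros, auto)
  have 3: "continuous_on ?D (\<lambda>z. snd z)" by (intro continuous_intros)
  have 4: "continuous_on ?D (\<lambda>z. max 0 (min \<rho> (snd z + snd (fst z))))" by (intro continuous_intros)
  have a: "continuous_on ?D (\<lambda>z. (\<lambda>(m, x). H m x) (\<Phi> t (fst (fst (fst z))), snd z))"
    by (rule continuous_on_compose2[OF H continuous_on_Pair[OF 1 3]]) (use \<rho> \<Phi>_in[OF _ t] in auto)
  have b: "continuous_on ?D (\<lambda>z. (\<lambda>(m, x). H m x) (\<Phi> t (snd (fst (fst z))), max 0 (min \<rho> (snd z + snd (fst z)))))"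
    by (rule continuous_on_compose2[OF H continuous_on_Pair[OF 2 4]]) (use \<rho> \<Phi>_in[OF _ t] in auto)
  from continuous_on_mult_left[OF continuous_on_diff[OF a b], of c]
  show ?thesis unfolding split_def fst_conv snd_conv .
qed

text \<open>At some time the difference has a unique zero, which moreover is simple; this survives small perturbations, and the
  later times inherit that there is only one sign change.\<close>
lemma slid_local:
  assumes b: "0 < b" "b < \<rho>" and sl: "slid b" and kk: "(k, k') \<in> pairs"
  shows "\<exists>A \<delta>. open A \<and> (k, k') \<in> A \<and> 0 < \<delta> \<and> (\<forall>(l, l')\<in>pairs \<inter> A. \<forall>b'. \<bar>b' - b\<bar> < \<delta> \<longrightarrow>
     \<not> sign_changes (sliding (\<Phi> 1 l) (\<Phi> 1 l') b') 0 (\<rho> - b') 1 (Suc 0))"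
proof -
  have k: "k \<in> M" "k' \<in> M" "\<pi> k = \<pi> k'" using kk by (auto simp: pairs_def)
  define w where "w t x = sliding (\<Phi> t k) (\<Phi> t k') b x" for t x
  obtain t0 z \<kappa> where t0: "0 < t0" "t0 \<le> 1" and z: "0 < z" "z < \<rho> - b" "w t0 z = 0" and \<kappa>: "0 < \<kappa>"
    and neg: "\<And>x. 0 \<le> x \<Longrightarrow> x < z \<Longrightarrow> w t0 x < 0" and pos: "\<And>x. x \<in> {z..\<rho> - b} \<Longrightarrow> \<kappa> * (x - z) \<le> w t0 x"
  proof (rule unique_simple_zero[OF C, where R = "\<rho> - b" and w = w])
    show "0 < \<rho> - b" using b by simp
    show "continuous_on ({0..1} \<times> {0..\<rho> - b}) (\<lambda>(t, x). w t x)"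
      unfolding w_def by (rule sliding_traj_cont[OF k(1,2) b])
    show "par_ineq C w t x" if "0 < t" "t \<le> 1" "0 < x" "x < \<rho> - b" for t x
      using sliding_par_ineq[OF k b(1) that(1,3,4)] unfolding w_def .
    fix t :: real assume "t \<in> {0..1}"
    then have P: "(\<Phi> t k, \<Phi> t k') \<in> pairs" using pairs_flow[OF kk] by simp
    then show "w t 0 < 0" "0 < w t (\<rho> - b)"
      using sliding_left[OF _ _ b] sliding_right[OF _ _ b] by (auto simp: w_def pairs_def)
    show "\<not> sign_changes (w t) 0 (\<rho> - b) 1 (Suc 0)"
      using sl P unfolding slid_def w_def by auto
  qed blast
  have t0': "0 \<le> t0" using t0 by simp
  define cl where "cl y = max 0 (min \<rho> y)" for y
  define f where "f q x = s * (U (\<Phi> t0 (fst (fst q))) x - U (\<Phi> t0 (snd (fst q))) (cl (x + snd q)))" for q x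
  define fx where "fx q x = s * (Ux (\<Phi> t0 (fst (fst q))) x - Ux (\<Phi> t0 (snd (fst q))) (cl (x + snd q)))" for q x
  let ?S = "(M \<times> M) \<times> (UNIV :: real set)"
  have cf: "continuous_on (?S \<times> {0..\<rho>}) (\<lambda>(q, x). c * f q x)" for c
    using clamped_sliding_cont[OF U_cont t0', of "c * s"] unfolding f_def cl_def by (simp add: mult.assoc)
  have cfx: "continuous_on (?S \<times> {0..\<rho>}) (\<lambda>(q, x). fx q x)"
    using clamped_sliding_cont[OF Ux_cont t0', of s] unfolding fx_def cl_def .
  let ?q = "((k, k'), b)"
  have q: "?q \<in> ?S" using k by simp
  have in': "\<Phi> t0 k \<in> M" "\<Phi> t0 k' \<in> M" using \<Phi>_in k t0' by auto
  have cl: "cl (x + c) = x + c" if "0 \<le> x" "0 < c" "x \<le> \<rho> - c" for x c using that by (simp add: cl_def)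
  have fw: "f ?q x = w t0 x" if "0 \<le> x" "x \<le> \<rho> - b" for x
    using cl[of x b] that b by (simp add: f_def w_def sliding_def)
  have fxz: "0 < fx ?q z"
  proof -
    have d: "(w t0 has_real_derivative fx ?q z) (at z)"
      using sliding_deriv[OF in', of z b] cl[of z b] z b unfolding w_def fx_def by simp
    have "\<kappa> \<le> fx ?q z"
      by (rule slope_lower_bound[OF has_field_derivative_at_within[OF d], where r = "\<rho> - b" and b = "\<rho> - b"]) (use z pos in auto)
    then show ?thesis using \<kappa> by simp
  qed
  have cfxq: "continuous_on {0..\<rho>} (\<lambda>x. fx ?q x)"
  proof -
    have "continuous_on {0..\<rho>} (\<lambda>x. (\<lambda>(q, x). fx q x) (?q, x))"
      by (rule continuous_on_compose2[OF cfx]) (intro continuous_intros, use q in auto)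
    then show ?thesis by simp
  qed
  have "z \<in> {0..\<rho>}" using z b by auto
  then obtain e where e: "0 < e" "\<And>x. x \<in> {0..\<rho>} \<Longrightarrow> dist x z < e \<Longrightarrow> dist (fx ?q x) (fx ?q z) < fx ?q z"
    using cfxq fxz unfolding continuous_on_iff by meson
  \<comment> \<open>\<open>\<eta>\<close> separates three zones that are perturbed independently:
    negative values on the left, a positive derivative around \<open>z\<close>, positive values on
    the right.\<close>
  define \<eta> where "\<eta> = Min {e / 2, z / 2, (\<rho> - b - z) / 2}"
  have \<eta>: "0 < \<eta>" "\<eta> < e" "0 < z - \<eta>" "z + \<eta> < \<rho> - b"
    using e(1) z by (auto simp: \<eta>_def min_def field_simps)
  have fxp: "0 < fx ?q x" if "x \<in> {z - \<eta>..z + \<eta>}" for x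
  proof -
    have "dist (fx ?q x) (fx ?q z) < fx ?q z" using that \<eta> b by (intro e(2)) (auto simp: dist_real_def)
    then show ?thesis by (simp add: dist_real_def abs_less_iff)
  qed
  have sub: "?S \<times> X \<subseteq> ?S \<times> {0..\<rho>}" if "X \<subseteq> {0..\<rho>}" for X using that by auto
  have "\<exists>T. open T \<and> ?q \<in> T \<and> (\<forall>q'\<in>T \<inter> ?S. \<forall>x\<in>{0..z - \<eta>}. 0 < - 1 * f q' x)"
  proof (rule tube_pos[OF continuous_on_subset[OF cf sub] compact_Icc q])
    show "{0..z - \<eta>} \<subseteq> {0..\<rho>}" using \<eta> b by auto
    show "0 < - 1 * f ?q x" if "x \<in> {0..z - \<eta>}" for x
      using neg[of x] fw[of x] that \<eta> by auto
  qed
  then obtain T1 where T1: "open T1" "?q \<in> T1" "\<forall>q'\<in>T1 \<inter> ?S. \<forall>x\<in>{0..z - \<eta>}. 0 < - 1 * f q' x" by (elim exE conjE)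
  have "\<exists>T. open T \<and> ?q \<in> T \<and> (\<forall>q'\<in>T \<inter> ?S. \<forall>x\<in>{z - \<eta>..z + \<eta>}. 0 < fx q' x)"
  proof (rule tube_pos[OF continuous_on_subset[OF cfx sub] compact_Icc q])
    show "{z - \<eta>..z + \<eta>} \<subseteq> {0..\<rho>}" using \<eta> b by auto
    show "0 < fx ?q x" if "x \<in> {z - \<eta>..z + \<eta>}" for x using fxp[OF that] .
  qed
  then obtain T2 where T2: "open T2" "?q \<in> T2" "\<forall>q'\<in>T2 \<inter> ?S. \<forall>x\<in>{z - \<eta>..z + \<eta>}. 0 < fx q' x" by (elim exE conjE)
  \<comment> \<open>The right zone extends beyond \<open>\<rho> - b\<close> to
    \<open>\<rho> - b / 2\<close>, so as to contain the rest of the domain for every nearby shift.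
    Beyond \<open>\<rho> - b\<close> the clamp puts the second profile at its zero
    \<open>\<rho>\<close>, and the first one is positive up to the factor \<open>s\<close>.\<close>
  have "\<exists>T. open T \<and> ?q \<in> T \<and> (\<forall>q'\<in>T \<inter> ?S. \<forall>x\<in>{z + \<eta>..\<rho> - b / 2}. 0 < 1 * f q' x)"
  proof (rule tube_pos[OF continuous_on_subset[OF cf sub] compact_Icc q])
    show "{z + \<eta>..\<rho> - b / 2} \<subseteq> {0..\<rho>}" using \<eta> b z by auto
    show "0 < 1 * f ?q x" if x: "x \<in> {z + \<eta>..\<rho> - b / 2}" for x
    proof (cases "x \<le> \<rho> - b")
      case True
      have "0 < \<kappa> * (x - z)" using x \<eta> \<kappa> by simp
      also have "\<dots> \<le> w t0 x" using pos[of x] x \<eta> True by auto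
      finally show ?thesis using fw[of x] x \<eta> True z by simp
    next
      case False
      then have "cl (x + b) = \<rho>" using \<rho> by (simp add: cl_def)
      then show ?thesis using U_pos[OF in'(1), of x] U_\<rho>[OF in'(2)] x \<eta> b z by (simp add: f_def)
    qed
  qed
  then obtain T3 where T3: "open T3" "?q \<in> T3" "\<forall>q'\<in>T3 \<inter> ?S. \<forall>x\<in>{z + \<eta>..\<rho> - b / 2}. 0 < 1 * f q' x" by (elim exE conjE)
  obtain A B where AB: "open A" "open B" "?q \<in> A \<times> B" "A \<times> B \<subseteq> T1 \<inter> T2 \<inter> T3"
  proof (rule open_prod_elim[of "T1 \<inter> T2 \<inter> T3" ?q])
    show "open (T1 \<inter> T2 \<inter> T3)" using T1(1) T2(1) T3(1) by (intro open_Int)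
    show "?q \<in> T1 \<inter> T2 \<inter> T3" using T1(2) T2(2) T3(2) by (intro IntI)
  qed
  obtain e' where e': "0 < e'" "ball b e' \<subseteq> B"
  proof -
    have "b \<in> B" using AB(3) by (simp only: mem_Sigma_iff)
    then show thesis using openE[OF AB(2)] that by metis
  qed
  \<comment> \<open>Keeps \<open>b'\<close> in \<open>B\<close>, the middle zone inside the domain
    for \<open>b'\<close>, and \<open>b / 2 < b'\<close>, so that the right zone reaches the end
    \<open>\<rho> - b'\<close>.\<close>
  define \<delta> where "\<delta> = Min {e', \<rho> - b - (z + \<eta>), b / 2}"
  have "0 < \<delta>" using e' \<eta> b by (simp add: \<delta>_def)
  moreover have "\<delta> \<le> e'" "\<delta> \<le> \<rho> - b - (z + \<eta>)" "\<delta> \<le> b / 2" unfolding \<delta>_def by (intro Min_le; simp)+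
  ultimately have \<delta>: "0 < \<delta>" "\<delta> \<le> e'" "\<delta> \<le> \<rho> - b - (z + \<eta>)" "\<delta> \<le> b / 2" by simp_all
  have "\<not> sign_changes (sliding (\<Phi> 1 l) (\<Phi> 1 l') b') 0 (\<rho> - b') 1 (Suc 0)"
    if ll: "(l, l') \<in> pairs" "(l, l') \<in> A" and b': "\<bar>b' - b\<bar> < \<delta>" for l l' b'
  proof -
    have l: "l \<in> M" "l' \<in> M" "\<pi> l = \<pi> l'" using ll by (auto simp: pairs_def)
    have bb: "0 < b'" "b' < \<rho>" "b / 2 < b'" "z + \<eta> < \<rho> - b'" using b' \<delta> b \<eta> z by (auto simp: abs_less_iff)
    let ?q' = "((l, l'), b')"
    have "b' \<in> B" using e' b' \<delta> by (auto simp: dist_real_def abs_minus_commute)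
    then have q': "?q' \<in> T1 \<inter> ?S" "?q' \<in> T2 \<inter> ?S" "?q' \<in> T3 \<inter> ?S" using AB(4) ll(2) l by auto
    have in2: "\<Phi> t0 l \<in> M" "\<Phi> t0 l' \<in> M" using \<Phi>_in l t0' by auto
    let ?v = "sliding (\<Phi> t0 l) (\<Phi> t0 l') b'"
    have fv: "f ?q' x = ?v x" "fx ?q' x = s * (Ux (\<Phi> t0 l) x - Ux (\<Phi> t0 l') (x + b'))" if "0 \<le> x" "x \<le> \<rho> - b'" for x
      using cl[of x b'] that bb by (simp_all add: f_def fx_def sliding_def)
    have "\<not> sign_changes ?v 0 (\<rho> - b') 1 (Suc 0)"
      unfolding sign_changes_1_iff
    proof clarify
      fix x y assume xy: "x \<in> {0..\<rho> - b'}" "y \<in> {0..\<rho> - b'}" "x < y" and v: "0 < ?v x" "?v y < 0"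
      have "z - \<eta> < x"
      proof (rule ccontr)
        assume "\<not> z - \<eta> < x"
        then show False using bspec[OF bspec[OF T1(3) q'(1)], of x] fv(1)[of x] xy v by auto
      qed
      moreover have "y < z + \<eta>"
      proof (rule ccontr)
        assume "\<not> y < z + \<eta>"
        moreover have "y \<le> \<rho> - b / 2" using xy bb by auto
        ultimately show False using bspec[OF bspec[OF T3(3) q'(3)], of y] fv(1)[of y] xy v by auto
      qed
      moreover have "?v x < ?v y"
      proof (rule DERIV_pos_imp_increasing_open[OF xy(3)])
        fix u assume u: "x < u" "u < y"
        have "0 < fx ?q' u" using bspec[OF bspec[OF T2(3) q'(2)], of u] u \<open>z - \<eta> < x\<close> \<open>y < z + \<eta>\<close> by auto
        then have "0 < s * (Ux (\<Phi> t0 l) u - Ux (\<Phi> t0 l') (u + b'))" using fv(2)[of u] u xy by auto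
        moreover have "(?v has_real_derivative s * (Ux (\<Phi> t0 l) u - Ux (\<Phi> t0 l') (u + b'))) (at u)"
          by (rule sliding_deriv[OF in2]) (use u xy bb in auto)
        ultimately show "\<exists>d. (?v has_real_derivative d) (at u) \<and> 0 < d" by blast
      next
        show "continuous_on {x..y} ?v"
          by (rule continuous_on_subset[OF sliding_cont[OF in2 bb(1,2)]]) (use xy in auto)
      qed
      ultimately show False using v by simp
    qed
    then show ?thesis by (rule sliding_persists[OF l bb(1,2) t0' t0(2)])
  qed
  then show ?thesis using AB \<delta>(1) by (intro exI[of _ A] exI[of _ \<delta>]) auto
qed

text \<open>Compactness makes the radius in \<open>slid_local\<close> independent of the pair. That
  lemma speaks of states at time 1, but every pair is such a state: time maps are onto and lying in
  one fibre is decided at any time.\<close>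

lemma slid_open:
  assumes b: "0 < b" "b < \<rho>" and sl: "slid b"
  shows "\<exists>\<epsilon>>0. \<forall>b'. \<bar>b' - b\<bar> < \<epsilon> \<longrightarrow> slid b'"
proof -
  let ?P = "\<lambda>\<delta> (l, l'). \<forall>b'. \<bar>b' - b\<bar> < \<delta> \<longrightarrow>
     \<not> sign_changes (sliding (\<Phi> 1 l) (\<Phi> 1 l') b') 0 (\<rho> - b') 1 (Suc 0)"
  have "\<exists>\<delta>>0. \<forall>z\<in>pairs. ?P \<delta> z"
  proof (rule compact_uniform_radius[OF compact_pairs])
    fix z assume z: "z \<in> pairs"
    obtain k k' where "z = (k, k')" by fastforce
    with slid_local[OF b sl, of k k'] z show "\<exists>T \<delta>. open T \<and> z \<in> T \<and> 0 < \<delta> \<and> (\<forall>z'\<in>pairs \<inter> T. ?P \<delta> z')"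
      by simp
  next
    fix \<delta> \<delta>' :: real and z assume "?P \<delta> z" "\<delta>' \<le> \<delta>"
    then show "?P \<delta>' z" by (auto simp: split_def)
  qed
  then obtain \<delta> where \<delta>: "0 < \<delta>" "\<And>l l' b'. (l, l') \<in> pairs \<Longrightarrow> \<bar>b' - b\<bar> < \<delta> \<Longrightarrow>
     \<not> sign_changes (sliding (\<Phi> 1 l) (\<Phi> 1 l') b') 0 (\<rho> - b') 1 (Suc 0)" by fast
  have "slid b'" if "\<bar>b' - b\<bar> < \<delta>" for b'
    unfolding slid_def
  proof clarify
    fix m m' assume mm: "(m, m') \<in> pairs" and sc: "sign_changes (sliding m m' b') 0 (\<rho> - b') 1 (Suc 0)"
    then have m: "m \<in> M" "m' \<in> M" "\<pi> m = \<pi> m'" by (auto simp: pairs_def)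
    obtain k where k: "k \<in> M" "\<Phi> 1 k = m" using \<Phi>_preimage[OF m(1), of 1] by auto
    obtain k' where k': "k' \<in> M" "\<Phi> 1 k' = m'" using \<Phi>_preimage[OF m(2), of 1] by auto
    have "(k, k') \<in> pairs" using k k' m fibre[OF k(1) k'(1), of 1] by (simp add: pairs_def)
    from \<delta>(2)[OF this that] show False using sc k k' by simp
  qed
  then show ?thesis using \<delta>(1) by blast
qed

text \<open>\<open>slid\<close> and its negation are open in a connected interval, and
  \<open>slid\<close> holds somewhere.\<close>

lemma all_slid:
  assumes b: "0 < b" "b < \<rho>" shows "slid b"
proof (rule ccontr)
  assume n: "\<not> slid b"
  let ?A = "{b \<in> {0<..<\<rho>}. slid b}" and ?B = "{b \<in> {0<..<\<rho>}. \<not> slid b}"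
  have op: "open {b \<in> {0<..<\<rho>}. Q b}" if Q: "\<And>b. 0 < b \<Longrightarrow> b < \<rho> \<Longrightarrow> Q b \<Longrightarrow> \<exists>\<epsilon>>0. \<forall>b'. \<bar>b' - b\<bar> < \<epsilon> \<longrightarrow> Q b'" for Q
    unfolding open_dist
  proof clarify
    fix b assume "b \<in> {0<..<\<rho>}" "Q b"
    then obtain \<epsilon> where \<epsilon>: "0 < \<epsilon>" "\<And>b'. \<bar>b' - b\<bar> < \<epsilon> \<Longrightarrow> Q b'" using Q[of b] by auto
    show "\<exists>e>0. \<forall>y. dist y b < e \<longrightarrow> y \<in> {b \<in> {0<..<\<rho>}. Q b}"
      using \<epsilon> \<open>b \<in> {0<..<\<rho>}\<close> by (intro exI[of _ "Min {\<epsilon>, b, \<rho> - b}"]) (auto simp: dist_real_def)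
  qed
  have "?A \<inter> {0<..<\<rho>} = {} \<or> ?B \<inter> {0<..<\<rho>} = {}"
  proof (rule connectedD[where A = "{0<..<\<rho>}"])
    show "connected {0<..<\<rho>}" by simp
    show "open ?A" "open ?B" using op[of slid] op[of "\<lambda>b. \<not> slid b"] slid_open not_slid_open by blast+
  qed auto
  then show False using n b slid_near_\<rho> by auto
qed

section \<open>Order in the fibres and its consequences\<close>

text \<open>A change from plus to minus in the unshifted difference would persist for small
  \<open>b > 0\<close>, against \<open>all_slid\<close>. The opposite change is excluded by
  exchanging the two elements, \<open>pairs\<close> being symmetric.\<close>

lemma ordered_fibres:
  assumes m: "(m, m') \<in> pairs"
  shows "(\<forall>x\<in>{0..\<rho>}. s * U m x \<le> s * U m' x) \<or> (\<forall>x\<in>{0..\<rho>}. s * U m' x \<le> s * U m x)"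
proof (rule ccontr)
  have key: False if P: "(k, k') \<in> pairs" and xy: "x \<in> {0..\<rho>}" "y \<in> {0..\<rho>}" "x < y"
    "s * U k' x < s * U k x" "s * U k y < s * U k' y" for k k' x y
  proof -
    have k: "k \<in> M" "k' \<in> M" using P by (auto simp: pairs_def)
    have x0: "x \<noteq> 0" "y \<noteq> \<rho>" using xy U_0 U_\<rho> k by auto
    have cU: "isCont (U k') u" if "0 < u" "u < \<rho>" for u
      using U_deriv_at[OF k(2), of u] that \<rho> DERIV_isCont by auto
    have c: "((\<lambda>b. sliding k k' b u) \<longlongrightarrow> sliding k k' 0 u) (at_right 0)" if "0 < u" "u < \<rho>" for u
      unfolding sliding_def by (intro tendsto_intros isCont_tendsto_compose[OF cU]) (use that in auto)
    have "\<forall>\<^sub>F b in at_right 0. 0 < sliding k k' b x"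
      by (rule order_tendstoD(1)[OF c]) (use xy x0 in \<open>auto simp: sliding_def right_diff_distrib\<close>)
    moreover have "\<forall>\<^sub>F b in at_right 0. sliding k k' b y < 0"
      by (rule order_tendstoD(2)[OF c]) (use xy x0 in \<open>auto simp: sliding_def right_diff_distrib\<close>)
    moreover have "\<forall>\<^sub>F b in at_right 0. b \<in> {0<..<\<rho> - y}"
      by (rule eventually_at_right_real) (use xy x0 in auto)
    ultimately have "\<forall>\<^sub>F b in at_right 0. 0 < sliding k k' b x \<and> sliding k k' b y < 0 \<and> b \<in> {0<..<\<rho> - y}"
      by eventually_elim simp
    then obtain b where b: "0 < sliding k k' b x" "sliding k k' b y < 0" "b \<in> {0<..<\<rho> - y}"
      using eventually_happens'[OF trivial_limit_at_right_real] by blast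
    have "slid b" by (rule all_slid) (use b xy in auto)
    then have "\<not> sign_changes (sliding k k' b) 0 (\<rho> - b) 1 (Suc 0)" using P unfolding slid_def by auto
    moreover have "sign_changes (sliding k k' b) 0 (\<rho> - b) 1 (Suc 0)"
      unfolding sign_changes_1_iff using b xy by (intro bexI[of _ x] bexI[of _ y]) auto
    ultimately show False by simp
  qed
  assume "\<not> ?thesis"
  then obtain x y where x: "x \<in> {0..\<rho>}" "s * U m' x < s * U m x" and y: "y \<in> {0..\<rho>}" "s * U m y < s * U m' y"
    by (auto simp: not_le)
  have m': "(m', m) \<in> pairs" using m by (auto simp: pairs_def)
  show False
  proof (cases x y rule: linorder_cases)
    case less
    then show False using key[OF m x(1) y(1)] x y by simp
  next
    case greater
    then show False using key[OF m' y(1) x(1)] x y by simp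
  qed (use x y in auto)
qed

lemma difference_cont:
  assumes "m \<in> M" "m' \<in> M"
  shows "continuous_on ({0..t} \<times> {0..\<rho>}) (\<lambda>(t, x). s * (U (\<Phi> t m') x - U (\<Phi> t m) x))"
proof -
  have "{0..t} \<times> {0..\<rho>} \<subseteq> {0..} \<times> {0..L}" using \<rho> by auto
  note c = continuous_on_subset[OF traj_cont this, unfolded split_def]
  show ?thesis unfolding split_def by (intro continuous_on_mult_left continuous_on_diff c assms)
qed

lemma difference_par_ineq:
  assumes m: "m \<in> M" "m' \<in> M" "\<pi> m = \<pi> m'" and t: "0 < t" and x: "0 < x" "x < \<rho>"
  shows "par_ineq C (\<lambda>t x. s * (U (\<Phi> t m') x - U (\<Phi> t m) x)) t x"
proof -
  have "par_ineq C (\<lambda>t x. s * (U (\<Phi> t m') x - U (\<Phi> t m) (x + 0))) t x"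
    by (rule par_ineq_cmult, rule par_ineq_shift_diff) (use m t x \<rho> in auto)
  then show ?thesis by simp
qed

text \<open>Two different elements are ordered one unit of time earlier, and in the direction found
  now, because order is preserved. The strong maximum principle over this unit of time separates the
  slopes at 0.\<close>

lemma slope_injective:
  assumes m: "m1 \<in> M" "m2 \<in> M" "\<pi> m1 = \<pi> m2" and sl: "Ux m1 0 = Ux m2 0" and x: "x \<in> {0..\<rho>}"
  shows "U m1 x = U m2 x"
proof (rule ccontr)
  assume ne: "U m1 x \<noteq> U m2 x"
  have "\<exists>m m'. (m, m') \<in> pairs \<and> Ux m 0 = Ux m' 0 \<and> s * U m x < s * U m' x"
  proof (cases "s * U m1 x < s * U m2 x")
    case True
    then show ?thesis using m sl by (intro exI[of _ m1] exI[of _ m2]) (auto simp: pairs_def)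
  next
    case False
    moreover have "s * U m1 x \<noteq> s * U m2 x" using ne s by auto
    ultimately have "s * U m2 x < s * U m1 x" by linarith
    then show ?thesis using m sl by (intro exI[of _ m2] exI[of _ m1]) (auto simp: pairs_def)
  qed
  then obtain m m' where mm: "(m, m') \<in> pairs" "Ux m 0 = Ux m' 0" "s * U m x < s * U m' x" by blast
  have m: "m \<in> M" "m' \<in> M" "\<pi> m = \<pi> m'" using mm by (auto simp: pairs_def)
  have x0: "0 < x" "x < \<rho>" using mm(3) m U_0 U_\<rho> x by (cases "x = 0"; cases "x = \<rho>"; auto)+
  obtain k where k: "k \<in> M" "\<Phi> 1 k = m" using \<Phi>_preimage[OF m(1), of 1] by auto
  obtain k' where k': "k' \<in> M" "\<Phi> 1 k' = m'" using \<Phi>_preimage[OF m(2), of 1] by auto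
  have kk: "\<pi> k = \<pi> k'" using k k' m fibre[OF k(1) k'(1), of 1] by simp
  have ord: "\<forall>x\<in>{0..\<rho>}. s * U k x \<le> s * U k' x"
  proof (rule ccontr)
    assume "\<not> ?thesis"
    then have "\<forall>x\<in>{0..\<rho>}. s * U k' x \<le> s * U k x" using ordered_fibres[of k k'] k k' kk by (auto simp: pairs_def)
    then have "s * U (\<Phi> 1 k') x \<le> s * U (\<Phi> 1 k) x"
      by (intro order_preserved[OF k'(1) k(1) kk[symmetric] s \<rho>]) (use U_\<rho> x in auto)
    then show False using mm(3) k k' by simp
  qed
  have "\<exists>\<kappa>>0. (\<forall>y\<in>{0..x}. \<kappa> * (y - 0) \<le> s * (U (\<Phi> 1 k') y - U (\<Phi> 1 k) y)) \<and>
      (\<forall>y\<in>{x..\<rho>}. \<kappa> * (\<rho> - y) \<le> s * (U (\<Phi> 1 k') y - U (\<Phi> 1 k) y))"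
  proof (rule strong_maximum_principle[OF C zero_less_one x0 difference_cont[OF k(1) k'(1)]])
    show "0 \<le> s * (U (\<Phi> t k') y - U (\<Phi> t k) y)" if "0 \<le> t" "t \<le> 1" "0 \<le> y" "y \<le> \<rho>" for t y
      using order_preserved[OF k(1) k'(1) kk s \<rho> U_\<rho> _ that(1), of y] ord that by (simp add: right_diff_distrib)
    show "0 < s * (U (\<Phi> 1 k') x - U (\<Phi> 1 k) x)" using mm(3) k k' by (simp add: right_diff_distrib)
    show "par_ineq C (\<lambda>t x. s * (U (\<Phi> t k') x - U (\<Phi> t k) x)) t y" if "0 < t" "t \<le> 1" "0 < y" "y < \<rho>" for t y
      by (rule difference_par_ineq[OF k(1) k'(1) kk that(1,3,4)])
  qed
  then obtain \<kappa> where \<kappa>: "0 < \<kappa>" "\<And>y. y \<in> {0..x} \<Longrightarrow> \<kappa> * (y - 0) \<le> s * (U m' y - U m y)" using k k' by auto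
  have "((\<lambda>y. s * (U m' y - U m y)) has_real_derivative s * (Ux m' 0 - Ux m 0)) (at 0 within {0..\<rho>})"
    by (intro DERIV_cmult DERIV_diff U_deriv_\<rho> m) (use \<rho> in auto)
  then have "\<kappa> \<le> s * (Ux m' 0 - Ux m 0)"
    by (rule slope_lower_bound[where r = x]) (use x0 \<kappa> m U_0 in auto)
  then show False using \<kappa>(1) mm(2) by simp
qed

text \<open>Ordered elements that differ at a point continue to differ at that point at all later
  times.\<close>

lemma backward_unique:
  assumes m: "m1 \<in> M" "m2 \<in> M" "\<pi> m1 = \<pi> m2" and t: "0 \<le> t" and eq: "U (\<Phi> t m1) = U (\<Phi> t m2)" and x: "x \<in> {0..\<rho>}"
  shows "U m1 x = U m2 x"
proof (rule ccontr)
  assume ne: "U m1 x \<noteq> U m2 x"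
  have "\<exists>m m'. (m, m') \<in> pairs \<and> U (\<Phi> t m) = U (\<Phi> t m') \<and> s * U m x < s * U m' x"
  proof (cases "s * U m1 x < s * U m2 x")
    case True
    then show ?thesis using m eq by (intro exI[of _ m1] exI[of _ m2]) (auto simp: pairs_def)
  next
    case False
    moreover have "s * U m1 x \<noteq> s * U m2 x" using ne s by auto
    ultimately have "s * U m2 x < s * U m1 x" by linarith
    then show ?thesis using m eq by (intro exI[of _ m2] exI[of _ m1]) (auto simp: pairs_def)
  qed
  then obtain m m' where mm: "(m, m') \<in> pairs" "U (\<Phi> t m) = U (\<Phi> t m')" "s * U m x < s * U m' x" by blast
  have m: "m \<in> M" "m' \<in> M" "\<pi> m = \<pi> m'" using mm by (auto simp: pairs_def)
  have x0: "0 < x" "x < \<rho>" using mm(3) m U_0 U_\<rho> x by (cases "x = 0"; cases "x = \<rho>"; auto)+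
  have ord: "\<forall>x\<in>{0..\<rho>}. s * U m x \<le> s * U m' x"
    using ordered_fibres[OF mm(1)] mm(3) x by force
  have "0 < s * (U (\<Phi> t m') x - U (\<Phi> t m) x)"
  proof (rule positivity_persists[OF C t x0 difference_cont[OF m(1,2)]])
    show "0 \<le> s * (U (\<Phi> \<tau> m') y - U (\<Phi> \<tau> m) y)" if "0 \<le> \<tau>" "\<tau> \<le> t" "0 \<le> y" "y \<le> \<rho>" for \<tau> y
      using order_preserved[OF m s \<rho> U_\<rho> _ that(1), of y] ord that by (simp add: right_diff_distrib)
    show "0 < s * (U (\<Phi> 0 m') x - U (\<Phi> 0 m) x)" using mm(3) m by (simp add: \<Phi>_0 right_diff_distrib)
    show "par_ineq C (\<lambda>t x. s * (U (\<Phi> t m') x - U (\<Phi> t m) x)) \<tau> y" if "0 < \<tau>" "\<tau> \<le> t" "0 < y" "y < \<rho>" for \<tau> y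
      by (rule difference_par_ineq[OF m that(1,3,4)])
  qed
  then show False using mm(2) by simp
qed

end

section \<open>Odd nonlinearities\<close>

lemma has_field_derivative_within_Un:
  assumes "(f has_field_derivative D) (at x within S)" "(f has_field_derivative D) (at x within T)"
  shows "(f has_field_derivative D) (at x within (S \<union> T))"
proof -
  have "((\<lambda>y. (f y - f x) / (y - x)) \<longlongrightarrow> D) (at x within (S \<union> T))"
    unfolding at_within_union by (rule filterlim_sup[OF assms[unfolded has_field_derivative_iff]])
  then show ?thesis by (simp only: has_field_derivative_iff)
qed

lemma DERIV_two_sided:
  fixes f :: "real \<Rightarrow> real"
  assumes "(f has_real_derivative D) (at x within {a..x})" "(f has_real_derivative D) (at x within {x..b})" "a < x" "x < b"
  shows "(f has_real_derivative D) (at x)"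
proof -
  have "(f has_real_derivative D) (at x within ({a..x} \<union> {x..b}))"
    using assms(1,2) by (rule has_field_derivative_within_Un)
  moreover have "{a..x} \<union> {x..b} = {a..b}" using assms(3,4) by auto
  moreover have "at x within {a..b} = at x" using assms(3,4) by (intro at_within_interior) simp
  ultimately show ?thesis by simp
qed

text \<open>An odd reflection keeps the slope. It is applied with \<open>e = 0\<close> and
  \<open>e = 2 * L\<close>.\<close>

lemma DERIV_odd_reflection:
  fixes v :: "real \<Rightarrow> real"
  assumes "(v has_real_derivative D) (at (e - x) within {e - b..e - a})"
  shows "((\<lambda>x. - v (e - x)) has_real_derivative D) (at x within {a..b})"
proof -
  have "(v has_real_derivative D) (at (e - x) within (-) e ` {a..b})" using assms by simp
  then have "(v \<circ> (-) e has_real_derivative D * (- 1)) (at x within {a..b})"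
    by (rule DERIV_image_chain) (auto intro!: derivative_eq_intros)
  from DERIV_minus[OF this] show ?thesis by (simp add: o_def)
qed

context minimal_dirichlet_flow
begin

text \<open>Comparison with the zero solution. Used with both signs, it shows that vanishing on
  \<open>{0..\<rho>}\<close> is preserved in time.\<close>

lemma zero_preserved:
  assumes m: "m \<in> M" and s: "\<bar>s\<bar> = 1" and \<rho>: "0 < \<rho>" "\<rho> \<le> L"
    and z: "\<And>m. m \<in> M \<Longrightarrow> U m \<rho> = 0"
    and le: "\<And>x. x \<in> {0..\<rho>} \<Longrightarrow> 0 \<le> s * U m x"
    and t: "0 \<le> t" and x: "x \<in> {0..\<rho>}"
  shows "0 \<le> s * U (\<Phi> t m) x"
proof -
  let ?d = "\<lambda>t x. s * U (\<Phi> t m) x"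
  show "0 \<le> ?d t x"
  proof (rule comparison_principle[where d = ?d and S = "{0..t} \<times> {0..\<rho>}" and C = C])
    show "compact ({0..t} \<times> {0..\<rho>})" by (intro compact_Times compact_Icc)
    show "continuous_on ({0..t} \<times> {0..\<rho>}) (\<lambda>(t, x). ?d t x)"
    proof -
      have "{0..t} \<times> {0..\<rho>} \<subseteq> {0..} \<times> {0..L}" using \<rho> by auto
      note c = continuous_on_subset[OF traj_cont this, unfolded split_def]
      show ?thesis unfolding split_def by (intro continuous_on_mult_left c m)
    qed
    show "(t, x) \<in> {0..t} \<times> {0..\<rho>}" using t x by auto
    fix \<tau> y assume S: "(\<tau>, y) \<in> {0..t} \<times> {0..\<rho>}" and n: "?d \<tau> y < 0"
    have \<tau>: "0 \<le> \<tau>" "y \<in> {0..\<rho>}" using S by auto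
    have "\<tau> \<noteq> 0"
    proof
      assume "\<tau> = 0"
      then show False using n le[OF \<tau>(2)] by (simp add: \<Phi>_0[OF m])
    qed
    moreover have "y \<noteq> 0" using n U_0[OF \<Phi>_in[OF m \<tau>(1)]] by (metis mult_zero_right order_less_irrefl)
    moreover have "y \<noteq> \<rho>" using n z[OF \<Phi>_in[OF m \<tau>(1)]] by (metis mult_zero_right order_less_irrefl)
    ultimately have y: "0 < \<tau>" "\<tau> \<le> t" "0 < y" "y < \<rho>" using S by auto
    have "par_ineq C ?d \<tau> y"
      by (rule par_ineq_cmult, rule par_ineq_single) (use m y \<rho> in auto)
    then have ps: "par_super C ?d \<tau> y" by (rule par_ineq_imp_super)
    define \<delta> where "\<delta> = Min {\<tau>, y, \<rho> - y}"
    have \<delta>: "0 < \<delta>" "\<delta> \<le> \<tau>" "\<delta> \<le> y" "\<delta> \<le> \<rho> - y" using y by (auto simp: \<delta>_def)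
    have "(a, y) \<in> {0..t} \<times> {0..\<rho>}" if "\<tau> - \<delta> < a" "a < \<tau>" for a using that \<delta> y by auto
    moreover have "(\<tau>, z) \<in> {0..t} \<times> {0..\<rho>}" if "\<bar>z - y\<bar> < \<delta>" for z using that \<delta> y by auto
    ultimately show "par_super C ?d \<tau> y \<and> (\<exists>\<delta>>0. (\<forall>s. \<tau> - \<delta> < s \<and> s < \<tau> \<longrightarrow> (s, y) \<in> {0..t} \<times> {0..\<rho>}) \<and>
        (\<forall>ya. \<bar>ya - y\<bar> < \<delta> \<longrightarrow> (\<tau>, ya) \<in> {0..t} \<times> {0..\<rho>}))"
      using ps \<delta>(1) by blast
  qed
qed

lemma U_cont_point: "x \<in> {0..L} \<Longrightarrow> continuous_on M (\<lambda>m. U m x)"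
proof -
  assume x: "x \<in> {0..L}"
  have "continuous_on M (\<lambda>m. (\<lambda>(m, x). U m x) (m, x))"
    by (rule continuous_on_compose2[OF U_cont continuous_on_Pair[OF continuous_on_id continuous_on_const]]) (use x in auto)
  then show ?thesis by simp
qed

text \<open>The elements vanishing on \<open>{0..\<rho>}\<close> form a closed positively invariant
  set that is not all of \<open>M\<close>, hence is empty. So every profile is nonzero somewhere,
  and since its past has the same weak sign, the strong maximum principle makes it strict
  throughout.\<close>

lemma strict_positivity:
  assumes s: "\<bar>s\<bar> = 1" and \<rho>: "0 < \<rho>" "\<rho> \<le> L" and z: "\<And>m. m \<in> M \<Longrightarrow> U m \<rho> = 0"
    and nn: "\<And>m x. m \<in> M \<Longrightarrow> x \<in> {0..\<rho>} \<Longrightarrow> 0 \<le> s * U m x"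
    and nz: "m0 \<in> M" "x0 \<in> {0..\<rho>}" "U m0 x0 \<noteq> 0"
    and m: "m \<in> M" and x: "0 < x" "x < \<rho>"
  shows "0 < s * U m x"
proof -
  define Z where "Z = {m \<in> M. \<forall>x\<in>{0..\<rho>}. U m x = 0}"
  have "Z = {}"
  proof (rule ccontr)
    assume "Z \<noteq> {}"
    have "closedin (top_of_set M) {m \<in> M. U m x = 0}" if "x \<in> {0..\<rho>}" for x
      using continuous_closedin_preimage_constant[OF U_cont_point[of x], of 0] that \<rho> by auto
    then have "closedin (top_of_set M) (\<Inter>x\<in>{0..\<rho>}. {m \<in> M. U m x = 0})" using \<rho> by (intro closedin_INT) auto
    moreover have "0 \<in> {0..\<rho>}" using \<rho> by simp
    then have "(\<Inter>x\<in>{0..\<rho>}. {m \<in> M. U m x = 0}) = Z" unfolding Z_def by blast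
    ultimately have cl: "compact Z" using closedin_compact[OF compact_M] by simp
    have "Z = M"
    proof (rule minimal[OF _ \<open>Z \<noteq> {}\<close> cl])
      show "Z \<subseteq> M" by (auto simp: Z_def)
      fix m t assume m: "m \<in> Z" and t: "0 \<le> (t::real)"
      have mM: "m \<in> M" using m by (simp add: Z_def)
      have "U (\<Phi> t m) x = 0" if x: "x \<in> {0..\<rho>}" for x
      proof -
        have "0 \<le> s * U (\<Phi> t m) x" by (rule zero_preserved[OF mM s \<rho> z nn[OF mM] t x])
        moreover have "0 \<le> - s * U (\<Phi> t m) x" 
          by (rule zero_preserved[OF mM _ \<rho> z _ t x]) (use s m in \<open>auto simp: Z_def\<close>)
        ultimately show ?thesis using s by (simp add: mult_le_0_iff zero_le_mult_iff) linarith
      qed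
      then show "\<Phi> t m \<in> Z" using \<Phi>_in[OF mM t] by (simp add: Z_def)
    qed
    then have "m0 \<in> Z" using nz(1) by simp
    then show False using nz by (simp add: Z_def)
  qed
  then obtain r where r: "r \<in> {0..\<rho>}" "U m r \<noteq> 0" using m by (auto simp: Z_def)
  have r0: "0 < r" "r < \<rho>" using r U_0[OF m] z[OF m] by (cases "r = 0"; cases "r = \<rho>"; auto)+
  have rp: "0 < s * U m r" using nn[OF m r(1)] r(2) s by (auto simp: order_less_le)
  obtain k where k: "k \<in> M" "\<Phi> 1 k = m" using \<Phi>_preimage[OF m, of 1] by auto
  have "\<exists>\<kappa>>0. (\<forall>x\<in>{0..r}. \<kappa> * (x - 0) \<le> s * U (\<Phi> 1 k) x) \<and> (\<forall>x\<in>{r..\<rho>}. \<kappa> * (\<rho> - x) \<le> s * U (\<Phi> 1 k) x)"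
  proof (rule strong_maximum_principle[OF C zero_less_one r0])
    have "{0..1} \<times> {0..\<rho>} \<subseteq> {0..} \<times> {0..L}" using \<rho> by auto
    note c = continuous_on_subset[OF traj_cont this, unfolded split_def]
    show "continuous_on ({0..1} \<times> {0..\<rho>}) (\<lambda>(t, x). s * U (\<Phi> t k) x)"
      unfolding split_def by (intro continuous_on_mult_left c k)
    show "0 \<le> s * U (\<Phi> t k) x" if "0 \<le> t" "t \<le> 1" "0 \<le> x" "x \<le> \<rho>" for t x
      using nn[OF \<Phi>_in[OF k(1) that(1)], of x] that by simp
    show "0 < s * U (\<Phi> 1 k) r" using rp k by simp
    show "par_ineq C (\<lambda>t x. s * U (\<Phi> t k) x) t x" if "0 < t" "t \<le> 1" "0 < x" "x < \<rho>" for t x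
      by (rule par_ineq_cmult, rule par_ineq_single) (use that k \<rho> in auto)
  qed
  then obtain \<kappa> where \<kappa>: "0 < \<kappa>" "\<forall>x\<in>{0..r}. \<kappa> * x \<le> s * U m x" "\<forall>x\<in>{r..\<rho>}. \<kappa> * (\<rho> - x) \<le> s * U m x"
    using k by auto
  show ?thesis
  proof (cases "x \<le> r")
    case True
    have "0 < \<kappa> * x" using \<kappa>(1) x by simp
    also have "\<dots> \<le> s * U m x" using \<kappa>(2) True x by auto
    finally show ?thesis .
  next
    case False
    have "0 < \<kappa> * (\<rho> - x)" using \<kappa>(1) x by simp
    also have "\<dots> \<le> s * U m x" using \<kappa>(3) False x by auto
    finally show ?thesis .
  qed
qed

end

section \<open>Odd extension beyond the boundary\<close>

locale odd_dirichlet_flow = minimal_dirichlet_flow +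
  assumes G_odd: "\<And>m u p. m \<in> M \<Longrightarrow> G (\<pi> m) (- u) p = - G (\<pi> m) u p"
begin

definition clamp_L :: "real \<Rightarrow> real" where "clamp_L x = max 0 (min L x)"

text \<open>The odd extension of \<open>U m\<close> to \<open>{-L..2 * L}\<close>, written so that continuity is evident.\<close>
definition ext :: "'a \<Rightarrow> real \<Rightarrow> real" where
  "ext m x = U m (clamp_L x) - U m (clamp_L (- x)) - U m (clamp_L (2 * L - x))"

definition extx :: "'a \<Rightarrow> real \<Rightarrow> real" where
  "extx m x = (if x < 0 then Ux m (- x) else if x \<le> L then Ux m x else Ux m (2 * L - x))"

lemma ext_eq:
  assumes "m \<in> M"
  shows "x \<in> {- L..0} \<Longrightarrow> ext m x = - U m (0 - x)" "x \<in> {0..L} \<Longrightarrow> ext m x = U m x"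
    "x \<in> {L..2 * L} \<Longrightarrow> ext m x = - U m (2 * L - x)"
proof -
  have c: "clamp_L y = 0" if "y \<le> 0" for y using that L by (simp add: clamp_L_def)
  have d: "clamp_L y = y" if "y \<in> {0..L}" for y using that by (simp add: clamp_L_def)
  have e: "clamp_L y = L" if "L \<le> y" for y using that L by (simp add: clamp_L_def)
  note U0 = U_0[OF assms] U_L[OF assms]
  show "ext m x = - U m (0 - x)" if "x \<in> {- L..0}"
    using c[of x] d[of "- x"] e[of "2 * L - x"] that L U0 by (simp add: ext_def)
  show "ext m x = U m x" if "x \<in> {0..L}"
    using d[of x] c[of "- x"] e[of "2 * L - x"] that L U0 by (simp add: ext_def)
  show "ext m x = - U m (2 * L - x)" if "x \<in> {L..2 * L}"
    using e[of x] c[of "- x"] d[of "2 * L - x"] that L U0 by (simp add: ext_def)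
qed

lemma ext_bound:
  assumes m: "m \<in> M" and x: "x \<in> {- L..2 * L}"
  shows "\<bar>ext m x\<bar> \<le> \<beta>" "\<bar>extx m x\<bar> \<le> \<beta>"
proof -
  consider "x \<in> {- L..0}" "x < 0" | "x \<in> {0..L}" | "x \<in> {L..2 * L}" "L < x" using x by force
  then have "\<bar>ext m x\<bar> \<le> \<beta> \<and> \<bar>extx m x\<bar> \<le> \<beta>"
  proof cases
    case 1
    then show ?thesis using U_bound[OF m, of "- x"] ext_eq(1)[OF m 1(1)] by (simp add: extx_def)
  next
    case 2
    then show ?thesis using U_bound[OF m, of "x"] ext_eq(2)[OF m 2] by (simp add: extx_def)
  next
    case 3
    then show ?thesis using U_bound[OF m, of "2 * L - x"] ext_eq(3)[OF m 3(1)] L by (simp add: extx_def)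
  qed
  then show "\<bar>ext m x\<bar> \<le> \<beta>" "\<bar>extx m x\<bar> \<le> \<beta>" by auto
qed

lemma clamp_L_in: "clamp_L x \<in> {0..L}" using L by (auto simp: clamp_L_def)

lemma ext_cont: "continuous_on (M \<times> UNIV) (\<lambda>(m, x). ext m x)"
proof -
  have "continuous_on (M \<times> UNIV) (\<lambda>z. (\<lambda>(m, x). U m x) (fst z, clamp_L (g (snd z))))"
    if "continuous_on UNIV g" for g
  proof (rule continuous_on_compose2[OF U_cont])
    have "continuous_on (M \<times> UNIV) (\<lambda>z. g (snd z))"
      by (rule continuous_on_compose2[OF that continuous_on_snd[OF continuous_on_id]]) auto
    then show "continuous_on (M \<times> UNIV) (\<lambda>z. (fst z, clamp_L (g (snd z))))"
      unfolding clamp_L_def by (intro continuous_intros)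
    show "(\<lambda>z. (fst z, clamp_L (g (snd z)))) ` (M \<times> UNIV) \<subseteq> M \<times> {0..L}" using clamp_L_in by auto
  qed
  note c = this
  have "continuous_on UNIV (\<lambda>x::real. x)" "continuous_on UNIV (\<lambda>x::real. - x)" "continuous_on UNIV (\<lambda>x. 2 * L - x)"
    by (intro continuous_intros)+
  from continuous_on_diff[OF continuous_on_diff[OF c[OF this(1)] c[OF this(2)]] c[OF this(3)]]
  show ?thesis unfolding ext_def split_def fst_conv snd_conv .
qed

text \<open>The reflected pieces have the same one-sided slopes at 0 and at \<open>L\<close>, so
  they fit together to a differentiable function.\<close>

lemma ext_deriv:
  assumes m: "m \<in> M" and x: "- L < x" "x < 2 * L"
  shows "(ext m has_real_derivative extx m x) (at x)"
proof -
  have piece1: "(ext m has_real_derivative Ux m (- x)) (at x within {- L..0})" if "x \<in> {- L..0}" for x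
  proof -
    have "((\<lambda>x. - U m (0 - x)) has_real_derivative Ux m (- x)) (at x within {- L..0})"
      using U_deriv[OF m, of "- x"] that by (intro DERIV_odd_reflection) simp
    then show ?thesis
      by (rule has_field_derivative_transform_within[OF _ zero_less_one]) (use that ext_eq(1)[OF m] in auto)
  qed
  have piece2: "(ext m has_real_derivative Ux m x) (at x within {0..L})" if "x \<in> {0..L}" for x
    by (rule has_field_derivative_transform_within[OF U_deriv[OF m that] zero_less_one]) (use that ext_eq(2)[OF m] in auto)
  have piece3: "(ext m has_real_derivative Ux m (2 * L - x)) (at x within {L..2 * L})" if "x \<in> {L..2 * L}" for x
  proof -
    have "((\<lambda>x. - U m (2 * L - x)) has_real_derivative Ux m (2 * L - x)) (at x within {L..2 * L})"
      using U_deriv[OF m, of "2 * L - x"] that by (intro DERIV_odd_reflection) simp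
    then show ?thesis
      by (rule has_field_derivative_transform_within[OF _ zero_less_one]) (use that ext_eq(3)[OF m] in auto)
  qed
  consider "x < 0" | "x = 0" | "0 < x" "x < L" | "x = L" | "L < x" by linarith
  then show ?thesis
  proof cases
    case 1
    then have "at x within {- L..0} = at x" using x by (intro at_within_interior) simp
    with \<open>x < 0\<close> 1 show ?thesis using piece1[of x] x by (simp add: extx_def)
  next
    case 2
    then show ?thesis using DERIV_two_sided[of "ext m" "Ux m 0" 0 "- L" L]
      piece1[of 0] piece2[of 0] L by (simp add: extx_def)
  next
    case 3
    then have "at x within {0..L} = at x" using x by (intro at_within_interior) simp
    with 3 show ?thesis using piece2[of x] x by (simp add: extx_def)
  next
    case 4
    then show ?thesis using DERIV_two_sided[of "ext m" "Ux m L" L 0 "2 * L"]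
      piece3[of L] piece2[of L] L by (simp add: extx_def)
  next
    case 5
    then have "at x within {L..2 * L} = at x" using x by (intro at_within_interior) simp
    with 5 show ?thesis using piece3[of x] x L by (simp add: extx_def)
  qed
qed

text \<open>By oddness the symmetric second difference is identically zero near the point.\<close>

lemma has_sym_deriv2_odd_point:
  assumes "0 < \<delta>" "\<And>h. 0 < h \<Longrightarrow> h < \<delta> \<Longrightarrow> v (x + h) = - v (x - h)" "v x = 0"
  shows "has_sym_deriv2 v x 0"
  unfolding has_sym_deriv2_def
proof (rule tendsto_eventually)
  show "\<forall>\<^sub>F h in at_right 0. (v (x + h) + v (x - h) - 2 * v x) / h\<^sup>2 = 0"
    unfolding eventually_at_right_field using assms by (intro exI[of _ \<delta>]) simp
qed

text \<open>At reflected points an odd reflection has the same slope and opposite value, time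
  derivative and second derivative, so oddness of \<open>G\<close> in \<open>u\<close> reproduces
  the equation. At 0 and \<open>L\<close> these three vanish, and so does \<open>G\<close>, whatever
  the slope.\<close>

lemma ext_pde:
  assumes m: "m \<in> M" and t: "0 < t" and x: "- L < x" "x < 2 * L"
  shows "\<exists>ut uxx. ((\<lambda>s. ext (\<Phi> s m) x) has_real_derivative ut) (at t) \<and> has_sym_deriv2 (ext (\<Phi> t m)) x uxx \<and>
        ut = uxx + G (\<pi> (\<Phi> t m)) (ext (\<Phi> t m) x) (extx (\<Phi> t m) x)"
proof -
  have in': "\<Phi> s m \<in> M" if "0 < s" for s using \<Phi>_in[OF m, of s] that by simp
  note mt = in'[OF t]
  have tr: "((\<lambda>s. ext (\<Phi> s m) x) has_real_derivative D) (at t)"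
    if "(f has_real_derivative D) (at t)" "\<And>s. 0 < s \<Longrightarrow> f s = ext (\<Phi> s m) x" for f D
    by (rule has_field_derivative_transform_within_open[OF that(1), of "{0<..}"]) (use t that(2) in auto)
  have refl: ?thesis
    if y: "0 < y" "y < L" and e: "y = e - x" and ev: "\<And>s. 0 < s \<Longrightarrow> ext (\<Phi> s m) x = - U (\<Phi> s m) (e - x)"
      and ex: "\<And>z. \<bar>z - x\<bar> < \<delta> \<Longrightarrow> ext (\<Phi> t m) z = - U (\<Phi> t m) (e - z)" and \<delta>: "0 < \<delta>"
      and exx: "extx (\<Phi> t m) x = Ux (\<Phi> t m) y" for y e \<delta>
  proof -
    obtain a b where ab: "((\<lambda>s. U (\<Phi> s m) y) has_real_derivative a) (at t)" "has_sym_deriv2 (U (\<Phi> t m)) y b"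
     "a = b + G (\<pi> (\<Phi> t m)) (U (\<Phi> t m) y) (Ux (\<Phi> t m) y)" using pde[OF m t y] by blast
    have "((\<lambda>s. ext (\<Phi> s m) x) has_real_derivative - a) (at t)"
      by (rule tr[OF DERIV_minus[OF ab(1)]]) (use ev e in auto)
    moreover have "has_sym_deriv2 (ext (\<Phi> t m)) x (-1 * b)"
      by (rule has_sym_deriv2_cong[OF has_sym_deriv2_cmult[OF has_sym_deriv2_reflect[of _ e]] \<delta>])
        (use ab(2) e ex in auto)
    moreover have "- a = -1 * b + G (\<pi> (\<Phi> t m)) (ext (\<Phi> t m) x) (extx (\<Phi> t m) x)"
      using G_odd[OF mt] ev[OF t] ab(3) exx e by simp
    ultimately show ?thesis by blast
  qed
  have odd: ?thesis if z: "\<And>s. 0 < s \<Longrightarrow> ext (\<Phi> s m) x = 0"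
      and o: "\<And>h. 0 < h \<Longrightarrow> h < L \<Longrightarrow> ext (\<Phi> t m) (x + h) = - ext (\<Phi> t m) (x - h)"
  proof -
    have "((\<lambda>s. ext (\<Phi> s m) x) has_real_derivative 0) (at t)"
      by (rule tr[of "\<lambda>_. 0"]) (use z in auto)
    moreover have "has_sym_deriv2 (ext (\<Phi> t m)) x 0"
      by (rule has_sym_deriv2_odd_point[OF L]) (use z t o in auto)
    moreover have "0 = 0 + G (\<pi> (\<Phi> t m)) (ext (\<Phi> t m) x) (extx (\<Phi> t m) x)"
      using G_0[OF mt] z[OF t] by simp
    ultimately show ?thesis by blast
  qed
  consider "x < 0" | "x = 0" | "0 < x" "x < L" | "x = L" | "L < x" by linarith
  then show ?thesis
  proof cases
    case 1
    show ?thesis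
    proof (rule refl[of "0 - x" 0 "min (- x) (x + L)"])
      show "ext (\<Phi> s m) x = - U (\<Phi> s m) (0 - x)" if "0 < s" for s
        using ext_eq(1)[OF in'[OF that], of x] 1 x by simp
      show "ext (\<Phi> t m) z = - U (\<Phi> t m) (0 - z)" if "\<bar>z - x\<bar> < min (- x) (x + L)" for z
        by (rule ext_eq(1)[OF mt]) (use that in auto)
    qed (use 1 x in \<open>auto simp: extx_def\<close>)
  next
    case 2
    show ?thesis
    proof (rule odd)
      show "ext (\<Phi> s m) x = 0" if "0 < s" for s
        using ext_eq(2)[OF in'[OF that], of x] 2 L U_0[OF in'[OF that]] by simp
      show "ext (\<Phi> t m) (x + h) = - ext (\<Phi> t m) (x - h)" if "0 < h" "h < L" for h
        using ext_eq(2)[OF mt, of h] ext_eq(1)[OF mt, of "- h"] 2 that by simp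
    qed
  next
    case 3
    obtain a b where ab: "((\<lambda>s. U (\<Phi> s m) x) has_real_derivative a) (at t)" "has_sym_deriv2 (U (\<Phi> t m)) x b"
     "a = b + G (\<pi> (\<Phi> t m)) (U (\<Phi> t m) x) (Ux (\<Phi> t m) x)" using pde[OF m t 3] by blast
    have "((\<lambda>s. ext (\<Phi> s m) x) has_real_derivative a) (at t)"
      by (rule tr[OF ab(1)]) (use ext_eq(2)[OF in'] 3 in auto)
    moreover have "has_sym_deriv2 (ext (\<Phi> t m)) x b"
    proof (rule has_sym_deriv2_cong[OF ab(2), of "min x (L - x)"])
      show "ext (\<Phi> t m) y = U (\<Phi> t m) y" if "\<bar>y - x\<bar> < min x (L - x)" for y
        by (rule ext_eq(2)[OF mt]) (use that in auto)
    qed (use 3 in auto)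
    moreover have "a = b + G (\<pi> (\<Phi> t m)) (ext (\<Phi> t m) x) (extx (\<Phi> t m) x)"
      using ab(3) ext_eq(2)[OF mt, of x] 3 by (simp add: extx_def)
    ultimately show ?thesis by blast
  next
    case 4
    show ?thesis
    proof (rule odd)
      show "ext (\<Phi> s m) x = 0" if "0 < s" for s
        using ext_eq(2)[OF in'[OF that], of x] 4 L U_L[OF in'[OF that]] by simp
      show "ext (\<Phi> t m) (x + h) = - ext (\<Phi> t m) (x - h)" if "0 < h" "h < L" for h
        using ext_eq(3)[OF mt, of "L + h"] ext_eq(2)[OF mt, of "L - h"] 4 that by simp
    qed
  next
    case 5
    show ?thesis
    proof (rule refl[of "2 * L - x" "2 * L" "min (2 * L - x) (x - L)"])
      show "ext (\<Phi> s m) x = - U (\<Phi> s m) (2 * L - x)" if "0 < s" for s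
        using ext_eq(3)[OF in'[OF that], of x] 5 x by simp
      show "ext (\<Phi> t m) z = - U (\<Phi> t m) (2 * L - z)" if "\<bar>z - x\<bar> < min (2 * L - x) (x - L)" for z
        by (rule ext_eq(3)[OF mt]) (use that in auto)
    qed (use 5 x L in \<open>auto simp: extx_def\<close>)
  qed
qed

text \<open>Even about \<open>a\<close>, with twice the value of \<open>ext m\<close> there, and with Neumann conditions at \<open>a\<close> and \<open>a + L\<close>.\<close>
definition point_sum :: "real \<Rightarrow> 'a \<Rightarrow> real \<Rightarrow> real" where
  "point_sum a m x = ext m x + ext m (2 * a - x)"

text \<open>\<open>- ext m (2 * a - x)\<close> solves the same equation as \<open>ext m x\<close>,
  so the sum is a difference of two solutions.\<close>

lemma point_sum_par_ineq:
  assumes m: "m \<in> M" and t: "0 < t" and a: "0 < a" "a < L" and x: "a - L < x" "x < a + L"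
  shows "par_ineq C (\<lambda>t. point_sum a (\<Phi> t m)) t x"
proof -
  have mt: "\<Phi> t m \<in> M" using \<Phi>_in m t by simp
  let ?y = "2 * a - x"
  have xy: "- L < x" "x < 2 * L" "- L < ?y" "?y < 2 * L" using a x by auto
  obtain a1 b1 where 1: "((\<lambda>s. ext (\<Phi> s m) x) has_real_derivative a1) (at t)" "has_sym_deriv2 (ext (\<Phi> t m)) x b1"
     "a1 = b1 + G (\<pi> (\<Phi> t m)) (ext (\<Phi> t m) x) (extx (\<Phi> t m) x)" using ext_pde[OF m t xy(1,2)] by blast
  obtain a2 b2 where 2: "((\<lambda>s. ext (\<Phi> s m) ?y) has_real_derivative a2) (at t)" "has_sym_deriv2 (ext (\<Phi> t m)) ?y b2"
     "a2 = b2 + G (\<pi> (\<Phi> t m)) (ext (\<Phi> t m) ?y) (extx (\<Phi> t m) ?y)" using ext_pde[OF m t xy(3,4)] by blast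
  have "((\<lambda>x. ext (\<Phi> t m) (2 * a - x)) has_real_derivative extx (\<Phi> t m) ?y * (- 1)) (at x)"
    by (rule DERIV_chain2[where f = "ext (\<Phi> t m)" and g = "\<lambda>x. 2 * a - x", OF ext_deriv[OF mt xy(3,4)]])
      (auto intro!: derivative_eq_intros)
  then have dx: "(point_sum a (\<Phi> t m) has_real_derivative extx (\<Phi> t m) x - extx (\<Phi> t m) ?y) (at x)"
    unfolding point_sum_def using DERIV_add[OF ext_deriv[OF mt xy(1,2)]] by fastforce
  have dxx: "has_sym_deriv2 (point_sum a (\<Phi> t m)) x (b1 - (- 1) * b2)"
    using has_sym_deriv2_diff[OF 1(2) has_sym_deriv2_cmult[OF has_sym_deriv2_reflect[OF 2(2)], of "- 1"]]
    unfolding point_sum_def by simp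
  have dt: "((\<lambda>s. point_sum a (\<Phi> s m) x) has_real_derivative a1 + a2) (at t)"
    unfolding point_sum_def by (rule DERIV_add[OF 1(1) 2(1)])
  have "\<bar>G (\<pi> (\<Phi> t m)) (ext (\<Phi> t m) x) (extx (\<Phi> t m) x) - G (\<pi> (\<Phi> t m)) (- ext (\<Phi> t m) ?y) (extx (\<Phi> t m) ?y)\<bar>
      \<le> C * (\<bar>ext (\<Phi> t m) x - - ext (\<Phi> t m) ?y\<bar> + \<bar>extx (\<Phi> t m) x - extx (\<Phi> t m) ?y\<bar>)"
    using ext_bound[OF mt, of x] ext_bound[OF mt, of ?y] xy by (intro lipschitz[OF mt]) auto
  then have "\<bar>(a1 + a2) - (b1 - (- 1) * b2)\<bar> \<le> C * (\<bar>point_sum a (\<Phi> t m) x\<bar> + \<bar>extx (\<Phi> t m) x - extx (\<Phi> t m) ?y\<bar>)"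
    using G_odd[OF mt] by (simp add: 1(3) 2(3) point_sum_def)
  then show ?thesis unfolding par_ineq_def using dt dx dxx by (intro exI conjI)
qed

text \<open>At \<open>a\<close> by evenness about \<open>a\<close>. At \<open>a + L\<close> because
  its mirror image \<open>a - L\<close> is a full period \<open>2 * L\<close> away, where the slope
  of the odd extension is the same.\<close>

lemma point_sum_neumann:
  assumes m: "m \<in> M" and a: "0 < a" "a < L"
  shows "(point_sum a m has_real_derivative 0) (at a)" "(point_sum a m has_real_derivative 0) (at (a + L))"
proof -
  have d: "(point_sum a m has_real_derivative extx m x - extx m (2 * a - x)) (at x)" if x: "a - L \<le> x" "x \<le> a + L" for x
  proof -
    have "((\<lambda>x. ext m (2 * a - x)) has_real_derivative extx m (2 * a - x) * (- 1)) (at x)"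
      by (rule DERIV_chain2[where f = "ext m" and g = "\<lambda>x. 2 * a - x", OF ext_deriv[OF m]])
        (use a x in \<open>auto intro!: derivative_eq_intros\<close>)
    moreover have "(ext m has_real_derivative extx m x) (at x)" using a x by (intro ext_deriv[OF m]) auto
    ultimately show ?thesis unfolding point_sum_def using DERIV_add by fastforce
  qed
  show "(point_sum a m has_real_derivative 0) (at a)" using d[of a] L by simp
  have "extx m (a + L) = extx m (2 * a - (a + L))" using a by (simp add: extx_def)
  then show "(point_sum a m has_real_derivative 0) (at (a + L))" using d[of "a + L"] L by simp
qed

lemma point_sum_cont_point: "continuous_on M (\<lambda>m. point_sum a m x)"
proof -
  have "continuous_on M (\<lambda>m. (\<lambda>(m, x). ext m x) (m, y))" for y
    by (rule continuous_on_compose2[OF ext_cont continuous_on_Pair[OF continuous_on_id continuous_on_const]]) auto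
  from continuous_on_add[OF this this, of x "2 * a - x"] show ?thesis unfolding point_sum_def by simp
qed

lemma point_sum_traj_cont:
  assumes m: "m \<in> M" shows "continuous_on ({0..} \<times> UNIV) (\<lambda>(t, x). point_sum a (\<Phi> t m) x)"
proof -
  have c: "continuous_on ({0..} \<times> UNIV) (\<lambda>z. \<Phi> (fst z) m)"
    by (rule continuous_on_compose2[OF \<Phi>_cont_time[OF m] continuous_on_fst[OF continuous_on_id]]) auto
  have "continuous_on ({0..} \<times> UNIV) (\<lambda>z. (\<lambda>(m, x). ext m x) (\<Phi> (fst z) m, g (snd z)))" if "continuous_on UNIV g" for g
  proof (rule continuous_on_compose2[OF ext_cont continuous_on_Pair[OF c]])
    show "continuous_on ({0..} \<times> UNIV) (\<lambda>z. g (snd z))"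
      by (rule continuous_on_compose2[OF that continuous_on_snd[OF continuous_on_id]]) auto
  qed (use \<Phi>_in[OF m] in auto)
  note c = this
  have "continuous_on UNIV (\<lambda>x::real. x)" "continuous_on UNIV (\<lambda>x. 2 * a - x)" by (intro continuous_intros)+
  from continuous_on_add[OF c[OF this(1)] c[OF this(2)]]
  show ?thesis unfolding point_sum_def split_def fst_conv snd_conv .
qed

end

text \<open>The last witness is dropped, so the sign \<open>s\<close> at the first one is
  kept.\<close>

lemma sign_changes_Suc_imp: "sign_changes w l r s (Suc n) \<Longrightarrow> sign_changes w l r s n"
  unfolding sign_changes_def by (meson le_Suc_eq less_Suc_eq)

lemma sign_changes_le: "sign_changes w l r s n \<Longrightarrow> k \<le> n \<Longrightarrow> sign_changes w l r s k"
  by (induction n) (auto simp: le_Suc_eq dest: sign_changes_Suc_imp)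

text \<open>A point of the wrong sign before the first point of a maximal alternation would prolong it.\<close>
lemma sign_before_alternation:
  assumes x: "\<And>i. i \<le> n \<Longrightarrow> x i \<in> {l..r} \<and> 0 < s * (-1) ^ i * w (x i)" "\<And>i. i < n \<Longrightarrow> x i < x (Suc i)"
    and n: "\<not> sign_changes w l r (- s) (Suc n)" and z: "z \<in> {l..x 0}"
  shows "0 \<le> s * w z"
proof (rule ccontr)
  assume neg: "\<not> 0 \<le> s * w z"
  have "z \<noteq> x 0" using neg x(1)[of 0] by auto
  then have zx: "z < x 0" using z by simp
  let ?y = "\<lambda>i. case i of 0 \<Rightarrow> z | Suc j \<Rightarrow> x j"
  have "?y i \<in> {l..r} \<and> 0 < - s * (-1) ^ i * w (?y i)" if "i \<le> Suc n" for i
  proof (cases i)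
    case 0
    then show ?thesis using neg z x(1)[of 0] by auto
  next
    case (Suc j)
    then show ?thesis using x(1)[of j] that by auto
  qed
  moreover have "?y i < ?y (Suc i)" if "i < Suc n" for i
    using that zx x(2) by (cases i) auto
  ultimately have "sign_changes w l r (- s) (Suc n)" unfolding sign_changes_def by (intro exI[of _ ?y]) auto
  with n show False by simp
qed

section \<open>Alternations of the sum with the reflection about a point\<close>

context odd_dirichlet_flow
begin

lemma point_sum_traj_cont_on:
  assumes m: "m \<in> M" and t: "0 \<le> t1" shows "continuous_on ({t1..t2} \<times> X) (\<lambda>(t, x). point_sum a (\<Phi> t m) x)"
  by (rule continuous_on_subset[OF point_sum_traj_cont[OF m]]) (use t in auto)

lemma point_sum_sign_changes_antimono:
  assumes m: "m \<in> M" and a: "0 < a" "a < L" and t: "0 \<le> t" and s: "\<bar>s\<bar> = 1"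
    and sc: "sign_changes (point_sum a (\<Phi> t m)) a (a + L) s n"
  shows "sign_changes (point_sum a m) a (a + L) s n"
proof -
  have "sign_changes (point_sum a (\<Phi> 0 m)) a (a + L) s n"
  proof (rule sign_changes_antimono[OF C t, where w = "\<lambda>t. point_sum a (\<Phi> t m)"])
    show "continuous_on ({0..t} \<times> {a..a + L}) (\<lambda>(t, x). point_sum a (\<Phi> t m) x)"
      by (rule point_sum_traj_cont_on[OF m order_refl])
    show "par_ineq C (\<lambda>t. point_sum a (\<Phi> t m)) t x" if "0 < t" "a < x" "x < a + L" for t x
      by (rule point_sum_par_ineq[OF m that(1) a]) (use that L in auto)
    fix \<tau> :: real assume "0 < \<tau>"
    then have "\<Phi> \<tau> m \<in> M" using \<Phi>_in[OF m] by simp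
    note nm = point_sum_neumann[OF this a, THEN has_field_derivative_at_within]
    show "s * point_sum a (\<Phi> \<tau> m) a \<le> 0 \<or> (point_sum a (\<Phi> \<tau> m) has_real_derivative 0) (at a within {a..a + L})"
      "s * (-1) ^ n * point_sum a (\<Phi> \<tau> m) (a + L) \<le> 0 \<or> (point_sum a (\<Phi> \<tau> m) has_real_derivative 0) (at (a + L) within {a..a + L})"
      using nm by blast+
  qed (use L s sc in auto)
  then show ?thesis using \<Phi>_0[OF m] by simp
qed

text \<open>The elements without the alternations form a closed set, since alternations are
  witnessed by strict inequalities, and a positively invariant one, since alternations do not
  increase. By minimality it is empty or all of \<open>M\<close>.\<close>

lemma sign_changes_all_or_none:
  assumes a: "0 < a" "a < L" and s: "\<bar>s\<bar> = 1" and m0: "m0 \<in> M" "sign_changes (point_sum a m0) a (a + L) s n" and m: "m \<in> M"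
  shows "sign_changes (point_sum a m) a (a + L) s n"
proof (rule ccontr)
  assume ns: "\<not> ?thesis"
  define Z where "Z = {m \<in> M. \<not> sign_changes (point_sum a m) a (a + L) s n}"
  define X where "X = {x. (\<forall>i\<le>n. x i \<in> {a..a + L}) \<and> (\<forall>i<n. x i < x (Suc i))}"
  have cl1: "closedin (top_of_set M) {m \<in> M. s * (-1) ^ i * point_sum a m y \<le> 0}" for i :: nat and y
  proof -
    have "continuous_on M (\<lambda>m. s * (-1) ^ i * point_sum a m y)"
      by (intro continuous_on_mult_left point_sum_cont_point)
    from continuous_closedin_preimage[OF this closed_atMost[of 0]] show ?thesis by (simp add: Int_def vimage_def)
  qed
  \<comment> \<open>Inserting \<open>M\<close> guarantees that the family to be intersected is
    nonempty.\<close>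
  have "closedin (top_of_set M) (\<Inter> (insert M ((\<lambda>x. \<Union>i\<in>{..n}. {m \<in> M. s * (-1) ^ i * point_sum a m (x i) \<le> 0}) ` X)))"
    using cl1 by (intro closedin_Inter) (auto intro!: closedin_Union)
  then have "closedin (top_of_set M) (M \<inter> (\<Inter>x\<in>X. \<Union>i\<in>{..n}. {m \<in> M. s * (-1) ^ i * point_sum a m (x i) \<le> 0}))"
    by simp
  moreover have "M \<inter> (\<Inter>x\<in>X. \<Union>i\<in>{..n}. {m \<in> M. s * (-1) ^ i * point_sum a m (x i) \<le> 0}) = Z"
  proof (intro equalityI subsetI)
    fix k assume k: "k \<in> Z"
    have "\<exists>i\<in>{..n}. s * (-1) ^ i * point_sum a k (x i) \<le> 0" if x: "x \<in> X" for x
    proof (rule ccontr)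
      assume "\<not> ?thesis"
      then have "\<forall>i\<le>n. 0 < s * (-1) ^ i * point_sum a k (x i)" by (auto simp: not_le)
      then have "sign_changes (point_sum a k) a (a + L) s n"
        using x unfolding sign_changes_def X_def by (intro exI[of _ x]) auto
      with k show False by (simp add: Z_def)
    qed
    then show "k \<in> M \<inter> (\<Inter>x\<in>X. \<Union>i\<in>{..n}. {m \<in> M. s * (-1) ^ i * point_sum a m (x i) \<le> 0})"
      using k by (simp add: Z_def)
  next
    fix k assume k: "k \<in> M \<inter> (\<Inter>x\<in>X. \<Union>i\<in>{..n}. {m \<in> M. s * (-1) ^ i * point_sum a m (x i) \<le> 0})"
    have "\<not> sign_changes (point_sum a k) a (a + L) s n"
    proof
      assume "sign_changes (point_sum a k) a (a + L) s n"
      then obtain x where x: "\<And>i. i \<le> n \<Longrightarrow> x i \<in> {a..a + L} \<and> 0 < s * (-1) ^ i * point_sum a k (x i)" "\<And>i. i < n \<Longrightarrow> x i < x (Suc i)"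
        unfolding sign_changes_def by blast
      then have "x \<in> X" by (simp add: X_def)
      then obtain i where "i \<le> n" "s * (-1) ^ i * point_sum a k (x i) \<le> 0" using k by auto
      then show False using x(1)[of i] by simp
    qed
    then show "k \<in> Z" using k by (simp add: Z_def)
  qed
  ultimately have cl: "compact Z" using closedin_compact[OF compact_M] by simp
  have "Z = M"
  proof (rule minimal[OF _ _ cl])
    show "Z \<subseteq> M" "Z \<noteq> {}" using m ns by (auto simp: Z_def)
    show "\<Phi> t k \<in> Z" if "k \<in> Z" "0 \<le> t" for k t
      using that point_sum_sign_changes_antimono[OF _ a that(2) s] \<Phi>_in by (auto simp: Z_def)
  qed
  then have "m0 \<in> Z" using m0(1) by simp
  then show False using m0(2) by (simp add: Z_def)
qed

text \<open>Pasts of length \<open>n\<close> exist inside \<open>M\<close>, where every sum is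
  bounded by \<open>2 * \<beta>\<close>. As the number in \<open>sign_changes_bounded\<close> is
  chosen before the solutions, one \<open>K\<close> serves all of \<open>M\<close>.\<close>

lemma finitely_many_sign_changes:
  assumes a: "0 < a" "a < L"
  obtains K where "\<And>m s. m \<in> M \<Longrightarrow> \<bar>s\<bar> = 1 \<Longrightarrow> \<not> sign_changes (point_sum a m) a (a + L) s K"
proof (rule sign_changes_bounded[OF C, of a "a + L"])
  show "a < a + L" using L by simp
  fix K
  assume K: "\<And>s v Bd W. \<bar>s\<bar> = 1 \<Longrightarrow> (\<And>n. W n (real n) = v) \<Longrightarrow>
    (\<And>n x. x \<in> {a..a + L} \<Longrightarrow> \<bar>W n 0 x\<bar> \<le> Bd) \<Longrightarrow>
    (\<And>n. continuous_on ({0..real n} \<times> {a..a + L}) (\<lambda>(t, x). W n t x)) \<Longrightarrow>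
    (\<And>n t x. 0 < t \<Longrightarrow> t \<le> real n \<Longrightarrow> a < x \<Longrightarrow> x < a + L \<Longrightarrow> par_ineq C (W n) t x) \<Longrightarrow>
    (\<And>n t. 0 < t \<Longrightarrow> t \<le> real n \<Longrightarrow> W n t a = 0 \<or> (W n t has_real_derivative 0) (at a within {a..a + L})) \<Longrightarrow>
    (\<And>n t. 0 < t \<Longrightarrow> t \<le> real n \<Longrightarrow> W n t (a + L) = 0 \<or> (W n t has_real_derivative 0) (at (a + L) within {a..a + L})) \<Longrightarrow>
    \<not> sign_changes v a (a + L) s K"
  show thesis
  proof (rule that[of K])
    fix m and s :: real assume m: "m \<in> M" and s: "\<bar>s\<bar> = 1"
    have "\<exists>k. k \<in> M \<and> \<Phi> (real n) k = m" for n using \<Phi>_preimage[OF m, of "real n"] by auto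
    then obtain k where k: "\<And>n. k n \<in> M" "\<And>n. \<Phi> (real n) (k n) = m" by metis
    show "\<not> sign_changes (point_sum a m) a (a + L) s K"
    proof (rule K[OF s, where W = "\<lambda>n t. point_sum a (\<Phi> t (k n))" and Bd = "2 * \<beta>"])
      show "point_sum a (\<Phi> (real n) (k n)) = point_sum a m" for n by (simp add: k)
      show "\<bar>point_sum a (\<Phi> 0 (k n)) x\<bar> \<le> 2 * \<beta>" if "x \<in> {a..a + L}" for n x
        using ext_bound(1)[OF k(1), of x n] ext_bound(1)[OF k(1), of "2 * a - x" n] that a
        by (simp add: \<Phi>_0 k point_sum_def)
      show "continuous_on ({0..real n} \<times> {a..a + L}) (\<lambda>(t, x). point_sum a (\<Phi> t (k n)) x)" for n
        by (rule point_sum_traj_cont_on[OF k(1) order_refl])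
      show "par_ineq C (\<lambda>t. point_sum a (\<Phi> t (k n))) t x" if "0 < t" "a < x" "x < a + L" for n t x
        by (rule point_sum_par_ineq[OF k(1) that(1) a]) (use that L in auto)
      fix n and \<tau> :: real assume "0 < \<tau>"
      then have "\<Phi> \<tau> (k n) \<in> M" using \<Phi>_in[OF k(1)] by simp
      note nm = point_sum_neumann[OF this a, THEN has_field_derivative_at_within]
      show "point_sum a (\<Phi> \<tau> (k n)) a = 0 \<or> (point_sum a (\<Phi> \<tau> (k n)) has_real_derivative 0) (at a within {a..a + L})"
        "point_sum a (\<Phi> \<tau> (k n)) (a + L) = 0 \<or> (point_sum a (\<Phi> \<tau> (k n)) has_real_derivative 0) (at (a + L) within {a..a + L})"
        using nm by blast+
    qed
  qed
qed

text \<open>\<open>n\<close> is the largest number of alternations that \<open>m0\<close> has with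
  either first sign; by the dichotomy it is shared by all of \<open>M\<close>. The last conclusion
  carries \<open>- s\<close> because a further point on the left reverses the first sign.\<close>

lemma constant_sign_changes:
  assumes a: "0 < a" "a < L" and nz: "m0 \<in> M" "x0 \<in> {a..a + L}" "point_sum a m0 x0 \<noteq> 0"
  obtains n s where "\<bar>s\<bar> = 1" "\<And>m. m \<in> M \<Longrightarrow> sign_changes (point_sum a m) a (a + L) s n"
    "\<And>m. m \<in> M \<Longrightarrow> \<not> sign_changes (point_sum a m) a (a + L) (- s) (Suc n)"
proof -
  obtain K where K: "\<And>m s. m \<in> M \<Longrightarrow> \<bar>s\<bar> = 1 \<Longrightarrow> \<not> sign_changes (point_sum a m) a (a + L) s K"
    using finitely_many_sign_changes[OF a] by metis
  define P where "P n \<longleftrightarrow> (\<exists>s. \<bar>s\<bar> = 1 \<and> sign_changes (point_sum a m0) a (a + L) s n)" for n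
  have "P 0" unfolding P_def
  proof (intro exI conjI)
    show "\<bar>sgn (point_sum a m0 x0)\<bar> = 1" using nz(3) by (simp add: abs_sgn_eq)
    show "sign_changes (point_sum a m0) a (a + L) (sgn (point_sum a m0 x0)) 0"
      unfolding sign_changes_def using nz by (intro exI[of _ "\<lambda>_. x0"]) (auto simp: sgn_if)
  qed
  moreover have bd: "n \<le> K" if Pn: "P n" for n
  proof (rule ccontr)
    assume "\<not> n \<le> K"
    obtain s where s: "\<bar>s\<bar> = 1" "sign_changes (point_sum a m0) a (a + L) s n" using Pn unfolding P_def by blast
    have "sign_changes (point_sum a m0) a (a + L) s K" using s(2) by (rule sign_changes_le) (use \<open>\<not> n \<le> K\<close> in simp)
    then show False using K[OF nz(1) s(1)] by simp
  qed
  ultimately have "P (GREATEST n. P n)" by (rule GreatestI_nat)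
  then obtain s where s: "\<bar>s\<bar> = 1" "sign_changes (point_sum a m0) a (a + L) s (GREATEST n. P n)" unfolding P_def by blast
  have "\<not> P (Suc (GREATEST n. P n))"
  proof
    assume "P (Suc (GREATEST n. P n))"
    then have "Suc (GREATEST n. P n) \<le> (GREATEST n. P n)" using bd by (rule Greatest_le_nat)
    then show False by simp
  qed
  then have ns: "\<not> sign_changes (point_sum a m0) a (a + L) (- s) (Suc (GREATEST n. P n))"
    using s(1) unfolding P_def by auto
  show thesis
  proof (rule that[OF s(1)])
    show "sign_changes (point_sum a m) a (a + L) s (GREATEST n. P n)" if "m \<in> M" for m
      by (rule sign_changes_all_or_none[OF a s(1) nz(1) s(2) that])
    \<comment> \<open>The dichotomy with the roles of \<open>m\<close> and \<open>m0\<close>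
      exchanged.\<close>
    show "\<not> sign_changes (point_sum a m) a (a + L) (- s) (Suc (GREATEST n. P n))" if "m \<in> M" for m
      using sign_changes_all_or_none[OF a _ that _ nz(1), of "- s"] s(1) ns by auto
  qed
qed

lemma point_sum_center: "m \<in> M \<Longrightarrow> 0 < a \<Longrightarrow> a < L \<Longrightarrow> point_sum a m a = 2 * U m a"
  by (simp add: point_sum_def ext_eq(2))

text \<open>The sum at the left end \<open>a\<close> is twice the value at \<open>a\<close>. A
  maximal alternation that begins with \<open>s\<close> leaves only the weak sign \<open>s\<close>
  there, and \<open>s\<close> is common to all elements.\<close>

lemma pointwise_sign:
  assumes a: "0 < a" "a < L"
  obtains s where "\<bar>s\<bar> = 1" "\<And>m. m \<in> M \<Longrightarrow> 0 \<le> s * U m a"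
proof (cases "\<exists>m\<in>M. \<exists>x\<in>{a..a + L}. point_sum a m x \<noteq> 0")
  case False
  have "U m a = 0" if "m \<in> M" for m using False that point_sum_center[OF that a] L by force
  then show ?thesis using that[of 1] by simp
next
  case True
  then obtain m0 x0 where nz: "m0 \<in> M" "x0 \<in> {a..a + L}" "point_sum a m0 x0 \<noteq> 0" by blast
  obtain n s where s: "\<bar>s\<bar> = 1" "\<And>m. m \<in> M \<Longrightarrow> sign_changes (point_sum a m) a (a + L) s n"
    "\<And>m. m \<in> M \<Longrightarrow> \<not> sign_changes (point_sum a m) a (a + L) (- s) (Suc n)"
    by (rule constant_sign_changes[OF a nz], rule that)
  show ?thesis
  proof (rule that[OF s(1)])
    fix m assume m: "m \<in> M"
    obtain x where x: "\<And>i. i \<le> n \<Longrightarrow> x i \<in> {a..a + L} \<and> 0 < s * (-1) ^ i * point_sum a m (x i)" "\<And>i. i < n \<Longrightarrow> x i < x (Suc i)"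
      using s(2)[OF m] unfolding sign_changes_def by blast
    have "0 \<le> s * point_sum a m a"
      by (rule sign_before_alternation[where x = x and n = n and l = a and r = "a + L"]) (use x s(3)[OF m] x(1)[of 0] in auto)
    then show "0 \<le> s * U m a" by (simp add: point_sum_center[OF m a])
  qed
qed

text \<open>Otherwise let \<open>y 0\<close> be the first point of a maximal alternation. Up to
  \<open>y 0\<close> the sum has the weak sign \<open>s\<close>, also for some time before, because
  the maximal number is common to all of \<open>M\<close>; evenness extends this to an interval
  symmetric about \<open>z\<close>. Now \<open>z\<close> is an inner point, and the Hopf lemma makes
  the sum nonzero at \<open>z\<close>.\<close>

lemma odd_about_common_zero:
  assumes z: "0 < z" "z < L" and zero: "\<And>m. m \<in> M \<Longrightarrow> U m z = 0" and m: "m \<in> M" and x: "x \<in> {z..z + L}"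
  shows "point_sum z m x = 0"
proof (rule ccontr)
  assume nz: "point_sum z m x \<noteq> 0"
  obtain n s where s: "\<bar>s\<bar> = 1" "\<And>m. m \<in> M \<Longrightarrow> sign_changes (point_sum z m) z (z + L) s n"
    "\<And>m. m \<in> M \<Longrightarrow> \<not> sign_changes (point_sum z m) z (z + L) (- s) (Suc n)"
    by (rule constant_sign_changes[OF z m x nz], rule that)
  obtain y where y: "\<And>i. i \<le> n \<Longrightarrow> y i \<in> {z..z + L} \<and> 0 < s * (-1) ^ i * point_sum z m (y i)" "\<And>i. i < n \<Longrightarrow> y i < y (Suc i)"
    using s(2)[OF m] unfolding sign_changes_def by blast
  obtain k where k: "k \<in> M" "\<Phi> 1 k = m" using \<Phi>_preimage[OF m, of 1] by auto
  let ?w = "\<lambda>t x. s * point_sum z (\<Phi> t k) x"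
  have "point_sum z m z = 0" using point_sum_center[OF m z] zero[OF m] by simp
  then have y0: "z < y 0" using y(1)[of 0] by (cases "y 0 = z") auto
  have y0L: "y 0 \<le> z + L" using y(1)[of 0] by simp
  \<comment> \<open>By continuity the same points witness the alternation shortly before time
    1.\<close>
  have "\<forall>\<^sub>F t in at 1 within {0..1}. \<forall>i\<in>{..n}. 0 < s * (-1) ^ i * point_sum z (\<Phi> t k) (y i)"
  proof (rule eventually_ball_finite)
    show "\<forall>i\<in>{..n}. \<forall>\<^sub>F t in at 1 within {0..1}. 0 < s * (-1) ^ i * point_sum z (\<Phi> t k) (y i)"
    proof
      fix i assume "i \<in> {..n}"
      have "continuous_on {0..1} (\<lambda>t. (\<lambda>(t, x). point_sum z (\<Phi> t k) x) (t, y i))"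
        by (rule continuous_on_compose2[OF point_sum_traj_cont[OF k(1)] continuous_on_Pair[OF continuous_on_id continuous_on_const]]) auto
      then have "continuous_on {0..1} (\<lambda>t. s * (-1) ^ i * point_sum z (\<Phi> t k) (y i))"
        by (intro continuous_on_mult_left) simp
      then have "((\<lambda>t. s * (-1) ^ i * point_sum z (\<Phi> t k) (y i)) \<longlongrightarrow> s * (-1) ^ i * point_sum z (\<Phi> 1 k) (y i)) (at 1 within {0..1})"
        unfolding continuous_on_def by simp
      then show "\<forall>\<^sub>F t in at 1 within {0..1}. 0 < s * (-1) ^ i * point_sum z (\<Phi> t k) (y i)"
        by (rule order_tendstoD(1)) (use y(1)[of i] \<open>i \<in> {..n}\<close> k in simp)
    qed
  qed simp
  then obtain d where d: "0 < d" "\<And>t i. t \<in> {0..1} \<Longrightarrow> t \<noteq> 1 \<Longrightarrow> dist t 1 < d \<Longrightarrow> i \<le> n \<Longrightarrow> 0 < s * (-1) ^ i * point_sum z (\<Phi> t k) (y i)"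
    unfolding eventually_at by auto
  define t1 where "t1 = max 0 (1 - d / 2)"
  have t1: "0 \<le> t1" "t1 < 1" "1 - t1 < d" using d(1) by (auto simp: t1_def)
  have pos: "0 < s * (-1) ^ i * point_sum z (\<Phi> t k) (y i)" if "t1 \<le> t" "t \<le> 1" "i \<le> n" for t i
    using d(2)[of t i] y(1)[OF that(3)] that k t1 by (cases "t = 1") (auto simp: dist_real_def)
  have nn1: "0 \<le> ?w t u" if "t1 \<le> t" "t \<le> 1" "u \<in> {z..y 0}" for t u
  proof -
    have "\<Phi> t k \<in> M" using \<Phi>_in[OF k(1), of t] that t1 by simp
    from s(3)[OF this] show ?thesis using pos[OF that(1,2)] y that(3)
      by (intro sign_before_alternation[where x = y and n = n and l = z and r = "z + L"]) auto
  qed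
  have nn: "0 \<le> ?w t u" if "t1 \<le> t" "t \<le> 1" "u \<in> {2 * z - y 0..y 0}" for t u
  proof (cases "z \<le> u")
    case False
    have "point_sum z (\<Phi> t k) u = point_sum z (\<Phi> t k) (2 * z - u)" by (simp add: point_sum_def)
    then show ?thesis using nn1[OF that(1,2), of "2 * z - u"] that(3) False by simp
  qed (use nn1 that in auto)
  \<comment> \<open>The width of the interval over the available time: the region of the Hopf lemma
    then shrinks to its right end at time \<open>t1\<close>.\<close>
  define \<mu> where "\<mu> = (y 0 - (2 * z - y 0)) / (1 - t1)"
  have "\<exists>\<kappa>>0. \<forall>u\<in>{2 * z - y 0..y 0}. \<kappa> * (u - (2 * z - y 0)) \<le> ?w 1 u"
  proof (rule hopf_lemma[OF C t1(2), where \<mu> = \<mu> and w = ?w])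
    show "2 * z - y 0 < y 0" using y0 by simp
    show \<mu>: "0 < \<mu>" "y 0 - (2 * z - y 0) \<le> \<mu> * (1 - t1)" using y0 t1 by (auto simp: \<mu>_def)
    show "continuous_on ({t1..1} \<times> {2 * z - y 0..y 0}) (\<lambda>(t, x). ?w t x)"
      unfolding split_def by (intro continuous_on_mult_left point_sum_traj_cont_on[OF k(1) t1(1), unfolded split_def])
    show "0 < ?w t (y 0)" if "t1 \<le> t" "t \<le> 1" for t using pos[OF that, of 0] by simp
    show "par_ineq C ?w t u" if "t1 < t" "t \<le> 1" "2 * z - y 0 < u" "u < y 0" for t u
      by (rule par_ineq_cmult, rule point_sum_par_ineq[OF k(1) _ z]) (use that t1 y0L in auto)
    fix t u assume tu: "t1 \<le> t" "t \<le> 1" "u \<le> y 0" "2 * z - y 0 + \<mu> * (1 - t) \<le> u"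
    have "0 \<le> \<mu> * (1 - t)" using \<mu>(1) tu by simp
    then show "0 \<le> ?w t u" using tu by (intro nn) auto
  qed
  then obtain \<kappa> where \<kappa>: "0 < \<kappa>" "\<And>u. u \<in> {2 * z - y 0..y 0} \<Longrightarrow> \<kappa> * (u - (2 * z - y 0)) \<le> ?w 1 u" by blast
  have "\<kappa> * (z - (2 * z - y 0)) \<le> ?w 1 z" using y0 by (intro \<kappa>(2)) auto
  also have "\<dots> = 0" using \<open>point_sum z m z = 0\<close> k by simp
  finally show False using \<kappa>(1) y0 by (simp add: mult_le_0_iff)
qed

section \<open>Common zeros and the nodal interval\<close>

text \<open>Oddness about \<open>z\<close>: in the first case the mirror point lies in
  \<open>{0..L}\<close>, in the second in \<open>{- L..0}\<close>, where oddness about 0 turns the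
  reflection into a translation by \<open>2 * z\<close>.\<close>

lemma common_zero_reflection:
  assumes z: "0 < z" "z < L" and zero: "\<And>m. m \<in> M \<Longrightarrow> U m z = 0" and m: "m \<in> M"
  shows "z \<le> x \<Longrightarrow> x \<le> 2 * z \<Longrightarrow> x \<le> L \<Longrightarrow> U m x = - U m (2 * z - x)"
    "2 * z \<le> x \<Longrightarrow> x \<le> L \<Longrightarrow> U m x = U m (x - 2 * z)"
proof -
  have ps: "ext m x + ext m (2 * z - x) = 0" if "z \<le> x" "x \<le> L" for x
    using odd_about_common_zero[OF z zero m, of x] that z by (simp add: point_sum_def)
  show "U m x = - U m (2 * z - x)" if "z \<le> x" "x \<le> 2 * z" "x \<le> L"
    using ps[of x] ext_eq(2)[OF m, of x] ext_eq(2)[OF m, of "2 * z - x"] that z by simp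
  show "U m x = U m (x - 2 * z)" if "2 * z \<le> x" "x \<le> L"
    using ps[of x] ext_eq(2)[OF m, of x] ext_eq(1)[OF m, of "2 * z - x"] that z by simp
qed

text \<open>The reflection reaches as far as \<open>2 * \<rho>\<close>, and translations by
  \<open>2 * \<rho>\<close> cover the rest by induction.\<close>

lemma determined_by_nodal_interval:
  assumes \<rho>: "0 < \<rho>" "\<rho> \<le> L" and zero: "\<And>m. m \<in> M \<Longrightarrow> U m \<rho> = 0" and m: "m1 \<in> M" "m2 \<in> M"
    and eq: "\<And>x. x \<in> {0..\<rho>} \<Longrightarrow> U m1 x = U m2 x" and x: "x \<in> {0..L}"
  shows "U m1 x = U m2 x"
proof (cases "\<rho> = L")
  case False
  then have \<rho>': "0 < \<rho>" "\<rho> < L" using \<rho> by auto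
  have base: "U m1 x = U m2 x" if "0 \<le> x" "x \<le> 2 * \<rho>" "x \<le> L" for x
  proof (cases "x \<le> \<rho>")
    case False
    then show ?thesis using common_zero_reflection(1)[OF \<rho>' zero, of _ x] m that eq[of "2 * \<rho> - x"] by simp
  qed (use that eq in auto)
  have "\<forall>x. x \<in> {0..L} \<and> x \<le> 2 * \<rho> * real n \<longrightarrow> U m1 x = U m2 x" for n
  proof (induction n)
    case 0
    show ?case using base \<rho> by auto
  next
    case (Suc n)
    show ?case
    proof (intro allI impI)
      fix x assume x: "x \<in> {0..L} \<and> x \<le> 2 * \<rho> * real (Suc n)"
      show "U m1 x = U m2 x"
      proof (cases "x \<le> 2 * \<rho>")
        case False
        then have "U m1 (x - 2 * \<rho>) = U m2 (x - 2 * \<rho>)"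
          using Suc.IH x \<rho> by (auto simp: algebra_simps)
        then show ?thesis using common_zero_reflection(2)[OF \<rho>' zero, of _ x] m False x by simp
      qed (use base x in auto)
    qed
  qed
  moreover obtain n where "x / (2 * \<rho>) \<le> real n" using real_arch_simple by blast
  ultimately show ?thesis using x \<rho> by (auto simp: field_simps)
qed (use eq x in auto)

text \<open>A common zero \<open>z\<close> makes the profiles \<open>2 * z\<close>-periodic on
  \<open>{0..L}\<close>. For small \<open>z\<close> all values are then taken close to 0, where they
  are smaller than the given nonzero value.\<close>

lemma common_zeros_discrete:
  assumes nz: "m0 \<in> M" "x0 \<in> {0..L}" "U m0 x0 \<noteq> 0"
  obtains \<delta> where "0 < \<delta>" "\<And>z. 0 < z \<Longrightarrow> z < \<delta> \<Longrightarrow> \<exists>m\<in>M. U m z \<noteq> 0"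
proof -
  have "continuous_on {0..L} (U m0)" using U_deriv[OF nz(1)] DERIV_continuous_on by blast
  then obtain d where d: "0 < d" "\<And>y. y \<in> {0..L} \<Longrightarrow> dist y 0 < d \<Longrightarrow> dist (U m0 y) (U m0 0) < \<bar>U m0 x0\<bar>"
    using nz L unfolding continuous_on_iff by (metis atLeastAtMost_iff less_imp_le order_refl zero_less_abs_iff)
  have small: "\<bar>U m0 y\<bar> < \<bar>U m0 x0\<bar>" if "y \<in> {0..L}" "y < d" for y
    using d(2)[of y] that U_0[OF nz(1)] by (simp add: dist_real_def)
  show thesis
  proof (rule that[of "min L (d / 2)"])
    fix z assume z: "0 < z" "z < min L (d / 2)"
    show "\<exists>m\<in>M. U m z \<noteq> 0"
    proof (rule ccontr)
      assume "\<not> ?thesis"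
      then have zero: "\<And>m. m \<in> M \<Longrightarrow> U m z = 0" by blast
      have zL: "0 < z" "z < L" using z by auto
      have "\<forall>x. x \<in> {0..L} \<and> x \<le> 2 * z * real n \<longrightarrow> \<bar>U m0 x\<bar> < \<bar>U m0 x0\<bar>" for n
      proof (induction n)
        case 0
        show ?case using small[of 0] L d by auto
      next
        case (Suc n)
        show ?case
        proof (intro allI impI)
          fix x assume x: "x \<in> {0..L} \<and> x \<le> 2 * z * real (Suc n)"
          show "\<bar>U m0 x\<bar> < \<bar>U m0 x0\<bar>"
          proof (cases "x < 2 * z")
            case False
            then have "\<bar>U m0 (x - 2 * z)\<bar> < \<bar>U m0 x0\<bar>"
              using Suc.IH x z by (auto simp: algebra_simps)
            then show ?thesis using common_zero_reflection(2)[OF zL zero nz(1), of x] False x by simp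
          qed (use small x z in auto)
        qed
      qed
      moreover obtain n where "x0 / (2 * z) \<le> real n" using real_arch_simple by blast
      ultimately show False using nz(2) z by (auto simp: field_simps)
    qed
  qed (use d L in auto)
qed

text \<open>Common zeros close to 0 are excluded first, since 0 itself is one; the least of the
  remaining ones exists because \<open>L\<close> is among them. Before it, the points carrying
  positive values and those carrying negative values form two open sets covering an interval; they
  are disjoint by \<open>pointwise_sign\<close>, so connectedness gives one sign for all points and
  all elements.\<close>

theorem nodal_structure:
  assumes nz: "m0 \<in> M" "x0 \<in> {0..L}" "U m0 x0 \<noteq> 0"
  obtains \<rho> s where "\<bar>s\<bar> = 1" "0 < \<rho>" "\<rho> \<le> L" "\<And>m. m \<in> M \<Longrightarrow> U m \<rho> = 0"
    "\<And>m x. m \<in> M \<Longrightarrow> 0 < x \<Longrightarrow> x < \<rho> \<Longrightarrow> 0 < s * U m x"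
proof -
  obtain \<delta> where \<delta>: "0 < \<delta>" "\<And>z. 0 < z \<Longrightarrow> z < \<delta> \<Longrightarrow> \<exists>m\<in>M. U m z \<noteq> 0"
    by (rule common_zeros_discrete[OF nz], rule that)
  have cU: "continuous_on {0..L} (U m)" if "m \<in> M" for m using U_deriv[OF that] DERIV_continuous_on by blast
  define Z where "Z = {\<delta>..L} \<inter> (\<Inter>m\<in>M. {x \<in> {0..L}. U m x = 0})"
  have "closed {x \<in> {0..L}. U m x = 0}" if "m \<in> M" for m
    using continuous_closed_preimage_constant[OF cU[OF that] closed_atLeastAtMost] .
  then have "compact Z" unfolding Z_def by (intro compact_Int_closed compact_Icc closed_INT) auto
  moreover have "L \<in> Z"
  proof -
    have "\<delta> \<le> L" using \<delta>(2)[OF L] U_L by force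
    then show ?thesis using U_L L by (auto simp: Z_def)
  qed
  ultimately obtain \<rho> where \<rho>Z: "\<rho> \<in> Z" and min: "\<And>z. z \<in> Z \<Longrightarrow> \<rho> \<le> z"
    using compact_attains_inf[of Z] by blast
  have \<rho>: "0 < \<rho>" "\<rho> \<le> L" and zero: "\<And>m. m \<in> M \<Longrightarrow> U m \<rho> = 0" using \<rho>Z \<delta>(1) by (auto simp: Z_def)
  have nonzero: "\<exists>m\<in>M. U m x \<noteq> 0" if x: "0 < x" "x < \<rho>" for x
  proof (cases "x < \<delta>")
    case False
    then show ?thesis using min[of x] x \<rho> by (force simp: Z_def)
  qed (use \<delta> x in auto)
  define A where "A s = {x \<in> {0<..<\<rho>}. \<exists>m\<in>M. 0 < s * U m x}" for s
  have opA: "open (A s)" for s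
  proof -
    have "open {x \<in> {0<..<\<rho>}. 0 < s * U m x}" if "m \<in> M" for m
    proof -
      have "continuous_on {0<..<\<rho>} (\<lambda>x. s * U m x)"
        by (intro continuous_on_mult_left continuous_on_subset[OF cU[OF that]]) (use \<rho> in auto)
      then have "open ({0<..<\<rho>} \<inter> (\<lambda>x. s * U m x) -` {0<..})" by (rule continuous_open_preimage) auto
      moreover have "{0<..<\<rho>} \<inter> (\<lambda>x. s * U m x) -` {0<..} = {x \<in> {0<..<\<rho>}. 0 < s * U m x}" by auto
      ultimately show ?thesis by simp
    qed
    then have "open (\<Union>m\<in>M. {x \<in> {0<..<\<rho>}. 0 < s * U m x})" by blast
    moreover have "(\<Union>m\<in>M. {x \<in> {0<..<\<rho>}. 0 < s * U m x}) = A s" by (auto simp: A_def)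
    ultimately show ?thesis by simp
  qed
  have "A 1 \<inter> {0<..<\<rho>} = {} \<or> A (- 1) \<inter> {0<..<\<rho>} = {}"
  proof (rule connectedD[where A = "{0<..<\<rho>}"])
    show "connected {0<..<\<rho>}" by simp
    show "open (A 1)" "open (A (- 1))" by (rule opA)+
    show "A 1 \<inter> A (- 1) \<inter> {0<..<\<rho>} = {}"
    proof (rule ccontr)
      assume "A 1 \<inter> A (- 1) \<inter> {0<..<\<rho>} \<noteq> {}"
      then obtain x m m' where x: "0 < x" "x < \<rho>" "m \<in> M" "m' \<in> M" "0 < U m x" "U m' x < 0" by (auto simp: A_def)
      obtain s where "\<bar>s\<bar> = 1" "\<And>m. m \<in> M \<Longrightarrow> 0 \<le> s * U m x" 
        by (rule pointwise_sign[of x]) (use x \<rho> in auto)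
      then have "\<bar>s\<bar> = 1" "0 \<le> s * U m x" "0 \<le> s * U m' x" using x by auto
      then show False using x(5,6) by (simp add: zero_le_mult_iff)
    qed
    show "{0<..<\<rho>} \<subseteq> A 1 \<union> A (- 1)" using nonzero by (force simp: A_def)
  qed
  moreover have "A \<sigma> \<inter> {0<..<\<rho>} = A \<sigma>" for \<sigma> by (auto simp: A_def)
  ultimately have "A 1 = {} \<or> A (- 1) = {}" by (simp only:)
  then have "\<exists>s. \<bar>s\<bar> = 1 \<and> A (- s) = {}"
  proof
    assume "A 1 = {}" then show ?thesis by (intro exI[of _ "- 1"]) simp
  next
    assume "A (- 1) = {}" then show ?thesis by (intro exI[of _ 1]) simp
  qed
  then obtain s where s: "\<bar>s\<bar> = 1" "A (- s) = {}" by blast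
  have nn: "0 \<le> s * U m x" if m: "m \<in> M" and x: "x \<in> {0..\<rho>}" for m x
  proof (cases "x = 0 \<or> x = \<rho>")
    case True
    then show ?thesis using U_0[OF m] zero[OF m] by auto
  next
    case False
    then have "x \<notin> A (- s)" "0 < x" "x < \<rho>" using s x by auto
    then show ?thesis using m by (auto simp: A_def not_less)
  qed
  obtain m1 where m1: "m1 \<in> M" "U m1 (\<rho> / 2) \<noteq> 0" using nonzero[of "\<rho> / 2"] \<rho> by auto
  show thesis
  proof (rule that[OF s(1) \<rho> zero])
    show "0 < s * U m x" if "m \<in> M" "0 < x" "x < \<rho>" for m x
      by (rule strict_positivity[OF s(1) \<rho> zero nn m1(1) _ m1(2) that]) (use \<rho> in auto)
  qed
qed

end

section \<open>The phase space\<close>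

lemma C1_interval_D_on:
  assumes L: "0 < L" and u: "u \<in> C1_interval L" and x: "x \<in> {0..L}"
  shows "(u has_real_derivative D_on L u x) (at x within {0..L})"
proof -
  have "u differentiable (at x within {0..L})" using u x by (simp add: C1_interval_def differentiable_on_def)
  then have "(u has_vector_derivative D_on L u x) (at x within {0..L})"
    unfolding D_on_def by (simp add: vector_derivative_works)
  then show ?thesis by (simp add: has_real_derivative_iff_has_vector_derivative)
qed

lemma D_on_eqI:
  assumes L: "0 < L" and u: "(u has_real_derivative d) (at x within {0..L})" and x: "x \<in> {0..L}"
  shows "D_on L u x = d"
  unfolding D_on_def
  using vector_derivative_within_cbox[of 0 L x u d] assms
  by (simp add: has_real_derivative_iff_has_vector_derivative)

lemma C1_interval_continuous: "u \<in> C1_interval L \<Longrightarrow> continuous_on {0..L} u"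
  by (simp add: C1_interval_def differentiable_imp_continuous_on)

lemma C1_intervalI:
  assumes L: "0 < L" and d: "\<And>x. x \<in> {0..L} \<Longrightarrow> (u has_real_derivative d x) (at x within {0..L})"
    and c: "continuous_on {0..L} d"
  shows "u \<in> C1_interval L"
proof -
  have "continuous_on {0..L} (D_on L u)"
    using c by (rule continuous_on_cong[THEN iffD1, rotated -1]) (use D_on_eqI[OF L d] in auto)
  moreover have "u differentiable_on {0..L}"
    unfolding differentiable_on_def using d by (meson differentiableI has_field_derivative_def real_differentiable_def)
  ultimately show ?thesis by (simp add: C1_interval_def)
qed

lemma frac_coeff_cmult: "frac_coeff L \<alpha> (\<lambda>x. c * u x) n = c * frac_coeff L \<alpha> u n"
  by (simp add: frac_coeff_def L2_inner_def mult.assoc)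

lemma frac_norm_cmult: "frac_norm L \<alpha> (\<lambda>x. c * u x) = \<bar>c\<bar> * frac_norm L \<alpha> u"
  unfolding frac_norm_def frac_coeff_cmult power_mult_distrib
  by (simp add: infsum_cmult_right' real_sqrt_mult)

lemma frac_norm_nonneg: "0 \<le> frac_norm L \<alpha> u"
  by (simp add: frac_norm_def infsum_nonneg)

lemma C1_interval_cmult:
  assumes L: "0 < L" and u: "u \<in> C1_interval L"
  shows "(\<lambda>x. c * u x) \<in> C1_interval L" "x \<in> {0..L} \<Longrightarrow> D_on L (\<lambda>x. c * u x) x = c * D_on L u x"
proof -
  have d: "((\<lambda>x. c * u x) has_real_derivative c * D_on L u x) (at x within {0..L})" if "x \<in> {0..L}" for x
    by (intro DERIV_cmult C1_interval_D_on[OF L u that])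
  show "(\<lambda>x. c * u x) \<in> C1_interval L"
    by (rule C1_intervalI[OF L d]) (use u in \<open>auto simp: C1_interval_def intro!: continuous_on_mult_left\<close>)
  show "D_on L (\<lambda>x. c * u x) x = c * D_on L u x" if "x \<in> {0..L}" using D_on_eqI[OF L d[OF that] that] .
qed

lemma C1_interval_diff:
  assumes L: "0 < L" and u: "u \<in> C1_interval L" "v \<in> C1_interval L"
  shows "(\<lambda>x. u x - v x) \<in> C1_interval L" "x \<in> {0..L} \<Longrightarrow> D_on L (\<lambda>x. u x - v x) x = D_on L u x - D_on L v x"
proof -
  have d: "((\<lambda>x. u x - v x) has_real_derivative D_on L u x - D_on L v x) (at x within {0..L})" if "x \<in> {0..L}" for x
    by (intro DERIV_diff C1_interval_D_on[OF L _ that] u)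
  show "(\<lambda>x. u x - v x) \<in> C1_interval L"
    by (rule C1_intervalI[OF L d]) (use u in \<open>auto simp: C1_interval_def intro!: continuous_on_diff\<close>)
  show "D_on L (\<lambda>x. u x - v x) x = D_on L u x - D_on L v x" if "x \<in> {0..L}" using D_on_eqI[OF L d[OF that] that] .
qed

section \<open>The embedding into continuously differentiable functions\<close>

lemma frac_domain_cmult:
  assumes "u \<in> frac_domain L \<alpha>" shows "(\<lambda>x. c * u x) \<in> frac_domain L \<alpha>"
proof -
  have "u \<in> borel_measurable (lebesgue_on {0..L})" using assms by (simp add: frac_domain_def L2_interval_def)
  then have "(\<lambda>x. c * u x) \<in> borel_measurable (lebesgue_on {0..L})" by (intro borel_measurable_times borel_measurable_const)
  then show ?thesis
    using assms by (simp add: frac_domain_def L2_interval_def frac_coeff_cmult power_mult_distrib summable_on_cmult_right)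
qed

text \<open>Otherwise a sequence violating every bound could be rescaled to be bounded in the fractional norm and
  unbounded in \<open>C\<^sup>1\<close>.\<close>
lemma embedding_bound:
  assumes L: "0 < L" and emb: "compactly_embedded_C1 L \<alpha>"
  obtains B where "0 \<le> B" "\<And>w x. w \<in> frac_domain L \<alpha> \<inter> C1_interval L \<Longrightarrow> x \<in> {0..L} \<Longrightarrow>
     \<bar>w x\<bar> \<le> B * frac_norm L \<alpha> w \<and> \<bar>D_on L w x\<bar> \<le> B * frac_norm L \<alpha> w"
proof (rule ccontr)
  assume no: "\<not> thesis"
  let ?m = "\<lambda>w x. max \<bar>w x\<bar> \<bar>D_on L w x\<bar>"
  have "\<exists>w x. w \<in> frac_domain L \<alpha> \<inter> C1_interval L \<and> x \<in> {0..L} \<and> real n * frac_norm L \<alpha> w < ?m w x" for n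
  proof (rule ccontr)
    assume "\<not> ?thesis"
    then have "?m w x \<le> real n * frac_norm L \<alpha> w" if "w \<in> frac_domain L \<alpha> \<inter> C1_interval L" "x \<in> {0..L}" for w x
      using that by (meson not_le)
    then show False using no that[of "real n"] by simp
  qed
  then obtain w x where w: "\<And>n. w n \<in> frac_domain L \<alpha> \<inter> C1_interval L" and x: "\<And>n. x n \<in> {0..L}"
    and lt: "\<And>n. real n * frac_norm L \<alpha> (w n) < ?m (w n) (x n)" by metis
  \<comment> \<open>With this factor the larger of value and slope of \<open>v n\<close> at
    \<open>x n\<close> is exactly \<open>n\<close>, while the fractional norm is at most 1.\<close>
  define c where "c n = real n / ?m (w n) (x n)" for n
  define v where "v n = (\<lambda>x. c n * w n x)" for n
  have mp: "0 < ?m (w n) (x n)" for n using lt[of n] frac_norm_nonneg[of L \<alpha> "w n"]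
    by (meson le_less_trans mult_nonneg_nonneg of_nat_0_le_iff)
  have c0: "0 \<le> c n" for n using mp[of n] unfolding c_def by (intro divide_nonneg_pos) auto
  have vm: "?m (v n) (x n) = real n" for n
  proof -
    have "?m (v n) (x n) = c n * ?m (w n) (x n)"
      using C1_interval_cmult(2)[OF L _ x[of n], of "w n" "c n"] w[of n] c0[of n]
      by (simp add: v_def abs_mult max_mult_distrib_left)
    also have "\<dots> = real n" using mp[of n] by (simp add: c_def)
    finally show ?thesis .
  qed
  have vn: "frac_norm L \<alpha> (v n) \<le> 1" for n
  proof -
    have "frac_norm L \<alpha> (v n) = real n * frac_norm L \<alpha> (w n) / ?m (w n) (x n)"
      using frac_norm_cmult[of L \<alpha> "c n" "w n"] c0[of n] unfolding v_def by (simp add: c_def)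
    also have "\<dots> \<le> 1" using lt[of n] mp[of n] by (subst pos_divide_le_eq) auto
    finally show ?thesis .
  qed
  have "range v \<subseteq> frac_domain L \<alpha> \<inter> C1_interval L"
    using w frac_domain_cmult C1_interval_cmult(1)[OF L] unfolding v_def by blast
  moreover have "bounded (range (\<lambda>n. frac_norm L \<alpha> (v n)))"
    unfolding bounded_iff using vn frac_norm_nonneg[of L \<alpha>] by (intro exI[of _ 1]) auto
  ultimately obtain r V where r: "strict_mono (r :: nat \<Rightarrow> nat)" and V: "V \<in> C1_interval L"
    and u: "uniform_limit {0..L} (\<lambda>n. v (r n)) V sequentially"
      "uniform_limit {0..L} (\<lambda>n. D_on L (v (r n))) (D_on L V) sequentially"
    using emb unfolding compactly_embedded_C1_def by meson
  have "bounded (V ` {0..L})" "bounded (D_on L V ` {0..L})"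
    using V C1_interval_continuous[OF V] by (auto intro!: compact_imp_bounded compact_continuous_image simp: C1_interval_def)
  then obtain b1 b2 where "\<forall>y\<in>V ` {0..L}. norm y \<le> b1" "\<forall>y\<in>D_on L V ` {0..L}. norm y \<le> b2"
    unfolding bounded_iff by (elim exE)
  then have b: "\<bar>V x\<bar> \<le> b1" "\<bar>D_on L V x\<bar> \<le> b2" if "x \<in> {0..L}" for x using that by simp_all
  have "\<forall>\<^sub>F n in sequentially. \<forall>x\<in>{0..L}. dist (v (r n) x) (V x) < 1"
    "\<forall>\<^sub>F n in sequentially. \<forall>x\<in>{0..L}. dist (D_on L (v (r n)) x) (D_on L V x) < 1"
    using u by (auto simp: uniform_limit_iff)
  moreover have "\<forall>\<^sub>F n in sequentially. max b1 b2 + 1 < real n"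
    using filterlim_real_sequentially by (simp add: filterlim_at_top_dense)
  ultimately have "\<forall>\<^sub>F n in sequentially. False"
  proof eventually_elim
    case (elim n)
    have "?m (v (r n)) (x (r n)) < max b1 b2 + 1"
    proof -
      have "\<bar>v (r n) (x (r n)) - V (x (r n))\<bar> < 1" "\<bar>D_on L (v (r n)) (x (r n)) - D_on L V (x (r n))\<bar> < 1"
        using elim(1,2) x[of "r n"] by (auto simp: dist_real_def)
      then show ?thesis using b[OF x[of "r n"]] by linarith
    qed
    then have "real (r n) < max b1 b2 + 1" using vm by simp
    moreover have "real n \<le> real (r n)" using seq_suble[OF r, of n] by simp
    ultimately show False using elim(3) by simp
  qed
  then show False by simp
qed

lemma XD_diff_mem:
  assumes L: "0 < L" and u: "u \<in> XD L \<alpha>" "v \<in> XD L \<alpha>"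
  shows "(\<lambda>x. u x - v x) \<in> frac_domain L \<alpha> \<inter> C1_interval L"
proof
  have C: "u \<in> C1_interval L" "v \<in> C1_interval L" using u by (auto simp: XD_def)
  show "(\<lambda>x. u x - v x) \<in> C1_interval L" by (rule C1_interval_diff(1)[OF L C])
  then have 1: "(\<lambda>x. u x - v x) \<in> L2_interval L" by (intro continuous_in_L2 C1_interval_continuous)
  have co: "frac_coeff L \<alpha> (\<lambda>x. u x - v x) n = frac_coeff L \<alpha> u n + - frac_coeff L \<alpha> v n" for n
    using u by (simp add: frac_coeff_def XD_def frac_domain_def L2_inner_diff right_diff_distrib)
  have su: "(\<lambda>n. (frac_coeff L \<alpha> u n)\<^sup>2) summable_on UNIV" "(\<lambda>n. (- frac_coeff L \<alpha> v n)\<^sup>2) summable_on UNIV"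
    using u by (simp_all add: XD_def frac_domain_def)
  show "(\<lambda>x. u x - v x) \<in> frac_domain L \<alpha>"
    using sqrt_infsum_triangle(1)[OF su] 1 by (simp add: frac_domain_def co)
qed

text \<open>Through this estimate neighbourhoods in the fractional norm control values and slopes
  uniformly on the interval.\<close>

lemma XD_C1_distance:
  assumes L: "0 < L"
    and B: "\<And>w x. w \<in> frac_domain L \<alpha> \<inter> C1_interval L \<Longrightarrow> x \<in> {0..L} \<Longrightarrow>
     \<bar>w x\<bar> \<le> B * frac_norm L \<alpha> w \<and> \<bar>D_on L w x\<bar> \<le> B * frac_norm L \<alpha> w"
    and u: "u \<in> XD L \<alpha>" "v \<in> XD L \<alpha>" and x: "x \<in> {0..L}"
  shows "\<bar>u x - v x\<bar> \<le> B * XD_dist L \<alpha> u v" "\<bar>D_on L u x - D_on L v x\<bar> \<le> B * XD_dist L \<alpha> u v"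
proof -
  have "D_on L (\<lambda>x. u x - v x) x = D_on L u x - D_on L v x"
    using C1_interval_diff(2)[OF L _ _ x] u by (auto simp: XD_def)
  then show "\<bar>u x - v x\<bar> \<le> B * XD_dist L \<alpha> u v" "\<bar>D_on L u x - D_on L v x\<bar> \<le> B * XD_dist L \<alpha> u v"
    using B[OF XD_diff_mem[OF L u] x] by (auto simp: XD_dist_def)
qed

lemma XD_eqI:
  assumes "u \<in> XD L \<alpha>" "v \<in> XD L \<alpha>" "\<And>x. x \<in> {0..L} \<Longrightarrow> u x = v x"
  shows "u = v"
proof
  show "u x = v x" for x using assms by (cases "x \<in> {0..L}") (auto simp: XD_def)
qed

lemma topspace_XD_topology: "0 < L \<Longrightarrow> topspace (XD_topology L \<alpha>) = XD L \<alpha>"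
  by (simp add: XD_topology_def Metric_space.topspace_mtopology[OF Metric_space_XD])

lemma openin_XD_ball:
  assumes "0 < L" shows "openin (XD_topology L \<alpha>) {v \<in> XD L \<alpha>. u \<in> XD L \<alpha> \<and> XD_dist L \<alpha> u v < e}"
proof -
  interpret Metric_space "XD L \<alpha>" "XD_dist L \<alpha>" by (rule Metric_space_XD[OF assms])
  have "mball u e = {v \<in> XD L \<alpha>. u \<in> XD L \<alpha> \<and> XD_dist L \<alpha> u v < e}" by (auto simp: mball_def)
  then show ?thesis unfolding XD_topology_def using openin_mball by metis
qed

section \<open>The compact-open topology and the hull\<close>

lemma topspace_compact_open:
  "topspace (compact_open_topology :: ('a::topological_space \<Rightarrow> 'b::topological_space) topology) = {g. continuous_on UNIV g}"
proof -
  have "(UNIV :: ('a \<Rightarrow> 'b) set) \<in> {{g. g ` K \<subseteq> U} | K U. compact K \<and> open U}" by (intro CollectI exI[of _ "{}"]) auto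
  then have "\<Union> {{g. g ` K \<subseteq> U} | K U. compact K \<and> open U} = (UNIV :: ('a \<Rightarrow> 'b) set)" by blast
  then show ?thesis unfolding compact_open_topology_def topspace_subtopology topology_generated_by_topspace by simp
qed

lemma openin_compact_open:
  assumes "compact K" "open U"
  shows "openin compact_open_topology {g. continuous_on UNIV g \<and> g ` K \<subseteq> U}"
proof -
  have "openin (topology_generated_by {{g. g ` K \<subseteq> U} | K U. compact K \<and> open U}) {g. g ` K \<subseteq> U}"
    by (intro topology_generated_by_Basis) (use assms in blast)
  then have "openin compact_open_topology ({g. g ` K \<subseteq> U} \<inter> {g. continuous_on UNIV g})"
    unfolding compact_open_topology_def by (rule openin_subtopology_Int)
  moreover have "{g. g ` K \<subseteq> U} \<inter> {g. continuous_on UNIV g} = {g. continuous_on UNIV g \<and> g ` K \<subseteq> U}" by auto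
  ultimately show ?thesis by simp
qed

lemma Hull_continuous: "g \<in> Hull f \<Longrightarrow> continuous_on UNIV g"
  unfolding Hull_def using closure_of_subset_topspace[of compact_open_topology] topspace_compact_open by blast

text \<open>Two points at once, because the Lipschitz bound and oddness, which are to pass to the
  hull, compare two values.\<close>

lemma Hull_approx:
  assumes g: "g \<in> Hull f" and e: "0 < e"
  obtains \<tau> where "\<bar>time_shift \<tau> f z1 - g z1\<bar> < e" "\<bar>time_shift \<tau> f z2 - g z2\<bar> < e"
proof -
  let ?O = "\<lambda>z. {h. continuous_on UNIV h \<and> h ` {z} \<subseteq> ball (g z) e}"
  have "openin compact_open_topology (?O z1 \<inter> ?O z2)"
    by (intro openin_Int openin_compact_open) auto
  moreover have "g \<in> ?O z1 \<inter> ?O z2" using Hull_continuous[OF g] e by auto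
  ultimately have "\<exists>h. h \<in> range (\<lambda>\<tau>. time_shift \<tau> f) \<and> h \<in> ?O z1 \<inter> ?O z2"
    using g unfolding Hull_def in_closure_of by meson
  then obtain \<tau> where "time_shift \<tau> f \<in> ?O z1 \<inter> ?O z2" by blast
  then show thesis using that[of \<tau>] by (simp add: dist_real_def abs_minus_commute)
qed

text \<open>Admissibility bounds the partial derivatives for all times over a compact square, so the
  mean value theorem gives a constant independent of time. Time shifts keep it, and so do pointwise
  limits.\<close>

lemma Hull_lipschitz:
  assumes f: "standing_assumption f"
  obtains C where "0 \<le> C" "\<And>g t u v p q. g \<in> Hull f \<Longrightarrow> \<bar>u\<bar> \<le> R \<Longrightarrow> \<bar>v\<bar> \<le> R \<Longrightarrow> \<bar>p\<bar> \<le> R \<Longrightarrow> \<bar>q\<bar> \<le> R \<Longrightarrow>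
    \<bar>g (t, u, p) - g (t, v, q)\<bar> \<le> C * (\<bar>u - v\<bar> + \<bar>p - q\<bar>)"
proof -
  let ?K = "{- R..R} \<times> {- R..R}"
  have "bounded (F ` (UNIV \<times> ?K))" if "F \<in> {partial_u f, partial_p f}" for F
    using f that compact_Times[OF compact_Icc compact_Icc]
    unfolding standing_assumption_def uniformly_almost_periodic_def admissible_def by blast
  then have "bounded (partial_u f ` (UNIV \<times> ?K))" "bounded (partial_p f ` (UNIV \<times> ?K))" by blast+
  then obtain b1 b2 where b12: "\<forall>y\<in>partial_u f ` (UNIV \<times> ?K). norm y \<le> b1" "\<forall>y\<in>partial_p f ` (UNIV \<times> ?K). norm y \<le> b2"
    unfolding bounded_iff by (elim exE)
  have b: "\<bar>partial_u f (t, u, p)\<bar> \<le> b1" "\<bar>partial_p f (t, u, p)\<bar> \<le> b2" if "\<bar>u\<bar> \<le> R" "\<bar>p\<bar> \<le> R" for t u p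
  proof -
    have "(t, u, p) \<in> UNIV \<times> ?K" using that by auto
    then show "\<bar>partial_u f (t, u, p)\<bar> \<le> b1" "\<bar>partial_p f (t, u, p)\<bar> \<le> b2"
      using bspec[OF b12(1), OF imageI] bspec[OF b12(2), OF imageI] by (simp_all only: real_norm_def)
  qed
  define C where "C = max 0 (max b1 b2)"
  have du: "((\<lambda>v. f (t, v, p)) has_real_derivative partial_u f (t, u, p)) (at u)"
    and dp: "((\<lambda>q. f (t, u, q)) has_real_derivative partial_p f (t, u, p)) (at p)" for t u p
  proof -
    have "(\<lambda>v. f (t, v, p)) field_differentiable (at u)" "(\<lambda>q. f (t, u, q)) field_differentiable (at p)"
      using f unfolding standing_assumption_def C1_fun_def by simp_all
    then show "((\<lambda>v. f (t, v, p)) has_real_derivative partial_u f (t, u, p)) (at u)"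
      "((\<lambda>q. f (t, u, q)) has_real_derivative partial_p f (t, u, p)) (at p)"
      by (simp_all add: DERIV_deriv_iff_field_differentiable partial_u_def partial_p_def)
  qed
  have mvt: "\<bar>h x - h y\<bar> \<le> C * \<bar>x - y\<bar>"
    if "\<And>z. (h has_real_derivative h' z) (at z)" "\<And>z. \<bar>z\<bar> \<le> R \<Longrightarrow> \<bar>h' z\<bar> \<le> C" "\<bar>x\<bar> \<le> R" "\<bar>y\<bar> \<le> R" for h h' x y
  proof -
    have "norm (h x - h y) \<le> C * norm (x - y)"
    proof (rule field_differentiable_bound[of "{- R..R}"])
      show "(h has_real_derivative h' z) (at z within {- R..R})" for z by (rule has_field_derivative_at_within[OF that(1)])
      show "norm (h' z) \<le> C" if "z \<in> {- R..R}" for z using \<open>\<And>z. \<bar>z\<bar> \<le> R \<Longrightarrow> \<bar>h' z\<bar> \<le> C\<close>[of z] that by (simp add: abs_le_iff)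
      show "x \<in> {- R..R}" "y \<in> {- R..R}" using that(3,4) by auto
    qed simp
    then show ?thesis by simp
  qed
  have fl: "\<bar>f (t, u, p) - f (t, v, q)\<bar> \<le> C * (\<bar>u - v\<bar> + \<bar>p - q\<bar>)"
    if "\<bar>u\<bar> \<le> R" "\<bar>v\<bar> \<le> R" "\<bar>p\<bar> \<le> R" "\<bar>q\<bar> \<le> R" for t u v p q
  proof -
    have "\<bar>f (t, u, p) - f (t, v, p)\<bar> \<le> C * \<bar>u - v\<bar>"
      by (rule mvt[of "\<lambda>v. f (t, v, p)" "\<lambda>v. partial_u f (t, v, p)", OF du]) (use b(1) that in \<open>auto simp: C_def le_max_iff_disj\<close>)
    moreover have "\<bar>f (t, v, p) - f (t, v, q)\<bar> \<le> C * \<bar>p - q\<bar>"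
      by (rule mvt[of "\<lambda>q. f (t, v, q)" "\<lambda>q. partial_p f (t, v, q)", OF dp]) (use b(2) that in \<open>auto simp: C_def le_max_iff_disj\<close>)
    ultimately show ?thesis by (simp add: distrib_left)
  qed
  show thesis
  proof (rule that[of C])
    show "0 \<le> C" by (simp add: C_def)
    fix g t u v p q assume g: "g \<in> Hull f" and R: "\<bar>u\<bar> \<le> R" "\<bar>v\<bar> \<le> R" "\<bar>p\<bar> \<le> R" "\<bar>q\<bar> \<le> R"
    show "\<bar>g (t, u, p) - g (t, v, q)\<bar> \<le> C * (\<bar>u - v\<bar> + \<bar>p - q\<bar>)"
    proof (rule field_le_epsilon)
      fix e :: real assume "0 < e"
      then have "0 < e / 2" "e = e / 2 + e / 2" by simp_all
      then obtain d where d: "0 < d" "e = d + d" by blast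
      obtain \<tau> where "\<bar>time_shift \<tau> f (t, u, p) - g (t, u, p)\<bar> < d" "\<bar>time_shift \<tau> f (t, v, q) - g (t, v, q)\<bar> < d"
        by (rule Hull_approx[OF g d(1)], rule that)
      moreover have "\<bar>time_shift \<tau> f (t, u, p) - time_shift \<tau> f (t, v, q)\<bar> \<le> C * (\<bar>u - v\<bar> + \<bar>p - q\<bar>)"
        using fl[OF R] by (simp add: time_shift_def)
      ultimately show "\<bar>g (t, u, p) - g (t, v, q)\<bar> \<le> C * (\<bar>u - v\<bar> + \<bar>p - q\<bar>) + e" unfolding d(2) by linarith
    qed
  qed
qed

lemma Hull_odd:
  assumes f: "\<And>t u p. f (t, - u, p) = - f (t, u, p)" and g: "g \<in> Hull f"
  shows "g (t, - u, p) = - g (t, u, p)"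
proof -
  have "\<bar>g (t, - u, p) - - g (t, u, p)\<bar> \<le> 0"
  proof (rule field_le_epsilon)
    fix e :: real assume "0 < e"
    then have "0 < e / 2" "e = e / 2 + e / 2" by simp_all
      then obtain d where d: "0 < d" "e = d + d" by blast
    obtain \<tau> where "\<bar>time_shift \<tau> f (t, - u, p) - g (t, - u, p)\<bar> < d" "\<bar>time_shift \<tau> f (t, u, p) - g (t, u, p)\<bar> < d"
      by (rule Hull_approx[OF g d(1)], rule that)
    moreover have "time_shift \<tau> f (t, - u, p) = - time_shift \<tau> f (t, u, p)" using f by (simp add: time_shift_def)
    ultimately show "\<bar>g (t, - u, p) - - g (t, u, p)\<bar> \<le> 0 + e" unfolding d(2) by linarith
  qed
  then show ?thesis by simp
qed

lemma Hull_zero: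
  assumes f: "\<And>t p. f (t, 0, p) = 0" and g: "g \<in> Hull f"
  shows "g (t, 0, p) = 0"
proof -
  have "\<bar>g (t, 0, p)\<bar> \<le> 0"
  proof (rule field_le_epsilon)
    fix e :: real assume "0 < e"
    then obtain \<tau> where "\<bar>time_shift \<tau> f (t, 0, p) - g (t, 0, p)\<bar> < e"
      using Hull_approx[OF g, of e "(t, 0, p)" "(t, 0, p)"] by auto
    then show "\<bar>g (t, 0, p)\<bar> \<le> 0 + e" using f by (simp add: time_shift_def)
  qed
  then show ?thesis by simp
qed

text \<open>\<open>K\<close> is covered by finitely many balls on which \<open>g0\<close> varies by
  less than \<open>e / 2\<close>. Closed balls define the subbasic sets, since their traces on
  \<open>K\<close> are compact.\<close>

lemma compact_open_uniform_nhd: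
  fixes g0 :: "'a::metric_space \<Rightarrow> real"
  assumes g0: "continuous_on UNIV g0" and K: "compact K" and e: "0 < e"
  obtains W where "openin compact_open_topology W" "g0 \<in> W" "\<And>g z. g \<in> W \<Longrightarrow> z \<in> K \<Longrightarrow> \<bar>g z - g0 z\<bar> < e"
proof -
  have "\<exists>r>0. \<forall>y. dist y z \<le> r \<longrightarrow> dist (g0 y) (g0 z) < e / 2" for z
  proof -
    obtain r where "0 < r" "\<And>y. dist y z < r \<Longrightarrow> dist (g0 y) (g0 z) < e / 2"
      using g0 e unfolding continuous_on_iff by (metis UNIV_I half_gt_zero)
    then show ?thesis by (intro exI[of _ "r / 2"]) auto
  qed
  then obtain r where r: "\<And>z. 0 < r z" "\<And>z y. dist y z \<le> r z \<Longrightarrow> dist (g0 y) (g0 z) < e / 2" by metis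
  have "K \<subseteq> (\<Union>z\<in>K. ball z (r z))" using r(1) by force
  then obtain F where F: "F \<subseteq> K" "finite F" "K \<subseteq> (\<Union>z\<in>F. ball z (r z))"
    by (rule compactE_image[OF K open_ball])
  let ?O = "\<lambda>z. {h. continuous_on UNIV h \<and> h ` (K \<inter> cball z (r z)) \<subseteq> ball (g0 z) (e / 2)}"
  \<comment> \<open>The first factor keeps \<open>W\<close> among the continuous functions when
    \<open>F\<close> is empty.\<close>
  define W where "W = {h. continuous_on UNIV h} \<inter> (\<Inter>z\<in>F. ?O z)"
  have O: "openin compact_open_topology (?O z)" for z
    by (intro openin_compact_open compact_Int_closed K) auto
  show thesis
  proof (rule that[of W])
    show "openin compact_open_topology W"
    proof (cases "F = {}")
      case True
      then show ?thesis unfolding W_def using openin_topspace[of compact_open_topology] by (simp add: topspace_compact_open)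
    next
      case False
      then have "openin compact_open_topology (\<Inter>z\<in>F. ?O z)" using O F by (intro openin_Inter) auto
      moreover have "W = (\<Inter>z\<in>F. ?O z)" unfolding W_def using False by auto
      ultimately show ?thesis by simp
    qed
    have "g0 y \<in> ball (g0 z) (e / 2)" if "y \<in> cball z (r z)" for y z
      using r(2)[of y z] that by (simp add: dist_commute)
    then show "g0 \<in> W" unfolding W_def using g0 by blast
    show "\<bar>g z - g0 z\<bar> < e" if g: "g \<in> W" and z: "z \<in> K" for g z
    proof -
      obtain y where y: "y \<in> F" "z \<in> ball y (r y)" using F z by blast
      then have "g z \<in> ball (g0 y) (e / 2)" using g z unfolding W_def by fastforce
      moreover have "dist (g0 z) (g0 y) < e / 2" using r(2)[of z y] y(2) by (simp add: dist_commute)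
      ultimately have "\<bar>g0 y - g z\<bar> < e / 2" "\<bar>g0 z - g0 y\<bar> < e / 2" by (simp_all add: dist_real_def)
      moreover have "e / 2 + e / 2 = e" by simp
      ultimately show ?thesis by linarith
    qed
  qed
qed

section \<open>Solutions and the semiflow\<close>

text \<open>A solution together with an embedding constant, so that continuity in the fractional
  space can be used as continuity of values and slopes.\<close>

locale dirichlet_sol =
  fixes L \<alpha> :: real and g :: nonlinearity and u0 :: "real \<Rightarrow> real" and T :: real and u :: "real \<Rightarrow> real \<Rightarrow> real" and B :: real
  assumes L: "0 < L" and sol: "dirichlet_solution L \<alpha> g u0 T u"
    and B: "0 \<le> B" "\<And>w x. w \<in> frac_domain L \<alpha> \<inter> C1_interval L \<Longrightarrow> x \<in> {0..L} \<Longrightarrow>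
     \<bar>w x\<bar> \<le> B * frac_norm L \<alpha> w \<and> \<bar>D_on L w x\<bar> \<le> B * frac_norm L \<alpha> w"
begin

lemma T: "0 < T" and u_0: "u 0 = u0"
  using sol by (auto simp: dirichlet_solution_def)

lemma u_XD: "t \<in> {0..<T} \<Longrightarrow> u t \<in> XD L \<alpha>"
  using sol continuous_map_image_subset_topspace[of "top_of_set {0..<T}" "XD_topology L \<alpha>" u]
  unfolding dirichlet_solution_def topspace_XD_topology[OF L] by auto

lemma u_C1: "t \<in> {0..<T} \<Longrightarrow> u t \<in> C1_interval L"
  using u_XD by (auto simp: XD_def)

lemma u_close:
  assumes t: "t \<in> {0..<T}" and e: "0 < e"
  obtains \<delta> where "0 < \<delta>" "\<And>s x. s \<in> {0..<T} \<Longrightarrow> \<bar>s - t\<bar> < \<delta> \<Longrightarrow> x \<in> {0..L} \<Longrightarrow> \<bar>u s x - u t x\<bar> < e \<and> \<bar>D_on L (u s) x - D_on L (u t) x\<bar> < e"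
proof -
  define d where "d = e / (B + 1)"
  have d: "0 < d" "B * d < e" using e B(1) by (auto simp: d_def field_simps)
  let ?W = "{v \<in> XD L \<alpha>. u t \<in> XD L \<alpha> \<and> XD_dist L \<alpha> (u t) v < d}"
  have "continuous_map (top_of_set {0..<T}) (XD_topology L \<alpha>) u" using sol by (simp add: dirichlet_solution_def)
  from openin_continuous_map_preimage[OF this openin_XD_ball[OF L]]
  have "openin (top_of_set {0..<T}) {s \<in> {0..<T}. u s \<in> ?W}" by simp
  then obtain O' where O': "open O'" "{s \<in> {0..<T}. u s \<in> ?W} = {0..<T} \<inter> O'" unfolding openin_open by blast
  have "XD_dist L \<alpha> (u t) (u t) = 0" using Metric_space.zero[OF Metric_space_XD[OF L] u_XD[OF t] u_XD[OF t]] by simp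
  then have "t \<in> {0..<T} \<inter> O'" using t u_XD[OF t] d(1) unfolding O'(2)[symmetric] by simp
  then obtain \<delta> where \<delta>: "0 < \<delta>" "ball t \<delta> \<subseteq> O'" using O'(1) openE by blast
  show thesis
  proof (rule that[OF \<delta>(1)])
    fix s x assume s: "s \<in> {0..<T}" "\<bar>s - t\<bar> < \<delta>" and x: "x \<in> {0..L}"
    have "s \<in> {0..<T} \<inter> O'" using s \<delta> by (auto simp: dist_real_def abs_minus_commute)
    then have dd: "XD_dist L \<alpha> (u t) (u s) < d" unfolding O'(2)[symmetric] by simp
    have "B * XD_dist L \<alpha> (u t) (u s) \<le> B * d" using dd B(1) by (intro mult_left_mono) auto
    then show "\<bar>u s x - u t x\<bar> < e \<and> \<bar>D_on L (u s) x - D_on L (u t) x\<bar> < e"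
      using XD_C1_distance[OF L B(2) u_XD[OF t] u_XD[OF s(1)] x] d(2) by (simp add: abs_minus_commute)
  qed
qed

text \<open>Continuity in time is uniform in space by the embedding; together with continuity of
  each single profile this is joint continuity.\<close>

lemma joint_cont:
  assumes H: "H = (\<lambda>t x. u t x) \<or> H = (\<lambda>t x. D_on L (u t) x)"
  shows "continuous_on ({0..<T} \<times> {0..L}) (\<lambda>(t, x). H t x)"
  unfolding continuous_on_iff
proof (intro ballI allI impI)
  fix z and e :: real assume z: "z \<in> {0..<T} \<times> {0..L}" and e: "0 < e"
  obtain t x where tx: "z = (t, x)" "t \<in> {0..<T}" "x \<in> {0..L}" using z by auto
  have e2: "0 < e / 2" using e by simp
  have "continuous_on {0..L} (H t)"
    using H C1_interval_continuous[OF u_C1[OF tx(2)]] u_C1[OF tx(2)] by (auto simp: C1_interval_def)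
  then obtain d1 where d1: "0 < d1" "\<And>y. y \<in> {0..L} \<Longrightarrow> dist y x < d1 \<Longrightarrow> dist (H t y) (H t x) < e / 2"
    using tx(3) e2 unfolding continuous_on_iff by meson
  obtain d2 where d2: "0 < d2" "\<And>s y. s \<in> {0..<T} \<Longrightarrow> \<bar>s - t\<bar> < d2 \<Longrightarrow> y \<in> {0..L} \<Longrightarrow> \<bar>u s y - u t y\<bar> < e / 2 \<and> \<bar>D_on L (u s) y - D_on L (u t) y\<bar> < e / 2"
    using u_close[OF tx(2) e2] by metis
  have "dist (H s y) (H t x) < e" if "s \<in> {0..<T}" "y \<in> {0..L}" "dist (s, y) (t, x) < min d1 d2" for s y
  proof -
    have "dist s t < min d1 d2" "dist y x < min d1 d2"
      using dist_fst_le[of "(s, y)" "(t, x)"] dist_snd_le[of "(s, y)" "(t, x)"] that(3) by simp_all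
    then have "dist (H t y) (H t x) < e / 2" "dist (H s y) (H t y) < e / 2"
      using d1(2)[of y] d2(2)[of s y] that H by (auto simp: dist_real_def)
    then show ?thesis using dist_triangle_half_l[of "H s y" "H t y" e "H t x"] by (simp add: dist_commute)
  qed
  then show "\<exists>d>0. \<forall>x'\<in>{0..<T} \<times> {0..L}. dist x' z < d \<longrightarrow> dist (case x' of (t, x) \<Rightarrow> H t x) (case z of (t, x) \<Rightarrow> H t x) < e"
    using d1(1) d2(1) unfolding tx(1) by (intro exI[of _ "min d1 d2"]) auto
qed

lemma u_cont: "continuous_on ({0..<T} \<times> {0..L}) (\<lambda>(t, x). u t x)"
  and ux_cont: "continuous_on ({0..<T} \<times> {0..L}) (\<lambda>(t, x). D_on L (u t) x)"
  by (rule joint_cont; simp)+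

lemma bounded_upto:
  assumes "t1 < T"
  obtains R where "\<And>t x. t \<in> {0..t1} \<Longrightarrow> x \<in> {0..L} \<Longrightarrow> \<bar>u t x\<bar> \<le> R \<and> \<bar>D_on L (u t) x\<bar> \<le> R"
proof -
  let ?S = "{0..t1} \<times> {0..L}"
  have S: "?S \<subseteq> {0..<T} \<times> {0..L}" "compact ?S" using assms by (auto intro: compact_Times)
  have "bounded ((\<lambda>(t, x). u t x) ` ?S)" "bounded ((\<lambda>(t, x). D_on L (u t) x) ` ?S)"
    by (intro compact_imp_bounded compact_continuous_image continuous_on_subset[OF _ S(1)] u_cont ux_cont S(2))+
  then obtain b1 b2 where b: "\<forall>y\<in>(\<lambda>(t, x). u t x) ` ?S. norm y \<le> b1" "\<forall>y\<in>(\<lambda>(t, x). D_on L (u t) x) ` ?S. norm y \<le> b2"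
    unfolding bounded_iff by (elim exE)
  show thesis
  proof (rule that[of "max b1 b2"])
    fix t x assume "t \<in> {0..t1}" "x \<in> {0..L}"
    then have "(t, x) \<in> ?S" by simp
    then show "\<bar>u t x\<bar> \<le> max b1 b2 \<and> \<bar>D_on L (u t) x\<bar> \<le> max b1 b2"
      using bspec[OF b(1) imageI, of "(t, x)"] bspec[OF b(2) imageI, of "(t, x)"] by (simp add: le_max_iff_disj)
  qed
qed

lemma interior:
  assumes t: "0 < t" "t < T" and x: "0 < x" "x < L"
  shows "\<exists>ut uxx. ((\<lambda>s. u s x) has_real_derivative ut) (at t) \<and> (u t has_real_derivative D_on L (u t) x) (at x) \<and>
    has_sym_deriv2 (u t) x uxx \<and> ut = uxx + g (t, u t x, D_on L (u t) x)"
proof -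
  have i: "(\<lambda>s. u s y) field_differentiable (at t)" "u t field_differentiable (at y)" "deriv (u t) field_differentiable (at y)"
    "deriv (\<lambda>s. u s y) t = deriv (deriv (u t)) y + g (t, u t y, deriv (u t) y)" if "0 < y" "y < L" for y
    using sol t that unfolding dirichlet_solution_def by auto
  have d: "(u t has_real_derivative deriv (u t) y) (at y)" if "0 < y" "y < L" for y
    using i(2)[OF that] by (simp add: DERIV_deriv_iff_field_differentiable)
  have "D_on L (u t) x = deriv (u t) x"
    by (rule D_on_eqI[OF L has_field_derivative_at_within[OF d[OF x]]]) (use x in auto)
  moreover have "has_sym_deriv2 (u t) x (deriv (deriv (u t)) x)"
  proof (rule has_sym_deriv2_DERIV[where \<delta> = "min x (L - x)"])
    show "(u t has_real_derivative deriv (u t) y) (at y)" if "\<bar>y - x\<bar> < min x (L - x)" for y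
      by (rule d) (use that in auto)
    show "(deriv (u t) has_real_derivative deriv (deriv (u t)) x) (at x)"
      using i(3)[OF x] by (simp add: DERIV_deriv_iff_field_differentiable)
  qed (use x in auto)
  moreover have "((\<lambda>s. u s x) has_real_derivative deriv (\<lambda>s. u s x) t) (at t)"
    using i(1)[OF x] by (simp add: DERIV_deriv_iff_field_differentiable)
  ultimately show ?thesis using i(4)[OF x] d[OF x] by (intro exI[of _ "deriv (\<lambda>s. u s x) t"] exI[of _ "deriv (deriv (u t)) x"]) simp
qed

lemma boundary: "t \<in> {0..<T} \<Longrightarrow> u t 0 = 0 \<and> u t L = 0"
  using sol by (auto simp: dirichlet_solution_def)

end

section \<open>Continuous dependence, uniqueness and time shifts\<close>

text \<open>Gronwall's estimate in the maximum norm, by comparison: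
  \<open>\<eta> t = exp (C * t) * (\<delta> + \<epsilon> * t)\<close> grows at least at the rate
  \<open>C * \<eta> + \<epsilon>\<close>, so for both signs \<open>\<sigma>\<close> the function
  \<open>\<eta> - \<sigma> * (u - v)\<close> is a supersolution wherever it is negative.\<close>

lemma solution_dependence:
  assumes U: "dirichlet_sol L \<alpha> g u0 T u B" and V: "dirichlet_sol L \<alpha> h v0 T' v B"
    and t1: "t1 < T" "t1 < T'" and C: "0 \<le> C"
    and R: "\<And>t x. t \<in> {0..t1} \<Longrightarrow> x \<in> {0..L} \<Longrightarrow> \<bar>u t x\<bar> \<le> R \<and> \<bar>D_on L (u t) x\<bar> \<le> R \<and> \<bar>v t x\<bar> \<le> R \<and> \<bar>D_on L (v t) x\<bar> \<le> R"
    and lip: "\<And>t a b p q. \<bar>a\<bar> \<le> R \<Longrightarrow> \<bar>b\<bar> \<le> R \<Longrightarrow> \<bar>p\<bar> \<le> R \<Longrightarrow> \<bar>q\<bar> \<le> R \<Longrightarrow>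
      \<bar>g (t, a, p) - g (t, b, q)\<bar> \<le> C * (\<bar>a - b\<bar> + \<bar>p - q\<bar>)"
    and gh: "\<And>t a p. t \<in> {0..t1} \<Longrightarrow> \<bar>a\<bar> \<le> R \<Longrightarrow> \<bar>p\<bar> \<le> R \<Longrightarrow> \<bar>g (t, a, p) - h (t, a, p)\<bar> \<le> \<epsilon>"
    and init: "\<And>x. x \<in> {0..L} \<Longrightarrow> \<bar>u0 x - v0 x\<bar> \<le> \<delta>" and ed: "0 \<le> \<epsilon>" "0 \<le> \<delta>"
    and t: "t \<in> {0..t1}" and x: "x \<in> {0..L}"
  shows "\<bar>u t x - v t x\<bar> \<le> exp (C * t) * (\<delta> + \<epsilon> * t)"
proof -
  interpret U: dirichlet_sol L \<alpha> g u0 T u B by (rule U)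
  interpret V: dirichlet_sol L \<alpha> h v0 T' v B by (rule V)
  define \<eta> where "\<eta> t = exp (C * t) * (\<delta> + \<epsilon> * t)" for t
  have \<eta>0: "0 \<le> \<eta> t" if "0 \<le> t" for t using that ed by (simp add: \<eta>_def)
  have main: "0 \<le> \<eta> t - \<sigma> * (u t x - v t x)" if \<sigma>: "\<bar>\<sigma>\<bar> = 1" for \<sigma>
  proof (rule comparison_principle[where d = "\<lambda>t x. \<eta> t - \<sigma> * (u t x - v t x)" and S = "{0..t1} \<times> {0..L}" and C = C])
    show "compact ({0..t1} \<times> {0..L})" by (intro compact_Times compact_Icc)
    show "(t, x) \<in> {0..t1} \<times> {0..L}" using t x by simp
    have S: "{0..t1} \<times> {0..L} \<subseteq> {0..<T} \<times> {0..L}" "{0..t1} \<times> {0..L} \<subseteq> {0..<T'} \<times> {0..L}" using t1 by auto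
    show "continuous_on ({0..t1} \<times> {0..L}) (\<lambda>(t, x). \<eta> t - \<sigma> * (u t x - v t x))"
      unfolding split_def \<eta>_def
      by (intro continuous_on_diff continuous_on_mult_left
          continuous_on_subset[OF U.u_cont[unfolded split_def] S(1)] continuous_on_subset[OF V.u_cont[unfolded split_def] S(2)])
        (intro continuous_intros)
    fix \<tau> y assume "(\<tau>, y) \<in> {0..t1} \<times> {0..L}" and n: "\<eta> \<tau> - \<sigma> * (u \<tau> y - v \<tau> y) < 0"
    then have S': "\<tau> \<in> {0..t1}" "y \<in> {0..L}" by auto
    have ab: "\<sigma> * (u \<tau> y - v \<tau> y) \<le> \<bar>u \<tau> y - v \<tau> y\<bar>"
      using abs_ge_self[of "\<sigma> * (u \<tau> y - v \<tau> y)"] \<sigma> by (simp add: abs_mult)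
    have "\<tau> \<noteq> 0"
    proof
      assume "\<tau> = 0"
      then show False using n ab init[OF S'(2)] by (simp add: \<eta>_def U.u_0 V.u_0)
    qed
    moreover have "y \<noteq> 0"
    proof
      assume "y = 0"
      then show False using n \<eta>0[of \<tau>] U.boundary[of \<tau>] V.boundary[of \<tau>] S' t1 by simp
    qed
    moreover have "y \<noteq> L"
    proof
      assume "y = L"
      then show False using n \<eta>0[of \<tau>] U.boundary[of \<tau>] V.boundary[of \<tau>] S' t1 by simp
    qed
    ultimately have y: "0 < \<tau>" "\<tau> \<le> t1" "0 < y" "y < L" using S' by auto
    obtain a1 b1 where 1: "((\<lambda>s. u s y) has_real_derivative a1) (at \<tau>)" "(u \<tau> has_real_derivative D_on L (u \<tau>) y) (at y)"
      "has_sym_deriv2 (u \<tau>) y b1" "a1 = b1 + g (\<tau>, u \<tau> y, D_on L (u \<tau>) y)" using U.interior[of \<tau> y] y t1 by auto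
    obtain a2 b2 where 2: "((\<lambda>s. v s y) has_real_derivative a2) (at \<tau>)" "(v \<tau> has_real_derivative D_on L (v \<tau>) y) (at y)"
      "has_sym_deriv2 (v \<tau>) y b2" "a2 = b2 + h (\<tau>, v \<tau> y, D_on L (v \<tau>) y)" using V.interior[of \<tau> y] y t1 by auto
    have d\<eta>: "(\<eta> has_real_derivative C * \<eta> \<tau> + \<epsilon> * exp (C * \<tau>)) (at \<tau>)"
      unfolding \<eta>_def by (auto intro!: derivative_eq_intros simp: algebra_simps)
    have "((\<lambda>s. \<eta> s - \<sigma> * (u s y - v s y)) has_real_derivative (C * \<eta> \<tau> + \<epsilon> * exp (C * \<tau>)) - \<sigma> * (a1 - a2)) (at \<tau>)"
      by (intro DERIV_diff DERIV_cmult d\<eta> 1(1) 2(1))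
    moreover have "((\<lambda>y. \<eta> \<tau> - \<sigma> * (u \<tau> y - v \<tau> y)) has_real_derivative 0 - \<sigma> * (D_on L (u \<tau>) y - D_on L (v \<tau>) y)) (at y)"
      by (intro DERIV_diff DERIV_cmult DERIV_const 1(2) 2(2))
    moreover have "has_sym_deriv2 (\<lambda>y. \<eta> \<tau> - \<sigma> * (u \<tau> y - v \<tau> y)) y (0 - \<sigma> * (b1 - b2))"
      by (intro has_sym_deriv2_diff has_sym_deriv2_cmult 1(3) 2(3)) (simp add: has_sym_deriv2_def)
    moreover have "- (C * (\<bar>\<eta> \<tau> - \<sigma> * (u \<tau> y - v \<tau> y)\<bar> + \<bar>0 - \<sigma> * (D_on L (u \<tau>) y - D_on L (v \<tau>) y)\<bar>))
        \<le> (C * \<eta> \<tau> + \<epsilon> * exp (C * \<tau>)) - \<sigma> * (a1 - a2) - (0 - \<sigma> * (b1 - b2))"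
    proof -
      let ?w = "\<bar>u \<tau> y - v \<tau> y\<bar>" and ?p = "\<bar>D_on L (u \<tau>) y - D_on L (v \<tau>) y\<bar>"
      have r: "\<bar>u \<tau> y\<bar> \<le> R" "\<bar>D_on L (u \<tau>) y\<bar> \<le> R" "\<bar>v \<tau> y\<bar> \<le> R" "\<bar>D_on L (v \<tau>) y\<bar> \<le> R" using R[OF S'] by auto
      have "\<bar>(a1 - a2) - (b1 - b2)\<bar> \<le> C * (?w + ?p) + \<epsilon>"
        using lip[OF r(1,3,2,4), of \<tau>] gh[OF S'(1) r(3,4)] unfolding 1(4) 2(4) by linarith
      moreover have "\<bar>\<sigma> * ((a1 - a2) - (b1 - b2))\<bar> = \<bar>(a1 - a2) - (b1 - b2)\<bar>" using \<sigma> by (simp add: abs_mult)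
      ultimately have 3: "\<sigma> * ((a1 - a2) - (b1 - b2)) \<le> C * (?w + ?p) + \<epsilon>" by linarith
      have "\<bar>\<sigma> * (u \<tau> y - v \<tau> y)\<bar> = ?w" using \<sigma> by (simp add: abs_mult)
      then have "?w \<le> \<bar>\<eta> \<tau> - \<sigma> * (u \<tau> y - v \<tau> y)\<bar> + \<eta> \<tau>" using n \<eta>0[of \<tau>] y by linarith
      moreover have "\<bar>0 - \<sigma> * (D_on L (u \<tau>) y - D_on L (v \<tau>) y)\<bar> = ?p" using \<sigma> by (simp add: abs_mult)
      ultimately have "C * (?w + ?p) \<le> C * ((\<bar>\<eta> \<tau> - \<sigma> * (u \<tau> y - v \<tau> y)\<bar> + \<bar>0 - \<sigma> * (D_on L (u \<tau>) y - D_on L (v \<tau>) y)\<bar>) + \<eta> \<tau>)"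
        using C by (intro mult_left_mono) auto
      moreover have "\<epsilon> * 1 \<le> \<epsilon> * exp (C * \<tau>)" using ed C y by (intro mult_left_mono) auto
      ultimately show ?thesis using 3 unfolding distrib_left[of C _ "\<eta> \<tau>"] right_diff_distrib[of \<sigma> "a1 - a2"] by linarith
    qed
    ultimately have ps: "par_super C (\<lambda>t x. \<eta> t - \<sigma> * (u t x - v t x)) \<tau> y" unfolding par_super_def by blast
    define d where "d = Min {\<tau>, y, L - y}"
    have d: "0 < d" "d \<le> \<tau>" "d \<le> y" "d \<le> L - y" using y by (auto simp: d_def)
    have "(a, y) \<in> {0..t1} \<times> {0..L}" if "\<tau> - d < a" "a < \<tau>" for a using that d y by auto
    moreover have "(\<tau>, z) \<in> {0..t1} \<times> {0..L}" if "\<bar>z - y\<bar> < d" for z using that d y by auto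
    ultimately show "par_super C (\<lambda>t x. \<eta> t - \<sigma> * (u t x - v t x)) \<tau> y \<and>
       (\<exists>\<delta>>0. (\<forall>s. \<tau> - \<delta> < s \<and> s < \<tau> \<longrightarrow> (s, y) \<in> {0..t1} \<times> {0..L}) \<and> (\<forall>ya. \<bar>ya - y\<bar> < \<delta> \<longrightarrow> (\<tau>, ya) \<in> {0..t1} \<times> {0..L}))"
      using ps d(1) by blast
  qed
  from main[of 1] main[of "- 1"] show ?thesis by (simp add: \<eta>_def abs_le_iff)
qed

lemma solution_unique:
  assumes f: "standing_assumption f" and g: "g \<in> Hull f"
    and U: "dirichlet_sol L \<alpha> g u0 T u B" and V: "dirichlet_sol L \<alpha> g u0 T' v B"
    and t: "0 \<le> t" "t < T" "t < T'"
  shows "u t = v t"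
proof -
  interpret U: dirichlet_sol L \<alpha> g u0 T u B by (rule U)
  interpret V: dirichlet_sol L \<alpha> g u0 T' v B by (rule V)
  obtain R1 where R1: "\<And>s x. s \<in> {0..t} \<Longrightarrow> x \<in> {0..L} \<Longrightarrow> \<bar>u s x\<bar> \<le> R1 \<and> \<bar>D_on L (u s) x\<bar> \<le> R1" using U.bounded_upto[OF t(2)] by metis
  obtain R2 where R2: "\<And>s x. s \<in> {0..t} \<Longrightarrow> x \<in> {0..L} \<Longrightarrow> \<bar>v s x\<bar> \<le> R2 \<and> \<bar>D_on L (v s) x\<bar> \<le> R2" using V.bounded_upto[OF t(3)] by metis
  obtain C where C: "0 \<le> C" "\<And>g t u v p q. g \<in> Hull f \<Longrightarrow> \<bar>u\<bar> \<le> max R1 R2 \<Longrightarrow> \<bar>v\<bar> \<le> max R1 R2 \<Longrightarrow> \<bar>p\<bar> \<le> max R1 R2 \<Longrightarrow> \<bar>q\<bar> \<le> max R1 R2 \<Longrightarrow>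
    \<bar>g (t, u, p) - g (t, v, q)\<bar> \<le> C * (\<bar>u - v\<bar> + \<bar>p - q\<bar>)" using Hull_lipschitz[OF f] by metis
  have "\<bar>u t x - v t x\<bar> \<le> exp (C * t) * (0 + 0 * t)" if x: "x \<in> {0..L}" for x
  proof (rule solution_dependence[OF U V t(2,3) C(1)])
    show "\<bar>u s x\<bar> \<le> max R1 R2 \<and> \<bar>D_on L (u s) x\<bar> \<le> max R1 R2 \<and> \<bar>v s x\<bar> \<le> max R1 R2 \<and> \<bar>D_on L (v s) x\<bar> \<le> max R1 R2"
      if "s \<in> {0..t}" "x \<in> {0..L}" for s x using R1[OF that] R2[OF that] by (auto simp: le_max_iff_disj)
  qed (use C(2)[OF g] t x in auto)
  then show ?thesis by (intro XD_eqI[OF U.u_XD V.u_XD]) (use t in auto)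
qed

text \<open>Uniqueness makes the definite description in \<open>phiD\<close> meaningful, whichever
  existence interval is used.\<close>

lemma phiD_eq:
  assumes f: "standing_assumption f" and g: "g \<in> Hull f" and U: "dirichlet_sol L \<alpha> g u0 T u B" and t: "0 \<le> t" "t < T"
  shows "phiD L \<alpha> t u0 g = u t"
  unfolding phiD_def
proof (rule the_equality)
  interpret U: dirichlet_sol L \<alpha> g u0 T u B by (rule U)
  show "\<exists>T ua. t < T \<and> dirichlet_solution L \<alpha> g u0 T ua \<and> u t = ua t" using t U.sol by blast
  fix w assume "\<exists>T u. t < T \<and> dirichlet_solution L \<alpha> g u0 T u \<and> w = u t"
  then obtain T' v where v: "t < T'" "dirichlet_solution L \<alpha> g u0 T' v" "w = v t" by blast
  have "dirichlet_sol L \<alpha> g u0 T' v B" using U.L U.B v(2) unfolding dirichlet_sol_def by blast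
  then show "w = u t" using solution_unique[OF f g _ U t(1) v(1) t(2)] v(3) by simp
qed

lemma solution_shift:
  assumes U: "dirichlet_sol L \<alpha> g u0 T u B" and s: "0 \<le> s" "s < T"
  shows "dirichlet_sol L \<alpha> (time_shift s g) (u s) (T - s) (\<lambda>t. u (t + s)) B"
proof -
  interpret U: dirichlet_sol L \<alpha> g u0 T u B by (rule U)
  have "dirichlet_solution L \<alpha> (time_shift s g) (u s) (T - s) (\<lambda>t. u (t + s))"
    unfolding dirichlet_solution_def
  proof (intro conjI ballI)
    have "continuous_map (top_of_set {0..<T - s}) (top_of_set {0..<T}) (\<lambda>t. t + s)"
      by (auto simp: continuous_map_in_subtopology intro!: continuous_intros) (use s in auto)
    then show "continuous_map (top_of_set {0..<T - s}) (XD_topology L \<alpha>) (\<lambda>t. u (t + s))"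
      using continuous_map_compose[of _ "top_of_set {0..<T}" "\<lambda>t. t + s" "XD_topology L \<alpha>" u] U.sol
      unfolding dirichlet_solution_def o_def by blast
    fix t assume t: "t \<in> {0<..<T - s}"
    fix x assume x: "x \<in> {0<..<L}"
    have ts: "t + s \<in> {0<..<T}" using t s by auto
    have i: "(\<lambda>r. u r x) field_differentiable (at (t + s))" "u (t + s) field_differentiable (at x)" "deriv (u (t + s)) field_differentiable (at x)"
      "deriv (\<lambda>r. u r x) (t + s) = deriv (deriv (u (t + s))) x + g (t + s, u (t + s) x, deriv (u (t + s)) x)"
      using U.sol ts x unfolding dirichlet_solution_def by blast+
    have "((\<lambda>r. u r x) has_real_derivative deriv (\<lambda>r. u r x) (t + s)) (at (t + s))"
      using i(1) by (simp add: DERIV_deriv_iff_field_differentiable)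
    then have d: "((\<lambda>r. u (r + s) x) has_real_derivative deriv (\<lambda>r. u r x) (t + s)) (at t)" by (simp add: DERIV_shift)
    then show "(\<lambda>r. u (r + s) x) field_differentiable (at t)" unfolding field_differentiable_def by blast
    show "u (t + s) field_differentiable (at x)" "deriv (u (t + s)) field_differentiable (at x)" using i by auto
    show "deriv (\<lambda>r. u (r + s) x) t = deriv (deriv (u (t + s))) x + time_shift s g (t, u (t + s) x, deriv (u (t + s)) x)"
      using DERIV_imp_deriv[OF d] i(4) by (simp add: time_shift_def)
  qed (use s U.boundary in auto)
  then show ?thesis using U.L U.B unfolding dirichlet_sol_def by blast
qed

lemma time_shift_add: "time_shift s (time_shift t g) = time_shift (s + t) g"
  by (auto simp: time_shift_def fun_eq_iff add_ac)

lemma time_shift_0 [simp]: "time_shift 0 g = g"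
  by (auto simp: time_shift_def fun_eq_iff)

lemma continuous_map_realI:
  assumes "\<And>m e. m \<in> topspace X \<Longrightarrow> 0 < e \<Longrightarrow> \<exists>W. openin X W \<and> m \<in> W \<and> (\<forall>m'\<in>W. \<bar>h m' - h m\<bar> < e)"
  shows "continuous_map X euclideanreal h"
  unfolding continuous_map_def
proof (intro conjI allI impI)
  fix O' :: "real set" assume O': "openin euclideanreal O'"
  show "openin X {m \<in> topspace X. h m \<in> O'}"
  proof (subst openin_subopen, intro ballI)
    fix m assume m: "m \<in> {m \<in> topspace X. h m \<in> O'}"
    then obtain e where e: "0 < e" "ball (h m) e \<subseteq> O'" using O' openE by (metis mem_Collect_eq open_openin)
    obtain W where W: "openin X W" "m \<in> W" "\<forall>m'\<in>W. \<bar>h m' - h m\<bar> < e" using assms[of m e] m e(1) by auto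
    have "W \<subseteq> {m \<in> topspace X. h m \<in> O'}"
      using W(3) e(2) openin_subset[OF W(1)] by (fastforce simp: dist_real_def abs_minus_commute)
    then show "\<exists>T. openin X T \<and> m \<in> T \<and> T \<subseteq> {m \<in> topspace X. h m \<in> O'}" using W by blast
  qed
qed auto

lemma continuous_on_realI:
  assumes "\<And>m e. m \<in> S \<Longrightarrow> 0 < e \<Longrightarrow> \<exists>W. openin (top_of_set S) W \<and> m \<in> W \<and> (\<forall>m'\<in>W. \<bar>h m' - h m\<bar> < e)"
  shows "continuous_on S (h :: _ \<Rightarrow> real)"
  using continuous_map_realI[of "top_of_set S" h] assms by simp

section \<open>The minimal set as a compact space with a continuous semiflow\<close>

lemma Hausdorff_euclidean_fun: "Hausdorff_space (euclidean :: ('a \<Rightarrow> real) topology)"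
  unfolding euclidean_product_topology[symmetric] by (simp add: Hausdorff_space_product_topology)

lemma Hausdorff_compact_open: "Hausdorff_space (compact_open_topology :: ('a::topological_space \<Rightarrow> real) topology)"
  unfolding Hausdorff_space_def
proof (intro allI impI)
  fix g h :: "'a \<Rightarrow> real"
  assume "g \<in> topspace compact_open_topology \<and> h \<in> topspace compact_open_topology \<and> g \<noteq> h"
  then have c: "continuous_on UNIV g" "continuous_on UNIV h" and "g \<noteq> h" by (auto simp: topspace_compact_open)
  then obtain z where "g z \<noteq> h z" by blast
  then obtain U V where UV: "open U" "open V" "g z \<in> U" "h z \<in> V" "U \<inter> V = {}" using hausdorff by metis
  let ?O = "\<lambda>W. {f. continuous_on UNIV f \<and> f ` {z} \<subseteq> (W :: real set)}"
  have "openin compact_open_topology (?O U)" "openin compact_open_topology (?O V)" by (rule openin_compact_open; simp add: UV)+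
  moreover have "disjnt (?O U) (?O V)" using UV(5) by (auto simp: disjnt_def)
  ultimately show "\<exists>U V. openin compact_open_topology U \<and> openin compact_open_topology V \<and> g \<in> U \<and> h \<in> V \<and> disjnt U V"
    using UV(3,4) c by (intro exI[of _ "?O U"] exI[of _ "?O V"]) auto
qed

locale minimal_setting =
  fixes f :: nonlinearity and L \<alpha> B :: real and M :: "phase_point set"
  assumes f: "standing_assumption f" and L: "0 < L"
    and B: "0 \<le> B" "\<And>w x. w \<in> frac_domain L \<alpha> \<inter> C1_interval L \<Longrightarrow> x \<in> {0..L} \<Longrightarrow>
     \<bar>w x\<bar> \<le> B * frac_norm L \<alpha> w \<and> \<bar>D_on L w x\<bar> \<le> B * frac_norm L \<alpha> w"
    and M: "minimal_set L \<alpha> f M"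
begin

abbreviation "XM \<equiv> subtopology (phase_space L \<alpha> f) M"
abbreviation "\<Phi> \<equiv> PiD L \<alpha>"

lemma M_mem:
  assumes "m \<in> M" shows "fst m \<in> XD L \<alpha>" "snd m \<in> Hull f"
proof -
  have "M \<subseteq> topspace (phase_space L \<alpha> f)" using M compactin_subset_topspace unfolding minimal_set_def by blast
  then have "M \<subseteq> XD L \<alpha> \<times> Hull f"
    by (auto simp: phase_space_def hull_topology_def topspace_XD_topology[OF L])
  then show "fst m \<in> XD L \<alpha>" "snd m \<in> Hull f" using assms by auto
qed

lemma topspace_XM: "topspace XM = M"
  using M compactin_subset_topspace unfolding minimal_set_def by (simp add: topspace_subtopology) blast

lemma \<Phi>_in: "m \<in> M \<Longrightarrow> 0 \<le> t \<Longrightarrow> \<Phi> t m \<in> M"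
  using M unfolding minimal_set_def positively_invariant_def by auto

text \<open>Positive invariance provides a solution beyond every prescribed time; one and the same
  solution describes the whole orbit up to then.\<close>

lemma solution:
  assumes m: "m \<in> M" and t: "0 \<le> t"
  obtains T u where "t < T" "dirichlet_sol L \<alpha> (snd m) (fst m) T u B"
    "\<And>s. 0 \<le> s \<Longrightarrow> s < T \<Longrightarrow> \<Phi> s m = (u s, time_shift s (snd m))"
proof -
  have "phiD_exists L \<alpha> t (fst m) (snd m)"
    using M m t unfolding minimal_set_def positively_invariant_def by (auto simp: split_def)
  then obtain T u where u: "t < T" "dirichlet_solution L \<alpha> (snd m) (fst m) T u" unfolding phiD_exists_def by blast
  then have ds: "dirichlet_sol L \<alpha> (snd m) (fst m) T u B" using L B unfolding dirichlet_sol_def by blast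
  show thesis
  proof (rule that[OF u(1) ds])
    fix s assume "0 \<le> s" "s < T"
    then show "\<Phi> s m = (u s, time_shift s (snd m))"
      using phiD_eq[OF f M_mem(2)[OF m] ds] by (simp add: PiD_def split_def)
  qed
qed

lemma snd_\<Phi>: "snd (\<Phi> t m) = time_shift t (snd m)"
  by (simp add: PiD_def split_def)

lemma \<Phi>_0: "m \<in> M \<Longrightarrow> \<Phi> 0 m = m"
proof -
  assume m: "m \<in> M"
  obtain T u where u: "0 < T" "dirichlet_sol L \<alpha> (snd m) (fst m) T u B"
    "\<And>s. 0 \<le> s \<Longrightarrow> s < T \<Longrightarrow> \<Phi> s m = (u s, time_shift s (snd m))" using solution[OF m order_refl] by metis
  then show "\<Phi> 0 m = m" using u(3)[of 0] dirichlet_sol.u_0[OF u(2)] by simp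
qed

lemma \<Phi>_add:
  assumes m: "m \<in> M" and s: "0 \<le> s" and t: "0 \<le> t"
  shows "\<Phi> (s + t) m = \<Phi> s (\<Phi> t m)"
proof -
  have st: "0 \<le> s + t" using s t by simp
  obtain T u where u: "s + t < T" "dirichlet_sol L \<alpha> (snd m) (fst m) T u B"
    "\<And>s. 0 \<le> s \<Longrightarrow> s < T \<Longrightarrow> \<Phi> s m = (u s, time_shift s (snd m))" using solution[OF m st] by metis
  have \<Phi>t: "\<Phi> t m = (u t, time_shift t (snd m))" using u(1,3) s t by simp
  have "dirichlet_sol L \<alpha> (time_shift t (snd m)) (u t) (T - t) (\<lambda>r. u (r + t)) B"
    by (rule solution_shift[OF u(2)]) (use u(1) s t in auto)
  moreover have "time_shift t (snd m) \<in> Hull f" using M_mem(2)[OF \<Phi>_in[OF m t]] by (simp add: snd_\<Phi>)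
  ultimately have "phiD L \<alpha> s (u t) (time_shift t (snd m)) = u (s + t)"
    using u(1) s by (intro phiD_eq[OF f]) auto
  then show ?thesis unfolding \<Phi>t using u(1,3) st by (simp add: PiD_def time_shift_add)
qed

lemma XM_nhd:
  assumes m0: "m0 \<in> M" and e: "0 < e" and K: "compact K"
  obtains W where "openin XM W" "m0 \<in> W"
    "\<And>m x. m \<in> W \<Longrightarrow> x \<in> {0..L} \<Longrightarrow> \<bar>fst m x - fst m0 x\<bar> < e \<and> \<bar>D_on L (fst m) x - D_on L (fst m0) x\<bar> < e"
    "\<And>m z. m \<in> W \<Longrightarrow> z \<in> K \<Longrightarrow> \<bar>snd m z - snd m0 z\<bar> < e"
proof -
  define d where "d = e / (B + 1)"
  have d: "0 < d" "B * d < e" using e B(1) by (auto simp: d_def field_simps)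
  let ?V = "{v \<in> XD L \<alpha>. fst m0 \<in> XD L \<alpha> \<and> XD_dist L \<alpha> (fst m0) v < d}"
  obtain W2 where W2: "openin compact_open_topology W2" "snd m0 \<in> W2" "\<And>g z. g \<in> W2 \<Longrightarrow> z \<in> K \<Longrightarrow> \<bar>g z - snd m0 z\<bar> < e"
    using compact_open_uniform_nhd[OF Hull_continuous[OF M_mem(2)[OF m0]] K e] by metis
  have "openin (hull_topology f) (W2 \<inter> Hull f)" unfolding hull_topology_def by (intro openin_subtopology_Int W2)
  then have "openin (phase_space L \<alpha> f) (?V \<times> (W2 \<inter> Hull f))"
    unfolding phase_space_def using openin_XD_ball[OF L] by (auto simp: openin_prod_Times_iff)
  then have 1: "openin XM ((?V \<times> (W2 \<inter> Hull f)) \<inter> M)" by (rule openin_subtopology_Int)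
  have z: "XD_dist L \<alpha> (fst m0) (fst m0) = 0"
    using Metric_space.zero[OF Metric_space_XD[OF L] M_mem(1)[OF m0] M_mem(1)[OF m0]] by simp
  show thesis
  proof (rule that[OF 1])
    show "m0 \<in> (?V \<times> (W2 \<inter> Hull f)) \<inter> M"
      using m0 M_mem[OF m0] W2(2) d(1) z by (auto simp: mem_Times_iff)
    show "\<bar>fst m x - fst m0 x\<bar> < e \<and> \<bar>D_on L (fst m) x - D_on L (fst m0) x\<bar> < e"
      if "m \<in> (?V \<times> (W2 \<inter> Hull f)) \<inter> M" "x \<in> {0..L}" for m x
    proof -
      have dd: "XD_dist L \<alpha> (fst m0) (fst m) < d" and m: "m \<in> M" using that(1) by auto
      have "B * XD_dist L \<alpha> (fst m0) (fst m) \<le> B * d" using dd B(1) by (intro mult_left_mono) auto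
      then show ?thesis
        using XD_C1_distance[OF L B(2) M_mem(1)[OF m0] M_mem(1)[OF m] that(2)] d(2) by (simp add: abs_minus_commute)
    qed
    show "\<bar>snd m z - snd m0 z\<bar> < e" if "m \<in> (?V \<times> (W2 \<inter> Hull f)) \<inter> M" "z \<in> K" for m z
      using that by (intro W2(3)) auto
  qed
qed

lemma Hausdorff_M: "Hausdorff_space (top_of_set M)"
  unfolding prod_topology_euclidean[symmetric]
  by (intro Hausdorff_space_subtopology) (simp only: Hausdorff_space_prod_topology Hausdorff_euclidean_fun simp_thms)

lemma compact_space_XM: "compact_space XM"
  using M unfolding minimal_set_def by (simp add: compact_space_subtopology)

text \<open>On the compact set \<open>M\<close> the topology of the phase space coincides with the (coarser, Hausdorff)
  topology of pointwise convergence, which is the one of the type class.\<close>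
lemma XM_eq: "XM = top_of_set M"
proof -
  have 1: "continuous_map XM euclideanreal (\<lambda>m. fst m x)" for x
  proof (rule continuous_map_realI)
    fix m0 and e :: real assume m0: "m0 \<in> topspace XM" and e: "0 < e"
    then have m0M: "m0 \<in> M" by (simp only: topspace_XM)
    show "\<exists>W. openin XM W \<and> m0 \<in> W \<and> (\<forall>m\<in>W. \<bar>fst m x - fst m0 x\<bar> < e)"
    proof (cases "x \<in> {0..L}")
      case True
      then show ?thesis using XM_nhd[OF m0M e compact_empty] by metis
    next
      case False
      have "fst m x = 0" if "m \<in> M" for m using M_mem(1)[OF that] False by (simp add: XD_def)
      then have "\<forall>m\<in>M. \<bar>fst m x - fst m0 x\<bar> < e" using m0M e by simp
      moreover have "openin XM M" using openin_topspace[of XM] by (simp only: topspace_XM)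
      ultimately show ?thesis using m0M by blast
    qed
  qed
  have 2: "continuous_map XM euclideanreal (\<lambda>m. snd m z)" for z
  proof (rule continuous_map_realI)
    fix m0 and e :: real assume m0: "m0 \<in> topspace XM" and e: "0 < e"
    then have m0M: "m0 \<in> M" by (simp only: topspace_XM)
    obtain W where "openin XM W" "m0 \<in> W" "\<And>m y. m \<in> W \<Longrightarrow> y \<in> {z} \<Longrightarrow> \<bar>snd m y - snd m0 y\<bar> < e"
      by (rule XM_nhd[OF m0M e, of "{z}"]) auto
    then show "\<exists>W. openin XM W \<and> m0 \<in> W \<and> (\<forall>m\<in>W. \<bar>snd m z - snd m0 z\<bar> < e)" by blast
  qed
  have "continuous_map XM euclidean (\<lambda>m. fst m)" "continuous_map XM euclidean (\<lambda>m. snd m)"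
    unfolding euclidean_product_topology[symmetric] continuous_map_componentwise_UNIV using 1 2 by auto
  then have "continuous_map XM (prod_topology euclidean euclidean) (\<lambda>m. (fst m, snd m))"
    by (intro continuous_map_pairedI)
  then have "continuous_map XM (top_of_set M) id"
    by (simp add: continuous_map_in_subtopology topspace_XM id_def)
  \<comment> \<open>A continuous bijection from a compact space to a Hausdorff space is a
    homeomorphism; for the identity this means equal topologies.\<close>
  from this compact_space_XM Hausdorff_M have "homeomorphic_map XM (top_of_set M) id"
    by (rule continuous_imp_homeomorphic_map)
      (simp_all only: topspace_XM image_id id_apply topspace_euclidean_subtopology inj_on_id)
  then show ?thesis by simp
qed

lemma compact_M: "compact M"
proof -
  have "compactin (top_of_set M) M" using compact_space_XM unfolding XM_eq compact_space_def by simp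
  then show ?thesis by (simp add: compactin_subtopology)
qed

lemma M_nhd:
  assumes "m0 \<in> M" "0 < e" "compact K"
  obtains W where "openin (top_of_set M) W" "m0 \<in> W"
    "\<And>m x. m \<in> W \<Longrightarrow> x \<in> {0..L} \<Longrightarrow> \<bar>fst m x - fst m0 x\<bar> < e \<and> \<bar>D_on L (fst m) x - D_on L (fst m0) x\<bar> < e"
    "\<And>m z. m \<in> W \<Longrightarrow> z \<in> K \<Longrightarrow> \<bar>snd m z - snd m0 z\<bar> < e"
  using XM_nhd[OF assms] unfolding XM_eq by metis

lemma U_cont:
  assumes H: "H = (\<lambda>m x. fst m x) \<or> H = (\<lambda>m x. D_on L (fst m) x)"
  shows "continuous_on (M \<times> {0..L}) (\<lambda>(m, x). H m x)"
proof (rule continuous_on_realI)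
  fix p and e :: real assume p: "p \<in> M \<times> {0..L}" and e: "0 < e"
  obtain m0 x0 where mx: "p = (m0, x0)" "m0 \<in> M" "x0 \<in> {0..L}" using p by auto
  have e2: "0 < e / 2" using e by simp
  have C1: "fst m0 \<in> C1_interval L" using M_mem(1)[OF mx(2)] by (simp add: XD_def)
  have "continuous_on {0..L} (H m0)"
    using H C1_interval_continuous[OF C1] C1 by (auto simp: C1_interval_def)
  then obtain d where d: "0 < d" "\<And>y. y \<in> {0..L} \<Longrightarrow> dist y x0 < d \<Longrightarrow> dist (H m0 y) (H m0 x0) < e / 2"
    using mx(3) e2 unfolding continuous_on_iff by meson
  obtain W where W: "openin (top_of_set M) W" "m0 \<in> W"
    "\<And>m x. m \<in> W \<Longrightarrow> x \<in> {0..L} \<Longrightarrow> \<bar>fst m x - fst m0 x\<bar> < e / 2 \<and> \<bar>D_on L (fst m) x - D_on L (fst m0) x\<bar> < e / 2"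
    using M_nhd[OF mx(2) e2 compact_empty] by metis
  have "openin (top_of_set {0..L}) ({0..L} \<inter> ball x0 d)" by (intro openin_open_Int) auto
  then have "openin (prod_topology (top_of_set M) (top_of_set {0..L})) (W \<times> ({0..L} \<inter> ball x0 d))"
    using W(1) by (simp only: openin_prod_Times_iff simp_thms)
  then have "openin (top_of_set (M \<times> {0..L})) (W \<times> ({0..L} \<inter> ball x0 d))" by simp
  moreover have "p \<in> W \<times> ({0..L} \<inter> ball x0 d)" using mx W(2) d(1) by simp
  moreover have "\<bar>(case q of (m, x) \<Rightarrow> H m x) - (case p of (m, x) \<Rightarrow> H m x)\<bar> < e" if "q \<in> W \<times> ({0..L} \<inter> ball x0 d)" for q
  proof -
    obtain m y where qm: "q = (m, y)" by (meson surj_pair)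
    have q: "q = (m, y)" "m \<in> W" "y \<in> {0..L}" "dist y x0 < d" using that qm by (auto simp: dist_commute)
    have "dist (H m y) (H m0 y) < e / 2" using W(3)[OF q(2,3)] H by (auto simp: dist_real_def)
    moreover have "dist (H m0 x0) (H m0 y) < e / 2" using d(2)[OF q(3,4)] by (simp add: dist_commute)
    ultimately have "dist (H m y) (H m0 x0) < e" using dist_triangle_half_l[of "H m y" "H m0 y" e "H m0 x0"] by simp
    then show ?thesis using q mx by (simp add: dist_real_def)
  qed
  ultimately show "\<exists>W. openin (top_of_set (M \<times> {0..L})) W \<and> p \<in> W \<and>
      (\<forall>q\<in>W. \<bar>(case q of (m, x) \<Rightarrow> H m x) - (case p of (m, x) \<Rightarrow> H m x)\<bar> < e)" by blast
qed

lemma uniform_bound: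
  obtains \<beta> where "\<And>m x. m \<in> M \<Longrightarrow> x \<in> {0..L} \<Longrightarrow> \<bar>fst m x\<bar> \<le> \<beta> \<and> \<bar>D_on L (fst m) x\<bar> \<le> \<beta>"
proof -
  let ?S = "M \<times> {0..L}"
  have S: "compact ?S" by (intro compact_Times compact_M compact_Icc)
  have "bounded ((\<lambda>(m, x). fst m x) ` ?S)" "bounded ((\<lambda>(m, x). D_on L (fst m) x) ` ?S)"
    by (intro compact_imp_bounded compact_continuous_image[OF _ S] U_cont; simp)+
  then obtain b1 b2 where b: "\<forall>y\<in>(\<lambda>(m, x). fst m x) ` ?S. norm y \<le> b1" "\<forall>y\<in>(\<lambda>(m, x). D_on L (fst m) x) ` ?S. norm y \<le> b2"
    unfolding bounded_iff by (elim exE)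
  show thesis
  proof (rule that[of "max b1 b2"])
    fix m x assume "m \<in> M" "x \<in> {0..L}"
    then have "(m, x) \<in> ?S" by simp
    then show "\<bar>fst m x\<bar> \<le> max b1 b2 \<and> \<bar>D_on L (fst m) x\<bar> \<le> max b1 b2"
      using bspec[OF b(1) imageI, of "(m, x)"] bspec[OF b(2) imageI, of "(m, x)"] by (simp add: le_max_iff_disj)
  qed
qed

text \<open>Pointwise values suffice in the topology of the type class. Continuous dependence up to
  time \<open>t0 + 1\<close> controls the passage from \<open>m\<close> to \<open>m0\<close>, and
  continuity of the single orbit of \<open>m0\<close> controls the change of time.\<close>

lemma fst_\<Phi>_cont: "continuous_on ({0..} \<times> M) (\<lambda>(t, m). fst (\<Phi> t m) x)"
proof (cases "x \<in> {0..L}")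
  case False
  have "fst (\<Phi> t m) x = 0" if "m \<in> M" "0 \<le> t" for t m
    using M_mem(1)[OF \<Phi>_in[OF that]] False by (simp add: XD_def)
  then show ?thesis by (intro continuous_on_eq[OF continuous_on_const[of _ 0]]) auto
next
  case x: True
  show ?thesis
  proof (rule continuous_on_realI)
    fix p :: "real \<times> phase_point" and e :: real assume p: "p \<in> {0..} \<times> M" and e: "0 < e"
    obtain t0 m0 where tm: "p = (t0, m0)" "0 \<le> t0" "m0 \<in> M" using p by auto
    define t1 where "t1 = t0 + 1"
    have t1: "0 \<le> t1" using tm by (simp add: t1_def)
    obtain \<beta> where \<beta>: "\<And>m x. m \<in> M \<Longrightarrow> x \<in> {0..L} \<Longrightarrow> \<bar>fst m x\<bar> \<le> \<beta> \<and> \<bar>D_on L (fst m) x\<bar> \<le> \<beta>" using uniform_bound by metis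
    obtain C where C: "0 \<le> C" "\<And>g t u v p q. g \<in> Hull f \<Longrightarrow> \<bar>u\<bar> \<le> \<beta> \<Longrightarrow> \<bar>v\<bar> \<le> \<beta> \<Longrightarrow> \<bar>p\<bar> \<le> \<beta> \<Longrightarrow> \<bar>q\<bar> \<le> \<beta> \<Longrightarrow>
      \<bar>g (t, u, p) - g (t, v, q)\<bar> \<le> C * (\<bar>u - v\<bar> + \<bar>p - q\<bar>)" using Hull_lipschitz[OF f] by metis
    \<comment> \<open>Makes the bound of \<open>solution_dependence\<close> at time
      \<open>t1\<close> equal to \<open>e / 2\<close>.\<close>
    define \<eta> where "\<eta> = e / (2 * (exp (C * t1) * (1 + t1)))"
    have \<eta>: "0 < \<eta>" using e t1 by (simp add: \<eta>_def add_pos_nonneg)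
    have \<eta>e: "exp (C * t1) * (\<eta> + \<eta> * t1) = e / 2"
    proof -
      have "exp (C * t1) * (1 + t1) \<noteq> 0" using t1 by simp
      then have "(exp (C * t1) * (1 + t1)) * \<eta> = e / 2" by (simp add: \<eta>_def)
      then show ?thesis by (simp add: algebra_simps)
    qed
    \<comment> \<open>Orbits in \<open>M\<close> take values and slopes in this range, so closeness
      of the nonlinearities is needed there.\<close>
    let ?K = "{0..t1} \<times> {- \<beta>..\<beta>} \<times> {- \<beta>..\<beta>}"
    have K: "compact ?K" by (intro compact_Times compact_Icc)
    obtain W where W: "openin (top_of_set M) W" "m0 \<in> W"
      "\<And>m x. m \<in> W \<Longrightarrow> x \<in> {0..L} \<Longrightarrow> \<bar>fst m x - fst m0 x\<bar> < \<eta> \<and> \<bar>D_on L (fst m) x - D_on L (fst m0) x\<bar> < \<eta>"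
      "\<And>m z. m \<in> W \<Longrightarrow> z \<in> ?K \<Longrightarrow> \<bar>snd m z - snd m0 z\<bar> < \<eta>"
      by (rule M_nhd[OF tm(3) \<eta> K], rule that)
    have WM: "W \<subseteq> M" using openin_subset[OF W(1)] by simp
    obtain T0 v where v: "t1 < T0" "dirichlet_sol L \<alpha> (snd m0) (fst m0) T0 v B"
      "\<And>s. 0 \<le> s \<Longrightarrow> s < T0 \<Longrightarrow> \<Phi> s m0 = (v s, time_shift s (snd m0))" using solution[OF tm(3) t1] by metis
    have close: "\<bar>fst (\<Phi> t m) x - fst (\<Phi> t m0) x\<bar> \<le> e / 2" if m: "m \<in> W" and t: "t \<in> {0..t1}" for t m
    proof -
      have mM: "m \<in> M" using m WM by blast
      obtain T u where u: "t1 < T" "dirichlet_sol L \<alpha> (snd m) (fst m) T u B"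
        "\<And>s. 0 \<le> s \<Longrightarrow> s < T \<Longrightarrow> \<Phi> s m = (u s, time_shift s (snd m))" using solution[OF mM t1] by metis
      have "\<bar>u t x - v t x\<bar> \<le> exp (C * t) * (\<eta> + \<eta> * t)"
      proof (rule solution_dependence[OF u(2) v(2) u(1) v(1) C(1)])
        fix s y assume s: "s \<in> {0..t1}" and y: "y \<in> {0..L}"
        have s0: "0 \<le> s" using s by simp
        have "u s = fst (\<Phi> s m)" "v s = fst (\<Phi> s m0)" using u(1,3) v(1,3) s by auto
        then show "\<bar>u s y\<bar> \<le> \<beta> \<and> \<bar>D_on L (u s) y\<bar> \<le> \<beta> \<and> \<bar>v s y\<bar> \<le> \<beta> \<and> \<bar>D_on L (v s) y\<bar> \<le> \<beta>"
          using \<beta>[OF \<Phi>_in[OF mM s0] y] \<beta>[OF \<Phi>_in[OF tm(3) s0] y] by simp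
      next
        show "\<bar>snd m (s, a, q) - snd m0 (s, a, q)\<bar> \<le> \<eta>" if "s \<in> {0..t1}" "\<bar>a\<bar> \<le> \<beta>" "\<bar>q\<bar> \<le> \<beta>" for s a q
        proof -
          have "(s, a, q) \<in> ?K" using that by (auto simp: abs_le_iff)
          then show ?thesis using W(4)[OF m] by (simp add: less_imp_le)
        qed
        show "\<bar>fst m y - fst m0 y\<bar> \<le> \<eta>" if "y \<in> {0..L}" for y using W(3)[OF m that] by simp
      qed (use C(2)[OF M_mem(2)[OF mM]] \<eta> t x in auto)
      also have "\<dots> \<le> exp (C * t1) * (\<eta> + \<eta> * t1)"
        using t \<eta> C(1) t1 by (intro mult_mono add_mono mult_left_mono) (auto intro: mult_left_mono)
      finally show ?thesis using \<eta>e u(1,3) v(1,3) t by auto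
    qed
    interpret V: dirichlet_sol L \<alpha> "snd m0" "fst m0" T0 v B by (rule v(2))
    have e2: "0 < e / 2" using e by simp
    have t0T: "t0 \<in> {0..<T0}" using tm v(1) by (simp add: t1_def)
    obtain d where d: "0 < d" "\<And>s x. s \<in> {0..<T0} \<Longrightarrow> \<bar>s - t0\<bar> < d \<Longrightarrow> x \<in> {0..L} \<Longrightarrow> \<bar>v s x - v t0 x\<bar> < e / 2 \<and> \<bar>D_on L (v s) x - D_on L (v t0) x\<bar> < e / 2"
      using V.u_close[OF t0T e2] by metis
    let ?I = "{0..} \<inter> ball t0 (min d 1)"
    have "openin (top_of_set {0..}) ?I" by (intro openin_open_Int) auto
    then have "openin (prod_topology (top_of_set {0..}) (top_of_set M)) (?I \<times> W)"
      using W(1) by (simp only: openin_prod_Times_iff simp_thms)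
    then have "openin (top_of_set ({0..} \<times> M)) (?I \<times> W)" by simp
    moreover have "p \<in> ?I \<times> W" using tm W(2) d(1) by simp
    moreover have "\<bar>(case q of (t, m) \<Rightarrow> fst (\<Phi> t m) x) - (case p of (t, m) \<Rightarrow> fst (\<Phi> t m) x)\<bar> < e" if "q \<in> ?I \<times> W" for q
    proof -
      obtain t m where qm: "q = (t, m)" by (meson surj_pair)
      have q: "q = (t, m)" "m \<in> W" "0 \<le> t" "\<bar>t - t0\<bar> < d" "\<bar>t - t0\<bar> < 1"
        using that qm by (auto simp: dist_real_def abs_minus_commute)
      have "t \<in> {0..t1}" using q by (auto simp: t1_def)
      note 1 = close[OF q(2) this]
      have "t < T0" using q v(1) by (auto simp: t1_def)
      then have "\<bar>v t x - v t0 x\<bar> < e / 2" "fst (\<Phi> t m0) = v t" "fst (\<Phi> t0 m0) = v t0"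
        using d(2)[of t x] q x v(3) t0T by auto
      then have "\<bar>fst (\<Phi> t m) x - fst (\<Phi> t0 m0) x\<bar> < e" using 1 by (simp add: abs_if split: if_splits)
      then show ?thesis using q tm by simp
    qed
    ultimately show "\<exists>W. openin (top_of_set ({0..} \<times> M)) W \<and> p \<in> W \<and>
      (\<forall>q\<in>W. \<bar>(case q of (t, m) \<Rightarrow> fst (\<Phi> t m) x) - (case p of (t, m) \<Rightarrow> fst (\<Phi> t m) x)\<bar> < e)" by blast
  qed
qed

lemma snd_\<Phi>_cont: "continuous_on (UNIV \<times> M) (\<lambda>(t, m). time_shift t (snd m) z)"
proof (rule continuous_on_realI)
  obtain s q where z: "z = (s, q)" by (meson surj_pair)
  fix p :: "real \<times> phase_point" and e :: real assume p: "p \<in> UNIV \<times> M" and e: "0 < e"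
  obtain t0 m0 where tm: "p = (t0, m0)" "m0 \<in> M" using p by auto
  have e2: "0 < e / 2" using e by simp
  let ?K = "{s + t0 - 1..s + t0 + 1} \<times> {q}"
  have K: "compact ?K" by (intro compact_Times) auto
  obtain W where W: "openin (top_of_set M) W" "m0 \<in> W" "\<And>m z. m \<in> W \<Longrightarrow> z \<in> ?K \<Longrightarrow> \<bar>snd m z - snd m0 z\<bar> < e / 2"
    by (rule M_nhd[OF tm(2) e2 K], rule that)
  have "continuous_on UNIV (\<lambda>t. snd m0 (t, q))"
    by (rule continuous_on_compose2[OF Hull_continuous[OF M_mem(2)[OF tm(2)]]]) (auto intro!: continuous_intros)
  then obtain d where d: "0 < d" "\<And>t. dist t (s + t0) < d \<Longrightarrow> dist (snd m0 (t, q)) (snd m0 (s + t0, q)) < e / 2"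
    using e2 unfolding continuous_on_iff by (metis UNIV_I)
  have "openin (prod_topology euclideanreal (top_of_set M)) (ball t0 (min d 1) \<times> W)"
    using W(1) by (auto simp: openin_prod_Times_iff)
  moreover have "prod_topology euclideanreal (top_of_set M) = top_of_set (UNIV \<times> M)"
    using prod_topology_subtopology_eu[of UNIV M] by simp
  ultimately have "openin (top_of_set (UNIV \<times> M)) (ball t0 (min d 1) \<times> W)" by simp
  moreover have "p \<in> ball t0 (min d 1) \<times> W" using tm W(2) d(1) by simp
  moreover have "\<bar>(case r of (t, m) \<Rightarrow> time_shift t (snd m) z) - (case p of (t, m) \<Rightarrow> time_shift t (snd m) z)\<bar> < e"
    if "r \<in> ball t0 (min d 1) \<times> W" for r
  proof -
    obtain t m where tm': "r = (t, m)" by (meson surj_pair)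
    have r: "r = (t, m)" "m \<in> W" "\<bar>t - t0\<bar> < d" "\<bar>t - t0\<bar> < 1"
      using that tm' by (auto simp: dist_real_def abs_minus_commute)
    have "\<bar>snd m (s + t, q) - snd m0 (s + t, q)\<bar> < e / 2" by (rule W(3)[OF r(2)]) (use r(4) in auto)
    moreover have "\<bar>snd m0 (s + t, q) - snd m0 (s + t0, q)\<bar> < e / 2" using d(2)[of "s + t"] r(3) by (simp add: dist_real_def)
    ultimately have "\<bar>snd m (s + t, q) - snd m0 (s + t0, q)\<bar> < e" by linarith
    then show ?thesis unfolding r tm z time_shift_def by (simp add: split_def)
  qed
  ultimately show "\<exists>W. openin (top_of_set (UNIV \<times> M)) W \<and> p \<in> W \<and>
     (\<forall>r\<in>W. \<bar>(case r of (t, m) \<Rightarrow> time_shift t (snd m) z) - (case p of (t, m) \<Rightarrow> time_shift t (snd m) z)\<bar> < e)" by blast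
qed

lemma \<Phi>_cont: "continuous_on ({0..} \<times> M) (\<lambda>(t, m). \<Phi> t m)"
proof -
  have "continuous_on ({0..} \<times> M) (\<lambda>p. fst (\<Phi> (fst p) (snd p)))"
    using fst_\<Phi>_cont by (intro continuous_on_coordinatewise_then_product) (simp add: split_def)
  moreover have "continuous_on ({0..} \<times> M) (\<lambda>p. snd (\<Phi> (fst p) (snd p)))"
    unfolding snd_\<Phi>
    by (intro continuous_on_coordinatewise_then_product continuous_on_subset[OF snd_\<Phi>_cont[unfolded split_def]]) auto
  ultimately have "continuous_on ({0..} \<times> M) (\<lambda>p. (fst (\<Phi> (fst p) (snd p)), snd (\<Phi> (fst p) (snd p))))"
    by (rule continuous_on_Pair)
  then show ?thesis by (simp add: split_def)
qed

lemma snd_\<Phi>_eq_iff: "snd (\<Phi> t m) = snd (\<Phi> t m') \<longleftrightarrow> snd m = snd m'"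
proof
  assume "snd (\<Phi> t m) = snd (\<Phi> t m')"
  then have "time_shift (- t) (time_shift t (snd m)) = time_shift (- t) (time_shift t (snd m'))" by (simp add: snd_\<Phi>)
  then show "snd m = snd m'" by (simp add: time_shift_add)
qed (simp add: snd_\<Phi>)

lemma minimality:
  assumes "N \<subseteq> M" "N \<noteq> {}" "compact N" "\<And>m t. m \<in> N \<Longrightarrow> 0 \<le> t \<Longrightarrow> \<Phi> t m \<in> N"
  shows "N = M"
proof -
  have "compactin (top_of_set M) N" using assms by (simp add: compactin_subtopology)
  then have "compactin XM N" by (simp only: XM_eq)
  then have "compactin (phase_space L \<alpha> f) N" by (simp add: compactin_subtopology)
  moreover have "positively_invariant L \<alpha> N"
    unfolding positively_invariant_def
  proof (intro ballI allI impI)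
    fix m assume "m \<in> N"
    then have m: "m \<in> M" "m \<in> N" using assms(1) by auto
    have "positively_invariant L \<alpha> M" using M by (simp add: minimal_set_def)
    from this[unfolded positively_invariant_def, rule_format, OF m(1)] assms(4)[OF m(2)]
    show "case m of (u0, g) \<Rightarrow> \<forall>t\<ge>0. phiD_exists L \<alpha> t u0 g \<and> \<Phi> t (u0, g) \<in> N" by (simp add: split_def)
  qed
  moreover have "\<forall>N\<subseteq>M. N \<noteq> {} \<and> compactin (phase_space L \<alpha> f) N \<and> positively_invariant L \<alpha> N \<longrightarrow> N = M"
    using M by (simp add: minimal_set_def)
  ultimately show ?thesis using assms(1,2) by simp
qed

text \<open>Equality in the hull is equality of all values, and each value is continuous on
  \<open>M\<close>; so this is a closed subset of a compact product.\<close>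

lemma compact_fibre_pairs: "compact {(m, m'). m \<in> M \<and> m' \<in> M \<and> snd m = snd m'}"
proof -
  let ?E = "\<lambda>z. {p \<in> M \<times> M. snd (fst p) z - snd (snd p) z = 0}"
  have c: "continuous_on (M \<times> M) (\<lambda>p. snd (fst p))" "continuous_on (M \<times> M) (\<lambda>p. snd (snd p))"
    by (rule continuous_on_snd[OF continuous_on_fst[OF continuous_on_id]],
        rule continuous_on_snd[OF continuous_on_snd[OF continuous_on_id]])
  have "continuous_on (M \<times> M) (\<lambda>p. snd (fst p) z - snd (snd p) z)" for z
    by (rule continuous_on_diff[OF continuous_on_product_then_coordinatewise[OF c(1)] continuous_on_product_then_coordinatewise[OF c(2)]])
  then have "closedin (top_of_set (M \<times> M)) (?E z)" for z
    by (rule continuous_closedin_preimage_constant)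
  then have "closedin (top_of_set (M \<times> M)) (\<Inter>z. ?E z)" by (intro closedin_INT) auto
  moreover have "compact (M \<times> M)" by (intro compact_Times compact_M)
  ultimately have "compact (\<Inter>z. ?E z)" by (rule closedin_compact[rotated])
  moreover have "(\<Inter>z. ?E z) = {(m, m'). m \<in> M \<and> m' \<in> M \<and> snd m = snd m'}" by (auto simp: fun_eq_iff)
  ultimately show ?thesis by simp
qed

text \<open>The value of \<open>snd (\<Phi> t m)\<close> at time 0 is that of \<open>snd m\<close>
  at time \<open>t\<close>, so the current time disappears from the equation.\<close>

lemma pde:
  assumes m: "m \<in> M" and t: "0 < t" and x: "0 < x" "x < L"
  shows "\<exists>ut uxx. ((\<lambda>s. fst (\<Phi> s m) x) has_real_derivative ut) (at t) \<and> has_sym_deriv2 (fst (\<Phi> t m)) x uxx \<and>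
        ut = uxx + snd (\<Phi> t m) (0, fst (\<Phi> t m) x, D_on L (fst (\<Phi> t m)) x)"
proof -
  have t0: "0 \<le> t" using t by simp
  obtain T u where u: "t < T" "dirichlet_sol L \<alpha> (snd m) (fst m) T u B"
    "\<And>s. 0 \<le> s \<Longrightarrow> s < T \<Longrightarrow> \<Phi> s m = (u s, time_shift s (snd m))" using solution[OF m t0] by metis
  obtain ut uxx where d: "((\<lambda>s. u s x) has_real_derivative ut) (at t)" "has_sym_deriv2 (u t) x uxx"
    "ut = uxx + snd m (t, u t x, D_on L (u t) x)"
    using dirichlet_sol.interior[OF u(2) t u(1) x] by blast
  have "((\<lambda>s. fst (\<Phi> s m) x) has_real_derivative ut) (at t)"
    by (rule has_field_derivative_transform_within_open[OF d(1) open_greaterThanLessThan[of 0 T]])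
      (use t u(1,3) in auto)
  then show ?thesis using d(2,3) u(3)[OF t0 u(1)] by (auto simp: time_shift_def)
qed

section \<open>Passage to the abstract flows\<close>

lemma yields_minimal_dirichlet_flow:
  assumes zero: "\<And>g t p. g \<in> Hull f \<Longrightarrow> g (t, 0, p) = 0"
  obtains C \<beta> where "minimal_dirichlet_flow M \<Phi> snd fst (\<lambda>m. D_on L (fst m)) (\<lambda>g u p. g (0, u, p)) L C \<beta>"
proof -
  obtain \<beta> where \<beta>: "\<And>m x. m \<in> M \<Longrightarrow> x \<in> {0..L} \<Longrightarrow> \<bar>fst m x\<bar> \<le> \<beta> \<and> \<bar>D_on L (fst m) x\<bar> \<le> \<beta>" using uniform_bound by metis
  obtain C where C: "0 \<le> C" "\<And>g t u v p q. g \<in> Hull f \<Longrightarrow> \<bar>u\<bar> \<le> \<beta> \<Longrightarrow> \<bar>v\<bar> \<le> \<beta> \<Longrightarrow> \<bar>p\<bar> \<le> \<beta> \<Longrightarrow> \<bar>q\<bar> \<le> \<beta> \<Longrightarrow>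
    \<bar>g (t, u, p) - g (t, v, q)\<bar> \<le> C * (\<bar>u - v\<bar> + \<bar>p - q\<bar>)" using Hull_lipschitz[OF f] by metis
  have boundary: "fst m 0 = 0 \<and> fst m L = 0" if m: "m \<in> M" for m
  proof -
    obtain T u where u: "0 < T" "dirichlet_sol L \<alpha> (snd m) (fst m) T u B" using solution[OF m order_refl] by metis
    then show ?thesis using dirichlet_sol.boundary[OF u(2), of 0] dirichlet_sol.u_0[OF u(2)] by simp
  qed
  have C1: "fst m \<in> C1_interval L" if "m \<in> M" for m using M_mem(1)[OF that] by (simp add: XD_def)
  show thesis
  proof (rule that, rule minimal_dirichlet_flow.intro)
    show "M \<noteq> {}" using M by (simp add: minimal_set_def)
    show "N = M" if "N \<subseteq> M" "N \<noteq> {}" "compact N" "\<And>m t. m \<in> N \<Longrightarrow> 0 \<le> t \<Longrightarrow> \<Phi> t m \<in> N" for N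
      using that by (rule minimality)
    show "continuous_on (M \<times> {0..L}) (\<lambda>(m, x). fst m x)" by (rule U_cont) simp
    show "continuous_on (M \<times> {0..L}) (\<lambda>(m, x). D_on L (fst m) x)" by (rule U_cont) simp
    show "(fst m has_real_derivative D_on L (fst m) x) (at x within {0..L})" if "m \<in> M" "x \<in> {0..L}" for m x
      using C1_interval_D_on[OF L C1[OF that(1)] that(2)] .
    show "\<bar>snd m (0, u, p) - snd m (0, v, q)\<bar> \<le> C * (\<bar>u - v\<bar> + \<bar>p - q\<bar>)"
      if "m \<in> M" "\<bar>u\<bar> \<le> \<beta>" "\<bar>v\<bar> \<le> \<beta>" "\<bar>p\<bar> \<le> \<beta>" "\<bar>q\<bar> \<le> \<beta>" for m u v p q
      using C(2)[OF M_mem(2)[OF that(1)] that(2-5)] .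
    show "snd m (0, 0, p) = 0" if "m \<in> M" for m p using zero[OF M_mem(2)[OF that]] .
    show "fst m 0 = 0" "fst m L = 0" if "m \<in> M" for m using boundary[OF that] by simp_all
    show "\<bar>fst m x\<bar> \<le> \<beta> \<and> \<bar>D_on L (fst m) x\<bar> \<le> \<beta>" if "m \<in> M" "x \<in> {0..L}" for m x using \<beta>[OF that] .
    show "\<Phi> t m \<in> M" if "m \<in> M" "0 \<le> t" for m t using \<Phi>_in[OF that] .
    show "\<Phi> 0 m = m" if "m \<in> M" for m using \<Phi>_0[OF that] .
    show "\<Phi> (s + t) m = \<Phi> s (\<Phi> t m)" if "m \<in> M" "0 \<le> s" "0 \<le> t" for m s t using \<Phi>_add[OF that] .
    show "snd (\<Phi> t m) = snd (\<Phi> t m') \<longleftrightarrow> snd m = snd m'" for t m m' by (rule snd_\<Phi>_eq_iff)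
    show "\<exists>ut uxx. ((\<lambda>s. fst (\<Phi> s m) x) has_real_derivative ut) (at t) \<and> has_sym_deriv2 (fst (\<Phi> t m)) x uxx \<and>
        ut = uxx + snd (\<Phi> t m) (0, fst (\<Phi> t m) x, D_on L (fst (\<Phi> t m)) x)"
      if "m \<in> M" "0 < t" "0 < x" "x < L" for m t x using pde[OF that] .
  qed (rule L C(1) compact_M \<Phi>_cont compact_fibre_pairs)+
qed

text \<open>The nonzero value in \<open>nz\<close> excludes the minimal sets of zero profiles, which
  have no strict sign on any interval.\<close>

lemma yields_signed_dirichlet_flow:
  assumes ab: "(\<forall>t u p. f (t, - u, p) = - f (t, u, p)) \<or>
         ((\<forall>t p. f (t, 0, p) = 0) \<and> (\<forall>m\<in>M. \<forall>x\<in>{0..L}. 0 \<le> fst m x))"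
    and nz: "m0 \<in> M" "x0 \<in> {0..L}" "fst m0 x0 \<noteq> 0"
  obtains C \<beta> s \<rho> where
    "signed_dirichlet_flow M \<Phi> snd fst (\<lambda>m. D_on L (fst m)) (\<lambda>g u p. g (0, u, p)) L C \<beta> s \<rho>"
    "\<And>m1 m2 x. m1 \<in> M \<Longrightarrow> m2 \<in> M \<Longrightarrow> \<forall>x\<in>{0..\<rho>}. fst m1 x = fst m2 x \<Longrightarrow> x \<in> {0..L} \<Longrightarrow> fst m1 x = fst m2 x"
  using ab
proof (elim disjE)
  let ?G = "\<lambda>(g :: nonlinearity) u p. g (0, u, p)"
  assume odd: "\<forall>t u p. f (t, - u, p) = - f (t, u, p)"
  have "f (t, 0, p) = 0" for t p using odd[rule_format, of t 0 p] by simp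
  then have "g (t, 0, p) = 0" if "g \<in> Hull f" for g t p using Hull_zero[OF _ that] by simp
  then obtain C \<beta> where base: "minimal_dirichlet_flow M \<Phi> snd fst (\<lambda>m. D_on L (fst m)) ?G L C \<beta>"
    by (rule yields_minimal_dirichlet_flow)
  have "odd_dirichlet_flow M \<Phi> snd fst (\<lambda>m. D_on L (fst m)) ?G L C \<beta>"
    by (intro odd_dirichlet_flow.intro[OF base] odd_dirichlet_flow_axioms.intro Hull_odd[OF _ M_mem(2)]) (use odd in auto)
  then interpret odd_dirichlet_flow M \<Phi> snd fst "\<lambda>m. D_on L (fst m)" ?G L C \<beta> .
  obtain \<rho> s where \<rho>: "\<bar>s\<bar> = 1" "0 < \<rho>" "\<rho> \<le> L" "\<And>m. m \<in> M \<Longrightarrow> fst m \<rho> = 0"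
    "\<And>m x. m \<in> M \<Longrightarrow> 0 < x \<Longrightarrow> x < \<rho> \<Longrightarrow> 0 < s * fst m x"
    by (rule nodal_structure[OF nz], rule that)
  show thesis
  proof (rule that)
    show "signed_dirichlet_flow M \<Phi> snd fst (\<lambda>m. D_on L (fst m)) ?G L C \<beta> s \<rho>"
      by (intro signed_dirichlet_flow.intro[OF base] signed_dirichlet_flow_axioms.intro \<rho>)
    show "fst m1 x = fst m2 x"
      if "m1 \<in> M" "m2 \<in> M" "\<forall>x\<in>{0..\<rho>}. fst m1 x = fst m2 x" "x \<in> {0..L}" for m1 m2 x
      by (rule determined_by_nodal_interval[OF \<rho>(2-4) that(1,2) _ that(4)]; (assumption | rule bspec[OF that(3)], assumption))
  qed
next
  let ?G = "\<lambda>(g :: nonlinearity) u p. g (0, u, p)"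
  assume b: "(\<forall>t p. f (t, 0, p) = 0) \<and> (\<forall>m\<in>M. \<forall>x\<in>{0..L}. 0 \<le> fst m x)"
  then have "g (t, 0, p) = 0" if "g \<in> Hull f" for g t p using Hull_zero[OF _ that] by simp
  then obtain C \<beta> where base: "minimal_dirichlet_flow M \<Phi> snd fst (\<lambda>m. D_on L (fst m)) ?G L C \<beta>"
    by (rule yields_minimal_dirichlet_flow)
  interpret minimal_dirichlet_flow M \<Phi> snd fst "\<lambda>m. D_on L (fst m)" ?G L C \<beta> by (rule base)
  show thesis
  proof (rule that)
    show "signed_dirichlet_flow M \<Phi> snd fst (\<lambda>m. D_on L (fst m)) ?G L C \<beta> 1 L"
    proof (intro signed_dirichlet_flow.intro[OF base] signed_dirichlet_flow_axioms.intro)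
      show "0 < 1 * fst m x" if m: "m \<in> M" and x: "0 < x" "x < L" for m x
        by (rule strict_positivity[OF _ L order_refl U_L _ nz m x]) (use b in auto)
    qed (use L U_L in auto)
  qed auto
qed

lemma slope_and_backward_uniqueness:
  assumes ab: "(\<forall>t u p. f (t, - u, p) = - f (t, u, p)) \<or>
         ((\<forall>t p. f (t, 0, p) = 0) \<and> (\<forall>m\<in>M. \<forall>x\<in>{0..L}. 0 \<le> fst m x))"
    and m: "m1 \<in> M" "m2 \<in> M"
  shows "boundary_slope L m1 = boundary_slope L m2 \<Longrightarrow> m1 = m2"
    and "0 \<le> t \<Longrightarrow> \<Phi> t m1 = \<Phi> t m2 \<Longrightarrow> m1 = m2"
proof -
  have *: "m1 = m2" if g: "snd m1 = snd m2" and eq: "D_on L (fst m1) 0 = D_on L (fst m2) 0 \<or> (\<exists>t\<ge>0. \<Phi> t m1 = \<Phi> t m2)"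
  proof -
    have "fst m1 x = fst m2 x" if x: "x \<in> {0..L}" for x
    proof (cases "\<exists>m\<in>M. \<exists>x\<in>{0..L}. fst m x \<noteq> 0")
      case True
      then obtain m0 x0 where nz: "m0 \<in> M" "x0 \<in> {0..L}" "fst m0 x0 \<noteq> 0" by blast
      obtain C \<beta> s \<rho> where s: "signed_dirichlet_flow M \<Phi> snd fst (\<lambda>m. D_on L (fst m)) (\<lambda>g u p. g (0, u, p)) L C \<beta> s \<rho>"
        and ext: "\<And>m1 m2 x. m1 \<in> M \<Longrightarrow> m2 \<in> M \<Longrightarrow> \<forall>x\<in>{0..\<rho>}. fst m1 x = fst m2 x \<Longrightarrow> x \<in> {0..L} \<Longrightarrow> fst m1 x = fst m2 x"
        by (rule yields_signed_dirichlet_flow[OF ab nz], rule that)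
      interpret signed_dirichlet_flow M \<Phi> snd fst "\<lambda>m. D_on L (fst m)" "\<lambda>g u p. g (0, u, p)" L C \<beta> s \<rho> by (rule s)
      show ?thesis
      proof (rule ext[OF m _ x], intro ballI)
        fix y assume y: "y \<in> {0..\<rho>}"
        show "fst m1 y = fst m2 y"
          using eq
        proof (elim disjE exE conjE)
          assume "D_on L (fst m1) 0 = D_on L (fst m2) 0"
          then show ?thesis by (rule slope_injective[OF m g _ y])
        next
          fix t :: real assume t: "0 \<le> t" and "\<Phi> t m1 = \<Phi> t m2"
          then have "fst (\<Phi> t m1) = fst (\<Phi> t m2)" by simp
          then show ?thesis by (rule backward_unique[OF m g t _ y])
        qed
      qed
    next
      \<comment> \<open>When all profiles vanish, an element is determined by its second
        component.\<close>
      case False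
      then show ?thesis using m x by simp
    qed
    then have "fst m1 = fst m2" using XD_eqI M_mem(1) m by blast
    with g show ?thesis by (rule prod_eqI[rotated])
  qed
  show "m1 = m2" if "boundary_slope L m1 = boundary_slope L m2"
    using that by (intro *) (auto simp: boundary_slope_def split_def)
  show "m1 = m2" if "0 \<le> t" "\<Phi> t m1 = \<Phi> t m2"
    using that snd_\<Phi>_eq_iff[of t m1 m2] by (intro *) auto
qed

lemma \<Phi>_bij:
  assumes ab: "(\<forall>t u p. f (t, - u, p) = - f (t, u, p)) \<or>
         ((\<forall>t p. f (t, 0, p) = 0) \<and> (\<forall>m\<in>M. \<forall>x\<in>{0..L}. 0 \<le> fst m x))" and t: "0 \<le> t"
  shows "bij_betw (\<Phi> t) M M"
  unfolding bij_betw_def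
proof
  show "inj_on (\<Phi> t) M" using slope_and_backward_uniqueness(2)[OF ab _ _ t] by (intro inj_onI)
  have "continuous_on M (\<lambda>m. (\<lambda>(t, m). \<Phi> t m) (t, m))"
    by (intro continuous_on_compose2[OF \<Phi>_cont] continuous_on_Pair continuous_on_id continuous_on_const) (use t in auto)
  then have "compact (\<Phi> t ` M)" using compact_continuous_image[OF _ compact_M] by simp
  then show "\<Phi> t ` M = M"
  proof (intro minimality)
    fix m and s :: real assume "m \<in> \<Phi> t ` M" and s: "0 \<le> s"
    then obtain k where k: "k \<in> M" "m = \<Phi> t k" by blast
    have "\<Phi> s m = \<Phi> t (\<Phi> s k)"
      using \<Phi>_add[OF k(1) s t] \<Phi>_add[OF k(1) t s] k(2) by (simp add: add.commute)
    then show "\<Phi> s m \<in> \<Phi> t ` M" using \<Phi>_in[OF k(1) s] by blast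
  qed (use \<Phi>_in t M in \<open>auto simp: minimal_set_def\<close>)
qed

end

section \<open>Transport of flows along homeomorphisms\<close>

lemma flow_on_transport:
  assumes P: "flow_on X P" and h: "homeomorphic_maps X Y h k"
  shows "flow_on Y (\<lambda>t y. h (P t (k y)))"
    and "topologically_conjugate X P Y (\<lambda>t y. h (P t (k y)))"
proof -
  have ch: "continuous_map X Y h" and ck: "continuous_map Y X k" and kh: "\<And>x. x \<in> topspace X \<Longrightarrow> k (h x) = x"
    and hk: "\<And>y. y \<in> topspace Y \<Longrightarrow> h (k y) = y" using h by (auto simp: homeomorphic_maps_def)
  have cP: "continuous_map (prod_topology euclideanreal X) X (\<lambda>(t, x). P t x)"
    and P0: "\<And>x. x \<in> topspace X \<Longrightarrow> P 0 x = x" and Padd: "\<And>x s t. x \<in> topspace X \<Longrightarrow> P (s + t) x = P s (P t x)"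
    using P by (auto simp: flow_on_def)
  have kin: "k y \<in> topspace X" if "y \<in> topspace Y" for y using continuous_map_image_subset_topspace[OF ck] that by blast
  have Pin: "P t x \<in> topspace X" if "x \<in> topspace X" for t x
    using continuous_map_image_subset_topspace[OF cP] that by (fastforce simp: image_subset_iff)
  show flow: "flow_on Y (\<lambda>t y. h (P t (k y)))"
    unfolding flow_on_def
  proof (intro conjI ballI allI)
    have "continuous_map (prod_topology euclideanreal Y) euclideanreal fst" "continuous_map (prod_topology euclideanreal Y) X (k \<circ> snd)"
      by (rule continuous_map_fst, rule continuous_map_compose[OF continuous_map_snd ck])
    then have "continuous_map (prod_topology euclideanreal Y) (prod_topology euclideanreal X) (\<lambda>z. (fst z, (k \<circ> snd) z))"
      by (rule continuous_map_pairedI)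
    from continuous_map_compose[OF continuous_map_compose[OF this cP] ch]
    show "continuous_map (prod_topology euclideanreal Y) Y (\<lambda>(t, y). h (P t (k y)))" by (simp add: o_def split_def)
  qed (use P0 Padd kin Pin kh hk in auto)
  show "topologically_conjugate X P Y (\<lambda>t y. h (P t (k y)))"
    unfolding topologically_conjugate_def
    using P flow homeomorphic_maps_imp_map[OF h] kh by (intro conjI exI[of _ h]) auto
qed

lemma minimal_flow_transport:
  assumes P: "minimal_flow X P" and h: "homeomorphic_maps X Y h k"
  shows "minimal_flow Y (\<lambda>t y. h (P t (k y)))"
  unfolding minimal_flow_def
proof (intro conjI allI impI)
  have ch: "continuous_map X Y h" and ck: "continuous_map Y X k" and kh: "\<And>x. x \<in> topspace X \<Longrightarrow> k (h x) = x"
    and hk: "\<And>y. y \<in> topspace Y \<Longrightarrow> h (k y) = y" using h by (auto simp: homeomorphic_maps_def)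
  have fl: "flow_on X P" and cpt: "compact_space X" and ne: "topspace X \<noteq> {}"
    and min: "\<And>N. N \<subseteq> topspace X \<Longrightarrow> N \<noteq> {} \<Longrightarrow> compactin X N \<Longrightarrow> \<forall>t\<ge>0. P t ` N \<subseteq> N \<Longrightarrow> N = topspace X"
    using P by (auto simp: minimal_flow_def)
  have im: "h ` topspace X = topspace Y" using homeomorphic_imp_surjective_map homeomorphic_maps_imp_map[OF h] by blast
  show "flow_on Y (\<lambda>t y. h (P t (k y)))" by (rule flow_on_transport(1)[OF fl h])
  show "compact_space Y" using cpt homeomorphic_compact_space homeomorphic_maps_imp_homeomorphic_space[OF h] by blast
  show "topspace Y \<noteq> {}" using ne im by auto
  fix N assume N: "N \<subseteq> topspace Y" and *: "N \<noteq> {} \<and> compactin Y N \<and> (\<forall>t\<ge>0. (\<lambda>y. h (P t (k y))) ` N \<subseteq> N)"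
  have kN: "k ` N \<subseteq> topspace X" using continuous_map_image_subset_topspace[OF ck] N by blast
  have Pin: "P t x \<in> topspace X" if "x \<in> topspace X" for t x
    using fl continuous_map_image_subset_topspace[of _ _ "\<lambda>(t, x). P t x"] that unfolding flow_on_def by (fastforce simp: image_subset_iff)
  have "k ` N = topspace X"
  proof (rule min[OF kN])
    show "compactin X (k ` N)" by (rule image_compactin[OF _ ck]) (use * in blast)
    show "\<forall>t\<ge>0. P t ` (k ` N) \<subseteq> k ` N"
    proof (intro allI impI subsetI)
      fix t :: real and z assume t: "0 \<le> t" and "z \<in> P t ` (k ` N)"
      then obtain y where y: "y \<in> N" "z = P t (k y)" by blast
      have "h z \<in> N" using * t y by blast
      moreover have "k (h z) = z" using y kN Pin by (intro kh) auto
      ultimately show "z \<in> k ` N" by (metis imageI)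
    qed
  qed (use * in auto)
  then have "h ` (k ` N) = topspace Y" using im by simp
  moreover have "h ` (k ` N) = N" using hk N by (force simp: image_image)
  ultimately show "N = topspace Y" by simp
qed

section \<open>The two-sided flow and its image\<close>

text \<open>Bijectivity of the time maps is what makes the definite description in
  \<open>PiD_on\<close> select the backward orbit.\<close>

locale invertible_setting = minimal_setting +
  assumes \<Phi>_bij: "\<And>t. 0 \<le> t \<Longrightarrow> bij_betw (\<Phi> t) M M"
    and slope_inj: "inj_on (boundary_slope L) M"
begin

abbreviation "P \<equiv> PiD_on L \<alpha> M"

lemma \<Phi>_inj: "m1 \<in> M \<Longrightarrow> m2 \<in> M \<Longrightarrow> 0 \<le> t \<Longrightarrow> \<Phi> t m1 = \<Phi> t m2 \<Longrightarrow> m1 = m2"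
  using \<Phi>_bij by (auto simp: bij_betw_def inj_on_def)

lemma P_pos: "0 \<le> t \<Longrightarrow> P t m = \<Phi> t m"
  by (simp add: PiD_on_def)

lemma P_neg:
  assumes m: "m \<in> M" and t: "t < 0"
  shows "P t m \<in> M \<and> \<Phi> (- t) (P t m) = m"
proof -
  have t': "0 \<le> - t" using t by simp
  have "m \<in> \<Phi> (- t) ` M" using m \<Phi>_bij[OF t'] by (simp add: bij_betw_def)
  then have "\<exists>!m'. m' \<in> M \<and> \<Phi> (- t) m' = m" using \<Phi>_inj[OF _ _ t'] by blast
  from theI'[OF this] show ?thesis using t by (simp add: PiD_on_def)
qed

lemma P_in: "m \<in> M \<Longrightarrow> P t m \<in> M"
  using P_neg[of m t] \<Phi>_in[of m t] P_pos[of t m] by (cases "0 \<le> t") auto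

text \<open>Advancing by \<open>n\<close> reduces statements about negative times to the semiflow;
  injectivity of \<open>\<Phi> n\<close> then removes the advance.\<close>

lemma \<Phi>_P:
  assumes m: "m \<in> M" and n: "0 \<le> n" "0 \<le> n + t"
  shows "\<Phi> n (P t m) = \<Phi> (n + t) m"
proof (cases "0 \<le> t")
  case True
  then show ?thesis using \<Phi>_add[OF m n(1) True] by (simp add: P_pos)
next
  case False
  then have *: "P t m \<in> M" "\<Phi> (- t) (P t m) = m" using P_neg[OF m, of t] by auto
  have "\<Phi> n (P t m) = \<Phi> (n + t) (\<Phi> (- t) (P t m))" using \<Phi>_add[OF *(1) n(2), of "- t"] False by simp
  then show ?thesis using *(2) by simp
qed

lemma P_add:
  assumes m: "m \<in> M" shows "P (s + t) m = P s (P t m)"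
proof (rule \<Phi>_inj[where t = "\<bar>s\<bar> + \<bar>t\<bar>"])
  \<comment> \<open>Far enough ahead for \<open>?n + s\<close> and \<open>?n + s + t\<close> to be
    nonnegative.\<close>
  let ?n = "\<bar>s\<bar> + \<bar>t\<bar>"
  have "\<Phi> ?n (P s (P t m)) = \<Phi> (?n + s) (P t m)" by (rule \<Phi>_P[OF P_in[OF m]]) auto
  also have "\<dots> = \<Phi> (?n + s + t) m" by (rule \<Phi>_P[OF m]) auto
  also have "\<dots> = \<Phi> ?n (P (s + t) m)" using \<Phi>_P[OF m, of ?n "s + t"] by (simp add: add.assoc)
  finally show "\<Phi> ?n (P (s + t) m) = \<Phi> ?n (P s (P t m))" by simp
qed (use P_in m in auto)

lemma snd_P:
  assumes m: "m \<in> M" shows "snd (P t m) = time_shift t (snd m)"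
proof (cases "0 \<le> t")
  case True
  then show ?thesis by (simp add: P_pos snd_\<Phi>)
next
  case False
  then have "\<Phi> (- t) (P t m) = m" using P_neg[OF m, of t] by auto
  then have "time_shift (- t) (snd (P t m)) = snd m" using snd_\<Phi>[of "- t" "P t m"] by simp
  then show ?thesis using time_shift_add[of t "- t" "snd (P t m)"] by simp
qed

text \<open>A continuous bijection of a compact Hausdorff space has a continuous inverse.\<close>

lemma P_backward_cont:
  assumes n: "0 < n" shows "continuous_on M (P (- n))"
proof -
  have n0: "0 \<le> n" using n by simp
  have "continuous_on M (\<lambda>m. (\<lambda>(t, m). \<Phi> t m) (n, m))"
    by (intro continuous_on_compose2[OF \<Phi>_cont] continuous_on_Pair continuous_on_id continuous_on_const) (use n in auto)
  then have "continuous_map (top_of_set M) (top_of_set M) (\<Phi> n)"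
    using \<Phi>_in n by (auto simp: continuous_map_in_subtopology)
  moreover have "compact_space (top_of_set M)" using compact_space_XM by (simp only: XM_eq)
  ultimately have "homeomorphic_map (top_of_set M) (top_of_set M) (\<Phi> n)"
    using \<Phi>_bij[OF n0] Hausdorff_M by (intro continuous_imp_homeomorphic_map) (auto simp: bij_betw_def)
  then obtain k where k: "homeomorphic_maps (top_of_set M) (top_of_set M) (\<Phi> n) k" by (auto simp: homeomorphic_map_maps)
  then have ck: "continuous_on M k" "k ` M \<subseteq> M" "\<And>m. m \<in> M \<Longrightarrow> \<Phi> n (k m) = m"
    by (auto simp: homeomorphic_maps_def continuous_map_in_subtopology)
  show ?thesis
  proof (rule continuous_on_eq[OF ck(1)])
    fix m assume m: "m \<in> M"
    have "P (- n) m \<in> M" "\<Phi> n (P (- n) m) = m" using P_neg[OF m, of "- n"] n by auto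
    then show "k m = P (- n) m" using \<Phi>_inj[of "k m" "P (- n) m" n] ck(2,3) m n0 by auto
  qed
qed

text \<open>For \<open>t > - n\<close> the flow is the semiflow after a fixed step back,
  \<open>P t m = \<Phi> (t + n) (P (- n) m)\<close>, which is a composition of continuous maps;
  \<open>n\<close> is chosen near the given time.\<close>

lemma P_cont: "continuous_on (UNIV \<times> M) (\<lambda>(t, m). P t m)"
  unfolding continuous_on_def
proof
  fix z assume z: "z \<in> (UNIV :: real set) \<times> M"
  define n where "n = \<bar>fst z\<bar> + 1"
  have n: "0 < n" "- n < fst z" by (auto simp: n_def)
  let ?S = "{- n<..} \<times> M"
  have "continuous_on ?S (\<lambda>z. (fst z + n, P (- n) (snd z)))"
    by (intro continuous_on_Pair continuous_on_add continuous_on_const continuous_on_fst[OF continuous_on_id]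
      continuous_on_compose2[OF P_backward_cont[OF n(1)] continuous_on_snd[OF continuous_on_id]]) auto
  then have "continuous_on ?S (\<lambda>z. (\<lambda>(t, m). \<Phi> t m) (fst z + n, P (- n) (snd z)))"
    by (rule continuous_on_compose2[OF \<Phi>_cont]) (use P_in in auto)
  then have "continuous_on ?S (\<lambda>(t, m). P t m)"
  proof (rule continuous_on_eq)
    fix w assume w: "w \<in> ?S"
    then have "P (fst w) (snd w) = P (fst w + n) (P (- n) (snd w))" using P_add[of "snd w" "fst w + n" "- n"] by auto
    then show "(\<lambda>(t, m). \<Phi> t m) (fst w + n, P (- n) (snd w)) = (\<lambda>(t, m). P t m) w" using w by (auto simp: P_pos)
  qed
  then have "((\<lambda>(t, m). P t m) \<longlongrightarrow> (\<lambda>(t, m). P t m) z) (at z within ?S)"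
    unfolding continuous_on_def by (rule bspec) (use z n in \<open>simp add: mem_Times_iff\<close>)
  moreover have "at z within UNIV \<times> M = at z within ?S"
    by (rule at_within_nhd[where S = "{- n<..} \<times> UNIV"]) (use n in \<open>auto simp: open_Times mem_Times_iff\<close>)
  ultimately show "((\<lambda>(t, m). P t m) \<longlongrightarrow> (\<lambda>(t, m). P t m) z) (at z within UNIV \<times> M)" by simp
qed

lemma flow_on_P: "flow_on XM P"
  unfolding flow_on_def
proof (intro conjI ballI allI)
  have "prod_topology euclideanreal (top_of_set M) = top_of_set (UNIV \<times> M)"
    using prod_topology_subtopology_eu[of UNIV M] by simp
  then show "continuous_map (prod_topology euclideanreal XM) XM (\<lambda>(t, m). P t m)"
    unfolding XM_eq using P_cont P_in by (auto simp: continuous_map_in_subtopology)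
  fix m assume "m \<in> topspace XM"
  then have m: "m \<in> M" by (simp only: topspace_XM)
  show "P 0 m = m" using \<Phi>_0[OF m] by (simp add: P_pos)
  show "P (s + t) m = P s (P t m)" for s t by (rule P_add[OF m])
qed

lemma minimal_flow_P: "minimal_flow XM P"
  unfolding minimal_flow_def
proof (intro conjI allI impI)
  show "topspace XM \<noteq> {}" using M unfolding topspace_XM minimal_set_def by blast
  fix N assume N: "N \<subseteq> topspace XM" and *: "N \<noteq> {} \<and> compactin XM N \<and> (\<forall>t\<ge>0. P t ` N \<subseteq> N)"
  have "compact N" using * unfolding XM_eq by (simp add: compactin_subtopology)
  then have "N = M" using N * unfolding topspace_XM by (intro minimality) (auto simp: P_pos)
  then show "N = topspace XM" by (simp only: topspace_XM)
qed (fact flow_on_P compact_space_XM)+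

section \<open>The slope map and the conjugate flow\<close>

abbreviation "XM0 \<equiv> subtopology (real_hull_space f) (boundary_slope L ` M)"

lemma slope_cont: "continuous_map XM XM0 (boundary_slope L)"
proof -
  have "continuous_on M (\<lambda>m. (\<lambda>(m, x). D_on L (fst m) x) (m, 0))"
    by (rule continuous_on_compose2[OF U_cont continuous_on_Pair[OF continuous_on_id continuous_on_const]]) (use L in auto)
  then have "continuous_map XM euclideanreal (\<lambda>m. D_on L (fst m) 0)" unfolding XM_eq by simp
  moreover have "continuous_map XM (hull_topology f) snd"
    unfolding phase_space_def by (intro continuous_map_from_subtopology continuous_map_snd)
  ultimately have "continuous_map XM (real_hull_space f) (\<lambda>m. (D_on L (fst m) 0, snd m))"
    by (rule continuous_map_pairedI)
  then have "continuous_map XM (real_hull_space f) (boundary_slope L)" by (simp add: boundary_slope_def split_def)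
  then show ?thesis by (intro continuous_map_into_subtopology) (use topspace_XM in auto)
qed

text \<open>Again a continuous bijection from a compact space to a Hausdorff space; points of the
  hull are separated by their values.\<close>

lemma slope_homeomorphic: "homeomorphic_map XM XM0 (boundary_slope L)"
proof (rule continuous_imp_homeomorphic_map[OF slope_cont compact_space_XM])
  show "Hausdorff_space XM0"
    by (intro Hausdorff_space_subtopology)
      (simp add: Hausdorff_space_prod_topology hull_topology_def Hausdorff_space_subtopology Hausdorff_compact_open)
  have "boundary_slope L ` M \<subseteq> topspace XM0"
    using continuous_map_image_subset_topspace[OF slope_cont] unfolding topspace_XM .
  then show "boundary_slope L ` topspace XM = topspace XM0" unfolding topspace_XM by auto
  show "inj_on (boundary_slope L) (topspace XM)" using slope_inj by (simp only: topspace_XM)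
qed

text \<open>The flow on the image is transported along the inverse of the slope map, so that
  conjugacy and minimality carry over. It lies over the time shift because the slope map keeps the
  second component.\<close>

lemma conjugate_to_slope_flow:
  obtains \<pi> where "topologically_conjugate XM P XM0 \<pi>" "ap_forced_minimal_flow f (boundary_slope L ` M) \<pi>"
    "\<And>t m. m \<in> M \<Longrightarrow> \<pi> t (boundary_slope L m) = boundary_slope L (P t m)"
proof -
  obtain k where k: "homeomorphic_maps XM XM0 (boundary_slope L) k"
    using slope_homeomorphic unfolding homeomorphic_map_maps by blast
  let ?\<pi> = "\<lambda>t y. boundary_slope L (P t (k y))"
  have k_slope: "k (boundary_slope L m) = m" if "m \<in> M" for m
    using k that topspace_XM unfolding homeomorphic_maps_def by blast
  show thesis
  proof (rule that[of ?\<pi>])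
    show "topologically_conjugate XM P XM0 ?\<pi>" by (rule flow_on_transport(2)[OF flow_on_P k])
    show "?\<pi> t (boundary_slope L m) = boundary_slope L (P t m)" if "m \<in> M" for t m
      using k_slope[OF that] by simp
    show "ap_forced_minimal_flow f (boundary_slope L ` M) ?\<pi>"
      unfolding ap_forced_minimal_flow_def
    proof (intro conjI)
      have "compactin XM M" using compact_space_XM unfolding compact_space_def topspace_XM .
      then have "compactin XM0 (boundary_slope L ` M)" by (rule image_compactin[OF _ slope_cont])
      then show "compactin (real_hull_space f) (boundary_slope L ` M)" by (simp add: compactin_subtopology)
      show "minimal_flow XM0 ?\<pi>" by (rule minimal_flow_transport[OF minimal_flow_P k])
      show "\<forall>t. \<forall>(a, g)\<in>boundary_slope L ` M. snd (?\<pi> t (a, g)) = time_shift t g"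
      proof (intro allI ballI)
        fix t and y assume "y \<in> boundary_slope L ` M"
        then obtain m where m: "m \<in> M" "y = boundary_slope L m" by blast
        have "snd (?\<pi> t y) = snd (P t m)" using k_slope[OF m(1)] m(2) by (simp add: boundary_slope_def split_def)
        moreover have "snd y = snd m" using m(2) by (simp add: boundary_slope_def split_def)
        ultimately show "case y of (a, g) \<Rightarrow> snd (?\<pi> t (a, g)) = time_shift t g"
          using snd_P[OF m(1)] by (simp add: split_def)
      qed
    qed
  qed
qed

end

theorem theorem1p6:
  fixes f :: "real \<times> real \<times> real \<Rightarrow> real"
    and L \<alpha> :: real
    and M :: "((real \<Rightarrow> real) \<times> (real \<times> real \<times> real \<Rightarrow> real)) set"
  assumes "standing_assumption f"
    and "0 < L"
    and "0 < \<alpha>" and "\<alpha> < 1" and "compactly_embedded_C1 L \<alpha>"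
    and "minimal_set L \<alpha> f M"
    and "(\<forall>t u p. f (t, - u, p) = - f (t, u, p)) \<or>
         ((\<forall>t p. f (t, 0, p) = 0) \<and> (\<forall>(u0, g)\<in>M. \<forall>x\<in>{0..L}. 0 \<le> u0 x))"
  defines "M0 \<equiv> boundary_slope L ` M"
    and "XM \<equiv> subtopology (phase_space L \<alpha> f) M"
  defines "XM0 \<equiv> subtopology (real_hull_space f) M0"
  shows "continuous_map XM XM0 (boundary_slope L) \<and> bij_betw (boundary_slope L) M M0 \<and>
    (\<exists>\<pi>. (\<forall>t. \<forall>(u0, g)\<in>M.
             \<pi> t (D_on L u0 0, g) = (D_on L (fst (PiD_on L \<alpha> M t (u0, g))) 0, time_shift t g)) \<and>
          topologically_conjugate XM (PiD_on L \<alpha> M) XM0 \<pi>) \<and>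
    (\<exists>K \<psi>. ap_forced_minimal_flow f K \<psi> \<and>
           topologically_conjugate XM (PiD_on L \<alpha> M) (subtopology (real_hull_space f) K) \<psi>)"
proof -
  obtain B where B: "0 \<le> B" "\<And>w x. w \<in> frac_domain L \<alpha> \<inter> C1_interval L \<Longrightarrow> x \<in> {0..L} \<Longrightarrow>
     \<bar>w x\<bar> \<le> B * frac_norm L \<alpha> w \<and> \<bar>D_on L w x\<bar> \<le> B * frac_norm L \<alpha> w"
    by (rule embedding_bound[OF assms(2,5)], rule that)
  interpret minimal_setting f L \<alpha> B M
    by unfold_locales (fact assms(1,2,6) B)+
  have ab: "(\<forall>t u p. f (t, - u, p) = - f (t, u, p)) \<or>
         ((\<forall>t p. f (t, 0, p) = 0) \<and> (\<forall>m\<in>M. \<forall>x\<in>{0..L}. 0 \<le> fst m x))"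
    using assms(7) by (simp add: split_def)
  interpret invertible_setting f L \<alpha> B M
    by unfold_locales (fact \<Phi>_bij[OF ab], intro inj_onI, rule slope_and_backward_uniqueness(1)[OF ab])
  obtain \<pi> where \<pi>: "topologically_conjugate XM P XM0 \<pi>" "ap_forced_minimal_flow f M0 \<pi>"
    "\<And>t m. m \<in> M \<Longrightarrow> \<pi> t (boundary_slope L m) = boundary_slope L (P t m)"
    using conjugate_to_slope_flow unfolding XM_def XM0_def M0_def by metis
  show ?thesis
  proof (intro conjI exI)
    show "continuous_map XM XM0 (boundary_slope L)" unfolding XM_def XM0_def M0_def by (rule slope_cont)
    show "bij_betw (boundary_slope L) M M0" unfolding M0_def using slope_inj by (rule inj_on_imp_bij_betw)
    show "\<forall>t. \<forall>(u0, g)\<in>M. \<pi> t (D_on L u0 0, g) = (D_on L (fst (P t (u0, g))) 0, time_shift t g)"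
    proof (intro allI ballI)
      fix t m assume m: "m \<in> M"
      show "case m of (u0, g) \<Rightarrow> \<pi> t (D_on L u0 0, g) = (D_on L (fst (P t (u0, g))) 0, time_shift t g)"
        using \<pi>(3)[OF m, of t] snd_P[OF m, of t] by (simp add: boundary_slope_def split_def)
    qed
    \<comment> \<open>The image \<open>M0\<close> itself serves as \<open>K\<close>, and
      \<open>\<pi>\<close> as \<open>\<psi>\<close>.\<close>
    show "ap_forced_minimal_flow f M0 \<pi>" by (rule \<pi>(2))
    show "topologically_conjugate XM P XM0 \<pi>" by (rule \<pi>(1))
    show "topologically_conjugate XM P (subtopology (real_hull_space f) M0) \<pi>" using \<pi>(1) unfolding XM0_def .
  qed
qed

end
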